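(* Let $H_1,H_2$ be real separable Hilbert spaces and $H=H_1\otimes H_2$. Let $X$ be a random element of $H$ satisfying $$\sum_{j=1}^\infty \big(\mathbb{E}[\langle X,e_j\rangle^4]\big)^{1/4}<\infty$$ for some orthonormal basis $(e_j)_{j\ge1}$ of $H$, let $C$ be the covariance operator of $X$, and assume $\operatorname{tr}(C)\neq 0$. Let $X_1,\dots,X_N$ be i.i.d. copies of $X$ and let $\widehat C_N=\frac1N\sum_{i=1}^N (X_i-\overline X)\otimes(X_i-\overline X)$, where $\overline X=\frac1N\sum_{k=1}^N X_k$. Suppose the null hypothesis $H_0: C=C_1\tilde\otimes C_2$ holds for some $C_1\in\mathcal S_1(H_1)$, $C_2\in\mathcal S_1(H_2)$. Then $$\sqrt N\left(\widehat C_N-\frac{\operatorname{tr}_2(\widehat C_N)\tilde\otimes \operatorname{tr}_1(\widehat C_N)}{\operatorname{tr}(\widehat C_N)}\right)\xrightarrow{d} Z,\qquad N\to\infty,$$ where convergence in distribution is with respect to the trace-norm topology and $Z$ is a mean-zero Gaussian random element of $\mathcal S_1(H_1\otimes H_2)$.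
   Context: $H_1\otimes H_2$ is the Hilbert tensor product (completion of finite sums of $u\otimes v$ under $\langle u\otimes v,z\otimes w\rangle=\langle u,z\rangle\langle v,w\rangle$). For $f,g\in H$, $f\otimes g$ also denotes the operator $h\mapsto\langle h,g\rangle f$. $\mathcal S_1(K)$ is the Banach space of trace-class operators on $K$ with trace norm $\|T\|_1=\sum_n s_n(T)$. For bounded operators $A$ on $H_1$ and $B$ on $H_2$, $A\tilde\otimes B$ is the unique bounded operator on $H_1\otimes H_2$ with $(A\tilde\otimes B)(u\otimes v)=Au\otimes Bv$. The partial trace $\operatorname{tr}_1:\mathcal S_1(H_1\otimes H_2)\to\mathcal S_1(H_2)$ is the unique bounded linear map with $\operatorname{tr}_1(A\tilde\otimes B)=\operatorname{tr}(A)B$ for $A\in\mathcal S_1(H_1)$, $B\in\mathcal S_1(H_2)$; $\operatorname{tr}_2:\mathcal S_1(H_1\otimes H_2)\to\mathcal S_1(H_1)$ is defined symmetrically by $\operatorname{tr}_2(A\tilde\otimes B)=\operatorname{tr}(B)A$. The covariance operator of $X$ (with $\mathbb E\|X\|^2<\infty$, $\mu=\mathbb EX$) is $C=\mathbb E[(X-\mu)\otimes(X-\mu)]$. A random element $Z$ of $\mathcal S_1(K)$ is Gaussian if $\operatorname{tr}(AZ)$ is a (real) Gaussian random variable for every bounded operator $A$ on $K$. *)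

theory Defs
  imports "HOL-Analysis.Analysis" "HOL-Probability.Probability"
begin

definition onb :: "'a::real_inner set \<Rightarrow> bool" where
  "onb B \<longleftrightarrow> (\<forall>e\<in>B. norm e = 1) \<and> pairwise orthogonal B \<and> closure (span B) = UNIV"

text \<open>Hilbert tensor product, characterised by its defining property:
  tens u v plays the role of u tensor v; inner products multiply and the
  elementary tensors span a dense subspace.\<close>
definition is_htensor :: "('a::real_inner \<Rightarrow> 'b::real_inner \<Rightarrow> 'h::real_inner) \<Rightarrow> bool" where
  "is_htensor tens \<longleftrightarrow>
     (\<forall>u v z w. inner (tens u v) (tens z w) = inner u z * inner v w) \<and>
     closure (span {tens u v | u v. True}) = UNIV"

definition outer :: "'a::real_inner \<Rightarrow> 'a \<Rightarrow> ('a \<Rightarrow>\<^sub>L 'a)" where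
  "outer f g = Blinfun (\<lambda>h. inner h g *\<^sub>R f)"

definition rank_le :: "('a::real_normed_vector \<Rightarrow>\<^sub>L 'a) \<Rightarrow> nat \<Rightarrow> bool" where
  "rank_le F n \<longleftrightarrow> (\<exists>S. finite S \<and> card S \<le> n \<and> range (blinfun_apply F) \<subseteq> span S)"

text \<open>Singular numbers s_{n+1}(T) (as approximation numbers), n = 0,1,...\<close>
definition sval :: "('a::real_normed_vector \<Rightarrow>\<^sub>L 'a) \<Rightarrow> nat \<Rightarrow> real" where
  "sval T n = Inf {norm (T - F) | F. rank_le F n}"

definition trace_class :: "('a::real_normed_vector \<Rightarrow>\<^sub>L 'a) \<Rightarrow> bool" where
  "trace_class T \<longleftrightarrow> summable (sval T)"

definition tnorm :: "('a::real_normed_vector \<Rightarrow>\<^sub>L 'a) \<Rightarrow> real" where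
  "tnorm T = suminf (sval T)"

definition trace :: "('a::real_inner \<Rightarrow>\<^sub>L 'a) \<Rightarrow> real" where
  "trace T = (\<Sum>\<^sub>\<infinity>e\<in>(SOME B. onb B). inner (blinfun_apply T e) e)"

definition optens :: "('a::real_inner \<Rightarrow> 'b::real_inner \<Rightarrow> 'h::real_inner) \<Rightarrow>
    ('a \<Rightarrow>\<^sub>L 'a) \<Rightarrow> ('b \<Rightarrow>\<^sub>L 'b) \<Rightarrow> ('h \<Rightarrow>\<^sub>L 'h)" where
  "optens tens A B = (THE T. \<forall>u v. blinfun_apply T (tens u v)
                          = tens (blinfun_apply A u) (blinfun_apply B v))"

definition s1_bounded_linear :: "(('h::real_normed_vector \<Rightarrow>\<^sub>L 'h) \<Rightarrow> ('k::real_normed_vector \<Rightarrow>\<^sub>L 'k)) \<Rightarrow> bool" where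
  "s1_bounded_linear f \<longleftrightarrow>
     (\<forall>S T. trace_class S \<and> trace_class T \<longrightarrow> f (S + T) = f S + f T) \<and>
     (\<forall>c T. trace_class T \<longrightarrow> f (c *\<^sub>R T) = c *\<^sub>R f T) \<and>
     (\<forall>T. trace_class T \<longrightarrow> trace_class (f T)) \<and>
     (\<exists>K. \<forall>T. trace_class T \<longrightarrow> tnorm (f T) \<le> K * tnorm T) \<and>
     (\<forall>T. \<not> trace_class T \<longrightarrow> f T = 0)"

definition ptr1 :: "('a::real_inner \<Rightarrow> 'b::real_inner \<Rightarrow> 'h::real_inner) \<Rightarrow> ('h \<Rightarrow>\<^sub>L 'h) \<Rightarrow> ('b \<Rightarrow>\<^sub>L 'b)" where
  "ptr1 tens = (THE f. s1_bounded_linear f \<and>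
     (\<forall>A B. trace_class A \<and> trace_class B \<longrightarrow> f (optens tens A B) = trace A *\<^sub>R B))"

definition ptr2 :: "('a::real_inner \<Rightarrow> 'b::real_inner \<Rightarrow> 'h::real_inner) \<Rightarrow> ('h \<Rightarrow>\<^sub>L 'h) \<Rightarrow> ('a \<Rightarrow>\<^sub>L 'a)" where
  "ptr2 tens = (THE f. s1_bounded_linear f \<and>
     (\<forall>A B. trace_class A \<and> trace_class B \<longrightarrow> f (optens tens A B) = trace B *\<^sub>R A))"

text \<open>Covariance operator C = E[(X-\<mu>) \<otimes> (X-\<mu>)], given weakly:
  <C u, v> = E[<X-\<mu>,u><X-\<mu>,v>].\<close>
definition covop :: "'x measure \<Rightarrow> ('x \<Rightarrow> 'h::{real_inner,banach,second_countable_topology}) \<Rightarrow> ('h \<Rightarrow>\<^sub>L 'h)" where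
  "covop M X = (THE C. \<forall>u v. inner (blinfun_apply C u) v =
      (\<integral>\<omega>. inner (X \<omega> - (\<integral>\<omega>'. X \<omega>' \<partial>M)) u * inner (X \<omega> - (\<integral>\<omega>'. X \<omega>' \<partial>M)) v \<partial>M))"

definition sample_mean :: "(nat \<Rightarrow> 'x \<Rightarrow> 'h::real_vector) \<Rightarrow> nat \<Rightarrow> 'x \<Rightarrow> 'h" where
  "sample_mean Xs N \<omega> = (1 / real N) *\<^sub>R (\<Sum>k<N. Xs k \<omega>)"

definition sample_cov :: "(nat \<Rightarrow> 'x \<Rightarrow> 'h::real_inner) \<Rightarrow> nat \<Rightarrow> 'x \<Rightarrow> ('h \<Rightarrow>\<^sub>L 'h)" where
  "sample_cov Xs N \<omega> = (1 / real N) *\<^sub>R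
     (\<Sum>i<N. outer (Xs i \<omega> - sample_mean Xs N \<omega>) (Xs i \<omega> - sample_mean Xs N \<omega>))"

definition tn_open :: "('h::real_normed_vector \<Rightarrow>\<^sub>L 'h) set \<Rightarrow> bool" where
  "tn_open U \<longleftrightarrow> U \<subseteq> {T. trace_class T} \<and>
     (\<forall>T\<in>U. \<exists>e>0. \<forall>S. trace_class S \<and> tnorm (S - T) < e \<longrightarrow> S \<in> U)"

definition tn_borel_sets :: "('h::real_normed_vector \<Rightarrow>\<^sub>L 'h) set set" where
  "tn_borel_sets = sigma_sets {T. trace_class T} (Collect tn_open)"

definition tn_bounded_continuous :: "(('h::real_normed_vector \<Rightarrow>\<^sub>L 'h) \<Rightarrow> real) \<Rightarrow> bool" where
  "tn_bounded_continuous f \<longleftrightarrow>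
     (\<exists>K. \<forall>T. trace_class T \<longrightarrow> \<bar>f T\<bar> \<le> K) \<and>
     (\<forall>T. trace_class T \<longrightarrow> (\<forall>e>0. \<exists>d>0. \<forall>S. trace_class S \<and> tnorm (S - T) < d \<longrightarrow> \<bar>f S - f T\<bar> < e))"

definition centered_gaussian_law :: "('h::real_inner \<Rightarrow>\<^sub>L 'h) measure \<Rightarrow> bool" where
  "centered_gaussian_law Q \<longleftrightarrow> prob_space Q \<and> space Q = {T. trace_class T} \<and> sets Q = tn_borel_sets \<and>
     (\<forall>A. \<exists>\<sigma>\<ge>0. distr Q borel (\<lambda>T. trace (A o\<^sub>L T)) =
         (if \<sigma> = 0 then return borel 0 else density lborel (normal_density 0 \<sigma>)))"

definition conv_distr_tn :: "'x measure \<Rightarrow> (nat \<Rightarrow> 'x \<Rightarrow> ('h::real_normed_vector \<Rightarrow>\<^sub>L 'h)) \<Rightarrow> ('h \<Rightarrow>\<^sub>L 'h) measure \<Rightarrow> bool" where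
  "conv_distr_tn M Y Q \<longleftrightarrow> (\<forall>f. tn_bounded_continuous f \<longrightarrow>
     (\<lambda>N. \<integral>\<omega>. f (Y N \<omega>) \<partial>M) \<longlonglongrightarrow> (\<integral>T. f T \<partial>Q))"

end

(* Let V_N be the square root of N times the difference of the sample covariance and C. In an
   orthonormal basis (e_j) the matrix entries of V_N are, up to a term of order N^(-1/2) coming from
   the sample mean, normalised i.i.d. sums, and the fourth moment condition makes the sum over all
   pairs (j, k) of their standard deviations finite. Hence V_N is close in trace norm, uniformly in N,
   to its finite matrix truncations, for which the multivariate central limit theorem is available;
   the limit is a random operator with jointly Gaussian, absolutely summable matrix entries. Because
   the partial traces and the tensor product are bounded in trace norm and C equals its own normalised
   product of partial traces, the statistic is a bounded linear map of V_N up to a remainder quadratic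
   in V_N divided by the square root of N. Only the topology of the trace norm matters, so singular
   value decompositions are avoided by working with nuclear representations, whose norm is equivalent
   to the sum of the approximation numbers. *)
theory Submission
  imports Defs
begin

section \<open>Separable Hilbert spaces: bases and Riesz representation\<close>

subsection \<open>Orthonormal bases\<close>

text \<open>\<open>optens\<close>, \<open>ptr1\<close>, \<open>ptr2\<close> and \<open>covop\<close>
  are definite descriptions and \<open>trace\<close> sums over a chosen basis, so nothing can be
  said about the statistic before the existence and uniqueness behind each of them is settled; hence
  the long stretch of operator theory before any probability. Two more constraints shape the rest.
  \<open>conv_distr_tn\<close> integrates a function of the statistic, and a Bochner integral of a
  non-measurable function is 0, so every random operator must be shown measurable for the trace
  norm. And a merely continuous test function gives no control of errors, so it is replaced by
  Lipschitz minorants for the nuclear norm: then an error in the operator becomes an error of the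
  integral governed by a first moment, which is all that the fourth moments of the coordinates
  provide for the nuclear size of the fluctuations. The limit is built concretely on a countable
  product of standard normal laws: a triangular factorisation of the covariances of the matrix
  entries turns independent normals into the required jointly Gaussian entries.\<close>

lemma onb_inner:
  assumes "onb B" "e \<in> B" "f \<in> B"
  shows "inner e f = (if e = f then 1 else 0)"
proof (cases "e = f")
  case True
  have "norm e = 1" using assms by (auto simp: onb_def)
  then show ?thesis using True by (simp add: power2_norm_eq_inner[symmetric])
next
  case False
  then show ?thesis using assms unfolding onb_def pairwise_def orthogonal_def by auto
qed

lemma onb_nonzero: "onb B \<Longrightarrow> 0 \<notin> B"
  unfolding onb_def by force

lemma orthonormal_diff_sum:
  fixes B :: "'a::real_inner set"
  assumes orth: "\<And>e f. e \<in> F \<Longrightarrow> f \<in> F \<Longrightarrow> inner e f = (if e = f then 1 else 0)"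
    and fin: "finite F"
  shows "\<And>f. f \<in> F \<Longrightarrow> inner (x - (\<Sum>e\<in>F. inner x e *\<^sub>R e)) f = 0"
proof -
  fix f assume f: "f \<in> F"
  have "(\<Sum>e\<in>F. inner x e * inner e f) = (\<Sum>e\<in>F. if e = f then inner x e else 0)"
    by (rule sum.cong) (auto simp: orth f)
  also have "\<dots> = inner x f" using fin f by simp
  finally show "inner (x - (\<Sum>e\<in>F. inner x e *\<^sub>R e)) f = 0"
    by (simp add: inner_diff_left inner_sum_left)
qed

lemma orthonormal_best_approx:
  fixes x :: "'a::real_inner"
  assumes orth: "\<And>e f. e \<in> F \<Longrightarrow> f \<in> F \<Longrightarrow> inner e f = (if e = f then 1 else 0)"
    and fin: "finite F" and y: "y \<in> span F"
  shows "norm (x - (\<Sum>e\<in>F. inner x e *\<^sub>R e)) \<le> norm (x - y)"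
proof -
  define p where "p = (\<Sum>e\<in>F. inner x e *\<^sub>R e)"
  have p: "p \<in> span F" unfolding p_def by (intro span_sum span_scale span_base)
  then have "p - y \<in> span F" using y by (rule span_diff)
  then have "orthogonal (x - p) (p - y)"
    by (rule orthogonal_to_span)
       (simp add: orthogonal_def p_def orthonormal_diff_sum[OF orth fin])
  then have "norm ((x - p) + (p - y)) ^ 2 = norm (x - p) ^ 2 + norm (p - y) ^ 2"
    by (rule norm_add_Pythagorean)
  then have "norm (x - p) ^ 2 \<le> norm (x - y) ^ 2" by simp
  then show ?thesis unfolding p_def by (rule power2_le_imp_le) simp
qed

lemma span_finite_subset:
  assumes "y \<in> span B" shows "\<exists>F. finite F \<and> F \<subseteq> B \<and> y \<in> span F"
proof -
  obtain t r where t: "finite t" "t \<subseteq> B" "y = (\<Sum>a\<in>t. r a *\<^sub>R a)"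
    using assms unfolding span_explicit by auto
  have "y \<in> span t" unfolding t(3) by (intro span_sum span_scale span_base)
  then show ?thesis using t by blast
qed

text \<open>Density supplies a good approximant in the span of a finite \<open>F\<close>. By
  \<open>orthonormal_best_approx\<close> the partial sum over any finite \<open>G\<close> containing
  \<open>F\<close> is at least as good, which is exactly convergence along finite subsets.\<close>

lemma onb_expand:
  assumes B: "onb B"
  shows "((\<lambda>e. inner x e *\<^sub>R e) has_sum x) B"
  unfolding has_sum_def tendsto_iff eventually_finite_subsets_at_top
proof (intro allI impI)
  fix \<epsilon> :: real assume "\<epsilon> > 0"
  moreover have "x \<in> closure (span B)" using B by (simp add: onb_def)
  ultimately obtain y where y: "y \<in> span B" "dist y x < \<epsilon>"
    using closure_approachable by blast
  then obtain F where F: "finite F" "F \<subseteq> B" "y \<in> span F" using span_finite_subset by blast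
  have "dist (\<Sum>e\<in>G. inner x e *\<^sub>R e) x < \<epsilon>" if G: "finite G" "F \<subseteq> G" "G \<subseteq> B" for G
  proof -
    have "norm (x - (\<Sum>e\<in>G. inner x e *\<^sub>R e)) \<le> norm (x - y)"
    proof (rule orthonormal_best_approx)
      show "inner e f = (if e = f then 1 else 0)" if "e \<in> G" "f \<in> G" for e f
        using that G(3) onb_inner[OF B] by blast
      show "y \<in> span G" using F(3) G(2) span_mono by blast
    qed (rule G)
    also have "\<dots> < \<epsilon>" using y by (simp add: dist_norm norm_minus_commute)
    finally show ?thesis by (simp add: dist_norm norm_minus_commute)
  qed
  then show "\<exists>X. finite X \<and> X \<subseteq> B \<and> (\<forall>Y. finite Y \<and> X \<subseteq> Y \<and> Y \<subseteq> B \<longrightarrow>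
      dist (\<Sum>e\<in>Y. inner x e *\<^sub>R e) x < \<epsilon>)"
    using F by (intro exI[of _ F]) auto
qed

lemma onb_inner_expand:
  assumes B: "onb B"
  shows "((\<lambda>e. inner x e * inner y e) has_sum inner x y) B"
proof -
  have "((\<lambda>e. inner (inner x e *\<^sub>R e) y) has_sum inner x y) B"
    by (rule has_sum_bounded_linear[OF bounded_linear_inner_left onb_expand[OF B]])
  moreover have "inner (inner x e *\<^sub>R e) y = inner x e * inner y e" for e
    by (simp only: inner_scaleR_left inner_commute[of e y])
  ultimately show ?thesis by (simp only:)
qed

lemma onb_parseval:
  assumes B: "onb B"
  shows "((\<lambda>e. (inner x e)\<^sup>2) has_sum (norm x)\<^sup>2) B"
  using onb_inner_expand[OF B, of x x] by (simp add: power2_norm_eq_inner flip: power2_eq_square)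

text \<open>Distinct basis vectors lie at distance sqrt 2, so balls of radius 1/2 around them are
  disjoint, and a second countable space has only countably many disjoint nonempty open
  sets.\<close>

lemma onb_countable:
  fixes B :: "'a::{real_inner,second_countable_topology} set"
  assumes B: "onb B" shows "countable B"
proof -
  have d: "dist e f > 1" if "e \<in> B" "f \<in> B" "e \<noteq> f" for e f
  proof -
    have "(dist e f)\<^sup>2 = 2" using that onb_inner[OF B]
      by (simp add: dist_norm power2_norm_eq_inner inner_diff_left inner_diff_right)
    then have "1\<^sup>2 < (dist e f)\<^sup>2" by simp
    then show ?thesis by (rule power2_less_imp_less) simp
  qed
  have disj: "disjnt (ball e (1/2)) (ball f (1/2))" if "e \<in> B" "f \<in> B" "e \<noteq> f" for e f
  proof -
    have False if z: "dist e z < 1/2" "dist f z < 1/2" for z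
      using d[OF \<open>e \<in> B\<close> \<open>f \<in> B\<close> \<open>e \<noteq> f\<close>] dist_triangle2[of e f z] z by linarith
    then show ?thesis by (auto simp: disjnt_iff)
  qed
  have "countable ((\<lambda>e. ball e (1/2)) ` B)"
    by (rule countable_disjoint_open_subsets) (auto simp: pairwise_def intro: disj)
  moreover have "inj_on (\<lambda>e. ball e (1/2)) B"
  proof (rule inj_onI, rule ccontr)
    fix e f assume a: "e \<in> B" "f \<in> B" "ball e (1/2) = ball f (1/2)" "e \<noteq> f"
    have "e \<in> ball e (1/2)" by simp
    then have "e \<in> ball f (1/2)" using a(3) by blast
    then show False using d[OF a(1,2,4)] by (simp add: dist_commute)
  qed
  ultimately show ?thesis by (rule countable_image_inj_on)
qed

text \<open>Gram-Schmidt along a countable dense sequence. It makes the basis chosen by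
  \<open>SOME\<close> in \<open>trace\<close> a genuine one.\<close>

lemma onb_exists: "\<exists>B :: 'a::{real_inner,second_countable_topology} set. onb B"
proof -
  obtain D :: "'a set" where D: "countable D" "D \<noteq> {}" and dense: "\<And>S. open S \<Longrightarrow> S \<noteq> {} \<Longrightarrow> \<exists>d\<in>D. d \<in> S"
  proof -
    obtain D :: "'a set" where D: "countable D" "\<And>S. open S \<Longrightarrow> S \<noteq> {} \<Longrightarrow> \<exists>d\<in>D. d \<in> S"
      using countable_dense_exists by blast
    have "\<exists>d\<in>D. d \<in> UNIV" by (rule D(2)) auto
    then have "D \<noteq> {}" by blast
    with D show ?thesis by (intro that[of D])
  qed
  define x where "x = from_nat_into D"
  have rx: "range x = D" unfolding x_def by (rule range_from_nat_into[OF D(2,1)])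
  \<comment> \<open>\<open>S\<close> is orthonormal and its span contains the first \<open>n\<close>
    points of the dense sequence. A point whose residual vanishes adds no vector, so finite
    dimension needs no separate treatment.\<close>
  define P where "P n S \<longleftrightarrow> finite S \<and> (\<forall>e\<in>S. \<forall>f\<in>S. inner e f = (if e = f then 1 else 0::real))
     \<and> (\<forall>i<n. x i \<in> span S)" for n and S :: "'a set"
  have "\<exists>f. \<forall>n. P n (f n) \<and> f n \<subseteq> f (Suc n)"
  proof (rule dependent_nat_choice)
    show "\<exists>S. P 0 S" by (intro exI[of _ "{}"]) (simp add: P_def)
  next
    fix S n assume S: "P n S"
    define r where "r = x n - (\<Sum>e\<in>S. inner (x n) e *\<^sub>R e)"
    have r: "inner r f = 0" if "f \<in> S" for f
      unfolding r_def by (rule orthonormal_diff_sum) (use S that in \<open>auto simp: P_def\<close>)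
    have x: "x n = r + (\<Sum>e\<in>S. inner (x n) e *\<^sub>R e)" by (simp add: r_def)
    have sp: "(\<Sum>e\<in>S. inner (x n) e *\<^sub>R e) \<in> span S" by (intro span_sum span_scale span_base)
    show "\<exists>T. P (Suc n) T \<and> S \<subseteq> T"
    proof (cases "r = 0")
      case True
      then show ?thesis using S sp x by (intro exI[of _ S]) (auto simp: P_def less_Suc_eq)
    next
      case False
      define T where "T = insert (sgn r) S"
      have s: "inner (sgn r) (sgn r) = 1" using False
        by (simp add: power2_norm_eq_inner[symmetric] norm_sgn)
      have s2: "inner (sgn r) f = 0" "inner f (sgn r) = 0" if "f \<in> S" for f
        using r[OF that] by (auto simp: sgn_div_norm inner_commute)
      have "r = norm r *\<^sub>R sgn r" using False by (simp add: sgn_div_norm)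
      then have "r \<in> span T" unfolding T_def by (metis insertI1 span_base span_scale)
      moreover have ST: "span S \<subseteq> span T" unfolding T_def by (intro span_mono) auto
      ultimately have "x n \<in> span T" using x sp by (metis span_add subsetD)
      moreover have "sgn r \<notin> S" using s s2 by fastforce
      ultimately have "P (Suc n) T" using S s s2 ST unfolding P_def T_def
        by (auto simp: less_Suc_eq)
      then show ?thesis unfolding T_def by auto
    qed
  qed
  then obtain f where f: "\<And>n. P n (f n)" "\<And>n. f n \<subseteq> f (Suc n)" by blast
  have mono: "f m \<subseteq> f n" if "m \<le> n" for m n using f(2) that by (rule lift_Suc_mono_le)
  define B where "B = (\<Union>n. f n)"
  have orth: "inner e g = (if e = g then 1 else 0)" if "e \<in> B" "g \<in> B" for e g
  proof -
    from that obtain m n where "e \<in> f m" "g \<in> f n" by (auto simp: B_def)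
    then have "e \<in> f (max m n)" "g \<in> f (max m n)" using mono[of m "max m n"] mono[of n "max m n"] by auto
    then show ?thesis using f(1)[of "max m n"] unfolding P_def by blast
  qed
  have "x n \<in> span B" for n
  proof -
    have "x n \<in> span (f (Suc n))" using f(1)[of "Suc n"] by (simp add: P_def)
    moreover have "span (f (Suc n)) \<subseteq> span B" by (rule span_mono) (auto simp: B_def)
    ultimately show ?thesis by auto
  qed
  then have DB: "D \<subseteq> span B" using rx by auto
  have "y \<in> closure (span B)" for y
    unfolding closure_approachable
  proof safe
    fix e :: real assume "e > 0"
    then obtain d where "d \<in> D" "d \<in> ball y e" using dense[of "ball y e"] by auto
    then show "\<exists>z\<in>span B. dist z y < e" using DB by (auto simp: dist_commute)
  qed
  then have "onb B" unfolding onb_def pairwise_def orthogonal_def using orth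
    by (simp add: norm_eq_1 set_eq_iff)
  then show ?thesis ..
qed

lemma onb_some: "onb (SOME B :: 'a::{real_inner,second_countable_topology} set. onb B)"
  using onb_exists by (rule someI_ex)

text \<open>Indices that enumerate nothing get the vector 0. Zero vectors contribute nothing to the
  sums below, so finite and infinite dimension are handled by one enumeration over
  \<open>nat\<close>.\<close>

lemma onb_enum:
  fixes B :: "'a::{real_inner,second_countable_topology} set"
  assumes B: "onb B"
  obtains e :: "nat \<Rightarrow> 'a" where "\<And>n. e n = 0 \<or> e n \<in> B" "bij_betw e {n. e n \<noteq> 0} B"
proof -
  define N where "N = to_nat_on B ` B"
  define e where "e n = (if n \<in> N then from_nat_into B n else 0)" for n
  have c: "countable B" using B by (rule onb_countable)
  have b: "e (to_nat_on B b) = b" if "b \<in> B" for b using that c by (simp add: e_def N_def)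
  have eq: "{n. e n \<noteq> 0} = N" using onb_nonzero[OF B] c by (auto simp: e_def N_def)
  have "e ` N = B" unfolding N_def image_image by (simp add: b)
  moreover have "inj_on e N" unfolding N_def by (rule inj_onI) (auto simp: b)
  ultimately have "bij_betw e {n. e n \<noteq> 0} B" unfolding eq bij_betw_def by blast
  moreover have "e n = 0 \<or> e n \<in> B" for n using c by (auto simp: e_def N_def)
  ultimately show ?thesis using that by blast
qed

lemma onb_enum_inner:
  assumes B: "onb B" and e: "\<And>n. e n = 0 \<or> e n \<in> B" "bij_betw e {n. e n \<noteq> 0} B"
  shows "inner (e i) (e j) = (if i = j \<and> e i \<noteq> 0 then 1 else 0)"
proof (cases "e i = 0 \<or> e j = 0")
  case False
  then have "e i = e j \<longleftrightarrow> i = j" using e(2) by (auto simp: bij_betw_def inj_on_def)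
  then show ?thesis using False e(1) onb_inner[OF B] by metis
qed auto

lemma onb_enum_has_sum:
  assumes e: "\<And>n. e n = 0 \<or> e n \<in> B" "bij_betw e {n. e n \<noteq> 0} B" and g: "g 0 = 0"
  shows "((\<lambda>n. g (e n)) has_sum s) UNIV \<longleftrightarrow> (g has_sum s) B"
proof -
  have "(g has_sum s) B \<longleftrightarrow> ((\<lambda>n. g (e n)) has_sum s) {n. e n \<noteq> 0}"
    using has_sum_reindex_bij_betw[OF e(2), of g s] by simp
  also have "\<dots> \<longleftrightarrow> ((\<lambda>n. g (e n)) has_sum s) UNIV"
    by (rule has_sum_cong_neutral) (auto simp: g)
  finally show ?thesis by simp
qed

lemma orthonormal_norm_sum:
  fixes e :: "'i \<Rightarrow> 'a::real_inner"
  assumes "finite I" "\<And>i j. i \<in> I \<Longrightarrow> j \<in> I \<Longrightarrow> i \<noteq> j \<Longrightarrow> inner (e i) (e j) = 0"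
  shows "(norm (\<Sum>i\<in>I. e i))\<^sup>2 = (\<Sum>i\<in>I. (norm (e i))\<^sup>2)"
proof -
  have "(norm (\<Sum>i\<in>I. e i))\<^sup>2 = (\<Sum>i\<in>I. \<Sum>j\<in>I. inner (e i) (e j))"
    by (simp add: power2_norm_eq_inner inner_sum_left inner_sum_right inner_commute)
  also have "\<dots> = (\<Sum>i\<in>I. \<Sum>j\<in>I. if i = j then inner (e i) (e i) else 0)"
    by (intro sum.cong) (auto simp: assms)
  finally show ?thesis using assms(1) by (simp add: power2_norm_eq_inner)
qed

text \<open>The representing vector has coordinates \<phi> (e i). Testing \<phi> on the partial sum
  of the t i, of norm s, gives s^2 <= s K, so the coordinates are square summable and completeness
  yields the vector.\<close>

lemma riesz:
  fixes \<phi> :: "'a::{real_inner,banach,second_countable_topology} \<Rightarrow> real"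
  assumes \<phi>: "bounded_linear \<phi>"
  shows "\<exists>y. \<forall>h. \<phi> h = inner h y"
proof -
  interpret bounded_linear \<phi> by (rule \<phi>)
  obtain B :: "'a set" where B: "onb B" using onb_exists by blast
  obtain e :: "nat \<Rightarrow> 'a" where e: "\<And>n. e n = 0 \<or> e n \<in> B" "bij_betw e {n. e n \<noteq> 0} B"
    using onb_enum[OF B] by blast
  note ei = onb_enum_inner[OF B e]
  obtain K where K: "\<And>x. norm (\<phi> x) \<le> norm x * K" "K > 0" using pos_bounded by blast
  define t where "t i = \<phi> (e i) *\<^sub>R e i" for i
  have nt: "(norm (\<Sum>i\<in>I. t i))\<^sup>2 = (\<Sum>i\<in>I. (\<phi> (e i))\<^sup>2)" if "finite I" for I
  proof -
    have "(norm (\<Sum>i\<in>I. t i))\<^sup>2 = (\<Sum>i\<in>I. (norm (t i))\<^sup>2)"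
      by (rule orthonormal_norm_sum[OF that]) (auto simp: t_def ei)
    also have "\<dots> = (\<Sum>i\<in>I. (\<phi> (e i))\<^sup>2)"
      by (rule sum.cong) (auto simp: t_def power_mult_distrib power2_norm_eq_inner ei zero)
    finally show ?thesis .
  qed
  have bd: "(\<Sum>i<n. (\<phi> (e i))\<^sup>2) \<le> K\<^sup>2" for n
  proof -
    define s where "s = norm (\<Sum>i<n. t i)"
    have "s\<^sup>2 = \<phi> (\<Sum>i<n. t i)" using nt[of "{..<n}"]
      by (simp add: s_def t_def sum scaleR power2_eq_square)
    also have "\<dots> \<le> s * K" using K(1)[of "\<Sum>i<n. t i"] by (simp add: s_def)
    finally have "s * s \<le> s * K" by (simp add: power2_eq_square)
    then have "s \<le> K" using K(2) s_def by (cases "s = 0") auto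
    then have "s\<^sup>2 \<le> K\<^sup>2" by (simp add: s_def power_mono)
    then show ?thesis using nt[of "{..<n}"] by (simp add: s_def)
  qed
  have "summable (\<lambda>i. (\<phi> (e i))\<^sup>2)"
    by (rule bounded_imp_summable[where B = "K\<^sup>2"])
       (use bd in \<open>simp_all only: lessThan_Suc_atMost[symmetric] zero_le_power2\<close>)
  then have su: "\<forall>\<epsilon>>0. \<exists>N. \<forall>m\<ge>N. \<forall>n. norm (\<Sum>i=m..<n. (\<phi> (e i))\<^sup>2) < \<epsilon>"
    by (simp add: summable_Cauchy)
  have "summable t" unfolding summable_Cauchy
  proof safe
    fix \<epsilon> :: real assume "\<epsilon> > 0"
    then obtain N where N: "\<And>m n. m \<ge> N \<Longrightarrow> norm (\<Sum>i=m..<n. (\<phi> (e i))\<^sup>2) < \<epsilon>\<^sup>2" using su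
      by (meson zero_less_power)
    have "norm (\<Sum>i=m..<n. t i) < \<epsilon>" if "m \<ge> N" for m n
    proof -
      have "(norm (\<Sum>i=m..<n. t i))\<^sup>2 < \<epsilon>\<^sup>2" using N[OF that, of n] nt[of "{m..<n}"] by simp
      then show ?thesis by (rule power2_less_imp_less) (use \<open>\<epsilon> > 0\<close> in simp)
    qed
    then show "\<exists>N. \<forall>m\<ge>N. \<forall>n. norm (\<Sum>i=m..<n. t i) < \<epsilon>" by blast
  qed
  then obtain y where y: "t sums y" by (auto simp: summable_def)
  have ey: "inner (e k) y = \<phi> (e k)" for k
  proof -
    have "(\<lambda>i. inner (e k) (t i)) sums inner (e k) y"
      by (rule bounded_linear.sums[OF bounded_linear_inner_right y])
    moreover have "(\<lambda>i. inner (e k) (t i)) = (\<lambda>i. if i = k then \<phi> (e k) else 0)"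
      by (rule ext) (auto simp: t_def ei zero)
    ultimately have "(\<lambda>i. if i = k then \<phi> (e k) else 0) sums inner (e k) y" by simp
    then show ?thesis using sums_single[of k "\<lambda>_. \<phi> (e k)"] by (rule sums_unique2)
  qed
  have be: "b \<in> range e" if "b \<in> B" for b using that e(2) by (auto simp: bij_betw_def)
  have "\<phi> h = inner h y" for h
  proof -
    have "((\<lambda>b. inner h b * \<phi> b) has_sum \<phi> h) B"
      using has_sum_bounded_linear[OF \<phi> onb_expand[OF B, of h]] by (simp add: scaleR)
    moreover have "((\<lambda>b. inner h b * inner y b) has_sum inner h y) B" by (rule onb_inner_expand[OF B])
    moreover have "((\<lambda>b. inner h b * \<phi> b) has_sum \<phi> h) B \<longleftrightarrow>
        ((\<lambda>b. inner h b * inner y b) has_sum \<phi> h) B"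
    proof (rule has_sum_cong)
      fix b assume "b \<in> B"
      then obtain k where "b = e k" using be by blast
      then have "\<phi> b = inner y b" using ey[of k] by (simp add: inner_commute)
      then show "inner h b * \<phi> b = inner h b * inner y b" by simp
    qed
    ultimately show ?thesis using has_sum_unique by blast
  qed
  then show ?thesis by blast
qed

lemma outer_apply [simp]: "blinfun_apply (outer f g) h = inner h g *\<^sub>R f"
proof -
  have "bounded_linear (\<lambda>h. inner h g *\<^sub>R f)"
    by (intro bounded_linear_intros bounded_linear_inner_left)
  then show ?thesis unfolding outer_def by (simp add: bounded_linear_Blinfun_apply)
qed

section \<open>Trace class described by nuclear representations\<close>

subsection \<open>Nuclear operators\<close>

text \<open>Carrying an upper bound \<open>s\<close> on the weight of one representation, instead of
  an infimum over all of them, lets estimates be composed with no question of attainment;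
  \<open>nu\<close> takes the infimum later.\<close>

definition nuc :: "('h::real_inner \<Rightarrow>\<^sub>L 'h) \<Rightarrow> real \<Rightarrow> bool" where
  "nuc T s \<longleftrightarrow> (\<exists>x y :: nat \<Rightarrow> 'h. (\<lambda>i. norm (x i) * norm (y i)) summable_on UNIV \<and>
     (\<Sum>\<^sub>\<infinity>i. norm (x i) * norm (y i)) \<le> s \<and>
     (\<forall>h. ((\<lambda>i. inner h (y i) *\<^sub>R x i) has_sum blinfun_apply T h) UNIV))"

lemma has_sum_to_nat:
  assumes "countable I"
  shows "((\<lambda>n. if n \<in> to_nat_on I ` I then F (from_nat_into I n) else 0) has_sum s) UNIV
     \<longleftrightarrow> (F has_sum s) I"
proof -
  have "((\<lambda>n. if n \<in> to_nat_on I ` I then F (from_nat_into I n) else 0) has_sum s) UNIV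
      \<longleftrightarrow> ((\<lambda>n. F (from_nat_into I n)) has_sum s) (to_nat_on I ` I)"
    by (rule has_sum_cong_neutral) auto
  also have "\<dots> \<longleftrightarrow> (((\<lambda>n. F (from_nat_into I n)) \<circ> to_nat_on I) has_sum s) I"
    by (rule has_sum_reindex) (use assms in \<open>rule inj_on_to_nat_on\<close>)
  also have "\<dots> \<longleftrightarrow> (F has_sum s) I"
    by (rule has_sum_cong) (use assms in auto)
  finally show ?thesis .
qed

text \<open>Series of operators, tensor products and partial traces produce representations indexed
  by pairs or by basis vectors; padding with zero vectors brings any countable index set back to
  \<open>nat\<close>.\<close>

lemma nucI:
  fixes x y :: "'i \<Rightarrow> 'h::real_inner"
  assumes I: "countable I" and sm: "(\<lambda>i. norm (x i) * norm (y i)) summable_on I"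
    and le: "(\<Sum>\<^sub>\<infinity>i\<in>I. norm (x i) * norm (y i)) \<le> s"
    and T: "\<And>h. ((\<lambda>i. inner h (y i) *\<^sub>R x i) has_sum blinfun_apply T h) I"
  shows "nuc T s"
proof -
  define N where "N = to_nat_on I ` I"
  define x' where "x' n = (if n \<in> N then x (from_nat_into I n) else 0)" for n
  define y' where "y' n = (if n \<in> N then y (from_nat_into I n) else 0)" for n
  have "((\<lambda>i. norm (x i) * norm (y i)) has_sum (\<Sum>\<^sub>\<infinity>i\<in>I. norm (x i) * norm (y i))) I"
    using sm by (rule has_sum_infsum)
  then have 1: "((\<lambda>n. norm (x' n) * norm (y' n)) has_sum (\<Sum>\<^sub>\<infinity>i\<in>I. norm (x i) * norm (y i))) UNIV"
    unfolding has_sum_to_nat[OF I, symmetric] x'_def y'_def N_def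
    by (rule has_sum_cong[THEN iffD1, rotated]) auto
  have 2: "((\<lambda>n. inner h (y' n) *\<^sub>R x' n) has_sum blinfun_apply T h) UNIV" for h
    using T[of h]
    unfolding has_sum_to_nat[OF I, symmetric] x'_def y'_def N_def
    by (rule has_sum_cong[THEN iffD1, rotated]) auto
  show ?thesis unfolding nuc_def
    using 1 2 le by (intro exI[of _ x'] exI[of _ y']) (auto simp: has_sum_iff)
qed

lemma nucE:
  assumes "nuc T s"
  obtains x y :: "nat \<Rightarrow> 'h::real_inner" where
    "(\<lambda>i. norm (x i) * norm (y i)) summable_on UNIV"
    "(\<Sum>\<^sub>\<infinity>i. norm (x i) * norm (y i)) \<le> s"
    "\<And>h. ((\<lambda>i. inner h (y i) *\<^sub>R x i) has_sum blinfun_apply T h) UNIV"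
  using assms unfolding nuc_def by blast

lemma norm_has_sum_le:
  fixes f :: "'i \<Rightarrow> 'a::real_normed_vector"
  assumes "(\<lambda>i. norm (f i)) summable_on A" "(f has_sum S) A"
  shows "norm S \<le> (\<Sum>\<^sub>\<infinity>i\<in>A. norm (f i))"
  using norm_has_sum_bound[OF has_sum_infsum[OF assms(1)] assms(2)] .

lemma summable_rank_one:
  fixes x y :: "'i \<Rightarrow> 'h::real_inner"
  assumes "(\<lambda>i. norm (x i) * norm (y i)) summable_on I"
  shows "(\<lambda>i. norm (inner h (y i) *\<^sub>R x i)) summable_on I"
    and "(\<Sum>\<^sub>\<infinity>i\<in>I. norm (inner h (y i) *\<^sub>R x i)) \<le> norm h * (\<Sum>\<^sub>\<infinity>i\<in>I. norm (x i) * norm (y i))"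
proof -
  have b: "norm (inner h (y i) *\<^sub>R x i) \<le> norm h * (norm (x i) * norm (y i))" for i
    using mult_right_mono[OF Cauchy_Schwarz_ineq2[of h "y i"], of "norm (x i)"]
    by (simp add: algebra_simps)
  have s: "(\<lambda>i. norm h * (norm (x i) * norm (y i))) summable_on I"
    using assms by (rule summable_on_cmult_right)
  show 1: "(\<lambda>i. norm (inner h (y i) *\<^sub>R x i)) summable_on I"
    by (rule summable_on_comparison_test[OF s]) (use b in auto)
  have "(\<Sum>\<^sub>\<infinity>i\<in>I. norm (inner h (y i) *\<^sub>R x i)) \<le> (\<Sum>\<^sub>\<infinity>i\<in>I. norm h * (norm (x i) * norm (y i)))"
    by (rule infsum_mono[OF 1 s b])
  also have "\<dots> = norm h * (\<Sum>\<^sub>\<infinity>i\<in>I. norm (x i) * norm (y i))"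
    using assms by (rule infsum_cmult_right)
  finally show "(\<Sum>\<^sub>\<infinity>i\<in>I. norm (inner h (y i) *\<^sub>R x i)) \<le> norm h * (\<Sum>\<^sub>\<infinity>i\<in>I. norm (x i) * norm (y i))" .
qed

lemma nuc_exists:
  fixes x y :: "'i \<Rightarrow> 'h::{real_inner,banach}"
  assumes I: "countable I" and sm: "(\<lambda>i. norm (x i) * norm (y i)) summable_on I"
  shows "\<exists>T. nuc T (\<Sum>\<^sub>\<infinity>i\<in>I. norm (x i) * norm (y i)) \<and>
    (\<forall>h. ((\<lambda>i. inner h (y i) *\<^sub>R x i) has_sum blinfun_apply T h) I)"
proof -
  define f where "f h = (\<Sum>\<^sub>\<infinity>i\<in>I. inner h (y i) *\<^sub>R x i)" for h
  have hs: "((\<lambda>i. inner h (y i) *\<^sub>R x i) has_sum f h) I" for h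
    unfolding f_def using abs_summable_summable[OF summable_rank_one(1)[OF sm]] by (rule has_sum_infsum)
  have "bounded_linear f"
  proof (rule bounded_linear_intro[where K = "\<Sum>\<^sub>\<infinity>i\<in>I. norm (x i) * norm (y i)"])
    fix h k and r :: real
    have "((\<lambda>i. inner (h + k) (y i) *\<^sub>R x i) has_sum f h + f k) I"
      using has_sum_add[OF hs[of h] hs[of k]] by (simp add: inner_add_left scaleR_add_left)
    then show "f (h + k) = f h + f k" using hs has_sum_unique by blast
    have "((\<lambda>i. inner (r *\<^sub>R h) (y i) *\<^sub>R x i) has_sum r *\<^sub>R f h) I"
      using has_sum_scaleR[OF hs[of h], of r] by simp
    then show "f (r *\<^sub>R h) = r *\<^sub>R f h" using hs has_sum_unique by blast
    have "norm (f h) \<le> (\<Sum>\<^sub>\<infinity>i\<in>I. norm (inner h (y i) *\<^sub>R x i))"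
      unfolding f_def by (rule norm_infsum_bound[OF summable_rank_one(1)[OF sm]])
    then show "norm (f h) \<le> norm h * (\<Sum>\<^sub>\<infinity>i\<in>I. norm (x i) * norm (y i))"
      using summable_rank_one(2)[OF sm, of h] by linarith
  qed
  then have "blinfun_apply (Blinfun f) = f" by (rule bounded_linear_Blinfun_apply)
  then have "\<forall>h. ((\<lambda>i. inner h (y i) *\<^sub>R x i) has_sum blinfun_apply (Blinfun f) h) I"
    using hs by simp
  then show ?thesis using nucI[OF I sm order_refl] by blast
qed

lemma nuc_mono: "nuc T s \<Longrightarrow> s \<le> t \<Longrightarrow> nuc T t"
  unfolding nuc_def by (meson order_trans)

lemma nuc_nonneg: "nuc T s \<Longrightarrow> 0 \<le> s"
proof (erule nucE)
  fix x y :: "nat \<Rightarrow> 'a"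
  assume "(\<Sum>\<^sub>\<infinity>i. norm (x i) * norm (y i)) \<le> s"
  moreover have "0 \<le> (\<Sum>\<^sub>\<infinity>i. norm (x i) * norm (y i))" by (rule infsum_nonneg) simp
  ultimately show "0 \<le> s" by linarith
qed

lemma nuc_outer: "nuc (outer f g) (norm f * norm g)"
  by (rule nucI[where I = "{()}" and x = "\<lambda>_. f" and y = "\<lambda>_. g"]) (auto intro: has_sum_finiteI)

lemma nuc_zero: "nuc 0 0"
  by (rule nucI[where I = "{} :: unit set" and x = "\<lambda>_. 0" and y = "\<lambda>_. 0"]) auto

lemma nuc_compose_left: 
  assumes "nuc T s" shows "nuc (A o\<^sub>L T) (norm A * s)"
proof -
  obtain x y where n: "(\<lambda>i. norm (x i) * norm (y i)) summable_on (UNIV::nat set)"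
    "(\<Sum>\<^sub>\<infinity>i. norm (x i) * norm (y i)) \<le> s"
    "\<And>h. ((\<lambda>i. inner h (y i) *\<^sub>R x i) has_sum blinfun_apply T h) UNIV"
    using assms by (rule nucE) blast
  have b: "norm (A (x i)) * norm (y i) \<le> norm A * (norm (x i) * norm (y i))" for i
    using mult_right_mono[OF norm_blinfun[of A "x i"], of "norm (y i)"] by (simp add: algebra_simps)
  have s: "(\<lambda>i. norm A * (norm (x i) * norm (y i))) summable_on UNIV"
    using n(1) by (rule summable_on_cmult_right)
  have s1: "(\<lambda>i. norm (A (x i)) * norm (y i)) summable_on UNIV"
    by (rule summable_on_comparison_test[OF s]) (use b in auto)
  show ?thesis
  proof (rule nucI[OF _ s1])
    have "(\<Sum>\<^sub>\<infinity>i. norm (A (x i)) * norm (y i)) \<le> (\<Sum>\<^sub>\<infinity>i. norm A * (norm (x i) * norm (y i)))"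
      by (rule infsum_mono[OF s1 s b])
    also have "\<dots> = norm A * (\<Sum>\<^sub>\<infinity>i. norm (x i) * norm (y i))" using n(1) by (rule infsum_cmult_right)
    also have "\<dots> \<le> norm A * s" using n(2) by (intro mult_left_mono) auto
    finally show "(\<Sum>\<^sub>\<infinity>i. norm (A (x i)) * norm (y i)) \<le> norm A * s" .
    show "((\<lambda>i. inner h (y i) *\<^sub>R A (x i)) has_sum blinfun_apply (A o\<^sub>L T) h) UNIV" for h
      using has_sum_bounded_linear[OF blinfun.bounded_linear_right n(3), of A h]
      by (simp add: blinfun.scaleR_right)
  qed auto
qed

lemma nuc_scaleR:
  assumes "nuc T s" shows "nuc (c *\<^sub>R T) (\<bar>c\<bar> * s)"
proof -
  have "nuc ((c *\<^sub>R id_blinfun) o\<^sub>L T) (norm (c *\<^sub>R id_blinfun :: 'a \<Rightarrow>\<^sub>L 'a) * s)"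
    by (rule nuc_compose_left[OF assms])
  moreover have "(c *\<^sub>R id_blinfun) o\<^sub>L T = c *\<^sub>R T"
    by (rule blinfun_eqI) (simp add: blinfun.scaleR_left)
  moreover have "norm (c *\<^sub>R id_blinfun :: 'a \<Rightarrow>\<^sub>L 'a) \<le> \<bar>c\<bar> * 1"
    unfolding norm_scaleR by (rule mult_left_mono) (auto intro!: norm_blinfun_bound)
  ultimately show ?thesis using nuc_nonneg[OF assms]
    by (metis mult.right_neutral mult_right_mono nuc_mono)
qed

text \<open>All representations are merged into one over pairs (k, i): the weights add up, and
  summing the merged series row by row identifies its limit. The series of operators has to converge
  only pointwise in \<open>h\<close>.\<close>

lemma nuc_suminf:
  fixes D :: "nat \<Rightarrow> ('h::{real_inner,banach} \<Rightarrow>\<^sub>L 'h)"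
  assumes D: "\<And>k. nuc (D k) (s k)" and s: "summable s"
    and T: "\<And>h. (\<lambda>k. blinfun_apply (D k) h) sums blinfun_apply T h"
  shows "nuc T (suminf s)"
proof -
  define R where "R k x y \<longleftrightarrow> (\<lambda>i. norm (x i) * norm (y i)) summable_on (UNIV::nat set) \<and>
    (\<Sum>\<^sub>\<infinity>i. norm (x i) * norm (y i)) \<le> s k \<and>
    (\<forall>h. ((\<lambda>i. inner h (y i) *\<^sub>R x i) has_sum blinfun_apply (D k) h) UNIV)"
    for k and x y :: "nat \<Rightarrow> 'h"
  have "\<exists>x y. R k x y" for k using D[of k] unfolding nuc_def R_def .
  then obtain x y where R: "\<And>k. R k (x k) (y k)" by metis
  have n: "(\<lambda>i. norm (x k i) * norm (y k i)) summable_on (UNIV::nat set)"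
    "(\<Sum>\<^sub>\<infinity>i. norm (x k i) * norm (y k i)) \<le> s k"
    "((\<lambda>i. inner h (y k i) *\<^sub>R x k i) has_sum blinfun_apply (D k) h) UNIV" for k h
    using R[of k] unfolding R_def by blast+
  define x' where "x' = (\<lambda>(k,i). x k i)"
  define y' where "y' = (\<lambda>(k,i). y k i)"
  define S where "S k = (\<Sum>\<^sub>\<infinity>i. norm (x k i) * norm (y k i))" for k
  have S0: "0 \<le> S k" for k unfolding S_def by (intro infsum_nonneg) auto
  have sS: "summable S" by (rule summable_comparison_test'[OF s, of 0]) (use S0 n(2) in \<open>auto simp: S_def\<close>)
  have sumS: "(S has_sum suminf S) UNIV"
    by (rule sums_nonneg_imp_has_sum) (use S0 sS in \<open>auto simp: summable_sums\<close>)
  have nn: "norm (x' p) * norm (y' p) \<ge> 0" for p by auto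
  have sm: "(\<lambda>p. norm (x' p) * norm (y' p)) summable_on (UNIV \<times> UNIV)"
    by (rule summable_on_SigmaI[where g = S])
       (use n(1) S0 sumS in \<open>auto simp: x'_def y'_def S_def has_sum_iff\<close>)
  have hs: "((\<lambda>p. norm (x' p) * norm (y' p)) has_sum suminf S) (UNIV \<times> UNIV)"
    by (rule has_sum_SigmaI[where g = S, OF _ sumS sm])
       (use n(1) in \<open>auto simp: x'_def y'_def S_def has_sum_iff\<close>)
  show ?thesis
  proof (rule nucI[where I = "UNIV \<times> UNIV" and x = x' and y = y', OF _ sm])
    show "(\<Sum>\<^sub>\<infinity>i\<in>UNIV \<times> UNIV. norm (x' i) * norm (y' i)) \<le> suminf s"
      using hs suminf_le[OF _ sS s] n(2) by (auto simp: has_sum_iff S_def)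
    fix h
    have "(\<lambda>p. inner h (y' p) *\<^sub>R x' p) summable_on (UNIV \<times> UNIV)"
      by (rule abs_summable_summable[OF summable_rank_one(1)[OF sm]])
    then have a: "((\<lambda>p. inner h (y' p) *\<^sub>R x' p) has_sum (\<Sum>\<^sub>\<infinity>p\<in>UNIV \<times> UNIV. inner h (y' p) *\<^sub>R x' p)) (UNIV \<times> UNIV)"
      by (rule has_sum_infsum)
    have "((\<lambda>k. blinfun_apply (D k) h) has_sum (\<Sum>\<^sub>\<infinity>p\<in>UNIV \<times> UNIV. inner h (y' p) *\<^sub>R x' p)) UNIV"
      by (rule has_sum_SigmaD[OF a]) (use n(3) in \<open>auto simp: x'_def y'_def\<close>)
    then have "(\<Sum>\<^sub>\<infinity>p\<in>UNIV \<times> UNIV. inner h (y' p) *\<^sub>R x' p) = blinfun_apply T h"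
      using has_sum_imp_sums T sums_unique2 by blast
    then show "((\<lambda>p. inner h (y' p) *\<^sub>R x' p) has_sum blinfun_apply T h) (UNIV \<times> UNIV)" using a by simp
  qed auto
qed

lemma nuc_add:
  fixes S T :: "'h::{real_inner,banach} \<Rightarrow>\<^sub>L 'h"
  assumes "nuc S s" "nuc T t" shows "nuc (S + T) (s + t)"
proof -
  define D where "D k = (if k = 0 then S else if k = Suc 0 then T else 0)" for k :: nat
  define r where "r k = (if k = 0 then s else if k = Suc 0 then t else 0)" for k :: nat
  have "r sums (\<Sum>k<2. r k)" by (rule sums_finite) (auto simp: r_def)
  then have r: "r sums (s + t)" by (simp add: r_def numeral_2_eq_2)
  have "nuc (S + T) (suminf r)"
  proof (rule nuc_suminf)
    show "nuc (D k) (r k)" for k using assms nuc_zero by (auto simp: D_def r_def)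
    show "summable r" using r by (rule sums_summable)
    fix h
    have "(\<lambda>k. blinfun_apply (D k) h) sums (\<Sum>k<2. blinfun_apply (D k) h)"
      by (rule sums_finite) (auto simp: D_def)
    then show "(\<lambda>k. blinfun_apply (D k) h) sums blinfun_apply (S + T) h"
      by (simp add: D_def numeral_2_eq_2 blinfun.add_left)
  qed
  then show ?thesis using r by (simp add: sums_iff)
qed

lemma nuc_sum:
  fixes S :: "'i \<Rightarrow> ('h::{real_inner,banach} \<Rightarrow>\<^sub>L 'h)"
  assumes "\<And>i. i \<in> I \<Longrightarrow> nuc (S i) (s i)" shows "nuc (\<Sum>i\<in>I. S i) (\<Sum>i\<in>I. s i)"
  using assms by (induction I rule: infinite_finite_induct) (auto intro: nuc_add nuc_zero)

lemma nuc_diff: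
  fixes S T :: "'h::{real_inner,banach} \<Rightarrow>\<^sub>L 'h"
  assumes "nuc S s" "nuc T t" shows "nuc (S - T) (s + t)"
  using nuc_add[OF assms(1) nuc_scaleR[OF assms(2), of "-1"]] by simp

subsection \<open>Approximation numbers\<close>

lemma rank_le_mono: "rank_le F m \<Longrightarrow> m \<le> n \<Longrightarrow> rank_le F n"
  unfolding rank_le_def by (meson order_trans)

lemma rank_le_zero: "rank_le 0 n"
  unfolding rank_le_def by (intro exI[of _ "{}"]) auto

lemma rank_le_diff: 
  assumes "rank_le F m" "rank_le G n" shows "rank_le (F - G) (m + n)"
proof -
  obtain S where S: "finite S" "card S \<le> m" "range (blinfun_apply F) \<subseteq> span S"
    using assms(1) by (auto simp: rank_le_def)
  obtain R where R: "finite R" "card R \<le> n" "range (blinfun_apply G) \<subseteq> span R"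
    using assms(2) by (auto simp: rank_le_def)
  have "F h - G h \<in> span (S \<union> R)" for h
    using S(3) R(3) span_mono[of S "S \<union> R"] span_mono[of R "S \<union> R"]
    by (intro span_diff) (auto simp: image_subset_iff)
  then show ?thesis unfolding rank_le_def
    using S R card_Un_le[of S R] by (intro exI[of _ "S \<union> R"]) (auto simp: blinfun.diff_left)
qed

lemma sval_bdd: "bdd_below {norm (T - F) | F. rank_le F n}"
  by (rule bdd_belowI[of _ 0]) auto

lemma sval_le: "rank_le F n \<Longrightarrow> sval T n \<le> norm (T - F)"
  unfolding sval_def by (rule cInf_lower[OF _ sval_bdd]) auto

lemma sval_nonneg: "0 \<le> sval T n"
  unfolding sval_def by (rule cInf_greatest) (use rank_le_zero in auto)

lemma sval_approx:
  assumes "\<epsilon> > 0" shows "\<exists>F. rank_le F n \<and> norm (T - F) < sval T n + \<epsilon>"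
proof -
  have "{norm (T - F) | F. rank_le F n} \<noteq> {}" using rank_le_zero by auto
  moreover have "Inf {norm (T - F) | F. rank_le F n} < sval T n + \<epsilon>" using assms by (simp add: sval_def)
  ultimately obtain r where "r \<in> {norm (T - F) | F. rank_le F n}" "r < sval T n + \<epsilon>"
    using cInf_lessD by meson
  then show ?thesis by auto
qed

lemma sval_antimono: "m \<le> n \<Longrightarrow> sval T n \<le> sval T m"
  unfolding sval_def[of T m]
  by (rule cInf_greatest) (use rank_le_zero in \<open>auto intro: sval_le rank_le_mono\<close>)

text \<open>Rank at most 0 forces F = 0, so the numbering starts with the operator norm at index
  0.\<close>

lemma sval_0: "sval T 0 = norm T"
proof -
  have "rank_le F 0 \<longleftrightarrow> F = 0" for F :: "'a \<Rightarrow>\<^sub>L 'a"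
  proof
    assume "rank_le F 0"
    then have "range (blinfun_apply F) \<subseteq> {0}" by (auto simp: rank_le_def)
    then have "blinfun_apply F i = 0" for i by blast
    then show "F = 0" by (intro blinfun_eqI) simp
  qed (simp add: rank_le_zero)
  then have "{norm (T - F) | F. rank_le F 0} = {norm T}" by auto
  then show ?thesis by (simp add: sval_def)
qed

lemma norm_le_tnorm: "trace_class T \<Longrightarrow> norm T \<le> tnorm T"
  unfolding trace_class_def tnorm_def
  using sum_le_suminf[of "sval T" "{0}"] by (simp add: sval_0 sval_nonneg)

lemma tnorm_nonneg: "trace_class T \<Longrightarrow> 0 \<le> tnorm T"
  using norm_le_tnorm norm_ge_zero order_trans by blast

text \<open>Expand F h in an orthonormal basis of a space of dimension at most n containing the
  range. The coefficient at u is the inner product of h with the adjoint of F at u (by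
  \<open>riesz\<close>), whose norm is at most that of F; there are at most n such terms.\<close>

lemma nuc_finite_rank:
  fixes F :: "'h::{real_inner,banach,second_countable_topology} \<Rightarrow>\<^sub>L 'h"
  assumes "rank_le F n" shows "nuc F (real n * norm F)"
proof -
  obtain S where S: "finite S" "card S \<le> n" "range (blinfun_apply F) \<subseteq> span S"
    using assms by (auto simp: rank_le_def)
  obtain C where C: "finite C" "card C \<le> card S" "span C = span S" "pairwise orthogonal C"
    using basis_orthogonal[OF S(1)] by blast
  define U where "U = sgn ` (C - {0})"
  have finU: "finite U" using C(1) by (simp add: U_def)
  have "card U \<le> card (C - {0})" unfolding U_def using C(1) by (intro card_image_le) auto
  also have "\<dots> \<le> card C" using C(1) by (intro card_mono) auto
  finally have cU: "card U \<le> n" using C(2) S(2) by linarith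
  have orth: "inner u v = (if u = v then 1 else 0)" if uv: "u \<in> U" "v \<in> U" for u v
  proof -
    obtain c d where cd: "c \<in> C" "c \<noteq> 0" "u = sgn c" "d \<in> C" "d \<noteq> 0" "v = sgn d"
      using uv unfolding U_def by blast
    show ?thesis
    proof (cases "c = d")
      case True then show ?thesis using cd by (simp add: power2_norm_eq_inner[symmetric] norm_sgn)
    next
      case False
      then have "inner c d = 0" using C(4) cd by (auto simp: pairwise_def orthogonal_def)
      then have "inner u v = 0" using cd by (simp add: sgn_div_norm)
      moreover have "inner u u = 1" using cd by (simp add: power2_norm_eq_inner[symmetric] norm_sgn)
      ultimately show ?thesis by auto
    qed
  qed
  have "c \<in> span U" if "c \<in> C" for c
  proof (cases "c = 0")
    case False
    then have "sgn c \<in> U" using that by (auto simp: U_def)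
    then have "norm c *\<^sub>R sgn c \<in> span U" by (intro span_scale span_base)
    then show ?thesis using False by (simp add: sgn_div_norm)
  qed (simp add: span_zero)
  then have "span C \<subseteq> span U" by (intro span_minimal) auto
  then have FU: "blinfun_apply F h \<in> span U" for h using S(3) C(3) by auto
  have Fh: "blinfun_apply F h = (\<Sum>u\<in>U. inner (F h) u *\<^sub>R u)" for h
    using orthonormal_best_approx[OF orth finU FU[of h], of "F h"] by simp
  have "\<exists>y. \<forall>h. inner (F h) u = inner h y" for u
    by (rule riesz) (intro bounded_linear_inner_left_comp blinfun.bounded_linear_right)
  then obtain y where y: "\<And>u h. inner (F h) u = inner h (y u)" by metis
  have ny: "norm (y u) \<le> norm F" if "u \<in> U" for u
  proof -
    have "norm u = 1" using orth[OF that that] by (simp add: norm_eq_1)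
    have "norm (y u) * norm (y u) = inner (F (y u)) u" by (simp add: y power2_norm_eq_inner flip: power2_eq_square)
    also have "\<dots> \<le> norm (F (y u)) * norm u" by (rule norm_cauchy_schwarz)
    also have "\<dots> \<le> norm F * norm (y u)" using \<open>norm u = 1\<close> by (simp add: norm_blinfun)
    finally show ?thesis by (cases "y u = 0") auto
  qed
  show ?thesis
  proof (rule nucI[where I = U and x = "\<lambda>u. u" and y = y])
    show "countable U" using finU by (rule countable_finite)
    have "(\<Sum>u\<in>U. norm u * norm (y u)) \<le> (\<Sum>u\<in>U. norm F)"
    proof (rule sum_mono)
      fix u assume u: "u \<in> U"
      have "norm u = 1" using orth[OF u u] by (simp add: norm_eq_1)
      then show "norm u * norm (y u) \<le> norm F" using ny[OF u] by simp
    qed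
    also have "\<dots> \<le> real n * norm F" using cU by (simp add: mult_right_mono)
    finally show "(\<Sum>\<^sub>\<infinity>u\<in>U. norm u * norm (y u)) \<le> real n * norm F" using finU by simp
    show "((\<lambda>u. inner h (y u) *\<^sub>R u) has_sum blinfun_apply F h) U" for h
      by (rule has_sum_finiteI[OF finU]) (use Fh[of h] in \<open>simp add: y\<close>)
  qed (use finU in auto)
qed

text \<open>The dyadic block from 2^K to 2^(K+1) has 2^K terms, each at least a (2^(K+1)); the
  factor 2 pays for writing 2^(K+1) in place of 2^K.\<close>

lemma condensation_bound:
  fixes a :: "nat \<Rightarrow> real"
  assumes a: "\<And>m n. m \<le> n \<Longrightarrow> a n \<le> a m"
  shows "(\<Sum>k<K. 2 ^ Suc k * a (2 ^ Suc k)) \<le> 2 * (\<Sum>n\<in>{1..<2^K}. a n)"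
proof (induction K)
  case (Suc K)
  have "2 ^ K * a (2 ^ Suc K) = (\<Sum>n\<in>{2^K..<2^Suc K::nat}. a (2 ^ Suc K))" by simp
  also have "\<dots> \<le> (\<Sum>n\<in>{2^K..<2^Suc K}. a n)" by (rule sum_mono) (auto intro: a)
  finally have "2 ^ Suc K * a (2 ^ Suc K) \<le> 2 * (\<Sum>n\<in>{2^K..<2^Suc K}. a n)" by simp
  moreover have "(\<Sum>n\<in>{1..<2^Suc K}. a n) = (\<Sum>n\<in>{1..<2^K}. a n) + (\<Sum>n\<in>{2^K..<2^Suc K}. a n)"
    by (rule sum.atLeastLessThan_concat[symmetric]) auto
  ultimately show ?case using Suc by (simp add: algebra_simps)
qed simp

text \<open>Telescope approximants of rank at most 2^k; the summands have rank of order 2^k and norm of order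
  the 2^k-th approximation number, and Cauchy condensation bounds the total.\<close>

lemma trace_class_nuc:
  fixes T :: "'h::{real_inner,banach,second_countable_topology} \<Rightarrow>\<^sub>L 'h"
  assumes T: "trace_class T" shows "nuc T (35 * tnorm T)"
proof (cases "T = 0")
  case True
  then show ?thesis using nuc_mono[OF nuc_zero, of "35 * tnorm T"] tnorm_nonneg[OF T] by simp
next
  case False
  define a where "a = sval T"
  define \<tau> where "\<tau> = tnorm T"
  have \<tau>: "\<tau> > 0" using norm_le_tnorm[OF T] False unfolding \<tau>_def
    by (metis less_le_trans zero_less_norm_iff)
  \<comment> \<open>The infimum in \<open>sval\<close> need not be attained. The slack is multiplied
    by ranks of order 2^k, so 4^k in the denominator leaves a geometric series; scaling by \<tau>
    keeps the total a multiple of \<open>tnorm T\<close>, and the strict inequality needs \<tau> >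
    0, hence the separate case T = 0.\<close>
  define \<epsilon> where "\<epsilon> k = \<tau> / 4 ^ k" for k :: nat
  have a0: "a n \<ge> 0" for n by (simp add: a_def sval_nonneg)
  have am: "m \<le> n \<Longrightarrow> a n \<le> a m" for m n by (simp add: a_def sval_antimono)
  have as: "summable a" using T by (simp add: a_def trace_class_def)
  have "\<exists>F. rank_le F (2 ^ k) \<and> norm (T - F) < a (2 ^ k) + \<epsilon> k" for k
    unfolding a_def by (rule sval_approx) (simp add: \<epsilon>_def \<tau>)
  then obtain F where F: "\<And>k. rank_le (F k) (2 ^ k)" "\<And>k. norm (T - F k) < a (2 ^ k) + \<epsilon> k" by metis
  \<comment> \<open>\<open>D (Suc j)\<close> has rank at most 2^(j+1) + 2^j <= 4 * 2^j and norm at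
    most 2 a (2^j) + 2 \<epsilon> j; \<open>s\<close> is a bound for rank times norm, with 2^j
    \<epsilon> j = \<tau> / 2^j.\<close>
  define D where "D k = (case k of 0 \<Rightarrow> F 0 | Suc j \<Rightarrow> F (Suc j) - F j)" for k
  define s where "s k = (case k of 0 \<Rightarrow> 2 * a 0 + \<tau> | Suc j \<Rightarrow> 8 * (2 ^ j * a (2 ^ j)) + 8 * (\<tau> * (1/2) ^ j))" for k
  have D: "nuc (D k) (s k)" for k
  proof (cases k)
    case 0
    have "norm (F 0) \<le> norm T + norm (T - F 0)" by (metis norm_minus_commute norm_triangle_sub)
    also have "\<dots> \<le> a 0 + (a 1 + \<tau>)" using F(2)[of 0] by (simp add: a_def sval_0 \<epsilon>_def)
    also have "\<dots> \<le> 2 * a 0 + \<tau>" using am[of 0 1] by simp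
    finally show ?thesis using nuc_finite_rank[OF F(1)[of 0]] 0 by (auto simp: D_def s_def intro: nuc_mono)
  next
    case (Suc j)
    have "norm (D k) = norm ((T - F j) - (T - F (Suc j)))" by (simp add: D_def Suc)
    also have "\<dots> \<le> norm (T - F j) + norm (T - F (Suc j))" by (rule norm_triangle_ineq4)
    also have "\<dots> \<le> (a (2 ^ j) + \<epsilon> j) + (a (2 ^ Suc j) + \<epsilon> (Suc j))" using F(2)[of j] F(2)[of "Suc j"] by linarith
    also have "\<dots> \<le> 2 * a (2 ^ j) + 2 * \<epsilon> j"
    proof -
      have "\<epsilon> (Suc j) = \<epsilon> j / 4" "\<epsilon> j > 0" using \<tau> by (simp_all add: \<epsilon>_def)
      moreover have "a (2 ^ Suc j) \<le> a (2 ^ j)" by (rule am) simp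
      ultimately show ?thesis by linarith
    qed
    finally have n: "norm (D k) \<le> 2 * a (2 ^ j) + 2 * \<epsilon> j" .
    have "rank_le (D k) (2 ^ Suc j + 2 ^ j)" unfolding D_def Suc using rank_le_diff[OF F(1) F(1), of "Suc j" j] by simp
    then have "rank_le (D k) (4 * 2 ^ j)" by (rule rank_le_mono) simp
    then have "nuc (D k) (real (4 * 2 ^ j) * norm (D k))" by (rule nuc_finite_rank)
    moreover have "real (4 * 2 ^ j) * norm (D k) \<le> real (4 * 2 ^ j) * (2 * a (2 ^ j) + 2 * \<epsilon> j)"
      using n by (intro mult_left_mono) auto
    moreover have "real (4 * 2 ^ j) * (2 * a (2 ^ j) + 2 * \<epsilon> j) = s k"
    proof -
      have "(4::real) ^ j = 2 ^ j * 2 ^ j" by (simp flip: power_mult_distrib)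
      then have "2 ^ j * \<epsilon> j = \<tau> * (1/2) ^ j" by (simp add: \<epsilon>_def field_simps)
      then show ?thesis by (simp add: s_def Suc algebra_simps)
    qed
    ultimately show ?thesis by (metis nuc_mono)
  qed
  define b where "b j = 2 ^ j * a (2 ^ j)" for j
  have bK: "(\<Sum>k<K. b k) \<le> 2 * \<tau>" for K
  proof -
    have "(\<Sum>k<K. b k) \<le> (\<Sum>k<Suc K. b k)" by (simp add: b_def a0)
    also have "\<dots> = b 0 + (\<Sum>k<K. b (Suc k))" by (rule sum.lessThan_Suc_shift)
    also have "\<dots> \<le> a 0 + 2 * (\<Sum>n\<in>{1..<2^K}. a n)"
      using condensation_bound[of a K, OF am] am[of 0 1] by (simp add: b_def)
    also have "\<dots> \<le> 2 * (a 0 + (\<Sum>n\<in>{1..<2^K}. a n))" using a0[of 0] by simp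
    also have "a 0 + (\<Sum>n\<in>{1..<2^K}. a n) = (\<Sum>n\<in>insert 0 {1..<2^K}. a n)" by simp
    also have "\<dots> \<le> suminf a" by (rule sum_le_suminf[OF as]) (use a0 in auto)
    finally show ?thesis by (simp add: \<tau>_def tnorm_def a_def)
  qed
  have b0: "b k \<ge> 0" for k by (simp add: b_def a0)
  have bs: "summable b"
    by (rule bounded_imp_summable[where B = "2 * \<tau>"]) (use bK b0 in \<open>simp_all only: lessThan_Suc_atMost[symmetric]\<close>)
  have bsum: "suminf b \<le> 2 * \<tau>" by (rule suminf_le_const[OF bs bK])
  have g: "(\<lambda>j. (1/2::real) ^ j) sums 2" using geometric_sums[of "1/2::real"] by simp
  have "(\<lambda>j. s (Suc j)) sums (8 * suminf b + 8 * (\<tau> * 2))"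
    unfolding s_def nat.case b_def[symmetric] by (intro sums_add sums_mult g summable_sums bs)
  then have ss: "s sums (8 * suminf b + 8 * (\<tau> * 2) + s 0)" by (rule sums_Suc)
  have "nuc T (suminf s)"
  proof (rule nuc_suminf[OF D])
    show "summable s" using ss by (rule sums_summable)
    fix h
    have "a \<longlonglongrightarrow> 0" using as by (rule summable_LIMSEQ_zero)
    moreover have "strict_mono (\<lambda>k. 2 ^ k :: nat)" by (rule strict_monoI) simp
    ultimately have "(\<lambda>k. a (2 ^ k)) \<longlonglongrightarrow> 0" using LIMSEQ_subseq_LIMSEQ by (force simp: o_def)
    moreover have "\<epsilon> \<longlonglongrightarrow> 0"
      using tendsto_mult_right_zero[OF LIMSEQ_power_zero[of "1/4::real"], of \<tau>]
      by (simp add: \<epsilon>_def[abs_def] power_divide)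
    ultimately have "(\<lambda>k. a (2 ^ k) + \<epsilon> k) \<longlonglongrightarrow> 0" using tendsto_add by fastforce
    then have "(\<lambda>k. T - F k) \<longlonglongrightarrow> 0" by (rule Lim_null_comparison[rotated]) (auto intro!: always_eventually less_imp_le F(2))
    then have "(\<lambda>k. F k) \<longlonglongrightarrow> T"
      using tendsto_diff[OF tendsto_const[of T], of "\<lambda>k. T - F k" 0 sequentially] by simp
    then have lim: "(\<lambda>k. blinfun_apply (F k) h) \<longlonglongrightarrow> blinfun_apply T h" by (intro tendsto_intros)
    have "(\<Sum>k<Suc n. blinfun_apply (D k) h) = blinfun_apply (F n) h" for n
      by (induction n) (simp_all add: D_def blinfun.diff_left)
    then have "(\<lambda>n. \<Sum>k<Suc n. blinfun_apply (D k) h) \<longlonglongrightarrow> blinfun_apply T h" using lim by simp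
    then show "(\<lambda>k. blinfun_apply (D k) h) sums blinfun_apply T h"
      unfolding sums_def by (rule LIMSEQ_imp_Suc)
  qed
  \<comment> \<open>35 = 16 + 16 + 3: eight times the condensed sum, which is at most 2 \<tau>;
    eight times the geometric sum 2 \<tau>; and s 0 <= 3 \<tau>.\<close>
  moreover have "suminf s \<le> 35 * tnorm T"
  proof -
    have "a 0 \<le> \<tau>" using norm_le_tnorm[OF T] by (simp add: a_def sval_0 \<tau>_def)
    then show ?thesis using ss bsum by (auto simp: sums_iff s_def \<tau>_def)
  qed
  ultimately show ?thesis by (rule nuc_mono)
qed

section \<open>Converse direction: nuclear operators have summable approximation numbers\<close>

lemma infsum_cauchy_schwarz:
  fixes u w :: "'i \<Rightarrow> real"
  assumes u: "(\<lambda>i. (u i)\<^sup>2) summable_on I" and w: "(\<lambda>i. (w i)\<^sup>2) summable_on I"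
  shows "(\<lambda>i. \<bar>u i * w i\<bar>) summable_on I"
    and "(\<Sum>\<^sub>\<infinity>i\<in>I. \<bar>u i * w i\<bar>) \<le> sqrt (\<Sum>\<^sub>\<infinity>i\<in>I. (u i)\<^sup>2) * sqrt (\<Sum>\<^sub>\<infinity>i\<in>I. (w i)\<^sup>2)"
proof -
  define c where "c = sqrt (\<Sum>\<^sub>\<infinity>i\<in>I. (u i)\<^sup>2) * sqrt (\<Sum>\<^sub>\<infinity>i\<in>I. (w i)\<^sup>2)"
  have f: "(\<Sum>i\<in>F. \<bar>u i * w i\<bar>) \<le> c" if "finite F" "F \<subseteq> I" for F
  proof -
    have "(\<Sum>i\<in>F. \<bar>u i * w i\<bar>) \<le> L2_set u F * L2_set w F"
      using L2_set_mult_ineq[of u w F] by (simp add: abs_mult)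
    also have "\<dots> \<le> c" unfolding c_def L2_set_def
      by (intro mult_mono real_sqrt_le_mono finite_sum_le_infsum u w that sum_nonneg) (auto intro: sum_nonneg infsum_nonneg)
    finally show ?thesis .
  qed
  show 1: "(\<lambda>i. \<bar>u i * w i\<bar>) summable_on I"
    by (rule nonneg_bdd_above_summable_on) (use f in \<open>auto intro!: bdd_aboveI[of _ c]\<close>)
  show "(\<Sum>\<^sub>\<infinity>i\<in>I. \<bar>u i * w i\<bar>) \<le> sqrt (\<Sum>\<^sub>\<infinity>i\<in>I. (u i)\<^sup>2) * sqrt (\<Sum>\<^sub>\<infinity>i\<in>I. (w i)\<^sup>2)"
    using infsum_le_finite_sums[OF 1 f] by (simp add: c_def)
qed

lemma bessel:
  fixes v :: "nat \<Rightarrow> 'h::real_inner"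
  assumes v: "\<And>i. v i = 0 \<or> norm (v i) = 1" "\<And>i j. i \<noteq> j \<Longrightarrow> inner (v i) (v j) = 0"
  shows "(\<Sum>i<n. (inner (v i) y)\<^sup>2) \<le> (norm y)\<^sup>2"
proof -
  define w where "w = (\<Sum>i<n. inner (v i) y *\<^sub>R v i)"
  have "(norm w)\<^sup>2 = (\<Sum>i<n. (norm (inner (v i) y *\<^sub>R v i))\<^sup>2)"
    unfolding w_def by (rule orthonormal_norm_sum) (auto simp: v)
  also have "\<dots> = (\<Sum>i<n. (inner (v i) y)\<^sup>2)"
  proof (rule sum.cong)
    fix i
    show "(norm (inner (v i) y *\<^sub>R v i))\<^sup>2 = (inner (v i) y)\<^sup>2"
      using v(1)[of i] by (auto simp: power_mult_distrib)
  qed simp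
  finally have 1: "(norm w)\<^sup>2 = (\<Sum>i<n. (inner (v i) y)\<^sup>2)" .
  have "inner w y = (\<Sum>i<n. (inner (v i) y)\<^sup>2)" by (simp add: w_def inner_sum_left power2_eq_square)
  then have "norm w * norm w \<le> norm w * norm y" using 1 norm_cauchy_schwarz[of w y] by (simp add: power2_eq_square)
  then have "norm w \<le> norm y" by (cases "w = 0") auto
  then show ?thesis using 1 by (metis norm_ge_zero power_mono)
qed

text \<open>A substitute for the singular value decomposition: choosing each vector within a factor 2 of the
  optimum on the orthogonal complement of its predecessors avoids any compactness argument.\<close>

lemma greedy_orthonormal:
  fixes y :: "nat \<Rightarrow> 'h::real_inner"
  assumes y: "(\<lambda>i. (norm (y i))\<^sup>2) summable_on UNIV"
  defines "q \<equiv> \<lambda>h. sqrt (\<Sum>\<^sub>\<infinity>i. (inner h (y i))\<^sup>2)"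
  obtains v :: "nat \<Rightarrow> 'h" where "\<And>i. v i = 0 \<or> norm (v i) = 1" "\<And>i j. i \<noteq> j \<Longrightarrow> inner (v i) (v j) = 0"
    "\<And>n h. (\<And>i. i < n \<Longrightarrow> inner h (v i) = 0) \<Longrightarrow> q h \<le> 2 * q (v n) * norm h"
    "\<And>n. (\<Sum>i<n. (q (v i))\<^sup>2) \<le> (\<Sum>\<^sub>\<infinity>i. (norm (y i))\<^sup>2)"
    "\<And>h. (\<lambda>i. (inner h (y i))\<^sup>2) summable_on UNIV"
proof -
  define s where "s = (\<Sum>\<^sub>\<infinity>i. (norm (y i))\<^sup>2)"
  have le: "(inner h (y i))\<^sup>2 \<le> (norm h)\<^sup>2 * (norm (y i))\<^sup>2" for h i
    using Cauchy_Schwarz_ineq[of h "y i"] by (simp add: power2_norm_eq_inner)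
  have sy: "(\<lambda>i. (norm h)\<^sup>2 * (norm (y i))\<^sup>2) summable_on UNIV" for h
    using y by (rule summable_on_cmult_right)
  have sm: "(\<lambda>i. (inner h (y i))\<^sup>2) summable_on UNIV" for h
    by (rule summable_on_comparison_test[OF sy]) (use le in auto)
  have "(\<Sum>\<^sub>\<infinity>i. (inner h (y i))\<^sup>2) \<le> (norm h)\<^sup>2 * s" for h
    using infsum_mono[OF sm sy le] unfolding s_def infsum_cmult_right[OF y] .
  then have qb: "q h \<le> norm h * sqrt s" for h
    unfolding q_def using real_sqrt_le_mono by (fastforce simp: real_sqrt_mult)
  have q0: "q h \<ge> 0" for h unfolding q_def by (simp add: infsum_nonneg)
  have q2: "(q h)\<^sup>2 = (\<Sum>\<^sub>\<infinity>i. (inner h (y i))\<^sup>2)" for h unfolding q_def by (simp add: infsum_nonneg)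
  have qs: "q (c *\<^sub>R h) = \<bar>c\<bar> * q h" for c h
    unfolding q_def by (simp add: power_mult_distrib infsum_cmult_right' real_sqrt_mult)
  \<comment> \<open>\<open>v\<close> is a unit vector orthogonal to \<open>P\<close> reaching at
    least half of the supremum of \<open>q\<close> over such vectors. It is 0 when there are none or
    the supremum is not positive; \<open>q\<close> then vanishes on the whole complement and the
    bound still holds.\<close>
  have pick: "\<exists>v. (v = 0 \<or> norm v = 1) \<and> (\<forall>p\<in>P. inner v p = 0) \<and>
      (\<forall>h. (\<forall>p\<in>P. inner h p = 0) \<longrightarrow> q h \<le> 2 * q v * norm h)" for P
  proof -
    define A where "A = {h. norm h = 1 \<and> (\<forall>p\<in>P. inner h p = 0)}"
    have "q h \<le> sqrt s" if "h \<in> A" for h using qb[of h] that by (simp add: A_def)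
    then have bdd: "bdd_above (q ` A)" by (intro bdd_aboveI[of _ "sqrt s"]) auto
    have key: "q h \<le> Sup (q ` A) * norm h" "A \<noteq> {} \<or> h = 0" if "\<forall>p\<in>P. inner h p = 0" for h
    proof -
      have "q h \<le> Sup (q ` A) * norm h \<and> (A \<noteq> {} \<or> h = 0)"
      proof (cases "h = 0")
        case True then show ?thesis by (simp add: q_def)
      next
        case False
        then have A: "sgn h \<in> A" using that by (simp add: A_def norm_sgn) (simp add: sgn_div_norm)
        then have "q (sgn h) \<le> Sup (q ` A)" using bdd by (intro cSup_upper) auto
        then have "norm h * q (sgn h) \<le> norm h * Sup (q ` A)" by (intro mult_left_mono) auto
        moreover have "norm h * q (sgn h) = q h"
        proof -
          have "q (norm h *\<^sub>R sgn h) = norm h * q (sgn h)" using qs[of "norm h" "sgn h"] by simp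
          moreover have "norm h *\<^sub>R sgn h = h" using False by (simp add: sgn_div_norm)
          ultimately show ?thesis by simp
        qed
        ultimately show ?thesis using A by (auto simp: mult.commute)
      qed
      then show "q h \<le> Sup (q ` A) * norm h" "A \<noteq> {} \<or> h = 0" by auto
    qed
    show ?thesis
    proof (cases "A \<noteq> {} \<and> Sup (q ` A) > 0")
      case True
      then have "\<exists>r\<in>q ` A. Sup (q ` A) / 2 < r"
        by (intro less_cSupD) auto
      then obtain v where v: "v \<in> A" "Sup (q ` A) \<le> 2 * q v" by auto
      have "q h \<le> 2 * q v * norm h" if "\<forall>p\<in>P. inner h p = 0" for h
        using key(1)[OF that] mult_right_mono[OF v(2), of "norm h"] by simp
      then show ?thesis using v(1) by (auto simp: A_def)
    next
      case False
      have "q h \<le> 0" if "\<forall>p\<in>P. inner h p = 0" for h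
      proof (cases "h = 0")
        case True then show ?thesis by (simp add: q_def)
      next
        case h: False
        then have "A \<noteq> {}" using key(2)[OF that] by blast
        then have "Sup (q ` A) \<le> 0" using False by simp
        then have "Sup (q ` A) * norm h \<le> 0" by (intro mult_nonpos_nonneg) auto
        then show ?thesis using key(1)[OF that] by linarith
      qed
      moreover have "q 0 = 0" by (simp add: q_def)
      ultimately show ?thesis by (intro exI[of _ 0]) auto
    qed
  qed
  define Q where "Q v n r \<longleftrightarrow> (r = 0 \<or> norm r = 1) \<and> (\<forall>i<n. inner r (v i) = 0) \<and>
      (\<forall>h. (\<forall>i<n. inner h (v i) = 0) \<longrightarrow> q h \<le> 2 * q r * norm h)" for v :: "nat \<Rightarrow> 'h" and n r
  have "\<exists>v. \<forall>n. Q v n (v n)"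
  proof (rule dependent_wf_choice[OF wf_less])
    fix f g :: "nat \<Rightarrow> 'h" and x r assume "\<And>z. (z, x) \<in> {(x, y). x < y} \<Longrightarrow> f z = g z"
    then show "Q f x r = Q g x r" unfolding Q_def by auto
  next
    fix f :: "nat \<Rightarrow> 'h" and n
    show "\<exists>r. Q f n r" using pick[of "f ` {..<n}"] unfolding Q_def by auto
  qed
  then obtain v where v: "\<And>n. Q v n (v n)" by blast
  have v1: "v i = 0 \<or> norm (v i) = 1" for i using v[of i] by (auto simp: Q_def)
  have v2: "inner (v i) (v j) = 0" if "i \<noteq> j" for i j
    using v[of i] v[of j] that by (cases i j rule: linorder_cases) (auto simp: Q_def inner_commute)
  have v3: "q h \<le> 2 * q (v n) * norm h" if "\<And>i. i < n \<Longrightarrow> inner h (v i) = 0" for n h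
    using v[of n] that by (auto simp: Q_def)
  have v4: "(\<Sum>i<n. (q (v i))\<^sup>2) \<le> s" for n
  proof -
    \<comment> \<open>Exchanging the two sums and applying Bessel's inequality to each y k: the
      squares of \<open>q\<close> along an orthonormal system stay below the squared Hilbert-Schmidt
      norm.\<close>
    have "((\<lambda>k. \<Sum>i<n. (inner (v i) (y k))\<^sup>2) has_sum (\<Sum>i<n. (q (v i))\<^sup>2)) UNIV"
      unfolding q2 by (induction n) (auto intro!: has_sum_add has_sum_infsum sm)
    then show ?thesis unfolding s_def
      by (rule has_sum_mono[OF _ has_sum_infsum[OF y]]) (rule bessel[OF v1 v2])
  qed
  show ?thesis using that[OF v1 v2 v3 v4[unfolded s_def] sm] by blast
qed

text \<open>Write the operator as a product of two Hilbert-Schmidt factors through sequence space and compress it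
  by the first n greedy vectors on either side, which costs rank 2n.\<close>

lemma nuc_trace_class:
  fixes T :: "'h::{real_inner,banach} \<Rightarrow>\<^sub>L 'h"
  assumes T: "nuc T s" shows "trace_class T" and "tnorm T \<le> 8 * s"
proof -
  obtain x0 y0 where n: "(\<lambda>i. norm (x0 i) * norm (y0 i)) summable_on (UNIV::nat set)"
    "(\<Sum>\<^sub>\<infinity>i. norm (x0 i) * norm (y0 i)) \<le> s"
    "\<And>h. ((\<lambda>i. inner h (y0 i) *\<^sub>R x0 i) has_sum blinfun_apply T h) UNIV"
    using assms by (rule nucE) blast
  \<comment> \<open>The weight of each term is split evenly between its two vectors, so both
    families become square summable, with total at most s each, while the rank-one terms are
    unchanged.\<close>
  define r where "r i = sqrt (norm (x0 i) * norm (y0 i))" for i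
  define x where "x i = r i *\<^sub>R sgn (x0 i)" for i
  define y where "y i = r i *\<^sub>R sgn (y0 i)" for i
  have r2: "r i * r i = norm (x0 i) * norm (y0 i)" for i by (simp add: r_def)
  have nx: "(norm (x i))\<^sup>2 = norm (x0 i) * norm (y0 i)" and ny: "(norm (y i))\<^sup>2 = norm (x0 i) * norm (y0 i)" for i
    by (auto simp: x_def y_def norm_sgn power_mult_distrib power2_eq_square r2)
  have xs: "(\<lambda>i. (norm (x i))\<^sup>2) summable_on UNIV" and ys: "(\<lambda>i. (norm (y i))\<^sup>2) summable_on UNIV"
    unfolding nx ny using n(1) by auto
  have eq: "inner h (y i) *\<^sub>R x i = inner h (y0 i) *\<^sub>R x0 i" for h i
  proof -
    have "inner h (y i) *\<^sub>R x i = (r i * r i) *\<^sub>R (inner h (sgn (y0 i)) *\<^sub>R sgn (x0 i))"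
      by (simp add: x_def y_def mult_ac)
    also have "\<dots> = inner h (norm (y0 i) *\<^sub>R sgn (y0 i)) *\<^sub>R (norm (x0 i) *\<^sub>R sgn (x0 i))"
      unfolding r2 by (simp add: mult_ac)
    also have "norm (y0 i) *\<^sub>R sgn (y0 i) = y0 i" by (cases "y0 i = 0") (auto simp: sgn_div_norm)
    also have "norm (x0 i) *\<^sub>R sgn (x0 i) = x0 i" by (cases "x0 i = 0") (auto simp: sgn_div_norm)
    finally show ?thesis .
  qed
  have Ts: "((\<lambda>i. inner h (y i) *\<^sub>R x i) has_sum blinfun_apply T h) UNIV" for h
    unfolding eq by (rule n(3))
  define qx where "qx h = sqrt (\<Sum>\<^sub>\<infinity>i. (inner h (x i))\<^sup>2)" for h
  define qy where "qy h = sqrt (\<Sum>\<^sub>\<infinity>i. (inner h (y i))\<^sup>2)" for h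
  obtain v :: "nat \<Rightarrow> 'h" where v: "\<And>i. v i = 0 \<or> norm (v i) = 1" "\<And>i j. i \<noteq> j \<Longrightarrow> inner (v i) (v j) = 0"
    "\<And>n h. (\<And>i. i < n \<Longrightarrow> inner h (v i) = 0) \<Longrightarrow> qy h \<le> 2 * qy (v n) * norm h"
    "\<And>n. (\<Sum>i<n. (qy (v i))\<^sup>2) \<le> (\<Sum>\<^sub>\<infinity>i. (norm (y i))\<^sup>2)"
    "\<And>h. (\<lambda>i. (inner h (y i))\<^sup>2) summable_on UNIV"
    using greedy_orthonormal[OF ys] unfolding qy_def by blast
  obtain w :: "nat \<Rightarrow> 'h" where w: "\<And>i. w i = 0 \<or> norm (w i) = 1" "\<And>i j. i \<noteq> j \<Longrightarrow> inner (w i) (w j) = 0"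
    "\<And>n h. (\<And>i. i < n \<Longrightarrow> inner h (w i) = 0) \<Longrightarrow> qx h \<le> 2 * qx (w n) * norm h"
    "\<And>n. (\<Sum>i<n. (qx (w i))\<^sup>2) \<le> (\<Sum>\<^sub>\<infinity>i. (norm (x i))\<^sup>2)"
    "\<And>h. (\<lambda>i. (inner h (x i))\<^sup>2) summable_on UNIV"
    using greedy_orthonormal[OF xs] unfolding qx_def by blast
  have q0: "qx h \<ge> 0" "qy h \<ge> 0" for h unfolding qx_def qy_def by (simp_all add: infsum_nonneg)
  define Pr where "Pr u n = (\<Sum>i<n. outer (u i) (u i))" for u :: "nat \<Rightarrow> 'h" and n :: nat
  have Pr: "blinfun_apply (Pr u n) h = (\<Sum>i<n. inner h (u i) *\<^sub>R u i)" for u n h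
    unfolding Pr_def by (induction n) (auto simp: blinfun.add_left)
  have ortho: "inner (h - Pr u n h) (u j) = 0" if u: "\<And>i. u i = 0 \<or> norm (u i) = 1" "\<And>i j. i \<noteq> j \<Longrightarrow> inner (u i) (u j) = 0"
    and j: "j < n" for u :: "nat \<Rightarrow> 'h" and n h j
  proof -
    have "inner (Pr u n h) (u j) = (\<Sum>i<n. if i = j then inner h (u j) * inner (u j) (u j) else 0)"
      unfolding Pr inner_sum_left by (rule sum.cong) (auto simp: u)
    also have "\<dots> = inner h (u j) * inner (u j) (u j)" using j by simp
    also have "\<dots> = inner h (u j)" using u(1)[of j] by (auto simp: norm_eq_1)
    finally show ?thesis by (simp add: inner_diff_left)
  qed
  have contr: "norm (h - Pr u n h) \<le> norm h" if u: "\<And>i. u i = 0 \<or> norm (u i) = 1" "\<And>i j. i \<noteq> j \<Longrightarrow> inner (u i) (u j) = 0"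
    for u :: "nat \<Rightarrow> 'h" and n h
  proof -
    have "(\<Sum>i<n. inner h (u i) * inner (h - Pr u n h) (u i)) = 0"
    proof (rule sum.neutral, rule ballI)
      fix i assume "i \<in> {..<n}"
      then have "inner (h - Pr u n h) (u i) = 0" by (intro ortho[OF u]) auto
      then show "inner h (u i) * inner (h - Pr u n h) (u i) = 0" by simp
    qed
    then have "orthogonal (h - Pr u n h) (Pr u n h)" unfolding orthogonal_def
      by (subst (2) Pr) (simp add: inner_sum_right)
    then have "(norm ((h - Pr u n h) + Pr u n h))\<^sup>2 = (norm (h - Pr u n h))\<^sup>2 + (norm (Pr u n h))\<^sup>2"
      by (rule norm_add_Pythagorean)
    then have "(norm (h - Pr u n h))\<^sup>2 \<le> (norm h)\<^sup>2" by simp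
    then show ?thesis by (rule power2_le_imp_le) simp
  qed
  have selfadj: "inner (h - Pr u n h) k = inner h (k - Pr u n k)" for u n h k
    by (simp add: inner_diff_left inner_diff_right Pr inner_sum_left inner_sum_right inner_commute mult.commute)
  have main: "sval T (2 * n) \<le> 4 * (qy (v n) * qx (w n))" for n
  proof -
    \<comment> \<open>T - G has range in the span of the w i and the T (v i) for i < n, hence rank
      at most 2 n, so the norm of G bounds the approximation number of index 2 n.\<close>
    define G where "G = (id_blinfun - Pr w n) o\<^sub>L T o\<^sub>L (id_blinfun - Pr v n)"
    have Gh: "G h = T (h - Pr v n h) - Pr w n (T (h - Pr v n h))" for h
      by (simp add: G_def blinfun.diff_left)
    have "rank_le (T - G) (2 * n)"
    proof -
      define S where "S = w ` {..<n} \<union> (\<lambda>i. T (v i)) ` {..<n}"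
      have "card S \<le> card (w ` {..<n}) + card ((\<lambda>i. T (v i)) ` {..<n})" unfolding S_def by (rule card_Un_le)
      also have "\<dots> \<le> 2 * n" using card_image_le[of "{..<n}" w] card_image_le[of "{..<n}" "\<lambda>i. T (v i)"] by simp
      finally have "card S \<le> 2 * n" .
      moreover have "(T - G) h \<in> span S" for h
      proof -
        have "(T - G) h = T (Pr v n h) + Pr w n (T (h - Pr v n h))"
          by (simp add: blinfun.diff_left Gh blinfun.diff_right)
        also have "T (Pr v n h) = (\<Sum>i<n. inner h (v i) *\<^sub>R T (v i))"
          by (simp add: Pr blinfun.sum_right blinfun.scaleR_right)
        finally have eq: "(T - G) h = (\<Sum>i<n. inner h (v i) *\<^sub>R T (v i)) +
          (\<Sum>i<n. inner (T (h - Pr v n h)) (w i) *\<^sub>R w i)" unfolding Pr[of w] .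
        show ?thesis unfolding eq
        proof (rule span_add)
          show "(\<Sum>i<n. inner h (v i) *\<^sub>R T (v i)) \<in> span S"
            by (intro span_sum span_scale span_base) (auto simp: S_def)
          show "(\<Sum>i<n. inner (T (h - Pr v n h)) (w i) *\<^sub>R w i) \<in> span S"
            by (intro span_sum span_scale span_base) (auto simp: S_def)
        qed
      qed
      ultimately show ?thesis unfolding rank_le_def
        by (intro exI[of _ S]) (auto simp: S_def)
    qed
    then have "sval T (2 * n) \<le> norm (T - (T - G))" by (rule sval_le)
    also have "T - (T - G) = G" by simp
    also have "norm G \<le> 4 * (qy (v n) * qx (w n))"
    proof (rule norm_blinfun_bound)
      fix h
      define k where "k = h - Pr v n h"
      define g where "g = G h - Pr w n (G h)"
      \<comment> \<open>Self-adjointness moves the left projection onto G h. Then k and g are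
        orthogonal to the first n greedy vectors of their sides; Cauchy-Schwarz over the
        representation separates \<open>qy k\<close> from \<open>qx g\<close>, and each greedy bound
        contributes a factor 2.\<close>
      have "norm (G h) * norm (G h) = inner (T k - Pr w n (T k)) (G h)"
        by (simp add: Gh[of h] k_def power2_norm_eq_inner flip: power2_eq_square)
      also have "\<dots> = inner (T k) g" unfolding g_def by (rule selfadj)
      also have "\<dots> \<le> qy k * qx g"
      proof -
        have a: "((\<lambda>i. inner (inner k (y i) *\<^sub>R x i) g) has_sum inner (T k) g) UNIV"
          by (rule has_sum_bounded_linear[OF bounded_linear_inner_left Ts])
        have "((\<lambda>i. inner k (y i) * inner g (x i)) has_sum inner (T k) g) UNIV"
          using a by (simp add: inner_commute[of _ g])
        then have "norm (inner (T k) g) \<le> (\<Sum>\<^sub>\<infinity>i. \<bar>inner k (y i) * inner g (x i)\<bar>)"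
          using norm_has_sum_le[of "\<lambda>i. inner k (y i) * inner g (x i)" UNIV "inner (T k) g"]
            infsum_cauchy_schwarz(1)[OF v(5) w(5)] by simp
        also have "\<dots> \<le> qy k * qx g"
          unfolding qx_def qy_def by (rule infsum_cauchy_schwarz(2)[OF v(5) w(5)])
        finally show ?thesis by simp
      qed
      also have "\<dots> \<le> (2 * qy (v n) * norm h) * (2 * qx (w n) * norm (G h))"
      proof (intro mult_mono q0)
        have "qy k \<le> 2 * qy (v n) * norm k" by (rule v(3)) (auto simp: k_def intro!: ortho v(1,2))
        also have "\<dots> \<le> 2 * qy (v n) * norm h"
          unfolding k_def using contr[OF v(1,2)] q0 by (intro mult_left_mono) auto
        finally show "qy k \<le> 2 * qy (v n) * norm h" .
        have "qx g \<le> 2 * qx (w n) * norm g" by (rule w(3)) (auto simp: g_def intro!: ortho w(1,2))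
        also have "\<dots> \<le> 2 * qx (w n) * norm (G h)"
          unfolding g_def using contr[OF w(1,2)] q0 by (intro mult_left_mono) auto
        finally show "qx g \<le> 2 * qx (w n) * norm (G h)" .
      qed (use q0 in auto)
      finally have "norm (G h) * norm (G h) \<le> (4 * (qy (v n) * qx (w n)) * norm h) * norm (G h)"
        by (simp add: algebra_simps)
      then show "norm (G h) \<le> 4 * (qy (v n) * qx (w n)) * norm h"
        using q0 by (cases "G h = 0") auto
    qed (use q0 in auto)
    finally show ?thesis .
  qed
  have sum: "(\<Sum>m<n. sval T m) \<le> 8 * s" for n
  proof -
    have "(\<Sum>m<n. sval T m) \<le> (\<Sum>m<2*n. sval T m)" by (rule sum_mono2) (auto simp: sval_nonneg)
    also have "\<dots> = (\<Sum>m<n. sval T (2 * m) + sval T (Suc (2 * m)))"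
      by (induction n) auto
    also have "\<dots> \<le> (\<Sum>m<n. 4 * ((qy (v m))\<^sup>2 + (qx (w m))\<^sup>2))"
    proof (rule sum_mono)
      fix m
      \<comment> \<open>The numbers of index 2m and 2m+1 are paired: their sum is at most 8 qy qx <=
        4 (qy^2 + qx^2). Summing over m gives 4 (s + s), the constant 8 of the statement.\<close>
      have arith: "x \<le> y \<Longrightarrow> 2 * p \<le> S \<Longrightarrow> y \<le> 4 * p \<Longrightarrow> y + x \<le> 4 * S" for x y p S :: real
        by linarith
      show "sval T (2 * m) + sval T (Suc (2 * m)) \<le> 4 * ((qy (v m))\<^sup>2 + (qx (w m))\<^sup>2)"
      proof (rule arith[OF _ _ main])
        show "sval T (Suc (2 * m)) \<le> sval T (2 * m)" by (rule sval_antimono) simp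
        show "2 * (qy (v m) * qx (w m)) \<le> (qy (v m))\<^sup>2 + (qx (w m))\<^sup>2"
          using sum_squares_bound[of "qy (v m)" "qx (w m)"] by (simp add: mult.assoc)
      qed
    qed
    also have "\<dots> = 4 * ((\<Sum>m<n. (qy (v m))\<^sup>2) + (\<Sum>m<n. (qx (w m))\<^sup>2))"
      by (simp add: sum_distrib_left sum.distrib)
    also have "\<dots> \<le> 4 * (s + s)" using v(4)[of n] w(4)[of n] n(2) unfolding nx ny by simp
    finally show ?thesis by simp
  qed
  have sm: "summable (sval T)"
    by (rule bounded_imp_summable[where B = "8 * s"])
       (use sum sval_nonneg in \<open>simp_all only: lessThan_Suc_atMost[symmetric]\<close>)
  then show "trace_class T" by (simp add: trace_class_def)
  show "tnorm T \<le> 8 * s" unfolding tnorm_def using suminf_le_const[OF sm sum] .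
qed

subsection \<open>The nuclear norm\<close>

text \<open>Equivalent to the sum of approximation numbers up to constants, but its triangle inequality needs
  no spectral theory.\<close>

definition nu :: "('h::real_inner \<Rightarrow>\<^sub>L 'h) \<Rightarrow> real" where
  "nu T = Inf {s. nuc T s}"

lemma nu_le: "nuc T s \<Longrightarrow> nu T \<le> s"
  unfolding nu_def by (rule cInf_lower) (auto intro!: bdd_belowI[of _ 0] nuc_nonneg)

lemma trace_class_iff_nuc:
  fixes T :: "'h::{real_inner,banach,second_countable_topology} \<Rightarrow>\<^sub>L 'h"
  shows "trace_class T \<longleftrightarrow> (\<exists>s. nuc T s)"
  using trace_class_nuc nuc_trace_class by blast

lemma nu_less:
  fixes T :: "'h::{real_inner,banach,second_countable_topology} \<Rightarrow>\<^sub>L 'h"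
  assumes "trace_class T" "nu T < r" shows "nuc T r"
proof -
  have "{s. nuc T s} \<noteq> {}" using assms(1) trace_class_iff_nuc by auto
  then obtain s where "s \<in> {s. nuc T s}" "s < r"
    using assms(2) cInf_lessD unfolding nu_def by meson
  then show ?thesis using nuc_mono[of T s r] by auto
qed

text \<open>Bounds linear in the weight pass to the infimum. Dividing by K + 1 avoids a case
  distinction for K = 0.\<close>

lemma nu_greatest:
  fixes T :: "'h::{real_inner,banach,second_countable_topology} \<Rightarrow>\<^sub>L 'h"
  assumes T: "trace_class T" and K: "0 \<le> K" and b: "\<And>s. nuc T s \<Longrightarrow> b \<le> K * s"
  shows "b \<le> K * nu T"
proof (rule field_le_epsilon)
  fix e :: real assume e: "e > 0"
  have "nuc T (nu T + e / (K + 1))" by (rule nu_less[OF T]) (use e K in simp)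
  from b[OF this] have "b \<le> K * nu T + K * (e / (K + 1))" by (simp add: distrib_left)
  moreover have "K * (e / (K + 1)) \<le> e" using K e by (simp add: field_simps)
  ultimately show "b \<le> K * nu T + e" by linarith
qed

lemma nu_nonneg:
  fixes T :: "'h::{real_inner,banach,second_countable_topology} \<Rightarrow>\<^sub>L 'h"
  shows "trace_class T \<Longrightarrow> 0 \<le> nu T"
  using nu_greatest[of T 1 0] nuc_nonneg by auto

lemma nu_map_le:
  fixes T :: "'h::{real_inner,banach,second_countable_topology} \<Rightarrow>\<^sub>L 'h"
  assumes "trace_class T" "0 \<le> K" "\<And>s. nuc T s \<Longrightarrow> nuc T' (K * s)"
  shows "nu T' \<le> K * nu T"
  using assms by (intro nu_greatest nu_le) auto

lemma nu_triangle:
  fixes S T :: "'h::{real_inner,banach,second_countable_topology} \<Rightarrow>\<^sub>L 'h"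
  assumes S: "trace_class S" and T: "trace_class T"
  shows "nu (S + T) \<le> nu S + nu T"
proof (rule field_le_epsilon)
  fix e :: real assume e: "e > 0"
  have "nuc (S + T) ((nu S + e/2) + (nu T + e/2))"
    by (intro nuc_add nu_less S T) (use e in auto)
  then show "nu (S + T) \<le> nu S + nu T + e" using nu_le by fastforce
qed

lemma tnorm_le_nu:
  fixes T :: "'h::{real_inner,banach,second_countable_topology} \<Rightarrow>\<^sub>L 'h"
  shows "trace_class T \<Longrightarrow> tnorm T \<le> 8 * nu T"
  by (rule nu_greatest) (auto intro: nuc_trace_class)

lemma nu_le_tnorm:
  fixes T :: "'h::{real_inner,banach,second_countable_topology} \<Rightarrow>\<^sub>L 'h"
  shows "trace_class T \<Longrightarrow> nu T \<le> 35 * tnorm T"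
  by (rule nu_le) (rule trace_class_nuc)

lemma trace_class_add:
  fixes S T :: "'h::{real_inner,banach,second_countable_topology} \<Rightarrow>\<^sub>L 'h"
  shows "trace_class S \<Longrightarrow> trace_class T \<Longrightarrow> trace_class (S + T)"
  unfolding trace_class_iff_nuc using nuc_add by blast

lemma trace_class_diff:
  fixes S T :: "'h::{real_inner,banach,second_countable_topology} \<Rightarrow>\<^sub>L 'h"
  shows "trace_class S \<Longrightarrow> trace_class T \<Longrightarrow> trace_class (S - T)"
  unfolding trace_class_iff_nuc using nuc_diff by blast

lemma trace_class_scaleR:
  fixes T :: "'h::{real_inner,banach,second_countable_topology} \<Rightarrow>\<^sub>L 'h"
  shows "trace_class T \<Longrightarrow> trace_class (c *\<^sub>R T)"
  unfolding trace_class_iff_nuc using nuc_scaleR by blast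

lemma trace_class_outer: "trace_class (outer f g :: 'h::{real_inner,banach,second_countable_topology} \<Rightarrow>\<^sub>L 'h)"
  unfolding trace_class_iff_nuc using nuc_outer by blast

lemma trace_class_zero: "trace_class (0 :: 'h::{real_inner,banach,second_countable_topology} \<Rightarrow>\<^sub>L 'h)"
  unfolding trace_class_iff_nuc using nuc_zero by blast

lemma trace_class_sum:
  fixes S :: "'i \<Rightarrow> ('h::{real_inner,banach,second_countable_topology} \<Rightarrow>\<^sub>L 'h)"
  assumes "\<And>i. i \<in> I \<Longrightarrow> trace_class (S i)" shows "trace_class (\<Sum>i\<in>I. S i)"
  using assms by (induction I rule: infinite_finite_induct) (auto intro: trace_class_add trace_class_zero)

lemma nu_scaleR_le:
  fixes T :: "'h::{real_inner,banach,second_countable_topology} \<Rightarrow>\<^sub>L 'h"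
  shows "trace_class T \<Longrightarrow> nu (c *\<^sub>R T) \<le> \<bar>c\<bar> * nu T"
  by (rule nu_map_le) (auto intro: nuc_scaleR)

lemma nu_minus_commute:
  fixes S T :: "'h::{real_inner,banach,second_countable_topology} \<Rightarrow>\<^sub>L 'h"
  assumes "trace_class S" "trace_class T" shows "nu (S - T) = nu (T - S)"
  using nu_scaleR_le[OF trace_class_diff[OF assms], of "-1"]
    nu_scaleR_le[OF trace_class_diff[OF assms(2,1)], of "-1"] by simp

lemma nu_zero: "nu (0 :: 'h::{real_inner,banach,second_countable_topology} \<Rightarrow>\<^sub>L 'h) = 0"
  using nu_le[OF nuc_zero] nu_nonneg[OF trace_class_zero] by (metis antisym)

subsection \<open>Double sums\<close>

lemma double_sum_bound:
  fixes f :: "'i \<times> 'j \<Rightarrow> real"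
  assumes f0: "\<And>p. 0 \<le> f p" and fs: "\<And>i. i \<in> I \<Longrightarrow> (\<lambda>j. f (i, j)) summable_on J"
    and fg: "\<And>i. i \<in> I \<Longrightarrow> (\<Sum>\<^sub>\<infinity>j\<in>J. f (i, j)) \<le> g i" and g: "g summable_on I"
  shows "f summable_on (I \<times> J)" and "(\<Sum>\<^sub>\<infinity>p\<in>I\<times>J. f p) \<le> (\<Sum>\<^sub>\<infinity>i\<in>I. g i)"
proof -
  define h where "h i = (\<Sum>\<^sub>\<infinity>j\<in>J. f (i, j))" for i
  have h0: "0 \<le> h i" for i unfolding h_def by (rule infsum_nonneg) (rule f0)
  have hs: "h summable_on I"
    by (rule summable_on_comparison_test[OF g]) (use fg h0 in \<open>auto simp: h_def\<close>)
  have fh: "((\<lambda>j. f (i, j)) has_sum h i) J" if "i \<in> I" for i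
    unfolding h_def using fs[OF that] by (rule has_sum_infsum)
  show 1: "f summable_on (I \<times> J)"
    by (rule summable_on_SigmaI[where g = h]) (use fh hs f0 in auto)
  have "(f has_sum infsum h I) (I \<times> J)"
    by (rule has_sum_SigmaI[where g = h]) (use fh hs 1 in auto)
  then have "(\<Sum>\<^sub>\<infinity>p\<in>I\<times>J. f p) = infsum h I" by (rule infsumI)
  also have "\<dots> \<le> infsum g I" by (rule infsum_mono[OF hs g]) (use fg in \<open>auto simp: h_def\<close>)
  finally show "(\<Sum>\<^sub>\<infinity>p\<in>I\<times>J. f p) \<le> (\<Sum>\<^sub>\<infinity>i\<in>I. g i)" .
qed

lemma has_sum_prod_nonneg:
  fixes f :: "'i \<Rightarrow> real" and g :: "'j \<Rightarrow> real"
  assumes f: "(f has_sum F) I" "\<And>i. 0 \<le> f i" and g: "(g has_sum G) J" "\<And>j. 0 \<le> g j"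
  shows "((\<lambda>(i, j). f i * g j) has_sum F * G) (I \<times> J)"
proof (rule has_sum_SigmaI[where g = "\<lambda>i. f i * G"])
  show inner: "((\<lambda>j. case (i, j) of (i, j) \<Rightarrow> f i * g j) has_sum f i * G) J" for i
    using has_sum_cmult_right[OF g(1), of "f i"] by simp
  show s: "((\<lambda>i. f i * G) has_sum F * G) I" by (rule has_sum_cmult_left[OF f(1)])
  show "(\<lambda>(i, j). f i * g j) summable_on (I \<times> J)"
    by (rule summable_on_SigmaI[where g = "\<lambda>i. f i * G"])
       (use inner s f(2) g(2) in \<open>auto simp: has_sum_iff\<close>)
qed

lemma suminf_tail_tendsto:
  fixes f :: "nat \<Rightarrow> real"
  assumes "summable f" shows "(\<lambda>d. \<Sum>j. f (j + d)) \<longlonglongrightarrow> 0"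
proof -
  have "(\<lambda>d. suminf f - (\<Sum>j<d. f j)) \<longlonglongrightarrow> suminf f - suminf f"
    by (intro tendsto_diff tendsto_const summable_LIMSEQ assms)
  then show ?thesis using suminf_minus_initial_segment[OF assms] by simp
qed

subsection \<open>The trace\<close>

text \<open>The double family of products of the coordinates of x i and y i over (i, e) is
  absolutely summable by Cauchy-Schwarz and Parseval. Summing it in the two orders gives the
  diagonal sum over the basis and the sum over the representation, so the trace depends on neither
  choice.\<close>

lemma rep_trace:
  fixes x y :: "'i \<Rightarrow> 'h::{real_inner,banach}"
  assumes B: "onb B" and sm: "(\<lambda>i. norm (x i) * norm (y i)) summable_on I"
    and T: "\<And>h. ((\<lambda>i. inner h (y i) *\<^sub>R x i) has_sum blinfun_apply T h) I"
  shows "((\<lambda>e. inner (T e) e) has_sum (\<Sum>\<^sub>\<infinity>i\<in>I. inner (x i) (y i))) B"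
    and "(\<lambda>i. inner (x i) (y i)) summable_on I"
proof -
  define F where "F = (\<lambda>(i, e). inner (y i) e * inner (x i) e)"
  have cs: "(\<lambda>e. \<bar>inner (y i) e * inner (x i) e\<bar>) summable_on B"
    "(\<Sum>\<^sub>\<infinity>e\<in>B. \<bar>inner (y i) e * inner (x i) e\<bar>) \<le> norm (x i) * norm (y i)" for i
  proof -
    note p = onb_parseval[OF B, unfolded has_sum_iff]
    show "(\<lambda>e. \<bar>inner (y i) e * inner (x i) e\<bar>) summable_on B"
      by (rule infsum_cauchy_schwarz(1)) (use p in auto)
    have "(\<Sum>\<^sub>\<infinity>e\<in>B. \<bar>inner (y i) e * inner (x i) e\<bar>) \<le> norm (y i) * norm (x i)"
      using infsum_cauchy_schwarz(2)[of "inner (y i)" B "inner (x i)"] p by simp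
    then show "(\<Sum>\<^sub>\<infinity>e\<in>B. \<bar>inner (y i) e * inner (x i) e\<bar>) \<le> norm (x i) * norm (y i)"
      by (simp add: mult.commute)
  qed
  have "(\<lambda>p. \<bar>F p\<bar>) summable_on (I \<times> B)"
    by (rule double_sum_bound(1)[where g = "\<lambda>i. norm (x i) * norm (y i)"]) (use cs sm in \<open>auto simp: F_def\<close>)
  then have "F summable_on (I \<times> B)" using abs_summable_summable[of F] by simp
  then have hF: "(F has_sum infsum F (I \<times> B)) (I \<times> B)" by (rule has_sum_infsum)
  have a: "((\<lambda>i. inner (x i) (y i)) has_sum infsum F (I \<times> B)) I"
  proof (rule has_sum_SigmaD[OF hF])
    show "((\<lambda>e. F (i, e)) has_sum inner (x i) (y i)) B" for i
      using onb_inner_expand[OF B, of "y i" "x i"] by (simp add: F_def inner_commute)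
  qed
  have hF': "((\<lambda>(e, i). F (i, e)) has_sum infsum F (I \<times> B)) (B \<times> I)"
    using hF has_sum_swap[of F] by (simp add: case_prod_unfold)
  have b: "((\<lambda>e. inner (T e) e) has_sum infsum F (I \<times> B)) B"
  proof (rule has_sum_SigmaD[OF hF'])
    fix e
    have "((\<lambda>i. inner (inner e (y i) *\<^sub>R x i) e) has_sum inner (T e) e) I"
      by (rule has_sum_bounded_linear[OF bounded_linear_inner_left T])
    then show "((\<lambda>i. case (e, i) of (e, i) \<Rightarrow> F (i, e)) has_sum inner (T e) e) I"
      by (simp add: F_def inner_commute[of e "y _"])
  qed
  show "(\<lambda>i. inner (x i) (y i)) summable_on I" using a by (auto simp: has_sum_iff)
  show "((\<lambda>e. inner (T e) e) has_sum (\<Sum>\<^sub>\<infinity>i\<in>I. inner (x i) (y i))) B"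
    using a b by (simp add: has_sum_iff)
qed

lemma trace_rep:
  fixes x y :: "'i \<Rightarrow> 'h::{real_inner,banach,second_countable_topology}"
  assumes sm: "(\<lambda>i. norm (x i) * norm (y i)) summable_on I"
    and T: "\<And>h. ((\<lambda>i. inner h (y i) *\<^sub>R x i) has_sum blinfun_apply T h) I"
  shows "((\<lambda>i. inner (x i) (y i)) has_sum trace T) I"
  using rep_trace[OF onb_some sm T] unfolding trace_def by (simp add: has_sum_iff)

lemma trace_has_sum:
  fixes T :: "'h::{real_inner,banach,second_countable_topology} \<Rightarrow>\<^sub>L 'h"
  assumes "nuc T s"
  shows "((\<lambda>e. inner (T e) e) has_sum trace T) (SOME B. onb B)"
proof -
  obtain x y where n: "(\<lambda>i. norm (x i) * norm (y i)) summable_on (UNIV::nat set)"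
    "\<And>h. ((\<lambda>i. inner h (y i) *\<^sub>R x i) has_sum blinfun_apply T h) UNIV"
    using assms by (rule nucE) blast
  show ?thesis
    using rep_trace(1)[OF onb_some n] by (simp add: has_sum_iff trace_def)
qed

lemma trace_bound:
  fixes T :: "'h::{real_inner,banach,second_countable_topology} \<Rightarrow>\<^sub>L 'h"
  assumes "nuc T s" shows "\<bar>trace T\<bar> \<le> s"
proof -
  obtain x y where n: "(\<lambda>i. norm (x i) * norm (y i)) summable_on (UNIV::nat set)"
    "(\<Sum>\<^sub>\<infinity>i. norm (x i) * norm (y i)) \<le> s"
    "\<And>h. ((\<lambda>i. inner h (y i) *\<^sub>R x i) has_sum blinfun_apply T h) UNIV"
    using assms by (rule nucE) blast
  have s: "(\<lambda>i. norm (inner (x i) (y i))) summable_on UNIV"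
    by (rule summable_on_comparison_test[OF n(1)]) (auto intro: Cauchy_Schwarz_ineq2)
  have "\<bar>trace T\<bar> \<le> (\<Sum>\<^sub>\<infinity>i. norm (inner (x i) (y i)))"
    using norm_has_sum_le[OF s trace_rep[OF n(1,3)]] by simp
  also have "\<dots> \<le> (\<Sum>\<^sub>\<infinity>i. norm (x i) * norm (y i))"
    by (rule infsum_mono[OF s n(1)]) (auto intro: Cauchy_Schwarz_ineq2)
  finally show ?thesis using n(2) by linarith
qed

lemma trace_add:
  fixes S T :: "'h::{real_inner,banach,second_countable_topology} \<Rightarrow>\<^sub>L 'h"
  assumes "trace_class S" "trace_class T" shows "trace (S + T) = trace S + trace T"
proof -
  obtain s t where st: "nuc S s" "nuc T t" using assms unfolding trace_class_iff_nuc by blast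
  have "((\<lambda>e. inner ((S + T) e) e) has_sum trace S + trace T) (SOME B. onb B)"
    using has_sum_add[OF trace_has_sum[OF st(1)] trace_has_sum[OF st(2)]]
    by (simp add: blinfun.add_left inner_add_left)
  then show ?thesis using trace_has_sum[OF nuc_add[OF st]] has_sum_unique by blast
qed

lemma trace_scaleR:
  fixes T :: "'h::{real_inner,banach,second_countable_topology} \<Rightarrow>\<^sub>L 'h"
  assumes "trace_class T" shows "trace (c *\<^sub>R T) = c * trace T"
proof -
  obtain t where t: "nuc T t" using assms unfolding trace_class_iff_nuc by blast
  have "((\<lambda>e. inner ((c *\<^sub>R T) e) e) has_sum c * trace T) (SOME B. onb B)"
    using has_sum_cmult_right[OF trace_has_sum[OF t], of c] by (simp add: blinfun.scaleR_left)
  then show ?thesis using trace_has_sum[OF nuc_scaleR[OF t]] has_sum_unique by blast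
qed

lemma trace_compose:
  fixes A :: "'h::{real_inner,banach,second_countable_topology} \<Rightarrow>\<^sub>L 'h"
  shows "trace_class S \<Longrightarrow> trace_class T \<Longrightarrow> trace (A o\<^sub>L (S + T)) = trace (A o\<^sub>L S) + trace (A o\<^sub>L T)"
    and "trace_class T \<Longrightarrow> trace (A o\<^sub>L (c *\<^sub>R T)) = c * trace (A o\<^sub>L T)"
    and "nuc T s \<Longrightarrow> \<bar>trace (A o\<^sub>L T)\<bar> \<le> norm A * s"
proof -
  have tc: "trace_class (A o\<^sub>L T)" if "trace_class T" for T
    using that nuc_compose_left unfolding trace_class_iff_nuc by blast
  have 1: "A o\<^sub>L (S + T) = (A o\<^sub>L S) + (A o\<^sub>L T)" for S T
    by (rule blinfun_eqI) (simp add: blinfun.add_left blinfun.add_right)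
  have 2: "A o\<^sub>L (c *\<^sub>R T) = c *\<^sub>R (A o\<^sub>L T)" for c T
    by (rule blinfun_eqI) (simp add: blinfun.scaleR_left blinfun.scaleR_right)
  show "trace_class S \<Longrightarrow> trace_class T \<Longrightarrow> trace (A o\<^sub>L (S + T)) = trace (A o\<^sub>L S) + trace (A o\<^sub>L T)"
    unfolding 1 by (intro trace_add tc)
  show "trace_class T \<Longrightarrow> trace (A o\<^sub>L (c *\<^sub>R T)) = c * trace (A o\<^sub>L T)"
    unfolding 2 by (intro trace_scaleR tc)
  show "nuc T s \<Longrightarrow> \<bar>trace (A o\<^sub>L T)\<bar> \<le> norm A * s"
    by (rule trace_bound[OF nuc_compose_left])
qed

lemma nuc_diff_partial_sum:
  fixes x y :: "'i \<Rightarrow> 'h::{real_inner,banach,second_countable_topology}"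
  assumes I: "countable I" and sm: "(\<lambda>i. norm (x i) * norm (y i)) summable_on I"
    and T: "\<And>h. ((\<lambda>i. inner h (y i) *\<^sub>R x i) has_sum blinfun_apply T h) I"
    and F: "finite F" "F \<subseteq> I"
  shows "nuc (T - (\<Sum>i\<in>F. outer (x i) (y i))) (\<Sum>\<^sub>\<infinity>i\<in>I - F. norm (x i) * norm (y i))"
proof (rule nucI[OF _ _ order_refl])
  show "countable (I - F)" using I by simp
  show "(\<lambda>i. norm (x i) * norm (y i)) summable_on I - F"
    by (rule summable_on_Diff[OF sm _ F(2)]) (use F in auto)
  fix h
  have ap: "blinfun_apply (\<Sum>i\<in>F. outer (x i) (y i)) h = (\<Sum>i\<in>F. inner h (y i) *\<^sub>R x i)"
    using F(1) by (induction F) (auto simp: blinfun.add_left)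
  have "((\<lambda>i. inner h (y i) *\<^sub>R x i) has_sum T h - (\<Sum>i\<in>F. inner h (y i) *\<^sub>R x i)) (I - F)"
    by (rule has_sum_Diff[OF T _ F(2)]) (use F in auto)
  then show "((\<lambda>i. inner h (y i) *\<^sub>R x i) has_sum blinfun_apply (T - (\<Sum>i\<in>F. outer (x i) (y i))) h) (I - F)"
    by (simp add: blinfun.diff_left ap)
qed

text \<open>Finite-rank operators are dense in nuclear norm; uniqueness of the partial traces is
  reduced to rank-one operators through this.\<close>

lemma nuc_approx:
  fixes x y :: "nat \<Rightarrow> 'h::{real_inner,banach,second_countable_topology}"
  assumes sm: "(\<lambda>i. norm (x i) * norm (y i)) summable_on UNIV"
    and T: "\<And>h. ((\<lambda>i. inner h (y i) *\<^sub>R x i) has_sum blinfun_apply T h) UNIV"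
    and e: "e > 0"
  shows "\<exists>n. nuc (T - (\<Sum>i<n. outer (x i) (y i))) e"
proof -
  define f where "f i = norm (x i) * norm (y i)" for i
  have s: "f sums infsum f UNIV" unfolding f_def using sm by (intro has_sum_imp_sums has_sum_infsum)
  then have "(\<lambda>n. \<Sum>i<n. f i) \<longlonglongrightarrow> infsum f UNIV" by (simp add: sums_def)
  then obtain n where n: "\<bar>(\<Sum>i<n. f i) - infsum f UNIV\<bar> < e"
    using e unfolding LIMSEQ_iff by (metis order_refl real_norm_def)
  have "infsum f (UNIV - {..<n}) = infsum f UNIV - infsum f {..<n}"
    by (rule infsum_Diff) (use sm in \<open>simp_all add: f_def[abs_def]\<close>)
  then have "infsum f (UNIV - {..<n}) \<le> e" using n by simp
  then show ?thesis
    using nuc_diff_partial_sum[OF _ sm T, of "{..<n}"] nuc_mono unfolding f_def by blast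
qed

lemma outer_add_left: "outer (x + x') y = outer x y + outer x' y"
  by (rule blinfun_eqI) (simp add: blinfun.add_left scaleR_add_right)

lemma outer_add_right: "outer x (y + y') = outer x y + outer x y'"
  by (rule blinfun_eqI) (simp add: blinfun.add_left inner_add_right scaleR_add_left)

lemma outer_scaleR_left: "outer (c *\<^sub>R x) y = c *\<^sub>R outer x y"
  by (rule blinfun_eqI) (simp add: blinfun.scaleR_left)

lemma outer_scaleR_right: "outer x (c *\<^sub>R y) = c *\<^sub>R outer x y"
  by (rule blinfun_eqI) (simp add: blinfun.scaleR_left)

section \<open>Tensor structure on trace-class operators\<close>

subsection \<open>Tensor products of trace-class operators\<close>

lemma eq_if_inner_diff_zero: "inner (a - b) (a - b) = 0 \<Longrightarrow> a = b"
  by simp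

context
  fixes tens :: "'a::{real_inner,banach,second_countable_topology} \<Rightarrow>
                 'b::{real_inner,banach,second_countable_topology} \<Rightarrow>
                 'h::{real_inner,banach,second_countable_topology}"
  assumes tens: "is_htensor tens"
begin

lemma tens_inner: "inner (tens u v) (tens z w) = inner u z * inner v w"
  using tens by (simp add: is_htensor_def)

lemma tens_norm: "norm (tens u v) = norm u * norm v"
  by (simp add: norm_eq_sqrt_inner tens_inner real_sqrt_mult)

text \<open>Bilinearity is not a clause of \<open>is_htensor\<close>; it is forced by the inner
  product rule, because the squared norm of the difference of both sides expands to 0. The same
  argument serves the next three lemmas.\<close>

lemma tens_add_left: "tens (u + u') v = tens u v + tens u' v"
  by (rule eq_if_inner_diff_zero)
     (simp add: inner_diff_left inner_diff_right inner_add_left inner_add_right tens_inner algebra_simps inner_commute)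

lemma tens_add_right: "tens u (v + v') = tens u v + tens u v'"
  by (rule eq_if_inner_diff_zero)
     (simp add: inner_diff_left inner_diff_right inner_add_left inner_add_right tens_inner algebra_simps inner_commute)

lemma tens_scaleR_left: "tens (c *\<^sub>R u) v = c *\<^sub>R tens u v"
  by (rule eq_if_inner_diff_zero)
     (simp add: inner_diff_left inner_diff_right tens_inner algebra_simps)

lemma tens_scaleR_right: "tens u (c *\<^sub>R v) = c *\<^sub>R tens u v"
  by (rule eq_if_inner_diff_zero)
     (simp add: inner_diff_left inner_diff_right tens_inner algebra_simps)

lemma tens_bounded_linear_left: "bounded_linear (\<lambda>u. tens u v)"
  by (rule bounded_linear_intro[where K = "norm v"])
     (auto simp: tens_add_left tens_scaleR_left tens_norm)

lemma tens_bounded_linear_right: "bounded_linear (\<lambda>v. tens u v)"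
  by (rule bounded_linear_intro[where K = "norm u"])
     (auto simp: tens_add_right tens_scaleR_right tens_norm mult.commute)

lemma tens_dense:
  assumes "closed S" "subspace S" "\<And>u v. tens u v \<in> S" shows "x \<in> S"
proof -
  have "span {tens u v | u v. True} \<subseteq> S" using assms by (intro span_minimal) auto
  then have "closure (span {tens u v | u v. True}) \<subseteq> S" using assms(1) by (intro closure_minimal)
  then show ?thesis using tens by (auto simp: is_htensor_def)
qed

lemma tens_ext:
  fixes S T :: "'h \<Rightarrow> 'k::real_normed_vector"
  assumes S: "bounded_linear S" and T: "bounded_linear T"
    and eq: "\<And>u v. S (tens u v) = T (tens u v)"
  shows "S = T"
proof
  fix x
  have "closed {x. S x = T x}"
    using S T by (intro closed_Collect_eq) (auto simp: linear_continuous_on)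
  moreover have "subspace {x. S x = T x}"
    using S T by (simp add: subspace_def linear_simps)
  ultimately have "x \<in> {x. S x = T x}" by (rule tens_dense) (simp add: eq)
  then show "S x = T x" by simp
qed

text \<open>Density of elementary tensors makes the operator behind \<open>THE\<close> unique, so
  exhibiting one with the right action evaluates \<open>optens\<close>.\<close>

lemma optens_eqI:
  assumes "\<And>u v. blinfun_apply T (tens u v) = tens (blinfun_apply A u) (blinfun_apply B v)"
  shows "optens tens A B = T"
  unfolding optens_def
proof (rule the_equality)
  fix S assume "\<forall>u v. blinfun_apply S (tens u v) = tens (blinfun_apply A u) (blinfun_apply B v)"
  then have "blinfun_apply S = blinfun_apply T"
    using assms by (intro tens_ext blinfun.bounded_linear_right) auto
  then show "S = T" by (simp add: blinfun_apply_inject)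
qed (use assms in auto)

text \<open>Existence for nuclear factors: tensoring two representations termwise gives a
  representation over pairs whose weight is the product of the weights. The action and the trace are
  read off the same representation, so the three facts are proved together.\<close>

lemma optens_nuc_apply_trace:
  assumes A: "nuc A s" and B: "nuc B t"
  shows "nuc (optens tens A B) (s * t) \<and> 
    (\<forall>u v. blinfun_apply (optens tens A B) (tens u v) = tens (A u) (B v)) \<and>
    trace (optens tens A B) = trace A * trace B"
proof -
  obtain a a' where a: "(\<lambda>i. norm (a i) * norm (a' i)) summable_on (UNIV::nat set)"
    "(\<Sum>\<^sub>\<infinity>i. norm (a i) * norm (a' i)) \<le> s"
    "\<And>h. ((\<lambda>i. inner h (a' i) *\<^sub>R a i) has_sum blinfun_apply A h) UNIV"
    using A by (rule nucE) blast
  obtain b b' where b: "(\<lambda>i. norm (b i) * norm (b' i)) summable_on (UNIV::nat set)"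
    "(\<Sum>\<^sub>\<infinity>i. norm (b i) * norm (b' i)) \<le> t"
    "\<And>h. ((\<lambda>i. inner h (b' i) *\<^sub>R b i) has_sum blinfun_apply B h) UNIV"
    using B by (rule nucE) blast
  define x where "x = (\<lambda>(i, j). tens (a i) (b j))"
  define y where "y = (\<lambda>(i, j). tens (a' i) (b' j))"
  have eq: "norm (x p) * norm (y p) = (case p of (i, j) \<Rightarrow> (norm (a i) * norm (a' i)) * (norm (b j) * norm (b' j)))" for p
    by (cases p) (simp add: x_def y_def tens_norm mult_ac)
  have hs: "((\<lambda>p. norm (x p) * norm (y p)) has_sum
     (\<Sum>\<^sub>\<infinity>i. norm (a i) * norm (a' i)) * (\<Sum>\<^sub>\<infinity>i. norm (b i) * norm (b' i))) (UNIV \<times> UNIV)"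
    unfolding eq by (rule has_sum_prod_nonneg) (use a b in auto)
  then have sm: "(\<lambda>p. norm (x p) * norm (y p)) summable_on (UNIV \<times> UNIV)" by (auto simp: has_sum_iff)
  obtain T where T: "nuc T (\<Sum>\<^sub>\<infinity>p\<in>UNIV\<times>UNIV. norm (x p) * norm (y p))"
    "\<And>h. ((\<lambda>p. inner h (y p) *\<^sub>R x p) has_sum blinfun_apply T h) (UNIV \<times> UNIV)"
    using nuc_exists[OF _ sm] by auto
  have "(\<Sum>\<^sub>\<infinity>p\<in>UNIV\<times>UNIV. norm (x p) * norm (y p)) =
    (\<Sum>\<^sub>\<infinity>i. norm (a i) * norm (a' i)) * (\<Sum>\<^sub>\<infinity>i. norm (b i) * norm (b' i))"
    using hs by (rule infsumI)
  also have "\<dots> \<le> s * t"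
    by (rule mult_mono[OF a(2) b(2)]) (auto intro!: infsum_nonneg nuc_nonneg[OF A])
  finally have 1: "nuc T (s * t)" using T(1) nuc_mono by blast
  have 2: "blinfun_apply T (tens u v) = tens (A u) (B v)" for u v
  proof -
    have "((\<lambda>i. tens (inner u (a' i) *\<^sub>R a i) (B v)) has_sum T (tens u v)) UNIV"
    proof (rule has_sum_SigmaD[OF T(2)])
      fix i
      have "((\<lambda>j. tens (inner u (a' i) *\<^sub>R a i) (inner v (b' j) *\<^sub>R b j)) has_sum tens (inner u (a' i) *\<^sub>R a i) (B v)) UNIV"
        by (rule has_sum_bounded_linear[OF tens_bounded_linear_right b(3)])
      then show "((\<lambda>j. inner (tens u v) (y (i, j)) *\<^sub>R x (i, j)) has_sum tens (inner u (a' i) *\<^sub>R a i) (B v)) UNIV"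
        by (simp add: x_def y_def tens_inner tens_scaleR_left tens_scaleR_right mult.commute)
    qed
    moreover have "((\<lambda>i. tens (inner u (a' i) *\<^sub>R a i) (B v)) has_sum tens (A u) (B v)) UNIV"
      by (rule has_sum_bounded_linear[OF tens_bounded_linear_left a(3)])
    ultimately show ?thesis using has_sum_unique by blast
  qed
  have 3: "optens tens A B = T" by (rule optens_eqI) (rule 2)
  have "((\<lambda>i. inner (a i) (a' i) * trace B) has_sum trace T) UNIV"
  proof (rule has_sum_SigmaD[OF trace_rep[OF sm T(2)]])
    fix i
    have "((\<lambda>j. inner (a i) (a' i) * inner (b j) (b' j)) has_sum inner (a i) (a' i) * trace B) UNIV"
      by (rule has_sum_cmult_right[OF trace_rep[OF b(1,3)]])
    then show "((\<lambda>j. inner (x (i, j)) (y (i, j))) has_sum inner (a i) (a' i) * trace B) UNIV"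
      by (simp add: x_def y_def tens_inner)
  qed
  moreover have "((\<lambda>i. inner (a i) (a' i) * trace B) has_sum trace A * trace B) UNIV"
    by (rule has_sum_cmult_left[OF trace_rep[OF a(1,3)]])
  ultimately have "trace T = trace A * trace B" using has_sum_unique by blast
  then show ?thesis using 1 2 3 by simp
qed

lemma optens_nuc: "nuc A s \<Longrightarrow> nuc B t \<Longrightarrow> nuc (optens tens A B) (s * t)"
  using optens_nuc_apply_trace by blast

lemma optens_apply:
  "trace_class A \<Longrightarrow> trace_class B \<Longrightarrow> blinfun_apply (optens tens A B) (tens u v) = tens (A u) (B v)"
  unfolding trace_class_iff_nuc using optens_nuc_apply_trace by blast

lemma trace_optens: "trace_class A \<Longrightarrow> trace_class B \<Longrightarrow> trace (optens tens A B) = trace A * trace B"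
  unfolding trace_class_iff_nuc using optens_nuc_apply_trace by blast

lemma trace_class_optens: "trace_class A \<Longrightarrow> trace_class B \<Longrightarrow> trace_class (optens tens A B)"
  unfolding trace_class_iff_nuc using optens_nuc_apply_trace by blast

lemma optens_add_left:
  "trace_class A \<Longrightarrow> trace_class A' \<Longrightarrow> trace_class B \<Longrightarrow>
    optens tens (A + A') B = optens tens A B + optens tens A' B"
  by (rule optens_eqI) (simp add: blinfun.add_left optens_apply tens_add_left)

lemma optens_add_right:
  "trace_class A \<Longrightarrow> trace_class B \<Longrightarrow> trace_class B' \<Longrightarrow>
    optens tens A (B + B') = optens tens A B + optens tens A B'"
  by (rule optens_eqI) (simp add: blinfun.add_left optens_apply tens_add_right)

lemma optens_scaleR_left:
  "trace_class A \<Longrightarrow> trace_class B \<Longrightarrow> optens tens (c *\<^sub>R A) B = c *\<^sub>R optens tens A B"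
  by (rule optens_eqI) (simp add: blinfun.scaleR_left optens_apply tens_scaleR_left)

lemma optens_scaleR_right:
  "trace_class A \<Longrightarrow> trace_class B \<Longrightarrow> optens tens A (c *\<^sub>R B) = c *\<^sub>R optens tens A B"
  by (rule optens_eqI) (simp add: blinfun.scaleR_left optens_apply tens_scaleR_right)

lemma optens_outer: "optens tens (outer a a') (outer b b') = outer (tens a b) (tens a' b')"
  by (rule optens_eqI) (simp add: tens_inner tens_scaleR_left tens_scaleR_right)

subsection \<open>Partial traces\<close>

text \<open>The adjoint of the map \<open>tens a\<close>, that is, contraction of the first tensor
  factor of \<open>x\<close> against \<open>a\<close>.\<close>

definition slice :: "'a \<Rightarrow> 'h \<Rightarrow> 'b" where
  "slice a x = (SOME z. \<forall>w. inner x (tens a w) = inner w z)"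

lemma slice: "inner (slice a x) w = inner x (tens a w)"
proof -
  have "\<exists>z. \<forall>w. inner x (tens a w) = inner w z"
    by (rule riesz) (intro bounded_linear_inner_right_comp tens_bounded_linear_right)
  from someI_ex[OF this] have "inner x (tens a w) = inner w (slice a x)"
    unfolding slice_def by (rule spec)
  then show ?thesis by (simp only: inner_commute[of "slice a x" w])
qed

text \<open>A Bessel inequality for the orthogonal vectors tens a (slice a x): the inner product of
  \<open>x\<close> with their sum W equals the squared norm of W, hence W is no longer than
  \<open>x\<close>.\<close>

lemma slice_summable:
  assumes B: "onb B"
  shows "(\<lambda>a. (norm (slice a x))\<^sup>2) summable_on B" "(\<Sum>\<^sub>\<infinity>a\<in>B. (norm (slice a x))\<^sup>2) \<le> (norm x)\<^sup>2"
proof -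
  have f: "(\<Sum>a\<in>F. (norm (slice a x))\<^sup>2) \<le> (norm x)\<^sup>2" if F: "finite F" "F \<subseteq> B" for F
  proof -
    define W where "W = (\<Sum>a\<in>F. tens a (slice a x))"
    have "(norm W)\<^sup>2 = (\<Sum>a\<in>F. (norm (tens a (slice a x)))\<^sup>2)"
      unfolding W_def by (rule orthonormal_norm_sum[OF F(1)]) (use F B in \<open>auto simp: tens_inner onb_inner subset_iff\<close>)
    also have "\<dots> = (\<Sum>a\<in>F. (norm (slice a x))\<^sup>2)"
      by (rule sum.cong) (use F B in \<open>auto simp: tens_norm onb_def\<close>)
    finally have 1: "(norm W)\<^sup>2 = (\<Sum>a\<in>F. (norm (slice a x))\<^sup>2)" .
    also have "\<dots> = inner x W"
      by (simp add: W_def inner_sum_right flip: slice) (simp add: power2_norm_eq_inner)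
    also have "\<dots> \<le> norm x * norm W" by (rule norm_cauchy_schwarz)
    finally have "norm W \<le> norm x" by (cases "W = 0") (auto simp: power2_eq_square)
    then show ?thesis unfolding 1[symmetric] by (rule power_mono) simp
  qed
  show 1: "(\<lambda>a. (norm (slice a x))\<^sup>2) summable_on B"
    by (rule nonneg_bdd_above_summable_on) (use f in \<open>auto intro!: bdd_aboveI[of _ "(norm x)\<^sup>2"]\<close>)
  show "(\<Sum>\<^sub>\<infinity>a\<in>B. (norm (slice a x))\<^sup>2) \<le> (norm x)\<^sup>2" by (rule infsum_le_finite_sums[OF 1 f])
qed

text \<open>Slicing both vectors of every term of a representation along the basis gives a
  representation of the partial trace over pairs (i, a). Cauchy-Schwarz in \<open>a\<close> with
  \<open>slice_summable\<close> shows that the weight does not grow.\<close>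

lemma partial_trace_exists:
  assumes B: "onb B" and T: "nuc T s"
  shows "\<exists>R. nuc R s \<and> (\<forall>v w. ((\<lambda>a. inner (T (tens a v)) (tens a w)) has_sum inner (blinfun_apply R v) w) B)"
proof -
  obtain x y where n: "(\<lambda>i. norm (x i) * norm (y i)) summable_on (UNIV::nat set)"
    "(\<Sum>\<^sub>\<infinity>i. norm (x i) * norm (y i)) \<le> s"
    "\<And>h. ((\<lambda>i. inner h (y i) *\<^sub>R x i) has_sum blinfun_apply T h) UNIV"
    using T by (rule nucE) blast
  define X where "X = (\<lambda>(i, a). slice a (x i))"
  define Y where "Y = (\<lambda>(i, a). slice a (y i))"
  have cs: "(\<lambda>a. norm (slice a (x i)) * norm (slice a (y i))) summable_on B"
    "(\<Sum>\<^sub>\<infinity>a\<in>B. norm (slice a (x i)) * norm (slice a (y i))) \<le> norm (x i) * norm (y i)" for i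
  proof -
    note s = slice_summable[OF B]
    show "(\<lambda>a. norm (slice a (x i)) * norm (slice a (y i))) summable_on B"
      using infsum_cauchy_schwarz(1)[OF s(1) s(1), of "x i" "y i"] by simp
    have "(\<Sum>\<^sub>\<infinity>a\<in>B. norm (slice a (x i)) * norm (slice a (y i))) \<le>
       sqrt (\<Sum>\<^sub>\<infinity>a\<in>B. (norm (slice a (x i)))\<^sup>2) * sqrt (\<Sum>\<^sub>\<infinity>a\<in>B. (norm (slice a (y i)))\<^sup>2)"
      using infsum_cauchy_schwarz(2)[OF s(1) s(1), of "x i" "y i"] by simp
    also have "\<dots> \<le> norm (x i) * norm (y i)"
      by (intro mult_mono real_le_lsqrt s) (auto intro: infsum_nonneg)
    finally show "(\<Sum>\<^sub>\<infinity>a\<in>B. norm (slice a (x i)) * norm (slice a (y i))) \<le> norm (x i) * norm (y i)" .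
  qed
  have db: "(\<lambda>p. norm (X p) * norm (Y p)) summable_on (UNIV \<times> B)"
    "(\<Sum>\<^sub>\<infinity>p\<in>UNIV \<times> B. norm (X p) * norm (Y p)) \<le> (\<Sum>\<^sub>\<infinity>i. norm (x i) * norm (y i))"
    by (rule double_sum_bound[where g = "\<lambda>i. norm (x i) * norm (y i)"];
        use cs n(1) in \<open>simp add: X_def Y_def\<close>)+
  have "countable (UNIV \<times> B :: (nat \<times> 'a) set)" using onb_countable[OF B] by auto
  from nuc_exists[OF this db(1)] obtain R where R: "nuc R (\<Sum>\<^sub>\<infinity>p\<in>UNIV \<times> B. norm (X p) * norm (Y p))"
    "\<And>h. ((\<lambda>p. inner h (Y p) *\<^sub>R X p) has_sum blinfun_apply R h) (UNIV \<times> B)" by blast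
  have "nuc R s" using R(1) db(2) n(2) nuc_mono by (meson order_trans)
  moreover have "((\<lambda>a. inner (T (tens a v)) (tens a w)) has_sum inner (blinfun_apply R v) w) B" for v w
  proof -
    have "((\<lambda>p. inner (inner v (Y p) *\<^sub>R X p) w) has_sum inner (R v) w) (UNIV \<times> B)"
      by (rule has_sum_bounded_linear[OF bounded_linear_inner_left R(2)])
    then have h: "((\<lambda>(a, i). inner (inner v (Y (i, a)) *\<^sub>R X (i, a)) w) has_sum inner (R v) w) (B \<times> UNIV)"
      using has_sum_swap[of "\<lambda>p. inner (inner v (Y p) *\<^sub>R X p) w"] by (simp add: case_prod_unfold)
    show ?thesis
    proof (rule has_sum_SigmaD[OF h])
      fix a
      have "((\<lambda>i. inner (inner (tens a v) (y i) *\<^sub>R x i) (tens a w)) has_sum inner (T (tens a v)) (tens a w)) UNIV"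
        by (rule has_sum_bounded_linear[OF bounded_linear_inner_left n(3)])
      then show "((\<lambda>i. case (a, i) of (a, i) \<Rightarrow> inner (inner v (Y (i, a)) *\<^sub>R X (i, a)) w) has_sum
          inner (T (tens a v)) (tens a w)) UNIV"
        by (simp add: X_def Y_def slice inner_commute[of v] inner_commute[of "tens a v"])
    qed
  qed
  ultimately show ?thesis by blast
qed

text \<open>The weak formula determines R, see \<open>ptrace_eqI\<close>. The value 0 off the trace
  class agrees with the last clause of \<open>s1_bounded_linear\<close>, so that equality of whole
  functions can hold in \<open>ptr1_eq\<close>.\<close>

definition ptrace :: "('h \<Rightarrow>\<^sub>L 'h) \<Rightarrow> ('b \<Rightarrow>\<^sub>L 'b)" where
  "ptrace T = (if trace_class T then SOME R. (\<exists>s. nuc R s) \<and> (\<forall>v w. ((\<lambda>a. inner (T (tens a v)) (tens a w)) has_sum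
      inner (blinfun_apply R v) w) (SOME B. onb B)) else 0)"

lemma ptrace_has_sum:
  assumes "trace_class T"
  shows "((\<lambda>a. inner (T (tens a v)) (tens a w)) has_sum inner (blinfun_apply (ptrace T) v) w) (SOME B. onb B)"
proof -
  obtain s where "nuc T s" using assms unfolding trace_class_iff_nuc by blast
  then have "\<exists>R. (\<exists>s. nuc R s) \<and> (\<forall>v w. ((\<lambda>a. inner (T (tens a v)) (tens a w)) has_sum
      inner (blinfun_apply R v) w) (SOME B. onb B))" using partial_trace_exists[OF onb_some] by blast
  from someI_ex[OF this] show ?thesis using assms by (simp add: ptrace_def)
qed

lemma ptrace_eqI:
  assumes "trace_class T"
    "\<And>v w. ((\<lambda>a. inner (T (tens a v)) (tens a w)) has_sum inner (blinfun_apply R v) w) (SOME B. onb B)"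
  shows "ptrace T = R"
proof (rule blinfun_eqI)
  fix v
  have "inner (ptrace T v) w = inner (R v) w" for w
    using ptrace_has_sum[OF assms(1)] assms(2) has_sum_unique by blast
  then show "ptrace T v = R v" using vector_eq_rdot by blast
qed

lemma ptrace_nuc: "nuc T s \<Longrightarrow> nuc (ptrace T) s"
proof -
  assume T: "nuc T s"
  obtain R where R: "nuc R s" "\<And>v w. ((\<lambda>a. inner (T (tens a v)) (tens a w)) has_sum
      inner (blinfun_apply R v) w) (SOME B. onb B)"
    using partial_trace_exists[OF onb_some T] by blast
  have "ptrace T = R" by (rule ptrace_eqI[OF nuc_trace_class(1)[OF T] R(2)])
  then show ?thesis using R(1) by simp
qed

lemma ptrace_s1_bounded_linear: "s1_bounded_linear ptrace"
  unfolding s1_bounded_linear_def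
proof (intro conjI allI impI)
  fix S T :: "'h \<Rightarrow>\<^sub>L 'h" and c :: real
  show "ptrace (S + T) = ptrace S + ptrace T" if "trace_class S \<and> trace_class T"
  proof (rule ptrace_eqI)
    show "trace_class (S + T)" using that by (simp add: trace_class_add)
    show "((\<lambda>a. inner ((S + T) (tens a v)) (tens a w)) has_sum inner ((ptrace S + ptrace T) v) w) (SOME B. onb B)" for v w
      using has_sum_add[OF ptrace_has_sum ptrace_has_sum, of S T v w v w] that
      by (simp add: blinfun.add_left inner_add_left)
  qed
  show "ptrace (c *\<^sub>R T) = c *\<^sub>R ptrace T" if T: "trace_class T"
  proof (rule ptrace_eqI)
    show "trace_class (c *\<^sub>R T)" using that by (rule trace_class_scaleR)
    show "((\<lambda>a. inner ((c *\<^sub>R T) (tens a v)) (tens a w)) has_sum inner ((c *\<^sub>R ptrace T) v) w) (SOME B. onb B)" for v w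
      using has_sum_cmult_right[OF ptrace_has_sum[OF T], of c v w] by (simp add: blinfun.scaleR_left)
  qed
  show "trace_class (ptrace T)" if "trace_class T" using that ptrace_nuc unfolding trace_class_iff_nuc by blast
  show "\<exists>K. \<forall>T. trace_class T \<longrightarrow> tnorm (ptrace T) \<le> K * tnorm T"
  \<comment> \<open>280 = 8 * 35: into nuclear weights by \<open>trace_class_nuc\<close> and back by
    \<open>nuc_trace_class\<close>.\<close>
  proof (intro exI[of _ 280] allI impI)
    fix T :: "'h \<Rightarrow>\<^sub>L 'h" assume "trace_class T"
    then have "tnorm (ptrace T) \<le> 8 * (35 * tnorm T)" by (intro nuc_trace_class(2) ptrace_nuc trace_class_nuc)
    then show "tnorm (ptrace T) \<le> 280 * tnorm T" by simp
  qed
  show "ptrace T = 0" if "\<not> trace_class T" using that by (simp add: ptrace_def)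
qed

lemma ptrace_optens:
  assumes A: "trace_class A" and B: "trace_class B" shows "ptrace (optens tens A B) = trace A *\<^sub>R B"
proof (rule ptrace_eqI)
  show "trace_class (optens tens A B)" by (rule trace_class_optens[OF A B])
  obtain s where s: "nuc A s" using A unfolding trace_class_iff_nuc by blast
  show "((\<lambda>a. inner (optens tens A B (tens a v)) (tens a w)) has_sum inner ((trace A *\<^sub>R B) v) w) (SOME B. onb B)" for v w
    using has_sum_cmult_left[OF trace_has_sum[OF s], of "inner (B v) w"]
    by (simp add: optens_apply[OF A B] tens_inner blinfun.scaleR_left)
qed

lemma s1_bounded_linear_norm_bound:
  fixes f :: "('h \<Rightarrow>\<^sub>L 'h) \<Rightarrow> ('k::{real_inner,banach,second_countable_topology} \<Rightarrow>\<^sub>L 'k)"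
  assumes f: "s1_bounded_linear f"
  shows "\<exists>K\<ge>0. \<forall>T s. nuc T s \<longrightarrow> norm (f T) \<le> K * s"
proof -
  from f obtain K where K: "\<And>T. trace_class T \<Longrightarrow> trace_class (f T)" "\<And>T. trace_class T \<Longrightarrow> tnorm (f T) \<le> K * tnorm T"
    unfolding s1_bounded_linear_def by blast
  have "norm (f T) \<le> (8 * \<bar>K\<bar>) * s" if T: "nuc T s" for T s
  proof -
    have tc: "trace_class T" using T nuc_trace_class by blast
    have "norm (f T) \<le> tnorm (f T)" by (rule norm_le_tnorm[OF K(1)[OF tc]])
    also have "\<dots> \<le> K * tnorm T" by (rule K(2)[OF tc])
    also have "\<dots> \<le> \<bar>K\<bar> * tnorm T" by (rule mult_right_mono) (use tnorm_nonneg[OF tc] in auto)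
    also have "\<dots> \<le> \<bar>K\<bar> * (8 * s)" by (rule mult_left_mono) (use nuc_trace_class(2)[OF T] in auto)
    finally show ?thesis by simp
  qed
  then show ?thesis by (intro exI[of _ "8 * \<bar>K\<bar>"]) auto
qed

text \<open>Agreement spreads in stages: on \<open>outer\<close> of elementary tensors, because
  these are tensors of rank-one operators; on all rank-one operators, by density in each argument
  separately; on finite sums, by additivity; on all trace-class operators, by
  \<open>nuc_approx\<close> and boundedness.\<close>

lemma s1_bounded_linear_unique:
  fixes f g :: "('h \<Rightarrow>\<^sub>L 'h) \<Rightarrow> ('k::{real_inner,banach,second_countable_topology} \<Rightarrow>\<^sub>L 'k)"
  assumes f: "s1_bounded_linear f" and g: "s1_bounded_linear g"
    and eq: "\<And>A B. trace_class A \<Longrightarrow> trace_class B \<Longrightarrow> f (optens tens A B) = g (optens tens A B)"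
  shows "f = g"
proof
  fix T
  have fa: "f (S + T) = f S + f T" "g (S + T) = g S + g T" if "trace_class S" "trace_class T" for S T
    using f g that unfolding s1_bounded_linear_def by blast+
  have fc: "f (c *\<^sub>R T) = c *\<^sub>R f T" "g (c *\<^sub>R T) = c *\<^sub>R g T" if "trace_class T" for c T
    using f g that unfolding s1_bounded_linear_def by blast+
  obtain K where K: "K \<ge> 0" "\<And>T s. nuc T s \<Longrightarrow> norm (f T) \<le> K * s"
    using s1_bounded_linear_norm_bound[OF f] by blast
  obtain L where L: "L \<ge> 0" "\<And>T s. nuc T s \<Longrightarrow> norm (g T) \<le> L * s"
    using s1_bounded_linear_norm_bound[OF g] by blast
  have bl: "bounded_linear (\<lambda>x. f (outer x y))" "bounded_linear (\<lambda>x. g (outer x y))" for y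
    by (rule bounded_linear_intro[where K = "K * norm y"],
        use K(2)[OF nuc_outer[of _ y]] in \<open>auto simp: outer_add_left outer_scaleR_left fa fc trace_class_outer mult_ac\<close>)
       (rule bounded_linear_intro[where K = "L * norm y"],
        use L(2)[OF nuc_outer[of _ y]] in \<open>auto simp: outer_add_left outer_scaleR_left fa fc trace_class_outer mult_ac\<close>)
  have bl2: "bounded_linear (\<lambda>y. f (outer x y))" "bounded_linear (\<lambda>y. g (outer x y))" for x
    by (rule bounded_linear_intro[where K = "K * norm x"],
        use K(2)[OF nuc_outer[of x]] in \<open>auto simp: outer_add_right outer_scaleR_right fa fc trace_class_outer mult_ac\<close>)
       (rule bounded_linear_intro[where K = "L * norm x"],
        use L(2)[OF nuc_outer[of x]] in \<open>auto simp: outer_add_right outer_scaleR_right fa fc trace_class_outer mult_ac\<close>)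
  have e1: "f (outer (tens u v) (tens z w)) = g (outer (tens u v) (tens z w))" for u v z w
    unfolding optens_outer[symmetric] by (rule eq) (rule trace_class_outer)+
  have e2: "f (outer x (tens z w)) = g (outer x (tens z w))" for x z w
    using tens_ext[OF bl(1) bl(2)] e1 by metis
  have e3: "f (outer x y) = g (outer x y)" for x y
    using tens_ext[OF bl2(1) bl2(2)] e2 by metis
  have e4: "f (\<Sum>i<n. outer (x i) (y i)) = g (\<Sum>i<n. outer (x i) (y i))" for x y and n :: nat
  proof (induction n)
    case 0
    show ?case using fc[OF trace_class_zero, of 0] by simp
  next
    case (Suc n)
    then show ?case by (simp add: fa trace_class_sum trace_class_outer e3)
  qed
  show "f T = g T"
  proof (cases "trace_class T")
    case True
    then obtain s where "nuc T s" unfolding trace_class_iff_nuc by blast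
    then obtain x y where n: "(\<lambda>i. norm (x i) * norm (y i)) summable_on (UNIV::nat set)"
      "\<And>h. ((\<lambda>i. inner h (y i) *\<^sub>R x i) has_sum blinfun_apply T h) UNIV"
      by (rule nucE) blast
    have "norm (f T - g T) \<le> 0 + e" if e: "e > 0" for e
    proof -
      have "e / (K + L + 1) > 0" using e K(1) L(1) by simp
      then obtain m where m: "nuc (T - (\<Sum>i<m. outer (x i) (y i))) (e / (K + L + 1))"
        using nuc_approx[OF n] by blast
      define S where "S = (\<Sum>i<m. outer (x i) (y i))"
      have tS: "trace_class S" unfolding S_def by (intro trace_class_sum trace_class_outer)
      have "f T = f (T - S) + f S" "g T = g (T - S) + g S"
        using fa[of "T - S" S] True tS trace_class_diff by auto
      then have "f T - g T = f (T - S) - g (T - S)" using e4[of x y m] by (simp add: S_def)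
      then have "norm (f T - g T) \<le> norm (f (T - S)) + norm (g (T - S))" by (simp add: norm_triangle_ineq4)
      also have "\<dots> \<le> K * (e / (K + L + 1)) + L * (e / (K + L + 1))"
        using m unfolding S_def[symmetric] by (intro add_mono K(2) L(2))
      also have "\<dots> = (K + L) * e / (K + L + 1)" by (simp add: add_divide_distrib distrib_right)
      also have "\<dots> \<le> e" using e K(1) L(1) by (simp add: field_simps)
      finally show ?thesis by simp
    qed
    then have "norm (f T - g T) \<le> 0" by (rule field_le_epsilon)
    then show ?thesis by simp
  next
    case False
    then show ?thesis using f g by (simp add: s1_bounded_linear_def)
  qed
qed

lemma ptr1_eq: "ptr1 tens = ptrace"
  unfolding ptr1_def
proof (rule the_equality)
  show "s1_bounded_linear ptrace \<and> (\<forall>A B. trace_class A \<and> trace_class B \<longrightarrow> ptrace (optens tens A B) = trace A *\<^sub>R B)"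
    using ptrace_s1_bounded_linear ptrace_optens by blast
  fix f assume "s1_bounded_linear f \<and> (\<forall>A B. trace_class A \<and> trace_class B \<longrightarrow> f (optens tens A B) = trace A *\<^sub>R B)"
  then show "f = ptrace"
    by (intro s1_bounded_linear_unique ptrace_s1_bounded_linear) (auto simp: ptrace_optens)
qed

lemma ptr1_nuc: "nuc T s \<Longrightarrow> nuc (ptr1 tens T) s"
  by (simp add: ptr1_eq ptrace_nuc)

lemma ptr1_add: "trace_class S \<Longrightarrow> trace_class T \<Longrightarrow> ptr1 tens (S + T) = ptr1 tens S + ptr1 tens T"
  using ptrace_s1_bounded_linear by (simp add: ptr1_eq s1_bounded_linear_def)

lemma ptr1_scaleR: "trace_class T \<Longrightarrow> ptr1 tens (c *\<^sub>R T) = c *\<^sub>R ptr1 tens T"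
  using ptrace_s1_bounded_linear by (simp add: ptr1_eq s1_bounded_linear_def)

lemma ptr1_optens: "trace_class A \<Longrightarrow> trace_class B \<Longrightarrow> ptr1 tens (optens tens A B) = trace A *\<^sub>R B"
  by (simp add: ptr1_eq ptrace_optens)

lemma htensor_flip: "is_htensor (\<lambda>v u. tens u v)"
proof -
  have "{tens u v | v u. True} = {tens u v | u v. True}" by blast
  then show ?thesis using tens unfolding is_htensor_def by (simp add: mult.commute)
qed

end

lemma optens_flip: "optens (\<lambda>v u. tens u v) B A = optens tens A B"
  unfolding optens_def by (rule arg_cong[where f = The]) (auto simp: fun_eq_iff)

text \<open>Exchanging the factors turns one partial trace into the other, so everything about
  \<open>ptr2\<close> is inherited from \<open>ptr1\<close> for the flipped tensor map.\<close>

lemma ptr2_flip: "ptr2 tens = ptr1 (\<lambda>v u. tens u v)"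
proof -
  have E: "optens (\<lambda>v u. tens u v) B A = optens tens A B" for A B by (rule optens_flip)
  show ?thesis unfolding ptr1_def ptr2_def E
    by (intro arg_cong[where f = The] ext conj_cong refl) blast
qed

context
  fixes tens :: "'a::{real_inner,banach,second_countable_topology} \<Rightarrow>
                 'b::{real_inner,banach,second_countable_topology} \<Rightarrow>
                 'h::{real_inner,banach,second_countable_topology}"
  assumes tens: "is_htensor tens"
begin

lemma ptr2_nuc: "nuc T s \<Longrightarrow> nuc (ptr2 tens T) s"
  unfolding ptr2_flip by (rule ptr1_nuc[OF htensor_flip[OF tens]])

lemma ptr2_add: "trace_class S \<Longrightarrow> trace_class T \<Longrightarrow> ptr2 tens (S + T) = ptr2 tens S + ptr2 tens T"
  unfolding ptr2_flip by (rule ptr1_add[OF htensor_flip[OF tens]])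

lemma ptr2_scaleR: "trace_class T \<Longrightarrow> ptr2 tens (c *\<^sub>R T) = c *\<^sub>R ptr2 tens T"
  unfolding ptr2_flip by (rule ptr1_scaleR[OF htensor_flip[OF tens]])

lemma ptr2_optens: "trace_class A \<Longrightarrow> trace_class B \<Longrightarrow> ptr2 tens (optens tens A B) = trace B *\<^sub>R A"
  unfolding ptr2_flip optens_flip[of tens B A, symmetric]
  by (rule ptr1_optens[OF htensor_flip[OF tens]])

end

section \<open>Measurability and weak convergence for the trace norm\<close>

subsection \<open>Measurability with respect to the trace norm\<close>

text \<open>The operator space carries no separable topology as a type, so measurability is expressed through
  approximation by simple functions.\<close>

definition simple_approx :: "'x measure \<Rightarrow> (nat \<Rightarrow> 'x \<Rightarrow> ('h::real_inner \<Rightarrow>\<^sub>L 'h)) \<Rightarrow> ('x \<Rightarrow> ('h \<Rightarrow>\<^sub>L 'h)) \<Rightarrow> bool" where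
  "simple_approx M G F \<longleftrightarrow> (\<forall>\<omega>\<in>space M. trace_class (F \<omega>)) \<and> (\<forall>d. simple_function M (G d)) \<and>
     (\<forall>d. \<forall>\<omega>\<in>space M. trace_class (G d \<omega>)) \<and> (\<forall>\<omega>\<in>space M. (\<lambda>d. nu (F \<omega> - G d \<omega>)) \<longlonglongrightarrow> 0)"

definition tn_measurable :: "'x measure \<Rightarrow> ('x \<Rightarrow> ('h::real_inner \<Rightarrow>\<^sub>L 'h)) \<Rightarrow> bool" where
  "tn_measurable M F \<longleftrightarrow> (\<exists>G. simple_approx M G F)"

lemma simple_approxD:
  assumes "simple_approx M G F"
  shows "\<omega> \<in> space M \<Longrightarrow> trace_class (F \<omega>)" "simple_function M (G d)"
    "\<omega> \<in> space M \<Longrightarrow> trace_class (G d \<omega>)" "\<omega> \<in> space M \<Longrightarrow> (\<lambda>d. nu (F \<omega> - G d \<omega>)) \<longlonglongrightarrow> 0"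
  using assms by (auto simp: simple_approx_def)

lemma tn_measurableI:
  assumes "\<And>\<omega>. \<omega> \<in> space M \<Longrightarrow> trace_class (F \<omega>)" "\<And>d::nat. simple_function M (G d)"
    "\<And>d \<omega>. \<omega> \<in> space M \<Longrightarrow> trace_class (G d \<omega>)"
    "\<And>\<omega>. \<omega> \<in> space M \<Longrightarrow> (\<lambda>d. nu (F \<omega> - G d \<omega>)) \<longlonglongrightarrow> 0"
  shows "tn_measurable M F"
  unfolding tn_measurable_def simple_approx_def using assms by blast

lemma null_seq_le:
  fixes f g :: "nat \<Rightarrow> real"
  assumes "\<And>n. 0 \<le> f n" "\<And>n. f n \<le> g n" "g \<longlonglongrightarrow> 0"
  shows "f \<longlonglongrightarrow> 0"
  by (rule real_tendsto_sandwich[OF _ _ tendsto_const assms(3)]) (use assms in auto)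

lemma nu_tendsto:
  fixes F :: "'h::{real_inner,banach,second_countable_topology} \<Rightarrow>\<^sub>L 'h"
  assumes "trace_class F" "\<And>d. trace_class (G d)" "(\<lambda>d. nu (F - G d)) \<longlonglongrightarrow> 0"
  shows "(\<lambda>d. nu (G d)) \<longlonglongrightarrow> nu F"
proof -
  have "(\<lambda>d. nu (G d) - nu F) \<longlonglongrightarrow> 0"
  proof (rule Lim_null_comparison[OF _ assms(3)], rule always_eventually, rule allI)
    fix d
    have "nu F \<le> nu (F - G d) + nu (G d)"
      using nu_triangle[OF trace_class_diff[OF assms(1) assms(2)[of d]] assms(2)[of d]] by simp
    moreover have "nu (G d) \<le> nu (F - G d) + nu F"
      using nu_triangle[OF trace_class_diff[OF assms(2)[of d] assms(1)] assms(1)]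
        nu_minus_commute[OF assms(1) assms(2)[of d]] by simp
    ultimately show "norm (nu (G d) - nu F) \<le> nu (F - G d)" by simp
  qed
  then show ?thesis by (rule LIM_zero_cancel)
qed

lemma tn_measurable_const:
  fixes T :: "'h::{real_inner,banach,second_countable_topology} \<Rightarrow>\<^sub>L 'h"
  shows "trace_class T \<Longrightarrow> tn_measurable M (\<lambda>_. T)"
  by (rule tn_measurableI[where G = "\<lambda>_ _. T"]) (auto simp: nu_zero)

lemma tn_measurable_add:
  fixes F F' :: "'x \<Rightarrow> ('h::{real_inner,banach,second_countable_topology} \<Rightarrow>\<^sub>L 'h)"
  assumes F: "tn_measurable M F" and F': "tn_measurable M F'"
  shows "tn_measurable M (\<lambda>\<omega>. F \<omega> + F' \<omega>)"
proof -
  obtain G where "simple_approx M G F" using F by (auto simp: tn_measurable_def)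
  note G = simple_approxD[OF this]
  obtain G' where "simple_approx M G' F'" using F' by (auto simp: tn_measurable_def)
  note G' = simple_approxD[OF this]
  show ?thesis
  proof (rule tn_measurableI[where G = "\<lambda>d \<omega>. G d \<omega> + G' d \<omega>"])
    show "simple_function M (\<lambda>\<omega>. G d \<omega> + G' d \<omega>)" for d
      by (rule simple_function_compose2[where h = "(+)", OF G(2) G'(2)])
    fix \<omega> assume w: "\<omega> \<in> space M"
    show "(\<lambda>d. nu ((F \<omega> + F' \<omega>) - (G d \<omega> + G' d \<omega>))) \<longlonglongrightarrow> 0"
    proof (rule null_seq_le)
      show "(\<lambda>d. nu (F \<omega> - G d \<omega>) + nu (F' \<omega> - G' d \<omega>)) \<longlonglongrightarrow> 0"
        using tendsto_add[OF G(4)[OF w] G'(4)[OF w]] by simp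
      show "nu ((F \<omega> + F' \<omega>) - (G d \<omega> + G' d \<omega>)) \<le> nu (F \<omega> - G d \<omega>) + nu (F' \<omega> - G' d \<omega>)" for d
        unfolding add_diff_add by (intro nu_triangle trace_class_diff G(1,3) G'(1,3) w)
    qed (intro nu_nonneg trace_class_diff trace_class_add G(1,3) G'(1,3) w)
  qed (intro trace_class_add G(1,3) G'(1,3); assumption)+
qed

lemma tn_measurable_sum:
  fixes F :: "'i \<Rightarrow> 'x \<Rightarrow> ('h::{real_inner,banach,second_countable_topology} \<Rightarrow>\<^sub>L 'h)"
  assumes "\<And>i. i \<in> I \<Longrightarrow> tn_measurable M (F i)"
  shows "tn_measurable M (\<lambda>\<omega>. \<Sum>i\<in>I. F i \<omega>)"
  using assms by (induction I rule: infinite_finite_induct)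
    (auto intro: tn_measurable_add tn_measurable_const trace_class_zero)

lemma tn_measurable_linear:
  fixes F :: "'x \<Rightarrow> ('h::{real_inner,banach,second_countable_topology} \<Rightarrow>\<^sub>L 'h)"
    and \<Phi> :: "('h \<Rightarrow>\<^sub>L 'h) \<Rightarrow> ('k::{real_inner,banach,second_countable_topology} \<Rightarrow>\<^sub>L 'k)"
  assumes F: "tn_measurable M F"
    and \<Phi>: "\<And>S T. trace_class S \<Longrightarrow> trace_class T \<Longrightarrow> \<Phi> (S - T) = \<Phi> S - \<Phi> T"
    "0 \<le> K" "\<And>T s. nuc T s \<Longrightarrow> nuc (\<Phi> T) (K * s)"
  shows "tn_measurable M (\<lambda>\<omega>. \<Phi> (F \<omega>))"
proof -
  obtain G where "simple_approx M G F" using F by (auto simp: tn_measurable_def)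
  note G = simple_approxD[OF this]
  have tc: "trace_class (\<Phi> T)" if "trace_class T" for T using that \<Phi>(3) unfolding trace_class_iff_nuc by blast
  show ?thesis
  proof (rule tn_measurableI[where G = "\<lambda>d \<omega>. \<Phi> (G d \<omega>)"])
    show "simple_function M (\<lambda>\<omega>. \<Phi> (G d \<omega>))" for d
      by (rule simple_function_compose1[OF G(2)])
    fix \<omega> assume w: "\<omega> \<in> space M"
    show "(\<lambda>d. nu (\<Phi> (F \<omega>) - \<Phi> (G d \<omega>))) \<longlonglongrightarrow> 0"
    proof (rule null_seq_le)
      show "(\<lambda>d. K * nu (F \<omega> - G d \<omega>)) \<longlonglongrightarrow> 0"
        using tendsto_mult_left[OF G(4)[OF w], of K] by simp
      show "nu (\<Phi> (F \<omega>) - \<Phi> (G d \<omega>)) \<le> K * nu (F \<omega> - G d \<omega>)" for d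
        unfolding \<Phi>(1)[OF G(1)[OF w] G(3)[OF w], symmetric]
        by (intro nu_map_le trace_class_diff G(1,3) w \<Phi>(2,3))
    qed (intro nu_nonneg trace_class_diff tc G(1,3) w)
  qed (intro tc G(1,3); assumption)+
qed

text \<open>The error telescopes into \<Phi> (F - G) F' and \<Phi> G (F' - G'), where
  \<open>nu\<close> of G converges by \<open>nu_tendsto\<close>. The product bound on
  \<open>nu\<close> comes from \<open>nu_greatest\<close>, one argument at a time.\<close>

lemma tn_measurable_bilinear:
  fixes F :: "'x \<Rightarrow> ('h::{real_inner,banach,second_countable_topology} \<Rightarrow>\<^sub>L 'h)"
    and F' :: "'x \<Rightarrow> ('g::{real_inner,banach,second_countable_topology} \<Rightarrow>\<^sub>L 'g)"
    and \<Phi> :: "('h \<Rightarrow>\<^sub>L 'h) \<Rightarrow> ('g \<Rightarrow>\<^sub>L 'g) \<Rightarrow> ('k::{real_inner,banach,second_countable_topology} \<Rightarrow>\<^sub>L 'k)"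
  assumes F: "tn_measurable M F" and F': "tn_measurable M F'"
    and \<Phi>1: "\<And>S S' T. trace_class S \<Longrightarrow> trace_class S' \<Longrightarrow> trace_class T \<Longrightarrow> \<Phi> (S + S') T = \<Phi> S T + \<Phi> S' T"
    and \<Phi>2: "\<And>S T T'. trace_class S \<Longrightarrow> trace_class T \<Longrightarrow> trace_class T' \<Longrightarrow> \<Phi> S (T + T') = \<Phi> S T + \<Phi> S T'"
    and \<Phi>: "\<And>S T s t. nuc S s \<Longrightarrow> nuc T t \<Longrightarrow> nuc (\<Phi> S T) (s * t)"
  shows "tn_measurable M (\<lambda>\<omega>. \<Phi> (F \<omega>) (F' \<omega>))"
proof -
  obtain G where "simple_approx M G F" using F by (auto simp: tn_measurable_def)
  note G = simple_approxD[OF this]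
  obtain G' where "simple_approx M G' F'" using F' by (auto simp: tn_measurable_def)
  note G' = simple_approxD[OF this]
  have tc: "trace_class (\<Phi> S T)" if "trace_class S" "trace_class T" for S T
    using that \<Phi> unfolding trace_class_iff_nuc by blast
  have nb: "nu (\<Phi> S T) \<le> nu S * nu T" if S: "trace_class S" and T: "trace_class T" for S T
  proof (rule nu_greatest[OF T nu_nonneg[OF S]])
    fix t assume t: "nuc T t"
    have "nu (\<Phi> S T) \<le> t * nu S"
      by (rule nu_greatest[OF S nuc_nonneg[OF t]]) (use nu_le[OF \<Phi>[OF _ t]] in \<open>simp add: mult.commute\<close>)
    then show "nu (\<Phi> S T) \<le> nu S * t" by (simp add: mult.commute)
  qed
  show ?thesis
  proof (rule tn_measurableI[where G = "\<lambda>d \<omega>. \<Phi> (G d \<omega>) (G' d \<omega>)"])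
    show "simple_function M (\<lambda>\<omega>. \<Phi> (G d \<omega>) (G' d \<omega>))" for d
      by (rule simple_function_compose2[where h = \<Phi>, OF G(2) G'(2)])
    fix \<omega> assume w: "\<omega> \<in> space M"
    show "(\<lambda>d. nu (\<Phi> (F \<omega>) (F' \<omega>) - \<Phi> (G d \<omega>) (G' d \<omega>))) \<longlonglongrightarrow> 0"
    proof (rule null_seq_le)
      have "(\<lambda>d. nu (F \<omega> - G d \<omega>) * nu (F' \<omega>) + nu (G d \<omega>) * nu (F' \<omega> - G' d \<omega>)) \<longlonglongrightarrow> 0 * nu (F' \<omega>) + nu (F \<omega>) * 0"
        by (intro tendsto_add tendsto_mult tendsto_const G(4)[OF w] G'(4)[OF w] nu_tendsto G(1,3) w)
      then show "(\<lambda>d. nu (F \<omega> - G d \<omega>) * nu (F' \<omega>) + nu (G d \<omega>) * nu (F' \<omega> - G' d \<omega>)) \<longlonglongrightarrow> 0" by simp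
      fix d
      have "\<Phi> (F \<omega>) (F' \<omega>) = \<Phi> (F \<omega> - G d \<omega>) (F' \<omega>) + \<Phi> (G d \<omega>) (F' \<omega>)"
        using \<Phi>1[of "F \<omega> - G d \<omega>" "G d \<omega>" "F' \<omega>"] w G G' by (simp add: trace_class_diff)
      also have "\<Phi> (G d \<omega>) (F' \<omega>) = \<Phi> (G d \<omega>) (F' \<omega> - G' d \<omega>) + \<Phi> (G d \<omega>) (G' d \<omega>)"
        using \<Phi>2[of "G d \<omega>" "F' \<omega> - G' d \<omega>" "G' d \<omega>"] w G G' by (simp add: trace_class_diff)
      finally have "\<Phi> (F \<omega>) (F' \<omega>) - \<Phi> (G d \<omega>) (G' d \<omega>) =
        \<Phi> (F \<omega> - G d \<omega>) (F' \<omega>) + \<Phi> (G d \<omega>) (F' \<omega> - G' d \<omega>)" by simp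
      then have "nu (\<Phi> (F \<omega>) (F' \<omega>) - \<Phi> (G d \<omega>) (G' d \<omega>)) \<le>
         nu (\<Phi> (F \<omega> - G d \<omega>) (F' \<omega>)) + nu (\<Phi> (G d \<omega>) (F' \<omega> - G' d \<omega>))"
        by (simp add: nu_triangle tc trace_class_diff G(1,3) G'(1,3) w)
      also have "\<dots> \<le> nu (F \<omega> - G d \<omega>) * nu (F' \<omega>) + nu (G d \<omega>) * nu (F' \<omega> - G' d \<omega>)"
        by (intro add_mono nb trace_class_diff G(1,3) G'(1,3) w)
      finally show "nu (\<Phi> (F \<omega>) (F' \<omega>) - \<Phi> (G d \<omega>) (G' d \<omega>)) \<le>
         nu (F \<omega> - G d \<omega>) * nu (F' \<omega>) + nu (G d \<omega>) * nu (F' \<omega> - G' d \<omega>)" .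
    qed (intro nu_nonneg trace_class_diff tc G(1,3) G'(1,3) w)
  qed (intro tc G(1,3) G'(1,3); assumption)+
qed

lemma tn_measurable_scaleR:
  fixes F :: "'x \<Rightarrow> ('h::{real_inner,banach,second_countable_topology} \<Rightarrow>\<^sub>L 'h)"
  assumes F: "tn_measurable M F" and a: "a \<in> borel_measurable M"
  shows "tn_measurable M (\<lambda>\<omega>. a \<omega> *\<^sub>R F \<omega>)"
proof -
  obtain G where "simple_approx M G F" using F by (auto simp: tn_measurable_def)
  note G = simple_approxD[OF this]
  obtain b where b: "\<And>d::nat. simple_function M (b d)" "\<And>\<omega>. \<omega> \<in> space M \<Longrightarrow> (\<lambda>d. b d \<omega>) \<longlonglongrightarrow> (a \<omega> :: real)"
    using borel_measurable_implies_sequence_metric[OF a, of 0] by blast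
  show ?thesis
  proof (rule tn_measurableI[where G = "\<lambda>d \<omega>. b d \<omega> *\<^sub>R G d \<omega>"])
    show "simple_function M (\<lambda>\<omega>. b d \<omega> *\<^sub>R G d \<omega>)" for d
      by (rule simple_function_compose2[where h = "scaleR", OF b(1) G(2)])
    fix \<omega> assume w: "\<omega> \<in> space M"
    show "(\<lambda>d. nu (a \<omega> *\<^sub>R F \<omega> - b d \<omega> *\<^sub>R G d \<omega>)) \<longlonglongrightarrow> 0"
    proof (rule null_seq_le)
      have "(\<lambda>d. \<bar>a \<omega>\<bar> * nu (F \<omega> - G d \<omega>) + \<bar>a \<omega> - b d \<omega>\<bar> * nu (G d \<omega>)) \<longlonglongrightarrow> \<bar>a \<omega>\<bar> * 0 + \<bar>a \<omega> - a \<omega>\<bar> * nu (F \<omega>)"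
        by (intro tendsto_intros b(2) G(4)[OF w] nu_tendsto G(1,3) w)
      then show "(\<lambda>d. \<bar>a \<omega>\<bar> * nu (F \<omega> - G d \<omega>) + \<bar>a \<omega> - b d \<omega>\<bar> * nu (G d \<omega>)) \<longlonglongrightarrow> 0" by simp
      fix d
      have eq: "a \<omega> *\<^sub>R F \<omega> - b d \<omega> *\<^sub>R G d \<omega> = a \<omega> *\<^sub>R (F \<omega> - G d \<omega>) + (a \<omega> - b d \<omega>) *\<^sub>R G d \<omega>"
        by (simp add: scaleR_diff_right scaleR_diff_left)
      have "nu (a \<omega> *\<^sub>R F \<omega> - b d \<omega> *\<^sub>R G d \<omega>) \<le> nu (a \<omega> *\<^sub>R (F \<omega> - G d \<omega>)) + nu ((a \<omega> - b d \<omega>) *\<^sub>R G d \<omega>)"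
        unfolding eq by (intro nu_triangle trace_class_scaleR trace_class_diff G(1,3) w)
      also have "\<dots> \<le> \<bar>a \<omega>\<bar> * nu (F \<omega> - G d \<omega>) + \<bar>a \<omega> - b d \<omega>\<bar> * nu (G d \<omega>)"
        by (intro add_mono nu_scaleR_le trace_class_diff G(1,3) w)
      finally show "nu (a \<omega> *\<^sub>R F \<omega> - b d \<omega> *\<^sub>R G d \<omega>) \<le> \<bar>a \<omega>\<bar> * nu (F \<omega> - G d \<omega>) + \<bar>a \<omega> - b d \<omega>\<bar> * nu (G d \<omega>)" .
    qed (intro nu_nonneg trace_class_diff trace_class_scaleR G(1,3) w)
  qed (intro trace_class_scaleR G(1,3); assumption)+
qed

lemma tn_measurable_diff:
  fixes F F' :: "'x \<Rightarrow> ('h::{real_inner,banach,second_countable_topology} \<Rightarrow>\<^sub>L 'h)"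
  assumes "tn_measurable M F" "tn_measurable M F'"
  shows "tn_measurable M (\<lambda>\<omega>. F \<omega> - F' \<omega>)"
  using tn_measurable_add[OF assms(1) tn_measurable_scaleR[OF assms(2), of "\<lambda>_. -1"]] by simp

lemma nuc_outer_diff:
  fixes x y :: "'h::{real_inner,banach}"
  shows "nuc (outer x x - outer y y) (norm (x - y) * norm x + norm y * norm (x - y))"
proof -
  have "outer x x - outer y y = outer (x - y) x + outer y (x - y)"
    by (rule blinfun_eqI) (simp add: blinfun.add_left blinfun.diff_left inner_diff_right scaleR_diff_left scaleR_diff_right)
  then show ?thesis by (simp add: nuc_add nuc_outer)
qed

lemma tn_measurable_outer:
  fixes X :: "'x \<Rightarrow> 'h::{real_inner,banach,second_countable_topology}"
  assumes X: "X \<in> borel_measurable M"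
  shows "tn_measurable M (\<lambda>\<omega>. outer (X \<omega>) (X \<omega>))"
proof -
  obtain Y where Y: "\<And>d::nat. simple_function M (Y d)" "\<And>\<omega>. \<omega> \<in> space M \<Longrightarrow> (\<lambda>d. Y d \<omega>) \<longlonglongrightarrow> X \<omega>"
    using borel_measurable_implies_sequence_metric[OF X, of 0] by blast
  show ?thesis
  proof (rule tn_measurableI[where G = "\<lambda>d \<omega>. outer (Y d \<omega>) (Y d \<omega>)"])
    show "simple_function M (\<lambda>\<omega>. outer (Y d \<omega>) (Y d \<omega>))" for d
      by (rule simple_function_compose1[OF Y(1)])
    fix \<omega> assume w: "\<omega> \<in> space M"
    show "(\<lambda>d. nu (outer (X \<omega>) (X \<omega>) - outer (Y d \<omega>) (Y d \<omega>))) \<longlonglongrightarrow> 0"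
    proof (rule null_seq_le)
      have "(\<lambda>d. norm (X \<omega> - Y d \<omega>) * norm (X \<omega>) + norm (Y d \<omega>) * norm (X \<omega> - Y d \<omega>)) \<longlonglongrightarrow>
        norm (X \<omega> - X \<omega>) * norm (X \<omega>) + norm (X \<omega>) * norm (X \<omega> - X \<omega>)"
        by (intro tendsto_intros Y(2)[OF w])
      then show "(\<lambda>d. norm (X \<omega> - Y d \<omega>) * norm (X \<omega>) + norm (Y d \<omega>) * norm (X \<omega> - Y d \<omega>)) \<longlonglongrightarrow> 0" by simp
      show "nu (outer (X \<omega>) (X \<omega>) - outer (Y d \<omega>) (Y d \<omega>)) \<le>
        norm (X \<omega> - Y d \<omega>) * norm (X \<omega>) + norm (Y d \<omega>) * norm (X \<omega> - Y d \<omega>)" for d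
        by (intro nu_le nuc_outer_diff)
    qed (intro nu_nonneg trace_class_diff trace_class_outer)
  qed (rule trace_class_outer)+
qed

text \<open>The continuity half of \<open>tn_bounded_continuous\<close>, kept apart because
  \<open>trace\<close> is continuous but unbounded.\<close>

definition tn_continuous :: "(('h::real_normed_vector \<Rightarrow>\<^sub>L 'h) \<Rightarrow> real) \<Rightarrow> bool" where
  "tn_continuous f \<longleftrightarrow> (\<forall>T. trace_class T \<longrightarrow>
     (\<forall>e>0. \<exists>d>0. \<forall>S. trace_class S \<and> tnorm (S - T) < d \<longrightarrow> \<bar>f S - f T\<bar> < e))"

lemma tn_continuous_seq:
  fixes T :: "'h::{real_inner,banach,second_countable_topology} \<Rightarrow>\<^sub>L 'h"
  assumes f: "tn_continuous f" and T: "trace_class T" and S: "\<And>d. trace_class (S d)"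
    and lim: "(\<lambda>d::nat. nu (T - S d)) \<longlonglongrightarrow> 0"
  shows "(\<lambda>d. f (S d)) \<longlonglongrightarrow> f T"
proof (rule tendstoI)
  fix e :: real assume "e > 0"
  then obtain \<delta> where d: "\<delta> > 0" "\<And>S. trace_class S \<Longrightarrow> tnorm (S - T) < \<delta> \<Longrightarrow> \<bar>f S - f T\<bar> < e"
    using f T unfolding tn_continuous_def by blast
  have "eventually (\<lambda>d. nu (T - S d) < \<delta> / 8) sequentially"
    by (rule order_tendstoD(2)[OF lim]) (use d in simp)
  then show "eventually (\<lambda>d. dist (f (S d)) (f T) < e) sequentially"
  proof eventually_elim
    case (elim k)
    have "tnorm (S k - T) \<le> 8 * nu (S k - T)" by (rule tnorm_le_nu[OF trace_class_diff[OF S T]])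
    also have "\<dots> < \<delta>" using elim nu_minus_commute[OF S T, of k] by simp
    finally show ?case using d(2)[OF S] by (simp add: dist_real_def)
  qed
qed

lemma tn_measurable_compose:
  fixes F :: "'x \<Rightarrow> ('h::{real_inner,banach,second_countable_topology} \<Rightarrow>\<^sub>L 'h)"
  assumes F: "tn_measurable M F" and f: "tn_continuous f"
  shows "(\<lambda>\<omega>. f (F \<omega>)) \<in> borel_measurable M"
proof -
  obtain G where "simple_approx M G F" using F by (auto simp: tn_measurable_def)
  note G = simple_approxD[OF this]
  show ?thesis
  proof (rule borel_measurable_LIMSEQ_real)
    show "(\<lambda>d. f (G d \<omega>)) \<longlonglongrightarrow> f (F \<omega>)" if "\<omega> \<in> space M" for \<omega>
      by (rule tn_continuous_seq[OF f]) (use G that in auto)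
    show "(\<lambda>\<omega>. f (G d \<omega>)) \<in> borel_measurable M" for d
      by (rule borel_measurable_simple_function[OF simple_function_compose1[OF G(2)]])
  qed
qed

subsection \<open>Lipschitz envelopes\<close>

definition nu_lipschitz :: "(('h::real_inner \<Rightarrow>\<^sub>L 'h) \<Rightarrow> real) \<Rightarrow> real \<Rightarrow> bool" where
  "nu_lipschitz f L \<longleftrightarrow> 0 \<le> L \<and> (\<forall>S T. trace_class S \<longrightarrow> trace_class T \<longrightarrow> \<bar>f S - f T\<bar> \<le> L * nu (S - T))"

lemma nu_lipschitz_continuous:
  fixes f :: "('h::{real_inner,banach,second_countable_topology} \<Rightarrow>\<^sub>L 'h) \<Rightarrow> real"
  assumes f: "nu_lipschitz f L" shows "tn_continuous f"
  unfolding tn_continuous_def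
proof (intro allI impI)
  fix T :: "'h \<Rightarrow>\<^sub>L 'h" and e :: real assume T: "trace_class T" and e: "e > 0"
  have L: "L \<ge> 0" using f by (simp add: nu_lipschitz_def)
  have "\<bar>f S - f T\<bar> < e" if S: "trace_class S" "tnorm (S - T) < e / (35 * L + 1)" for S
  proof -
    have t0: "0 \<le> tnorm (S - T)" by (rule tnorm_nonneg[OF trace_class_diff[OF S(1) T]])
    have "\<bar>f S - f T\<bar> \<le> L * nu (S - T)" using f S(1) T by (simp add: nu_lipschitz_def)
    also have "\<dots> \<le> L * (35 * tnorm (S - T))" by (intro mult_left_mono nu_le_tnorm trace_class_diff S T L)
    also have "\<dots> \<le> (35 * L + 1) * tnorm (S - T)" using t0 by (simp add: algebra_simps)
    also have "\<dots> < e" using S(2) L by (simp add: field_simps)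
    finally show ?thesis .
  qed
  then show "\<exists>d>0. \<forall>S. trace_class S \<and> tnorm (S - T) < d \<longrightarrow> \<bar>f S - f T\<bar> < e"
    using e L by (intro exI[of _ "e / (35 * L + 1)"]) auto
qed

lemma linear_nu_lipschitz:
  fixes \<psi> :: "('h::{real_inner,banach,second_countable_topology} \<Rightarrow>\<^sub>L 'h) \<Rightarrow> real"
  assumes \<psi>: "\<And>S T. trace_class S \<Longrightarrow> trace_class T \<Longrightarrow> \<psi> (S + T) = \<psi> S + \<psi> T"
      "\<And>c T. trace_class T \<Longrightarrow> \<psi> (c *\<^sub>R T) = c * \<psi> T"
      "0 \<le> \<kappa>" "\<And>T s. nuc T s \<Longrightarrow> \<bar>\<psi> T\<bar> \<le> \<kappa> * s"
  shows "nu_lipschitz \<psi> \<kappa>"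
  unfolding nu_lipschitz_def
proof (intro conjI allI impI \<psi>(3))
  fix S T :: "'h \<Rightarrow>\<^sub>L 'h" assume S: "trace_class S" and T: "trace_class T"
  have "\<psi> (S - T) = \<psi> S - \<psi> T"
    using \<psi>(1)[OF S trace_class_scaleR[OF T, of "-1"]] \<psi>(2)[OF T, of "-1"] by simp
  moreover have "\<bar>\<psi> (S - T)\<bar> \<le> \<kappa> * nu (S - T)" by (rule nu_greatest[OF trace_class_diff[OF S T] \<psi>(3,4)])
  ultimately show "\<bar>\<psi> S - \<psi> T\<bar> \<le> \<kappa> * nu (S - T)" by simp
qed

lemma trace_continuous:
  "tn_continuous (trace :: ('h::{real_inner,banach,second_countable_topology} \<Rightarrow>\<^sub>L 'h) \<Rightarrow> real)"
  by (rule nu_lipschitz_continuous[OF linear_nu_lipschitz[where \<kappa> = 1]])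
     (auto simp: trace_add trace_scaleR intro: trace_bound)

lemma tn_continuous_linear_compose:
  fixes \<Phi> :: "('h::{real_inner,banach,second_countable_topology} \<Rightarrow>\<^sub>L 'h) \<Rightarrow> ('k::{real_inner,banach,second_countable_topology} \<Rightarrow>\<^sub>L 'k)"
  assumes f: "tn_continuous f"
    and \<Phi>: "\<And>S T. trace_class S \<Longrightarrow> trace_class T \<Longrightarrow> \<Phi> (S - T) = \<Phi> S - \<Phi> T"
    "0 \<le> K" "\<And>T s. nuc T s \<Longrightarrow> nuc (\<Phi> T) (K * s)"
  shows "tn_continuous (\<lambda>T. f (\<Phi> T))"
  unfolding tn_continuous_def
proof (intro allI impI)
  fix T :: "'h \<Rightarrow>\<^sub>L 'h" and \<epsilon> :: real assume T: "trace_class T" and "\<epsilon> > 0"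
  have tc: "trace_class (\<Phi> S)" if "trace_class S" for S using that \<Phi>(3) unfolding trace_class_iff_nuc by blast
  obtain d where d: "d > 0" "\<And>S. trace_class S \<Longrightarrow> tnorm (S - \<Phi> T) < d \<Longrightarrow> \<bar>f S - f (\<Phi> T)\<bar> < \<epsilon>"
    using f tc[OF T] \<open>\<epsilon> > 0\<close> unfolding tn_continuous_def by blast
  have "\<bar>f (\<Phi> S) - f (\<Phi> T)\<bar> < \<epsilon>" if S: "trace_class S" "tnorm (S - T) < d / (280 * K + 1)" for S
  proof (rule d(2)[OF tc[OF S(1)]])
    have tST: "trace_class (S - T)" by (rule trace_class_diff[OF S(1) T])
    have "tnorm (\<Phi> S - \<Phi> T) = tnorm (\<Phi> (S - T))" by (simp add: \<Phi>(1) S(1) T)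
    also have "\<dots> \<le> 8 * (K * (35 * tnorm (S - T)))"
      by (intro nuc_trace_class(2) \<Phi>(3) trace_class_nuc tST)
    also have "\<dots> \<le> (280 * K + 1) * tnorm (S - T)" using tnorm_nonneg[OF tST] by (simp add: algebra_simps)
    also have "\<dots> < d" using S(2) \<Phi>(2) by (simp add: field_simps)
    finally show "tnorm (\<Phi> S - \<Phi> T) < d" .
  qed
  then show "\<exists>d>0. \<forall>S. trace_class S \<and> tnorm (S - T) < d \<longrightarrow> \<bar>f (\<Phi> S) - f (\<Phi> T)\<bar> < \<epsilon>"
    using d(1) \<Phi>(2) by (intro exI[of _ "d / (280 * K + 1)"]) auto
qed

lemma nu_lipschitz_linear_compose:
  fixes \<Phi> :: "('h::{real_inner,banach,second_countable_topology} \<Rightarrow>\<^sub>L 'h) \<Rightarrow> ('k::{real_inner,banach,second_countable_topology} \<Rightarrow>\<^sub>L 'k)"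
  assumes f: "nu_lipschitz f L"
    and \<Phi>: "\<And>S T. trace_class S \<Longrightarrow> trace_class T \<Longrightarrow> \<Phi> (S - T) = \<Phi> S - \<Phi> T"
    "0 \<le> K" "\<And>T s. nuc T s \<Longrightarrow> nuc (\<Phi> T) (K * s)"
  shows "nu_lipschitz (\<lambda>T. f (\<Phi> T)) (L * K)"
  unfolding nu_lipschitz_def
proof (intro conjI allI impI)
  have L: "0 \<le> L" using f by (simp add: nu_lipschitz_def)
  then show "0 \<le> L * K" using \<Phi>(2) by simp
  fix S T :: "'h \<Rightarrow>\<^sub>L 'h" assume S: "trace_class S" and T: "trace_class T"
  have tc: "trace_class (\<Phi> S)" if "trace_class S" for S using that \<Phi>(3) unfolding trace_class_iff_nuc by blast
  have "\<bar>f (\<Phi> S) - f (\<Phi> T)\<bar> \<le> L * nu (\<Phi> S - \<Phi> T)"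
    using f tc[OF S] tc[OF T] unfolding nu_lipschitz_def by blast
  also have "nu (\<Phi> S - \<Phi> T) = nu (\<Phi> (S - T))" by (simp add: \<Phi>(1) S T)
  also have "L * nu (\<Phi> (S - T)) \<le> L * (K * nu (S - T))"
    by (intro mult_left_mono nu_map_le trace_class_diff S T \<Phi> L)
  finally show "\<bar>f (\<Phi> S) - f (\<Phi> T)\<bar> \<le> L * K * nu (S - T)" by (simp add: mult.assoc)
qed

text \<open>The largest k-Lipschitz minorant of g with respect to the nuclear norm.\<close>

definition envelope :: "(('h::real_inner \<Rightarrow>\<^sub>L 'h) \<Rightarrow> real) \<Rightarrow> real \<Rightarrow> ('h \<Rightarrow>\<^sub>L 'h) \<Rightarrow> real" where
  "envelope g k T = (INF S\<in>{S. trace_class S}. g S + k * nu (S - T))"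

context
  fixes g :: "('h::{real_inner,banach,second_countable_topology} \<Rightarrow>\<^sub>L 'h) \<Rightarrow> real" and K k :: real
  assumes g: "\<And>T. trace_class T \<Longrightarrow> \<bar>g T\<bar> \<le> K" and k: "k \<ge> 0"
begin

lemma envelope_term_lower:
  assumes "trace_class S" "trace_class T" shows "- K \<le> g S + k * nu (S - T)"
proof -
  have "0 \<le> k * nu (S - T)" by (intro mult_nonneg_nonneg k nu_nonneg trace_class_diff assms)
  then show ?thesis using g[OF assms(1)] by linarith
qed

lemma envelope_bdd:
  "trace_class T \<Longrightarrow> bdd_below ((\<lambda>S. g S + k * nu (S - T)) ` {S. trace_class S})"
  by (rule bdd_belowI[of _ "- K"]) (auto intro: envelope_term_lower)

lemma envelope_lower: "trace_class T \<Longrightarrow> - K \<le> envelope g k T"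
  unfolding envelope_def by (rule cINF_greatest) (auto intro: envelope_term_lower trace_class_zero)

lemma envelope_le_term: "trace_class S \<Longrightarrow> trace_class T \<Longrightarrow> envelope g k T \<le> g S + k * nu (S - T)"
  unfolding envelope_def by (rule cINF_lower[OF envelope_bdd]) auto

lemma envelope_le: "trace_class T \<Longrightarrow> envelope g k T \<le> g T"
  using envelope_le_term[of T T] by (simp add: nu_zero)

lemma envelope_abs_le: "trace_class T \<Longrightarrow> \<bar>envelope g k T\<bar> \<le> K"
  using envelope_lower[of T] envelope_le[of T] g[of T] by linarith

lemma envelope_greatest:
  "(\<And>S :: 'h \<Rightarrow>\<^sub>L 'h. trace_class S \<Longrightarrow> b \<le> g S + k * nu (S - T)) \<Longrightarrow> b \<le> envelope g k T"
  unfolding envelope_def by (rule cINF_greatest) (auto intro: trace_class_zero)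

lemma envelope_lipschitz: "nu_lipschitz (envelope g k) k"
proof -
  have le: "envelope g k T \<le> envelope g k T' + k * nu (T - T')" if T: "trace_class T" and T': "trace_class T'" for T T'
  proof -
    have "envelope g k T - k * nu (T - T') \<le> envelope g k T'"
    proof (rule envelope_greatest)
      fix S :: "'h \<Rightarrow>\<^sub>L 'h" assume S: "trace_class S"
      have "nu (S - T) \<le> nu (S - T') + nu (T' - T)"
        using nu_triangle[OF trace_class_diff[OF S T'] trace_class_diff[OF T' T]] by simp
      then have "nu (S - T) \<le> nu (S - T') + nu (T - T')" using nu_minus_commute[OF T T'] by simp
      from mult_left_mono[OF this k] have "k * nu (S - T) \<le> k * nu (S - T') + k * nu (T - T')"
        by (simp add: distrib_left)
      then show "envelope g k T - k * nu (T - T') \<le> g S + k * nu (S - T')"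
        using envelope_le_term[OF S T] by linarith
    qed
    then show ?thesis by simp
  qed
  show ?thesis unfolding nu_lipschitz_def
  proof (intro conjI allI impI k)
    fix S T :: "'h \<Rightarrow>\<^sub>L 'h" assume "trace_class S" "trace_class T"
    then show "\<bar>envelope g k S - envelope g k T\<bar> \<le> k * nu (S - T)"
      using le[of S T] le[of T S] nu_minus_commute[of S T] by simp
  qed
qed

end

text \<open>Near T the values of g are within e / 2 of g T; away from T the penalty exceeds the
  total oscillation 2 K of g once n is large.\<close>

lemma envelope_tendsto:
  fixes g :: "('h::{real_inner,banach,second_countable_topology} \<Rightarrow>\<^sub>L 'h) \<Rightarrow> real"
  assumes g: "\<And>T. trace_class T \<Longrightarrow> \<bar>g T\<bar> \<le> K" and c: "tn_continuous g" and T: "trace_class T"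
  shows "(\<lambda>n. envelope g (real n) T) \<longlonglongrightarrow> g T"
proof (rule tendstoI)
  fix e :: real assume e: "e > 0"
  then obtain d where d: "d > 0" "\<And>S. trace_class S \<Longrightarrow> tnorm (S - T) < d \<Longrightarrow> \<bar>g S - g T\<bar> < e / 2"
    using c T unfolding tn_continuous_def by (meson half_gt_zero)
  \<comment> \<open>Since \<open>tnorm\<close> is at most 8 \<open>nu\<close>, away from T means
    \<open>nu\<close> at least d / 8, and n d / 8 >= 2 K holds as soon as n >= 16 K / d.\<close>
  obtain n0 :: nat where n0: "real n0 > 16 * K / d" using reals_Archimedean2 by blast
  have "dist (envelope g (real n) T) (g T) < e" if n: "n \<ge> n0" for n
  proof -
    have "g T - e / 2 \<le> envelope g (real n) T"
    proof (rule envelope_greatest[OF g])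
      fix S :: "'h \<Rightarrow>\<^sub>L 'h" assume S: "trace_class S"
      have nn: "nu (S - T) \<ge> 0" by (rule nu_nonneg[OF trace_class_diff[OF S T]])
      show "g T - e / 2 \<le> g S + real n * nu (S - T)"
      proof (cases "nu (S - T) < d / 8")
        case True
        then have "tnorm (S - T) < d" using tnorm_le_nu[OF trace_class_diff[OF S T]] by linarith
        then have "g T - e / 2 \<le> g S" using d(2)[OF S] by (simp add: abs_if split: if_splits)
        moreover have "0 \<le> real n * nu (S - T)" using nn by simp
        ultimately show ?thesis by linarith
      next
        case False
        have "16 * K / d \<le> real n" using n0 n by linarith
        then have "2 * K \<le> real n * (d / 8)" using d(1) by (simp add: field_simps)
        also have "\<dots> \<le> real n * nu (S - T)" using False by (intro mult_left_mono) auto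
        finally show ?thesis using g[OF S] g[OF T] e by linarith
      qed
    qed auto
    moreover have "envelope g (real n) T \<le> g T" by (rule envelope_le[OF g _ T]) auto
    ultimately show ?thesis using e by (simp add: dist_real_def)
  qed
  then show "eventually (\<lambda>n. dist (envelope g (real n) T) (g T) < e) sequentially"
    by (auto simp: eventually_sequentially)
qed

subsection \<open>The Borel space of trace-class operators\<close>

definition tn_space :: "('h::real_normed_vector \<Rightarrow>\<^sub>L 'h) measure" where
  "tn_space = sigma {T. trace_class T} (Collect tn_open)"

lemma space_tn_space [simp]: "space tn_space = {T. trace_class T}"
  unfolding tn_space_def by (rule space_measure_of) (auto simp: tn_open_def)

lemma sets_tn_space: "sets tn_space = tn_borel_sets"
  unfolding tn_space_def tn_borel_sets_def by (rule sets_measure_of) (auto simp: tn_open_def)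

text \<open>Open sets generate, and an open set is exactly where the Lipschitz envelope of its
  indicator is positive, the envelope acting as a truncated distance to the complement.
  Measurability of real functions therefore suffices.\<close>

lemma measurable_tn_space:
  fixes Z :: "'p \<Rightarrow> ('h::{real_inner,banach,second_countable_topology} \<Rightarrow>\<^sub>L 'h)"
  assumes tc: "\<And>\<omega>. \<omega> \<in> space P \<Longrightarrow> trace_class (Z \<omega>)"
    and m: "\<And>f L. nu_lipschitz f L \<Longrightarrow> (\<lambda>\<omega>. f (Z \<omega>)) \<in> borel_measurable P"
  shows "Z \<in> measurable P tn_space"
  unfolding tn_space_def
proof (rule measurable_measure_of)
  show "Collect tn_open \<subseteq> Pow {T :: 'h \<Rightarrow>\<^sub>L 'h. trace_class T}" by (auto simp: tn_open_def)
  show "Z \<in> space P \<rightarrow> {T. trace_class T}" using tc by auto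
  fix U :: "('h \<Rightarrow>\<^sub>L 'h) set" assume "U \<in> Collect tn_open"
  then have U: "\<And>T. T \<in> U \<Longrightarrow> trace_class T"
    "\<And>T. T \<in> U \<Longrightarrow> \<exists>e>0. \<forall>S. trace_class S \<and> tnorm (S - T) < e \<longrightarrow> S \<in> U" by (auto simp: tn_open_def)
  define g :: "('h \<Rightarrow>\<^sub>L 'h) \<Rightarrow> real" where "g = indicator U"
  have g: "\<bar>g T\<bar> \<le> 1" if "trace_class T" for T by (simp add: g_def indicator_def)
  have pos: "T \<in> U \<longleftrightarrow> envelope g 1 T > 0" if T: "trace_class T" for T
  proof
    assume TU: "T \<in> U"
    then obtain e where e: "e > 0" "\<And>S. trace_class S \<Longrightarrow> tnorm (S - T) < e \<Longrightarrow> S \<in> U" using U by blast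
    have "min 1 (e / 8) \<le> envelope g 1 T"
    proof (rule envelope_greatest[OF g])
      fix S :: "'h \<Rightarrow>\<^sub>L 'h" assume S: "trace_class S"
      have nn: "nu (S - T) \<ge> 0" by (rule nu_nonneg[OF trace_class_diff[OF S T]])
      show "min 1 (e / 8) \<le> g S + 1 * nu (S - T)"
      proof (cases "S \<in> U")
        case True then show ?thesis using nn by (simp add: g_def)
      next
        case False
        then have "e \<le> tnorm (S - T)" using e(2)[OF S] by force
        also have "\<dots> \<le> 8 * nu (S - T)" by (rule tnorm_le_nu[OF trace_class_diff[OF S T]])
        finally show ?thesis using False by (simp add: g_def)
      qed
    qed auto
    then show "envelope g 1 T > 0" using e(1) by (simp add: min_def split: if_splits)
  next
    assume "envelope g 1 T > 0"
    moreover have "envelope g 1 T \<le> g T" by (rule envelope_le[OF g _ T]) auto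
    ultimately have "g T > 0" by linarith
    then show "T \<in> U" by (simp add: g_def indicator_def split: if_splits)
  qed
  have "(\<lambda>\<omega>. envelope g 1 (Z \<omega>)) \<in> borel_measurable P"
    by (rule m[OF envelope_lipschitz[OF g]]) auto
  then have "{\<omega> \<in> space P. 0 < envelope g 1 (Z \<omega>)} \<in> sets P" by (rule borel_measurable_less[rotated]) simp
  moreover have "Z -` U \<inter> space P = {\<omega> \<in> space P. 0 < envelope g 1 (Z \<omega>)}" using pos tc by auto
  ultimately show "Z -` U \<inter> space P \<in> sets P" by simp
qed

lemma tn_continuous_measurable:
  fixes f :: "('h::{real_inner,banach,second_countable_topology} \<Rightarrow>\<^sub>L 'h) \<Rightarrow> real"
  assumes f: "tn_continuous f" shows "f \<in> borel_measurable tn_space"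
proof (rule borel_measurableI)
  fix S :: "real set" assume S: "open S"
  have "tn_open (f -` S \<inter> {T. trace_class T})"
    unfolding tn_open_def
  proof (intro conjI ballI)
    fix T assume T: "T \<in> f -` S \<inter> {T. trace_class T}"
    then obtain e where e: "e > 0" "\<And>y. dist y (f T) < e \<Longrightarrow> y \<in> S" using S by (auto simp: open_dist)
    obtain d where d: "d > 0" "\<And>S. trace_class S \<Longrightarrow> tnorm (S - T) < d \<Longrightarrow> \<bar>f S - f T\<bar> < e"
      using f T e(1) unfolding tn_continuous_def by blast
    show "\<exists>e>0. \<forall>R. trace_class R \<and> tnorm (R - T) < e \<longrightarrow> R \<in> f -` S \<inter> {T. trace_class T}"
      using d e(2) by (intro exI[of _ d]) (auto simp: dist_real_def)
  qed auto
  then show "f -` S \<inter> space tn_space \<in> sets tn_space"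
    unfolding sets_tn_space tn_borel_sets_def space_tn_space by (intro sigma_sets.Basic) auto
qed

text \<open>One half of a portmanteau argument: the envelopes increase the Lipschitz constant and
  converge to f from below, so the integral of f against the limit is nearly reached by a single
  Lipschitz minorant, whose integrals converge by assumption.\<close>

lemma conv_from_lipschitz_lower:
  fixes Y :: "nat \<Rightarrow> 'x \<Rightarrow> ('h::{real_inner,banach,second_countable_topology} \<Rightarrow>\<^sub>L 'h)"
  assumes M: "prob_space M" and P: "prob_space P"
    and Y: "\<And>N \<omega>. \<omega> \<in> space M \<Longrightarrow> trace_class (Y N \<omega>)" and Z: "\<And>\<omega>. \<omega> \<in> space P \<Longrightarrow> trace_class (Z \<omega>)"
    and Ym: "\<And>f N. tn_continuous f \<Longrightarrow> (\<lambda>\<omega>. f (Y N \<omega>)) \<in> borel_measurable M"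
    and Zm: "\<And>f. tn_continuous f \<Longrightarrow> (\<lambda>\<omega>. f (Z \<omega>)) \<in> borel_measurable P"
    and lip: "\<And>f L K. nu_lipschitz f L \<Longrightarrow> (\<And>T. trace_class T \<Longrightarrow> \<bar>f T\<bar> \<le> K) \<Longrightarrow>
        (\<lambda>N. \<integral>\<omega>. f (Y N \<omega>) \<partial>M) \<longlonglongrightarrow> (\<integral>\<omega>. f (Z \<omega>) \<partial>P)"
    and f: "tn_continuous f" "\<And>T. trace_class T \<Longrightarrow> \<bar>f T\<bar> \<le> K" and e: "e > 0"
  shows "eventually (\<lambda>N. (\<integral>\<omega>. f (Y N \<omega>) \<partial>M) > (\<integral>\<omega>. f (Z \<omega>) \<partial>P) - e) sequentially"
proof -
  interpret M: prob_space M by (rule M)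
  interpret P: prob_space P by (rule P)
  have lp: "nu_lipschitz (envelope f (real n)) (real n)" for n by (rule envelope_lipschitz[OF f(2)]) auto
  have ab: "\<bar>envelope f (real n) T\<bar> \<le> K" if "trace_class T" for n T
    by (rule envelope_abs_le[OF f(2) _ that]) auto
  have "(\<lambda>n. \<integral>\<omega>. envelope f (real n) (Z \<omega>) \<partial>P) \<longlonglongrightarrow> (\<integral>\<omega>. f (Z \<omega>) \<partial>P)"
  proof (rule integral_dominated_convergence[where w = "\<lambda>_. K"])
    show "AE \<omega> in P. (\<lambda>n. envelope f (real n) (Z \<omega>)) \<longlonglongrightarrow> f (Z \<omega>)"
      by (rule AE_I2) (intro envelope_tendsto[OF f(2) f(1)] Z)
    show "AE \<omega> in P. norm (envelope f (real n) (Z \<omega>)) \<le> K" for n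
      by (rule AE_I2) (use ab Z in simp)
  qed (use Zm f(1) nu_lipschitz_continuous[OF lp] in auto)
  then have "eventually (\<lambda>n. (\<integral>\<omega>. envelope f (real n) (Z \<omega>) \<partial>P) > (\<integral>\<omega>. f (Z \<omega>) \<partial>P) - e / 2) sequentially"
    by (rule order_tendstoD(1)) (use e in simp)
  then obtain n where n: "(\<integral>\<omega>. envelope f (real n) (Z \<omega>) \<partial>P) > (\<integral>\<omega>. f (Z \<omega>) \<partial>P) - e / 2"
    by (auto simp: eventually_sequentially)
  have "(\<lambda>N. \<integral>\<omega>. envelope f (real n) (Y N \<omega>) \<partial>M) \<longlonglongrightarrow> (\<integral>\<omega>. envelope f (real n) (Z \<omega>) \<partial>P)"
    by (rule lip[OF lp ab])
  then have "eventually (\<lambda>N. (\<integral>\<omega>. envelope f (real n) (Y N \<omega>) \<partial>M) > (\<integral>\<omega>. envelope f (real n) (Z \<omega>) \<partial>P) - e / 2) sequentially"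
    by (rule order_tendstoD(1)) (use e in simp)
  then show ?thesis
  proof eventually_elim
    case (elim N)
    have "(\<integral>\<omega>. envelope f (real n) (Y N \<omega>) \<partial>M) \<le> (\<integral>\<omega>. f (Y N \<omega>) \<partial>M)"
    proof (rule integral_mono)
      show "integrable M (\<lambda>\<omega>. envelope f (real n) (Y N \<omega>))"
        by (rule M.integrable_const_bound[where B = K])
           (use ab Y Ym[OF nu_lipschitz_continuous[OF lp]] in auto)
      show "integrable M (\<lambda>\<omega>. f (Y N \<omega>))"
        by (rule M.integrable_const_bound[where B = K]) (use f Y Ym in auto)
      show "envelope f (real n) (Y N \<omega>) \<le> f (Y N \<omega>)" if "\<omega> \<in> space M" for \<omega>
        by (rule envelope_le[OF f(2) _ Y[OF that]]) auto
    qed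
    then show ?case using elim n by linarith
  qed
qed

lemma conv_from_lipschitz:
  fixes Y :: "nat \<Rightarrow> 'x \<Rightarrow> ('h::{real_inner,banach,second_countable_topology} \<Rightarrow>\<^sub>L 'h)"
  assumes M: "prob_space M" and P: "prob_space P"
    and Y: "\<And>N \<omega>. \<omega> \<in> space M \<Longrightarrow> trace_class (Y N \<omega>)" and Z: "\<And>\<omega>. \<omega> \<in> space P \<Longrightarrow> trace_class (Z \<omega>)"
    and Ym: "\<And>f N. tn_continuous f \<Longrightarrow> (\<lambda>\<omega>. f (Y N \<omega>)) \<in> borel_measurable M"
    and Zm: "\<And>f. tn_continuous f \<Longrightarrow> (\<lambda>\<omega>. f (Z \<omega>)) \<in> borel_measurable P"
    and lip: "\<And>f L K. nu_lipschitz f L \<Longrightarrow> (\<And>T. trace_class T \<Longrightarrow> \<bar>f T\<bar> \<le> K) \<Longrightarrow>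
        (\<lambda>N. \<integral>\<omega>. f (Y N \<omega>) \<partial>M) \<longlonglongrightarrow> (\<integral>\<omega>. f (Z \<omega>) \<partial>P)"
  shows "conv_distr_tn M Y (distr P tn_space Z)"
  unfolding conv_distr_tn_def
proof (intro allI impI)
  fix f :: "('h \<Rightarrow>\<^sub>L 'h) \<Rightarrow> real" assume "tn_bounded_continuous f"
  then obtain K where f: "tn_continuous f" "\<And>T. trace_class T \<Longrightarrow> \<bar>f T\<bar> \<le> K"
    unfolding tn_bounded_continuous_def tn_continuous_def by blast
  \<comment> \<open>The lower bound applied to - f is the upper bound for f.\<close>
  have fm: "tn_continuous (\<lambda>T. - f T)" using f(1) unfolding tn_continuous_def by (simp add: abs_minus_commute)
  have "Z \<in> measurable P tn_space"
    by (rule measurable_tn_space[OF Z]) (auto intro: Zm nu_lipschitz_continuous)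
  then have eq: "(\<integral>T. f T \<partial>distr P tn_space Z) = (\<integral>\<omega>. f (Z \<omega>) \<partial>P)"
    by (rule integral_distr[OF _ tn_continuous_measurable[OF f(1)]])
  have low: "eventually (\<lambda>N. (\<integral>\<omega>. g (Y N \<omega>) \<partial>M) > (\<integral>\<omega>. g (Z \<omega>) \<partial>P) - e) sequentially"
    if "tn_continuous g" "\<And>T. trace_class T \<Longrightarrow> \<bar>g T\<bar> \<le> K" "e > 0" for g K e
    by (rule conv_from_lipschitz_lower[OF M P _ _ _ _ _ that(1) _ that(3)])
       (erule Y Z Ym Zm that(2) | rule lip, assumption, blast)+
  show "(\<lambda>N. \<integral>\<omega>. f (Y N \<omega>) \<partial>M) \<longlonglongrightarrow> (\<integral>T. f T \<partial>distr P tn_space Z)"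
    unfolding eq
  proof (rule tendstoI)
    fix e :: real assume e: "e > 0"
    have "eventually (\<lambda>N. (\<integral>\<omega>. f (Y N \<omega>) \<partial>M) > (\<integral>\<omega>. f (Z \<omega>) \<partial>P) - e) sequentially"
      by (rule low[OF f e]) 
    moreover have "eventually (\<lambda>N. (\<integral>\<omega>. - f (Y N \<omega>) \<partial>M) > (\<integral>\<omega>. - f (Z \<omega>) \<partial>P) - e) sequentially"
      by (rule low[OF fm _ e]) (use f(2) in auto)
    ultimately show "eventually (\<lambda>N. dist (\<integral>\<omega>. f (Y N \<omega>) \<partial>M) (\<integral>\<omega>. f (Z \<omega>) \<partial>P) < e) sequentially"
      by eventually_elim (simp add: dist_real_def abs_less_iff)
  qed
qed

section \<open>Convergence in law of finitely many coordinates\<close>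

subsection \<open>Second moments\<close>

lemma integrable_mult_square:
  fixes u v :: "'x \<Rightarrow> real"
  assumes [measurable]: "u \<in> borel_measurable M" "v \<in> borel_measurable M"
    and u: "integrable M (\<lambda>x. (u x)\<^sup>2)" and v: "integrable M (\<lambda>x. (v x)\<^sup>2)"
  shows "integrable M (\<lambda>x. u x * v x)"
proof (rule Bochner_Integration.integrable_bound[OF Bochner_Integration.integrable_add[OF u v]])
  show "AE x in M. norm (u x * v x) \<le> norm ((u x)\<^sup>2 + (v x)\<^sup>2)"
  proof (rule AE_I2)
    fix x
    have "2 * \<bar>u x * v x\<bar> \<le> (u x)\<^sup>2 + (v x)\<^sup>2"
      using sum_squares_bound[of "\<bar>u x\<bar>" "\<bar>v x\<bar>"] by (simp add: abs_mult)
    then show "norm (u x * v x) \<le> norm ((u x)\<^sup>2 + (v x)\<^sup>2)" by simp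
  qed
qed simp

lemma integrable_add_square:
  fixes u v :: "'x \<Rightarrow> real"
  assumes [measurable]: "u \<in> borel_measurable M" "v \<in> borel_measurable M"
    and u: "integrable M (\<lambda>x. (u x)\<^sup>2)" and v: "integrable M (\<lambda>x. (v x)\<^sup>2)"
  shows "integrable M (\<lambda>x. (u x + c * v x)\<^sup>2)"
proof -
  have "integrable M (\<lambda>x. (u x)\<^sup>2 + c\<^sup>2 * (v x)\<^sup>2 + (2 * c) * (u x * v x))"
    by (intro Bochner_Integration.integrable_add integrable_mult_right u v integrable_mult_square) auto
  then show ?thesis by (simp add: power2_sum power_mult_distrib mult_ac)
qed

lemma integral_cauchy_schwarz:
  fixes u v :: "'x \<Rightarrow> real"
  assumes [measurable]: "u \<in> borel_measurable M" "v \<in> borel_measurable M"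
    and u: "integrable M (\<lambda>x. (u x)\<^sup>2)" and v: "integrable M (\<lambda>x. (v x)\<^sup>2)"
  shows "(\<integral>x. u x * v x \<partial>M)\<^sup>2 \<le> (\<integral>x. (u x)\<^sup>2 \<partial>M) * (\<integral>x. (v x)\<^sup>2 \<partial>M)"
proof -
  define a where "a = (\<integral>x. (u x)\<^sup>2 \<partial>M)"
  define b where "b = (\<integral>x. u x * v x \<partial>M)"
  define c where "c = (\<integral>x. (v x)\<^sup>2 \<partial>M)"
  note uv = integrable_mult_square[OF assms]
  have q: "0 \<le> a * s\<^sup>2 + 2 * s * t * b + t\<^sup>2 * c" for s t
  proof -
    have "0 \<le> (\<integral>x. (s * u x + t * v x)\<^sup>2 \<partial>M)" by (rule integral_nonneg_AE) simp
    also have "\<dots> = (\<integral>x. s\<^sup>2 * (u x)\<^sup>2 + (2 * s * t) * (u x * v x) + t\<^sup>2 * (v x)\<^sup>2 \<partial>M)"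
      by (rule Bochner_Integration.integral_cong) (auto simp: power2_sum power_mult_distrib)
    also have "\<dots> = s\<^sup>2 * a + (2 * s * t) * b + t\<^sup>2 * c"
      unfolding a_def b_def c_def using u v uv by (simp add: Bochner_Integration.integral_add)
    finally show ?thesis by (simp add: mult_ac)
  qed
  have a0: "a \<ge> 0" and c0: "c \<ge> 0" using q[of 1 0] q[of 0 1] by auto
  \<comment> \<open>The quadratic form at (s, t) = (c, - b) gives the discriminant inequality after
    division by c. For c = 0 the form at s = 1 is affine in t and nonnegative, so b must
    vanish.\<close>
  have "b\<^sup>2 \<le> a * c"
  proof (cases "c = 0")
    case True
    have "b = 0"
    proof (rule ccontr)
      assume "b \<noteq> 0"
      have "0 \<le> a + 2 * (- (a + 1) / (2 * b)) * b" using q[of 1 "- (a + 1) / (2 * b)"] True by simp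
      also have "\<dots> = -1" using \<open>b \<noteq> 0\<close> by (simp add: field_simps)
      finally show False by simp
    qed
    then show ?thesis using a0 c0 by simp
  next
    case False
    then have c: "c > 0" using c0 by simp
    have "0 \<le> a * c\<^sup>2 - 2 * c * b * b + b\<^sup>2 * c" using q[of c "- b"] by (simp add: power2_eq_square)
    also have "\<dots> = c * (a * c - b\<^sup>2)" by (simp add: power2_eq_square algebra_simps)
    finally have "0 \<le> a * c - b\<^sup>2" using c by (simp add: zero_le_mult_iff)
    then show ?thesis by simp
  qed
  then show ?thesis by (simp add: a_def b_def c_def)
qed

lemma (in prob_space) expectation_abs_le:
  fixes u :: "'a \<Rightarrow> real"
  assumes [measurable]: "u \<in> borel_measurable M" and u: "integrable M (\<lambda>x. (u x)\<^sup>2)"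
  shows "(\<integral>x. \<bar>u x\<bar> \<partial>M) \<le> sqrt (\<integral>x. (u x)\<^sup>2 \<partial>M)"
proof -
  have "(\<integral>x. \<bar>u x\<bar> * 1 \<partial>M)\<^sup>2 \<le> (\<integral>x. (\<bar>u x\<bar>)\<^sup>2 \<partial>M) * (\<integral>x. 1\<^sup>2 \<partial>M)"
    by (rule integral_cauchy_schwarz) (use u in auto)
  then show ?thesis by (intro real_le_rsqrt) (simp add: prob_space)
qed

lemma integrable_sum_square:
  fixes Y :: "nat \<Rightarrow> 'x \<Rightarrow> real"
  assumes [measurable]: "\<And>i. Y i \<in> borel_measurable M" and Y: "\<And>i. integrable M (\<lambda>x. (Y i x)\<^sup>2)"
  shows "integrable M (\<lambda>x. (\<Sum>i<n. Y i x)\<^sup>2)"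
proof (induction n)
  case (Suc n)
  have "integrable M (\<lambda>x. ((\<Sum>i<n. Y i x) + 1 * Y n x)\<^sup>2)"
    by (rule integrable_add_square) (use Suc Y in auto)
  then show ?case by simp
qed simp

lemma orthogonal_sum_square:
  fixes Y :: "nat \<Rightarrow> 'x \<Rightarrow> real"
  assumes [measurable]: "\<And>i. Y i \<in> borel_measurable M" and Y: "\<And>i. integrable M (\<lambda>x. (Y i x)\<^sup>2)"
    and o: "\<And>i j. i \<noteq> j \<Longrightarrow> (\<integral>x. Y i x * Y j x \<partial>M) = 0"
  shows "(\<integral>x. (\<Sum>i<n. Y i x)\<^sup>2 \<partial>M) = (\<Sum>i<n. \<integral>x. (Y i x)\<^sup>2 \<partial>M)"
proof -
  have i: "integrable M (\<lambda>x. Y i x * Y j x)" for i j by (rule integrable_mult_square) (use Y in auto)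
  have "(\<integral>x. (\<Sum>i<n. Y i x)\<^sup>2 \<partial>M) = (\<integral>x. (\<Sum>i<n. \<Sum>j<n. Y i x * Y j x) \<partial>M)"
    by (simp add: power2_eq_square sum_product)
  also have "\<dots> = (\<Sum>i<n. \<Sum>j<n. \<integral>x. Y i x * Y j x \<partial>M)"
    by (simp add: Bochner_Integration.integral_sum Bochner_Integration.integrable_sum i)
  also have "\<dots> = (\<Sum>i<n. \<Sum>j<n. if i = j then \<integral>x. (Y i x)\<^sup>2 \<partial>M else 0)"
    by (intro sum.cong refl) (auto simp: o power2_eq_square)
  finally show ?thesis by simp
qed

text \<open>Minkowski's inequality in L2 in squared form, obtained from Cauchy-Schwarz on the mixed
  terms.\<close>

lemma sum_square_bound:
  fixes u :: "nat \<Rightarrow> 'x \<Rightarrow> real"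
  assumes um [measurable]: "\<And>j. u j \<in> borel_measurable M" and u: "\<And>j. integrable M (\<lambda>x. (u j x)\<^sup>2)"
    and a: "\<And>j. (\<integral>x. (u j x)\<^sup>2 \<partial>M) \<le> (a j)\<^sup>2" "\<And>j. a j \<ge> 0"
  shows "(\<integral>x. (\<Sum>j<d. u j x)\<^sup>2 \<partial>M) \<le> (\<Sum>j<d. a j)\<^sup>2"
proof -
  have i: "integrable M (\<lambda>x. u j x * u k x)" for j k by (rule integrable_mult_square) (use u in auto)
  have le: "(\<integral>x. u j x * u k x \<partial>M) \<le> a j * a k" for j k
  proof -
    have "(\<integral>x. u j x * u k x \<partial>M)\<^sup>2 \<le> (\<integral>x. (u j x)\<^sup>2 \<partial>M) * (\<integral>x. (u k x)\<^sup>2 \<partial>M)"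
      by (rule integral_cauchy_schwarz) (use u in auto)
    also have "\<dots> \<le> (a j)\<^sup>2 * (a k)\<^sup>2" by (intro mult_mono a) auto
    finally have "\<bar>\<integral>x. u j x * u k x \<partial>M\<bar> \<le> \<bar>a j * a k\<bar>"
      by (simp add: power_mult_distrib[symmetric] abs_le_square_iff)
    then show ?thesis using a(2) by simp
  qed
  have "(\<integral>x. (\<Sum>j<d. u j x)\<^sup>2 \<partial>M) = (\<Sum>j<d. \<Sum>k<d. \<integral>x. u j x * u k x \<partial>M)"
    by (simp add: power2_eq_square sum_product Bochner_Integration.integral_sum Bochner_Integration.integrable_sum i)
  also have "\<dots> \<le> (\<Sum>j<d. \<Sum>k<d. a j * a k)" by (intro sum_mono le)
  finally show ?thesis by (simp add: power2_eq_square sum_product)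
qed

text \<open>The pointwise bound \<open>R\<close> may be infinite. Matrix series can thus be
  integrated as extended reals, with no prior proof that they converge almost surely.\<close>

lemma abs_integral_le_nn:
  fixes F :: "'x \<Rightarrow> real"
  assumes F: "F \<in> borel_measurable M" and b: "\<And>\<omega>. \<omega> \<in> space M \<Longrightarrow> ennreal \<bar>F \<omega>\<bar> \<le> R \<omega>"
    and R: "(\<integral>\<^sup>+\<omega>. R \<omega> \<partial>M) \<le> ennreal r" and r: "r \<ge> 0"
  shows "\<bar>\<integral>\<omega>. F \<omega> \<partial>M\<bar> \<le> r"
proof -
  have "(\<integral>\<^sup>+\<omega>. ennreal (norm (F \<omega>)) \<partial>M) \<le> (\<integral>\<^sup>+\<omega>. R \<omega> \<partial>M)"
    by (rule nn_integral_mono) (use b in simp)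
  then have le: "(\<integral>\<^sup>+\<omega>. ennreal (norm (F \<omega>)) \<partial>M) \<le> ennreal r" using R by (rule order_trans)
  then have "integrable M F"
    by (intro integrableI_bounded F) (auto intro: le_less_trans)
  then have "ennreal (norm (\<integral>\<omega>. F \<omega> \<partial>M)) \<le> (\<integral>\<^sup>+\<omega>. ennreal (norm (F \<omega>)) \<partial>M)"
    by (rule integral_norm_bound_ennreal)
  then have "ennreal (norm (\<integral>\<omega>. F \<omega> \<partial>M)) \<le> ennreal r" using le by (rule order_trans)
  then show ?thesis using r by simp
qed

lemma (in prob_space) indep_orthogonal:
  fixes Y :: "nat \<Rightarrow> 'a \<Rightarrow> real"
  assumes ind: "indep_vars (\<lambda>_. borel) Y UNIV" and Y: "\<And>i. integrable M (Y i)"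
    and m: "\<And>i. expectation (Y i) = 0" and ij: "i \<noteq> j"
  shows "(\<integral>x. Y i x * Y j x \<partial>M) = 0"
proof -
  have "(\<integral>x. (\<Prod>k\<in>{i, j}. Y k x) \<partial>M) = (\<Prod>k\<in>{i, j}. expectation (Y k))"
    by (rule indep_vars_lebesgue_integral) (use Y indep_vars_subset[OF ind] in auto)
  then show ?thesis using ij m by simp
qed

subsection \<open>The central limit theorem for finite linear combinations\<close>

text \<open>The phase \<open>b\<close> lets one real integral carry both the real and the imaginary
  part of the characteristic function, so the later limit statements stay real-valued.\<close>

lemma integral_cos_shift:
  fixes u :: "'x \<Rightarrow> real"
  assumes M: "prob_space M" and [measurable]: "u \<in> borel_measurable M"
  shows "(\<integral>x. cos (b + u x) \<partial>M) = Re (iexp b * char (distr M borel u) 1)"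
proof -
  interpret prob_space M by (rule M)
  have i: "complex_integrable M (\<lambda>x. iexp (u x))"
    by (rule integrable_const_bound[where B = 1]) auto
  have "char (distr M borel u) 1 = (CLINT x|M. iexp (u x))"
    by (simp add: char_def integral_distr)
  then have "iexp b * char (distr M borel u) 1 = (CLINT x|M. iexp b * iexp (u x))" using i by simp
  also have "Re \<dots> = (\<integral>x. Re (iexp b * iexp (u x)) \<partial>M)"
    by (rule integral_Re[symmetric]) (rule integrable_mult_right[OF i])
  also have "\<dots> = (\<integral>x. cos (b + u x) \<partial>M)"
    by (rule Bochner_Integration.integral_cong) (auto simp: Re_exp exp_add[symmetric] distrib_left[symmetric])
  finally show ?thesis by simp
qed

lemma (in prob_space) clt_cos:
  fixes Y :: "nat \<Rightarrow> 'a \<Rightarrow> real"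
  assumes ind: "indep_vars (\<lambda>_. borel) Y UNIV" and sq: "\<And>i. integrable M (\<lambda>x. (Y i x)\<^sup>2)"
    and m: "\<And>i. expectation (Y i) = 0" and s: "\<And>i. (\<integral>x. (Y i x)\<^sup>2 \<partial>M) = s"
    and d: "\<And>i. distr M borel (Y i) = \<mu>"
  shows "(\<lambda>N. \<integral>x. cos (b + (\<Sum>i<N. Y i x) / sqrt (real N)) \<partial>M) \<longlonglongrightarrow> cos b * exp (- s / 2)"
proof -
  have [measurable]: "Y i \<in> borel_measurable M" for i using ind by (auto simp: indep_vars_def)
  have int: "integrable M (Y i)" for i by (rule square_integrable_imp_integrable[OF _ sq]) simp
  have s0: "s \<ge> 0" unfolding s[of 0, symmetric] by simp
  show ?thesis
  proof (cases "s = 0")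
    \<comment> \<open>The central limit theorem divides by the standard deviation; with variance 0
      all summands vanish almost surely and the integral is constant in N.\<close>
    case True
    have "AE x in M. Y i x = 0" for i
    proof -
      have "AE x in M. (Y i x)\<^sup>2 = 0"
        by (subst integral_nonneg_eq_0_iff_AE[symmetric]) (use sq s True in auto)
      then show ?thesis by simp
    qed
    then have a: "AE x in M. \<forall>i. Y i x = 0" by (simp add: AE_all_countable)
    have "(\<integral>x. cos (b + (\<Sum>i<N. Y i x) / sqrt (real N)) \<partial>M) = (\<integral>x. cos b \<partial>M)" for N
      by (rule integral_cong_AE) (use a in auto)
    then show ?thesis using True by (simp add: prob_space)
  next
    case False
    define \<sigma> where "\<sigma> = sqrt s"
    have \<sigma>: "\<sigma> > 0" "\<sigma>\<^sup>2 = s" using False s0 by (auto simp: \<sigma>_def)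
    have w: "weak_conv_m (\<lambda>n. distr M borel (\<lambda>x. (\<Sum>i<n. Y i x) / sqrt (n * \<sigma>\<^sup>2))) std_normal_distribution"
      by (rule central_limit_theorem_zero_mean[OF ind m \<sigma>(1) sq _ d]) (simp add: m s \<sigma>)
    \<comment> \<open>Evaluating at \<sigma> instead of 1 undoes the normalisation to unit
      variance.\<close>
    have "(\<lambda>n. char (distr M borel (\<lambda>x. (\<Sum>i<n. Y i x) / sqrt (n * \<sigma>\<^sup>2))) \<sigma>) \<longlonglongrightarrow> char std_normal_distribution \<sigma>"
      by (rule levy_continuity1[OF _ real_dist_normal_dist w]) simp
    moreover have "char (distr M borel (\<lambda>x. (\<Sum>i<n. Y i x) / sqrt (n * \<sigma>\<^sup>2))) \<sigma> =
        char (distr M borel (\<lambda>x. (\<Sum>i<n. Y i x) / sqrt n)) 1" for n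
    proof -
      have "\<sigma> * ((\<Sum>i<n. Y i x) / sqrt (n * \<sigma>\<^sup>2)) = 1 * ((\<Sum>i<n. Y i x) / sqrt n)" for x
        using \<sigma>(1) by (simp add: real_sqrt_mult)
      then show ?thesis unfolding char_def by (subst (1 2) integral_distr) auto
    qed
    ultimately have "(\<lambda>n. char (distr M borel (\<lambda>x. (\<Sum>i<n. Y i x) / sqrt n)) 1) \<longlonglongrightarrow> complex_of_real (exp (- s / 2))"
      using \<sigma> by (simp add: char_std_normal_distribution)
    then have "(\<lambda>n. Re (iexp b * char (distr M borel (\<lambda>x. (\<Sum>i<n. Y i x) / sqrt n)) 1)) \<longlonglongrightarrow>
        Re (iexp b * complex_of_real (exp (- s / 2)))" by (intro tendsto_intros)
    moreover have "Re (iexp b * complex_of_real (exp (- s / 2))) = cos b * exp (- s / 2)"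
      by (simp add: Re_exp)
    ultimately show ?thesis by (subst integral_cos_shift) (auto simp: prob_space_axioms)
  qed
qed

subsection \<open>Gaussian sequences with prescribed covariances\<close>

text \<open>Gram-Schmidt in L2, with the quotient read as 0 when the pivot vanishes.\<close>

primrec gs_residual :: "'x measure \<Rightarrow> (nat \<Rightarrow> 'x \<Rightarrow> real) \<Rightarrow> nat \<Rightarrow> nat \<Rightarrow> 'x \<Rightarrow> real" where
  "gs_residual M Y 0 j = Y j"
| "gs_residual M Y (Suc n) j = (\<lambda>x. gs_residual M Y n j x +
     (- ((\<integral>x. gs_residual M Y n j x * gs_residual M Y n n x \<partial>M) / (\<integral>x. (gs_residual M Y n n x)\<^sup>2 \<partial>M))) * gs_residual M Y n n x)"

text \<open>A lower triangular factor of an infinite Gram matrix. Row j uses only columns up to j,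
  so each entry is a finite sum that does not change once d exceeds j. The proof follows the
  covariances \<open>K n\<close> of the residuals: step n subtracts L j n * L k n, and after n steps
  the first n rows and columns vanish.\<close>

lemma cholesky:
  fixes Y :: "nat \<Rightarrow> 'x \<Rightarrow> real"
  assumes Ym: "\<And>i. Y i \<in> borel_measurable M" and Y: "\<And>i. integrable M (\<lambda>x. (Y i x)\<^sup>2)"
  shows "\<exists>L. (\<forall>j m. j < m \<longrightarrow> L j m = 0) \<and> (\<forall>j k d. j < d \<longrightarrow> (\<integral>x. Y j x * Y k x \<partial>M) = (\<Sum>m<d. L j m * L k m))"
proof -
  define R where "R = gs_residual M Y"
  define K where "K n j k = (\<integral>x. R n j x * R n k x \<partial>M)" for n j k
  define L where "L j n = K n j n / sqrt (K n n n)" for j n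
  have RS: "R (Suc n) j = (\<lambda>x. R n j x + (- (K n j n / K n n n)) * R n n x)" for n j
    by (simp add: R_def K_def power2_eq_square)
  have R: "R n j \<in> borel_measurable M \<and> integrable M (\<lambda>x. (R n j x)\<^sup>2)" for n j
  proof (induction n arbitrary: j)
    case 0 show ?case using Ym Y by (simp add: R_def)
  next
    case (Suc n)
    have [measurable]: "R n j \<in> borel_measurable M" for j using Suc by blast
    show ?case unfolding RS using Suc by (intro conjI integrable_add_square) auto
  qed
  have Rm [measurable]: "R n j \<in> borel_measurable M" for n j using R by blast
  have RR: "integrable M (\<lambda>x. R n j x * R n k x)" for n j k
    by (rule integrable_mult_square) (use R in auto)
  have sym: "K n j k = K n k j" for n j k by (simp add: K_def mult.commute)
  have K0: "K n n n \<ge> 0" for n by (simp add: K_def)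
  \<comment> \<open>A vanishing pivot makes its whole column vanish by Cauchy-Schwarz, which is what
    makes the convention x / 0 = 0 harmless in \<open>L\<close> and in the residuals.\<close>
  have deg: "K n j n = 0" if "K n n n = 0" for n j
  proof -
    have "(K n j n)\<^sup>2 \<le> K n j j * K n n n" unfolding K_def
      using integral_cauchy_schwarz[of "R n j" M "R n n"] R by (simp add: power2_eq_square)
    then show ?thesis using that by simp
  qed
  have step: "K (Suc n) j k = K n j k - L j n * L k n" for n j k
  proof -
    define a where "a = K n j n / K n n n"
    define b where "b = K n k n / K n n n"
    have "K (Suc n) j k = (\<integral>x. R n j x * R n k x + ((- b) * (R n j x * R n n x) + ((- a) * (R n k x * R n n x) + (a * b) * (R n n x * R n n x))) \<partial>M)"
      unfolding K_def[of "Suc n"] RS a_def[symmetric] b_def[symmetric]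
      by (rule Bochner_Integration.integral_cong) (auto simp: algebra_simps)
    also have "\<dots> = K n j k + ((- b) * K n j n + ((- a) * K n k n + (a * b) * K n n n))"
      unfolding K_def by (simp add: RR Bochner_Integration.integral_add)
    also have "\<dots> = K n j k - L j n * L k n"
    proof (cases "K n n n = 0")
      case True then show ?thesis by (simp add: deg[OF True] L_def)
    next
      case False
      have "L j n * L k n = K n j n * K n k n / K n n n" using K0 by (simp add: L_def)
      then show ?thesis using False by (simp add: a_def b_def field_simps)
    qed
    finally show ?thesis .
  qed
  have zero: "K n j k = 0" if "j < n \<or> k < n" for n j k
    using that
  proof (induction n arbitrary: j k)
    case (Suc n)
    have piv: "K (Suc n) n k = 0" for k
    proof (cases "K n n n = 0")
      case True then show ?thesis by (simp add: step deg[OF True] L_def sym[of n n k])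
    next
      case False
      have "L n n * L k n = K n n n * K n k n / K n n n" using K0 by (simp add: L_def)
      then show ?thesis using False by (simp add: step sym[of n n k])
    qed
    have low: "K (Suc n) j k = 0" if "j < n" for j k
      using Suc.IH[of j k] Suc.IH[of j n] that by (simp add: step L_def)
    have all: "K (Suc n) j k = 0" if "j < Suc n" for j k
      using that piv low by (cases "j = n") auto
    show ?case using Suc.prems all sym by metis
  qed simp
  have expand: "K 0 j k = (\<Sum>m<n. L j m * L k m) + K n j k" for n j k
    by (induction n) (auto simp: step)
  have "L j m = 0" if "j < m" for j m using zero[of j m m] that by (simp add: L_def)
  moreover have "(\<integral>x. Y j x * Y k x \<partial>M) = (\<Sum>m<d. L j m * L k m)" if "j < d" for j k d
    using expand[of j k d] zero[of j d k] that by (simp add: K_def R_def)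
  ultimately show ?thesis by blast
qed

definition gauss_space :: "(nat \<Rightarrow> real) measure" where
  "gauss_space = PiM UNIV (\<lambda>_. std_normal_distribution)"

lemma std_normal_prob: "prob_space std_normal_distribution"
  by (rule prob_space_normal_density) simp

lemma gauss_space_prob: "prob_space gauss_space"
  unfolding gauss_space_def by (rule prob_space_PiM) (rule std_normal_prob)

lemma gauss_space_coord [measurable]: "(\<lambda>\<omega>. \<omega> i) \<in> borel_measurable gauss_space"
proof -
  have "(\<lambda>\<omega>. \<omega> i) \<in> measurable gauss_space std_normal_distribution"
    unfolding gauss_space_def by (rule measurable_component_singleton) simp
  then show ?thesis by (simp cong: measurable_cong_sets)
qed

lemma gauss_space_distr: "distr gauss_space borel (\<lambda>\<omega>. \<omega> i) = std_normal_distribution"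
proof -
  have "distr gauss_space std_normal_distribution (\<lambda>\<omega>. \<omega> i) = std_normal_distribution"
    unfolding gauss_space_def by (rule distr_PiM_component) (auto intro: std_normal_prob)
  moreover have "distr gauss_space borel (\<lambda>\<omega>. \<omega> i) = distr gauss_space std_normal_distribution (\<lambda>\<omega>. \<omega> i)"
    by (rule distr_cong) auto
  ultimately show ?thesis by simp
qed

lemma gauss_space_indep: "prob_space.indep_vars gauss_space (\<lambda>_. borel) (\<lambda>i \<omega>. \<omega> i) UNIV"
proof -
  interpret prob_space gauss_space by (rule gauss_space_prob)
  have s: "sets gauss_space = sets (PiM UNIV (\<lambda>_. borel))"
    unfolding gauss_space_def by (rule sets_PiM_cong) auto
  have "distr gauss_space (PiM UNIV (\<lambda>_. borel)) (\<lambda>x. \<lambda>i\<in>UNIV. x i) = distr gauss_space gauss_space (\<lambda>x. x)"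
    by (rule distr_cong) (auto simp: s)
  also have "\<dots> = gauss_space" by (rule distr_id)
  also have "\<dots> = PiM UNIV (\<lambda>i. distr gauss_space borel (\<lambda>\<omega>. \<omega> i))"
    unfolding gauss_space_distr by (rule gauss_space_def)
  finally show ?thesis by (subst indep_vars_iff_distr_eq_PiM) auto
qed

lemma gauss_space_cos:
  "(\<integral>\<omega>. cos (b + (\<Sum>m<d. s m * \<omega> m)) \<partial>gauss_space) = cos b * exp (- (\<Sum>m<d. (s m)\<^sup>2) / 2)"
proof -
  interpret prob_space gauss_space by (rule gauss_space_prob)
  have "indep_vars (\<lambda>_. borel) (\<lambda>m \<omega>. s m * \<omega> m) {..<d}"
    by (rule indep_vars_subset[OF indep_vars_compose2[OF gauss_space_indep]]) auto
  then have "char (distr gauss_space borel (\<lambda>\<omega>. \<Sum>m<d. s m * \<omega> m)) 1 =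
      (\<Prod>m<d. char (distr gauss_space borel (\<lambda>\<omega>. s m * \<omega> m)) 1)" by (rule char_distr_sum)
  also have "\<dots> = (\<Prod>m<d. complex_of_real (exp (- (s m)\<^sup>2 / 2)))"
  proof (rule prod.cong)
    fix m
    have "char (distr gauss_space borel (\<lambda>\<omega>. s m * \<omega> m)) 1 = char (distr gauss_space borel (\<lambda>\<omega>. \<omega> m)) (s m)"
      unfolding char_def by (simp add: integral_distr)
    then show "char (distr gauss_space borel (\<lambda>\<omega>. s m * \<omega> m)) 1 = complex_of_real (exp (- (s m)\<^sup>2 / 2))"
      by (simp add: gauss_space_distr char_std_normal_distribution)
  qed simp
  also have "\<dots> = complex_of_real (\<Prod>m<d. exp (- (s m)\<^sup>2 / 2))" by simp
  also have "(\<Prod>m<d. exp (- (s m)\<^sup>2 / 2)) = exp (\<Sum>m<d. - (s m)\<^sup>2 / 2)" by (simp add: exp_sum)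
  also have "(\<Sum>m<d. - (s m)\<^sup>2 / 2) = - (\<Sum>m<d. (s m)\<^sup>2) / 2" by (simp add: sum_divide_distrib sum_negf)
  finally have c: "char (distr gauss_space borel (\<lambda>\<omega>. \<Sum>m<d. s m * \<omega> m)) 1 =
     complex_of_real (exp (- (\<Sum>m<d. (s m)\<^sup>2) / 2))" .
  have "(\<integral>\<omega>. cos (b + (\<Sum>m<d. s m * \<omega> m)) \<partial>gauss_space) =
      Re (iexp b * char (distr gauss_space borel (\<lambda>\<omega>. \<Sum>m<d. s m * \<omega> m)) 1)"
    by (rule integral_cos_shift[OF gauss_space_prob]) simp
  then show ?thesis unfolding c by (simp add: Re_exp)
qed

lemma gauss_space_square: "integrable gauss_space (\<lambda>\<omega>. (\<omega> i)\<^sup>2)" "(\<integral>\<omega>. (\<omega> i)\<^sup>2 \<partial>gauss_space) = 1"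
    "(\<integral>\<omega>. \<omega> i \<partial>gauss_space) = 0"
proof -
  have i: "integrable std_normal_distribution (\<lambda>x. x\<^sup>2)" by (rule integrable_std_normal_distribution_moment)
  have "(\<integral>x. x\<^sup>2 \<partial>std_normal_distribution) = 1"
    using std_normal_distribution_even_moments(1)[of 1] by (simp add: numeral_2_eq_2)
  moreover have "(\<integral>x. x ^ 1 \<partial>std_normal_distribution) = 0"
    by (rule integral_std_normal_distribution_moment_odd) simp
  ultimately show "integrable gauss_space (\<lambda>\<omega>. (\<omega> i)\<^sup>2)" "(\<integral>\<omega>. (\<omega> i)\<^sup>2 \<partial>gauss_space) = 1"
    "(\<integral>\<omega>. \<omega> i \<partial>gauss_space) = 0"
    using i unfolding gauss_space_distr[of i, symmetric]
    by (simp_all add: integrable_distr_eq integral_distr)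
qed

text \<open>G is the triangular factor applied to independent standard normals, so every G j lives
  on the one space \<open>gauss_space\<close> and is a finite sum. The cosine integrals fix all
  finite-dimensional laws.\<close>

lemma gaussian_sequence_exists:
  fixes Y :: "nat \<Rightarrow> 'x \<Rightarrow> real"
  assumes Ym [measurable]: "\<And>i. Y i \<in> borel_measurable M" and Y: "\<And>i. integrable M (\<lambda>x. (Y i x)\<^sup>2)"
  shows "\<exists>G :: nat \<Rightarrow> (nat \<Rightarrow> real) \<Rightarrow> real. (\<forall>j. G j \<in> borel_measurable gauss_space) \<and>
    (\<forall>j. integrable gauss_space (\<lambda>\<omega>. (G j \<omega>)\<^sup>2)) \<and>
    (\<forall>j. (\<integral>\<omega>. (G j \<omega>)\<^sup>2 \<partial>gauss_space) = (\<integral>x. (Y j x)\<^sup>2 \<partial>M)) \<and>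
    (\<forall>t d b. (\<integral>\<omega>. cos (b + (\<Sum>j<d. t j * G j \<omega>)) \<partial>gauss_space) =
        cos b * exp (- (\<integral>x. (\<Sum>j<d. t j * Y j x)\<^sup>2 \<partial>M) / 2))"
proof -
  from cholesky[of Y M, OF Ym Y] obtain L where L0: "(\<forall>j m. j < m \<longrightarrow> L j m = 0) \<and>
    (\<forall>j k d. j < d \<longrightarrow> (\<integral>x. Y j x * Y k x \<partial>M) = (\<Sum>m<d. L j m * L k m))" by (elim exE)
  have L: "j < m \<Longrightarrow> L j m = 0"
    "j < d \<Longrightarrow> (\<integral>x. Y j x * Y k x \<partial>M) = (\<Sum>m<d. L j m * L k m)" for j k d m
    using L0 by auto
  interpret P: prob_space gauss_space by (rule gauss_space_prob)
  define G where "G j \<omega> = (\<Sum>m<Suc j. L j m * \<omega> m)" for j and \<omega> :: "nat \<Rightarrow> real"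
  have GE: "G j \<omega> = (\<Sum>m<d. L j m * \<omega> m)" if "j < d" for j d \<omega>
    unfolding G_def by (rule sum.mono_neutral_left) (use that L(1)[of j] in auto)
  have [measurable]: "G j \<in> borel_measurable gauss_space" for j unfolding G_def by measurable
  have ortho: "(\<integral>\<omega>. (a i * \<omega> i) * (a j * \<omega> j) \<partial>gauss_space) = 0" if "i \<noteq> j" for i j and a :: "nat \<Rightarrow> real"
  proof -
    have "(\<integral>\<omega>. \<omega> i * \<omega> j \<partial>gauss_space) = 0"
      by (rule P.indep_orthogonal[OF gauss_space_indep _ _ that])
        (auto intro: P.square_integrable_imp_integrable gauss_space_square)
    then have "(\<integral>\<omega>. (a i * a j) * (\<omega> i * \<omega> j) \<partial>gauss_space) = 0" by simp
    then show ?thesis by (simp add: mult_ac)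
  qed
  have sqi: "integrable gauss_space (\<lambda>\<omega>. (a i * \<omega> i)\<^sup>2)" for a :: "nat \<Rightarrow> real" and i
    by (simp add: power_mult_distrib gauss_space_square)
  have G2: "integrable gauss_space (\<lambda>\<omega>. (G j \<omega>)\<^sup>2)" for j
    unfolding G_def by (rule integrable_sum_square) (auto intro: sqi)
  have "(\<integral>\<omega>. (G j \<omega>)\<^sup>2 \<partial>gauss_space) = (\<Sum>m<Suc j. \<integral>\<omega>. (L j m * \<omega> m)\<^sup>2 \<partial>gauss_space)" for j
    unfolding G_def by (rule orthogonal_sum_square) (auto intro: sqi ortho)
  also have "(\<Sum>m<Suc j. \<integral>\<omega>. (L j m * \<omega> m)\<^sup>2 \<partial>gauss_space) = (\<Sum>m<Suc j. L j m * L j m)" for j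
    by (rule sum.cong) (auto simp: power_mult_distrib gauss_space_square power2_eq_square[of "L _ _"])
  also have "(\<Sum>m<Suc j. L j m * L j m) = (\<integral>x. (Y j x)\<^sup>2 \<partial>M)" for j
    using L(2)[of j "Suc j" j] by (simp add: power2_eq_square)
  finally have G3: "(\<integral>\<omega>. (G j \<omega>)\<^sup>2 \<partial>gauss_space) = (\<integral>x. (Y j x)\<^sup>2 \<partial>M)" for j .
  have YY: "integrable M (\<lambda>x. Y j x * Y k x)" for j k by (rule integrable_mult_square) (use Y in auto)
  have G4: "(\<integral>\<omega>. cos (b + (\<Sum>j<d. t j * G j \<omega>)) \<partial>gauss_space) =
        cos b * exp (- (\<integral>x. (\<Sum>j<d. t j * Y j x)\<^sup>2 \<partial>M) / 2)" for t d b
  proof -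
    define s where "s m = (\<Sum>j<d. t j * L j m)" for m
    have "(\<Sum>j<d. t j * G j \<omega>) = (\<Sum>j<d. \<Sum>m<d. t j * L j m * \<omega> m)" for \<omega>
      by (rule sum.cong) (auto simp: GE[of _ d] sum_distrib_left mult.assoc)
    also have "(\<Sum>j<d. \<Sum>m<d. t j * L j m * \<omega> m) = (\<Sum>m<d. s m * \<omega> m)" for \<omega>
      unfolding s_def sum_distrib_right by (rule sum.swap)
    finally have 1: "(\<Sum>j<d. t j * G j \<omega>) = (\<Sum>m<d. s m * \<omega> m)" for \<omega> .
    have "(\<integral>x. (\<Sum>j<d. t j * Y j x)\<^sup>2 \<partial>M) = (\<integral>x. (\<Sum>j<d. \<Sum>k<d. (t j * t k) * (Y j x * Y k x)) \<partial>M)"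
      by (simp add: power2_eq_square sum_product mult_ac)
    also have "\<dots> = (\<Sum>j<d. \<Sum>k<d. (t j * t k) * (\<integral>x. Y j x * Y k x \<partial>M))"
      by (simp add: Bochner_Integration.integral_sum Bochner_Integration.integrable_sum YY)
    also have "\<dots> = (\<Sum>j<d. \<Sum>k<d. \<Sum>m<d. (t j * L j m) * (t k * L k m))"
      by (intro sum.cong refl) (simp add: L(2)[of _ d] sum_distrib_left mult_ac)
    also have "\<dots> = (\<Sum>j<d. \<Sum>m<d. \<Sum>k<d. (t j * L j m) * (t k * L k m))"
      by (intro sum.cong refl sum.swap)
    also have "\<dots> = (\<Sum>m<d. \<Sum>j<d. \<Sum>k<d. (t j * L j m) * (t k * L k m))" by (rule sum.swap)
    also have "\<dots> = (\<Sum>m<d. (s m)\<^sup>2)" by (simp add: s_def power2_eq_square sum_product)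
    finally have 2: "(\<integral>x. (\<Sum>j<d. t j * Y j x)\<^sup>2 \<partial>M) = (\<Sum>m<d. (s m)\<^sup>2)" .
    show ?thesis unfolding 1 2 by (rule gauss_space_cos)
  qed
  show ?thesis by (intro exI[of _ G] conjI allI) (use G2 G3 G4 in auto)
qed

subsection \<open>Weak convergence from trigonometric moments\<close>

text \<open>Trigonometric polynomials in the first \<open>d\<close> coordinates. The free phase
  provides sines, and zero frequencies provide constants. Product-to-sum formulas make the set
  closed under multiplication, as Stone-Weierstrass requires.\<close>

inductive_set trig :: "nat \<Rightarrow> ((nat \<Rightarrow> real) \<Rightarrow> real) set" for d :: nat where
  cos: "(\<lambda>x. c * cos (b + (\<Sum>j<d. t j * x j))) \<in> trig d"
| add: "p \<in> trig d \<Longrightarrow> q \<in> trig d \<Longrightarrow> (\<lambda>x. p x + q x) \<in> trig d"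

lemma trig_mult_cos:
  assumes "q \<in> trig d" shows "(\<lambda>x. c * cos (b + (\<Sum>j<d. t j * x j)) * q x) \<in> trig d"
  using assms
proof induction
  case (cos c' b' t')
  have "c * cos (b + (\<Sum>j<d. t j * x j)) * (c' * cos (b' + (\<Sum>j<d. t' j * x j))) =
    (c * c' / 2) * cos ((b - b') + (\<Sum>j<d. (t j - t' j) * x j)) +
    (c * c' / 2) * cos ((b + b') + (\<Sum>j<d. (t j + t' j) * x j))" for x :: "nat \<Rightarrow> real"
  proof -
    have p: "a * cos A * (a' * cos B) = (a * a' / 2) * cos (A - B) + (a * a' / 2) * cos (A + B)" for a a' A B :: real
      by (simp add: cos_times_cos field_simps)
    have "(b - b') + (\<Sum>j<d. (t j - t' j) * x j) = (b + (\<Sum>j<d. t j * x j)) - (b' + (\<Sum>j<d. t' j * x j))"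
      by (simp add: left_diff_distrib sum_subtractf)
    moreover have "(b + b') + (\<Sum>j<d. (t j + t' j) * x j) = (b + (\<Sum>j<d. t j * x j)) + (b' + (\<Sum>j<d. t' j * x j))"
      by (simp add: distrib_right sum.distrib)
    ultimately show ?thesis by (simp only: p)
  qed
  then show ?case using trig.add[OF trig.cos trig.cos] by presburger
next
  case (add p q)
  then show ?case using trig.add by (simp add: distrib_left)
qed

lemma trig_mult: "p \<in> trig d \<Longrightarrow> q \<in> trig d \<Longrightarrow> (\<lambda>x. p x * q x) \<in> trig d"
proof (induction rule: trig.induct)
  case (cos c b t)
  then show ?case by (rule trig_mult_cos)
next
  case (add p p')
  then show ?case using trig.add by (simp add: distrib_right)
qed

lemma trig_continuous_bounded:
  assumes "p \<in> trig d"
  shows "continuous_on UNIV p \<and> (\<exists>K. \<forall>x. \<bar>p x\<bar> \<le> K)"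
  using assms
proof induction
  case (cos c b t)
  have "\<bar>c * cos (b + (\<Sum>j<d. t j * x j))\<bar> \<le> \<bar>c\<bar>" for x :: "nat \<Rightarrow> real"
    using mult_left_mono[OF abs_cos_le_one, of "\<bar>c\<bar>"] by (simp add: abs_mult)
  moreover have "continuous_on UNIV (\<lambda>x::nat \<Rightarrow> real. c * cos (b + (\<Sum>j<d. t j * x j)))"
    by (intro continuous_intros continuous_on_product_coordinates)
  ultimately show ?case by blast
next
  case (add p q)
  then obtain K L where "\<And>x. \<bar>p x\<bar> \<le> K" "\<And>x. \<bar>q x\<bar> \<le> L" by blast
  then have "\<bar>p x + q x\<bar> \<le> K + L" for x using abs_triangle_ineq[of "p x" "q x"] by (meson add_mono order_trans)
  then show ?case using add by (auto intro!: continuous_intros)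
qed

text \<open>A quadratic bound, though the difference is of third order at 0: it matches the second
  moments, the only ones at hand for the coordinates.\<close>

lemma abs_sin_diff_le: "\<bar>x - sin x\<bar> \<le> x\<^sup>2" for x :: real
proof -
  have "cmod (iexp x - (\<Sum>k\<le>1. (\<i> * x) ^ k / fact k)) \<le> \<bar>x\<bar> ^ 2 / 2"
    using iexp_approx1[of x 1] by (simp add: numeral_2_eq_2)
  then have "cmod (iexp x - (1 + \<i> * x)) \<le> x\<^sup>2 / 2" by simp
  then have "\<bar>Im (iexp x - (1 + \<i> * x))\<bar> \<le> x\<^sup>2 / 2"
    by (rule order_trans[OF abs_Im_le_cmod])
  moreover have "Im (iexp x - (1 + \<i> * x)) = sin x - x" by (simp add: Im_exp)
  ultimately have "\<bar>sin x - x\<bar> \<le> x\<^sup>2 / 2" by simp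
  moreover have "x\<^sup>2 / 2 \<le> x\<^sup>2" by simp
  ultimately have "\<bar>sin x - x\<bar> \<le> x\<^sup>2" by linarith
  then show ?thesis by (simp add: abs_minus_commute)
qed

lemma trig_convergence:
  fixes W :: "nat \<Rightarrow> 'x \<Rightarrow> nat \<Rightarrow> real" and G :: "'p \<Rightarrow> nat \<Rightarrow> real"
  assumes M: "prob_space M" and P: "prob_space P"
    and Wm: "\<And>N j. (\<lambda>\<omega>. W N \<omega> j) \<in> borel_measurable M" and Gm: "\<And>j. (\<lambda>\<omega>. G \<omega> j) \<in> borel_measurable P"
    and char: "\<And>t b. (\<lambda>N. \<integral>\<omega>. cos (b + (\<Sum>j<d. t j * W N \<omega> j)) \<partial>M) \<longlonglongrightarrow> (\<integral>\<omega>. cos (b + (\<Sum>j<d. t j * G \<omega> j)) \<partial>P)"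
    and p: "p \<in> trig d"
  shows "(\<lambda>N. \<integral>\<omega>. p (W N \<omega>) \<partial>M) \<longlonglongrightarrow> (\<integral>\<omega>. p (G \<omega>) \<partial>P)"
proof -
  interpret M: prob_space M by (rule M)
  interpret P: prob_space P by (rule P)
  have W: "W N \<in> borel_measurable M" for N using Wm by (intro measurable_coordinatewise_then_product)
  have G: "G \<in> borel_measurable P" using Gm by (intro measurable_coordinatewise_then_product)
  have int: "integrable M (\<lambda>\<omega>. q (W N \<omega>)) \<and> integrable P (\<lambda>\<omega>. q (G \<omega>))" if q: "q \<in> trig d" for q N
  proof -
    obtain K where K: "\<And>x. \<bar>q x\<bar> \<le> K" using trig_continuous_bounded[OF q] by blast
    have [measurable]: "q \<in> borel_measurable borel"
      using trig_continuous_bounded[OF q] by (intro borel_measurable_continuous_onI) auto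
    show ?thesis
      by (intro conjI M.integrable_const_bound[where B = K] P.integrable_const_bound[where B = K])
         (use K W G in \<open>auto intro: measurable_compose\<close>)
  qed
  show ?thesis using p
  proof induction
    case (cos c b t)
    have "(\<lambda>N. c * (\<integral>\<omega>. cos (b + (\<Sum>j<d. t j * W N \<omega> j)) \<partial>M)) \<longlonglongrightarrow>
        c * (\<integral>\<omega>. cos (b + (\<Sum>j<d. t j * G \<omega> j)) \<partial>P)"
      by (rule tendsto_mult_left[OF char[where b = b and t = t]])
    then show ?case by simp
  next
    case (add p q)
    have "(\<lambda>N. (\<integral>\<omega>. p (W N \<omega>) \<partial>M) + (\<integral>\<omega>. q (W N \<omega>) \<partial>M)) \<longlonglongrightarrow> (\<integral>\<omega>. p (G \<omega>) \<partial>P) + (\<integral>\<omega>. q (G \<omega>) \<partial>P)"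
      by (rule tendsto_add[OF add.IH])
    then show ?case using int[OF add.hyps(1)] int[OF add.hyps(2)] by simp
  qed
qed

lemma compact_box:
  fixes C :: "nat \<Rightarrow> real set"
  assumes "\<And>i. compact (C i)" shows "compact {x. \<forall>i. x i \<in> C i}"
proof -
  have "compactin (product_topology (\<lambda>i. euclidean) UNIV) (PiE UNIV C)"
    unfolding compactin_PiE using assms by (simp add: compactin_euclidean_iff)
  moreover have "PiE UNIV C = {x. \<forall>i. x i \<in> C i}" by (auto simp: PiE_UNIV_domain)
  ultimately show ?thesis by (simp add: euclidean_product_topology compactin_euclidean_iff)
qed

lemma lipschitz_coordinates_continuous:
  fixes g :: "(nat \<Rightarrow> real) \<Rightarrow> real"
  assumes lip: "\<And>x y. \<bar>g x - g y\<bar> \<le> L * (\<Sum>j<d. \<bar>x j - y j\<bar>)"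
  shows "continuous_on UNIV g"
proof (unfold continuous_on_def, rule ballI)
  fix x :: "nat \<Rightarrow> real"
  have c: "((\<lambda>y. y j) \<longlongrightarrow> x j) (at x within UNIV)" for j
    using continuous_on_product_coordinates[of j] unfolding continuous_on_def by blast
  have "((\<lambda>y. L * (\<Sum>j<d. \<bar>y j - x j\<bar>)) \<longlongrightarrow> L * (\<Sum>j<d. \<bar>x j - x j\<bar>)) (at x within UNIV)"
    by (intro tendsto_intros c)
  then have "((\<lambda>y. L * (\<Sum>j<d. \<bar>y j - x j\<bar>)) \<longlongrightarrow> 0) (at x within UNIV)" by simp
  then have "((\<lambda>y. g y - g x) \<longlongrightarrow> 0) (at x within UNIV)"
    by (rule Lim_null_comparison[rotated]) (use lip in auto)
  then show "(g \<longlongrightarrow> g x) (at x within UNIV)" by (rule LIM_zero_cancel)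
qed

text \<open>Substituting l sin (x/l) for the coordinates makes every polynomial a bounded trigonometric
  polynomial and moves x by at most x^2/l.\<close>

lemma sine_approximation:
  fixes g :: "(nat \<Rightarrow> real) \<Rightarrow> real"
  assumes lip: "\<And>x y. \<bar>g x - g y\<bar> \<le> L * (\<Sum>j<d. \<bar>x j - y j\<bar>)" and l: "l > 0" and e: "e > 0"
  shows "\<exists>p\<in>trig d. \<forall>x. \<bar>g (\<lambda>j. if j < d then l * sin (x j / l) else 0) - p x\<bar> < e"
proof -
  define s where "s x = (\<lambda>j. if j < d then l * sin (x j / l) else 0)" for x :: "nat \<Rightarrow> real"
  define S where "S = {x :: nat \<Rightarrow> real. \<forall>i. x i \<in> (if i < d then {-l..l} else {0})}"
  \<comment> \<open>Continuous functions that become trigonometric polynomials under the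
    substitution \<open>s\<close>. They form a ring by \<open>trig_mult\<close>, and it contains the
    coordinates below d since sine is a cosine shifted by pi / 2. Points of the compact
    \<open>S\<close> have the other coordinates equal to 0, so these coordinates separate
    them.\<close>
  define R where "R = {p. continuous_on UNIV p \<and> (\<lambda>x. p (s x)) \<in> trig d}"
  interpret function_ring_on R S
  proof
    show "compact S" unfolding S_def by (rule compact_box) auto
    show "continuous_on S f" if "f \<in> R" for f using that continuous_on_subset by (auto simp: R_def)
    show "(\<lambda>x. f x + g x) \<in> R" if "f \<in> R" "g \<in> R" for f g
      using that by (auto simp: R_def intro!: continuous_intros trig.add)
    show "(\<lambda>x. f x * g x) \<in> R" if "f \<in> R" "g \<in> R" for f g
      using that by (auto simp: R_def intro!: continuous_intros trig_mult)
    show "(\<lambda>_. c) \<in> R" for c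
      using trig.cos[of c 0 "\<lambda>_. 0" d] by (auto simp: R_def intro!: continuous_intros)
    show "\<exists>f\<in>R. f x \<noteq> f y" if xy: "x \<in> S" "y \<in> S" "x \<noteq> y" for x y
    proof -
      obtain k where k: "x k \<noteq> y k" using xy(3) by auto
      then have kd: "k < d" using xy(1,2) by (force simp: S_def split: if_splits)
      have "s x k = l * cos (- (pi / 2) + (\<Sum>j<d. (if j = k then 1 / l else 0) * x j))" for x
        using kd by (simp add: s_def if_distrib[of "\<lambda>a. a * _"] sum.delta cos_diff cong: if_cong)
      then have "(\<lambda>x. s x k) \<in> trig d" using trig.cos[of l "- (pi / 2)" "\<lambda>j. if j = k then 1 / l else 0" d] by presburger
      then have "(\<lambda>x. x k) \<in> R" by (auto simp: R_def)
      then show ?thesis using k by (intro bexI[of _ "\<lambda>x. x k"])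
    qed
  qed
  have "continuous_on UNIV g" by (rule lipschitz_coordinates_continuous[OF lip])
  then have "continuous_on S g" by (rule continuous_on_subset) simp
  from Stone_Weierstrass[OF this] obtain F where F: "F \<in> UNIV \<rightarrow> R" "uniform_limit S F g sequentially" by blast
  then have "eventually (\<lambda>n. \<forall>x\<in>S. dist (F n x) (g x) < e) sequentially" using e by (auto simp: uniform_limit_iff)
  then obtain n where n: "\<forall>x\<in>S. dist (F n x) (g x) < e" by (auto simp: eventually_sequentially)
  have sS: "s x \<in> S" for x
  proof -
    have "\<bar>l * sin (x j / l)\<bar> \<le> l * 1" for j unfolding abs_mult using l by (intro mult_mono) auto
    then show ?thesis by (auto simp: S_def s_def abs_le_iff minus_le_iff)
  qed
  show ?thesis
  proof (intro bexI[of _ "\<lambda>x. F n (s x)"] allI)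
    show "(\<lambda>x. F n (s x)) \<in> trig d" using F(1) by (auto simp: R_def)
    show "\<bar>g (\<lambda>j. if j < d then l * sin (x j / l) else 0) - F n (s x)\<bar> < e" for x
      using n sS[of x] by (auto simp: dist_real_def s_def abs_minus_commute)
  qed
qed

lemma expectation_close:
  fixes U :: "'q \<Rightarrow> nat \<Rightarrow> real"
  assumes Q: "prob_space Q" and Um: "\<And>j. (\<lambda>\<omega>. U \<omega> j) \<in> borel_measurable Q"
    and U2: "\<And>j. integrable Q (\<lambda>\<omega>. (U \<omega> j)\<^sup>2)" "\<And>j. (\<integral>\<omega>. (U \<omega> j)\<^sup>2 \<partial>Q) \<le> v j"
    and gm: "g \<in> borel_measurable borel" and pm: "p \<in> borel_measurable borel"
    and bdd: "\<And>x. \<bar>g x\<bar> \<le> K" and K': "\<And>x. \<bar>p x\<bar> \<le> K'"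
    and gp: "\<And>x. \<bar>g x - p x\<bar> \<le> c + L * (\<Sum>j<d. (x j)\<^sup>2 / l)" and L: "L \<ge> 0" and l: "l > 0"
  shows "\<bar>(\<integral>\<omega>. g (U \<omega>) \<partial>Q) - (\<integral>\<omega>. p (U \<omega>) \<partial>Q)\<bar> \<le> c + L * (\<Sum>j<d. v j / l)"
proof -
  interpret Q: prob_space Q by (rule Q)
  have U: "U \<in> borel_measurable Q" using Um by (intro measurable_coordinatewise_then_product)
  have ig: "integrable Q (\<lambda>\<omega>. g (U \<omega>))"
    by (rule Q.integrable_const_bound[where B = K]) (use bdd gm U in \<open>auto intro: measurable_compose\<close>)
  have ip: "integrable Q (\<lambda>\<omega>. p (U \<omega>))"
    by (rule Q.integrable_const_bound[where B = K']) (use K' pm U in \<open>auto intro: measurable_compose\<close>)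
  have ib: "integrable Q (\<lambda>\<omega>. c + L * (\<Sum>j<d. (U \<omega> j)\<^sup>2 / l))"
    by (intro Bochner_Integration.integrable_add integrable_mult_right Bochner_Integration.integrable_sum integrable_divide U2) simp
  have "\<bar>(\<integral>\<omega>. g (U \<omega>) \<partial>Q) - (\<integral>\<omega>. p (U \<omega>) \<partial>Q)\<bar> = \<bar>\<integral>\<omega>. g (U \<omega>) - p (U \<omega>) \<partial>Q\<bar>"
    using ig ip by simp
  also have "\<dots> \<le> (\<integral>\<omega>. \<bar>g (U \<omega>) - p (U \<omega>)\<bar> \<partial>Q)" by (rule integral_abs_bound)
  also have "\<dots> \<le> (\<integral>\<omega>. c + L * (\<Sum>j<d. (U \<omega> j)\<^sup>2 / l) \<partial>Q)"
    by (rule integral_mono) (use ig ip ib gp in auto)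
  also have "\<dots> = c + L * (\<Sum>j<d. (\<integral>\<omega>. (U \<omega> j)\<^sup>2 \<partial>Q) / l)"
    by (simp add: Bochner_Integration.integral_add Bochner_Integration.integral_sum
      Bochner_Integration.integrable_sum U2 Q.prob_space)
  also have "\<dots> \<le> c + L * (\<Sum>j<d. v j / l)"
    using L l U2(2) by (intro add_left_mono mult_left_mono sum_mono divide_right_mono) auto
  finally show ?thesis .
qed

lemma abs_triangle_three:
  fixes a b c x e :: real
  assumes "\<bar>b - c\<bar> < e / 3" "\<bar>a - b\<bar> \<le> e / 3" "\<bar>x - c\<bar> \<le> e / 3"
  shows "\<bar>a - x\<bar> < e"
  using assms by (auto simp: abs_if split: if_splits)

text \<open>The second moment bounds, uniform in N, take the place of tightness: they make the sine
  substitution cost at most V / l in expectation for every N and for the limit. What remains is a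
  trigonometric polynomial, for which convergence is assumed.\<close>

lemma lipschitz_convergence:
  fixes W :: "nat \<Rightarrow> 'x \<Rightarrow> nat \<Rightarrow> real" and G :: "'p \<Rightarrow> nat \<Rightarrow> real" and v :: "nat \<Rightarrow> real"
  assumes M: "prob_space M" and P: "prob_space P"
    and Wm: "\<And>N j. (\<lambda>\<omega>. W N \<omega> j) \<in> borel_measurable M" and Gm: "\<And>j. (\<lambda>\<omega>. G \<omega> j) \<in> borel_measurable P"
    and W2: "\<And>N j. integrable M (\<lambda>\<omega>. (W N \<omega> j)\<^sup>2)" "\<And>N j. (\<integral>\<omega>. (W N \<omega> j)\<^sup>2 \<partial>M) \<le> v j"
    and G2: "\<And>j. integrable P (\<lambda>\<omega>. (G \<omega> j)\<^sup>2)" "\<And>j. (\<integral>\<omega>. (G \<omega> j)\<^sup>2 \<partial>P) \<le> v j"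
    and char: "\<And>t b. (\<lambda>N. \<integral>\<omega>. cos (b + (\<Sum>j<d. t j * W N \<omega> j)) \<partial>M) \<longlonglongrightarrow> (\<integral>\<omega>. cos (b + (\<Sum>j<d. t j * G \<omega> j)) \<partial>P)"
    and lip: "\<And>x y. \<bar>g x - g y\<bar> \<le> L * (\<Sum>j<d. \<bar>x j - y j\<bar>)" and L: "L \<ge> 0"
    and bdd: "\<And>x. \<bar>g x\<bar> \<le> K"
  shows "(\<lambda>N. \<integral>\<omega>. g (W N \<omega>) \<partial>M) \<longlonglongrightarrow> (\<integral>\<omega>. g (G \<omega>) \<partial>P)"
proof (rule tendstoI)
  fix e :: real assume e: "e > 0"
  define V where "V = L * (\<Sum>j<d. v j)"
  have v0: "v j \<ge> 0" for j
  proof -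
    have "0 \<le> (\<integral>\<omega>. (G \<omega> j)\<^sup>2 \<partial>P)" by simp
    then show ?thesis using G2(2)[of j] by linarith
  qed
  have V0: "V \<ge> 0" unfolding V_def using L v0 by (intro mult_nonneg_nonneg sum_nonneg) auto
  \<comment> \<open>Chosen so that V / l <= e / 6; the summand 1 keeps l positive when V =
    0.\<close>
  define l where "l = (V + 1) / (e / 6)"
  have l: "l > 0" using V0 e by (simp add: l_def)
  have Vl: "V / l \<le> e / 6"
  proof -
    have "V / l = e / 6 * (V / (V + 1))" using V0 e by (simp add: l_def field_simps)
    also have "\<dots> \<le> e / 6 * 1" using V0 e by (intro mult_left_mono) auto
    finally show ?thesis by simp
  qed
  obtain p where p: "p \<in> trig d" "\<And>x. \<bar>g (\<lambda>j. if j < d then l * sin (x j / l) else 0) - p x\<bar> < e / 6"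
    using sine_approximation[OF lip l, of "e / 6"] e by auto
  have gp: "\<bar>g x - p x\<bar> \<le> e / 6 + L * (\<Sum>j<d. (x j)\<^sup>2 / l)" for x
  proof -
    have "\<bar>g x - g (\<lambda>j. if j < d then l * sin (x j / l) else 0)\<bar> \<le>
        L * (\<Sum>j<d. \<bar>x j - (if j < d then l * sin (x j / l) else 0)\<bar>)" by (rule lip)
    also have "\<dots> \<le> L * (\<Sum>j<d. (x j)\<^sup>2 / l)"
    proof (intro mult_left_mono sum_mono L)
      fix j assume "j \<in> {..<d}"
      have "\<bar>x j - l * sin (x j / l)\<bar> = l * \<bar>x j / l - sin (x j / l)\<bar>"
      proof -
        have "x j - l * sin (x j / l) = l * (x j / l - sin (x j / l))" using l by (simp add: right_diff_distrib)
        then show ?thesis using l by (simp add: abs_mult)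
      qed
      also have "\<dots> \<le> l * (x j / l)\<^sup>2" using l abs_sin_diff_le by (intro mult_left_mono) auto
      also have "\<dots> = (x j)\<^sup>2 / l" using l by (simp add: power2_eq_square)
      finally show "\<bar>x j - (if j < d then l * sin (x j / l) else 0)\<bar> \<le> (x j)\<^sup>2 / l" using \<open>j \<in> {..<d}\<close> by simp
    qed
    finally show ?thesis using p(2)[of x] by linarith
  qed
  have gm: "g \<in> borel_measurable borel"
    by (rule borel_measurable_continuous_onI[OF lipschitz_coordinates_continuous[OF lip]])
  obtain K' where K': "\<And>x. \<bar>p x\<bar> \<le> K'" using trig_continuous_bounded[OF p(1)] by blast
  have pm: "p \<in> borel_measurable borel"
    using trig_continuous_bounded[OF p(1)] by (intro borel_measurable_continuous_onI) auto
  have VV: "e / 6 + L * (\<Sum>j<d. v j / l) \<le> e / 3"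
  proof -
    have "L * (\<Sum>j<d. v j / l) = V / l" by (simp add: V_def flip: sum_divide_distrib)
    then show ?thesis using Vl by linarith
  qed
  have closeW: "\<bar>(\<integral>\<omega>. g (W N \<omega>) \<partial>M) - (\<integral>\<omega>. p (W N \<omega>) \<partial>M)\<bar> \<le> e / 3" for N
    by (rule order_trans[OF expectation_close[OF M Wm W2 gm pm bdd K' gp L l] VV])
  have closeG: "\<bar>(\<integral>\<omega>. g (G \<omega>) \<partial>P) - (\<integral>\<omega>. p (G \<omega>) \<partial>P)\<bar> \<le> e / 3"
    by (rule order_trans[OF expectation_close[OF P Gm G2 gm pm bdd K' gp L l] VV])
  have "(\<lambda>N. \<integral>\<omega>. p (W N \<omega>) \<partial>M) \<longlonglongrightarrow> (\<integral>\<omega>. p (G \<omega>) \<partial>P)"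
    by (rule trig_convergence[OF M P Wm Gm char p(1)])
  then have "eventually (\<lambda>N. dist (\<integral>\<omega>. p (W N \<omega>) \<partial>M) (\<integral>\<omega>. p (G \<omega>) \<partial>P) < e / 3) sequentially"
    using e by (intro tendstoD) auto
  then show "eventually (\<lambda>N. dist (\<integral>\<omega>. g (W N \<omega>) \<partial>M) (\<integral>\<omega>. g (G \<omega>) \<partial>P) < e) sequentially"
  proof eventually_elim
    case (elim N)
    show ?case unfolding dist_real_def
      by (rule abs_triangle_three[OF elim[unfolded dist_real_def] closeW closeG])
  qed
qed

section \<open>The delta method for the separability defect\<close>

subsection \<open>Linearisation of the product of partial traces\<close>

text \<open>The exact remainder of the linearisation, with i = 1 / \<epsilon>, \<tau> the inverse
  perturbed trace and \<kappa> the inverse trace of C. Collecting the coefficients of C, V, B and D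
  leaves scalar identities. The right side has an explicit factor \<epsilon> and is quadratic in the
  perturbation.\<close>

lemma expansion_algebra:
  fixes C V B D :: "'v::real_vector"
  assumes i: "i * \<epsilon> = 1" and \<tau>: "\<tau> * (c + \<epsilon> * v) = 1" and \<kappa>: "\<kappa> * c = 1"
  shows "i *\<^sub>R (C + \<epsilon> *\<^sub>R V - \<tau> *\<^sub>R (c *\<^sub>R C + \<epsilon> *\<^sub>R B + (\<epsilon> * \<epsilon>) *\<^sub>R D)) - (V + \<kappa> *\<^sub>R (v *\<^sub>R C - B)) =
    (\<epsilon> * \<tau>) *\<^sub>R (v *\<^sub>R V - D - v *\<^sub>R (V + \<kappa> *\<^sub>R (v *\<^sub>R C - B)))" (is "?l = ?r")
proof -
  have "?l - ?r = (i - i * \<tau> * c - \<kappa> * v + \<epsilon> * \<tau> * v * \<kappa> * v) *\<^sub>R C + (i * \<epsilon> - 1) *\<^sub>R V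
     + (\<kappa> - i * \<tau> * \<epsilon> - \<epsilon> * \<tau> * v * \<kappa>) *\<^sub>R B + (\<epsilon> * \<tau> - i * \<tau> * \<epsilon> * \<epsilon>) *\<^sub>R D"
    by (simp add: algebra_simps)
  moreover have "i - i * \<tau> * c - \<kappa> * v + \<epsilon> * \<tau> * v * \<kappa> * v = 0" using i \<tau> \<kappa> by algebra
  moreover have "\<kappa> - i * \<tau> * \<epsilon> - \<epsilon> * \<tau> * v * \<kappa> = 0" using i \<tau> \<kappa> by algebra
  moreover have "\<epsilon> * \<tau> - i * \<tau> * \<epsilon> * \<epsilon> = 0" using i by algebra
  ultimately have "?l - ?r = 0" using i by simp
  then show ?thesis by simp
qed

context
  fixes tens :: "'a::{real_inner,banach,second_countable_topology} \<Rightarrow>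
                 'b::{real_inner,banach,second_countable_topology} \<Rightarrow>
                 'h::{real_inner,banach,second_countable_topology}"
    and C :: "'h \<Rightarrow>\<^sub>L 'h"
  assumes tens: "is_htensor tens" and C: "trace_class C"
begin

text \<open>The derivative at C of the map sending T to T minus the normalised product of its partial
  traces, at those C that coincide with their normalised product.\<close>

definition theta :: "('h \<Rightarrow>\<^sub>L 'h) \<Rightarrow> ('h \<Rightarrow>\<^sub>L 'h)" where
  "theta V = V + (1 / trace C) *\<^sub>R (trace V *\<^sub>R C -
     (optens tens (ptr2 tens V) (ptr1 tens C) + optens tens (ptr2 tens C) (ptr1 tens V)))"

lemma ptr_trace_class:
  "trace_class V \<Longrightarrow> trace_class (ptr1 tens V)" "trace_class V \<Longrightarrow> trace_class (ptr2 tens V)"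
  unfolding trace_class_iff_nuc using ptr1_nuc[OF tens] ptr2_nuc[OF tens] by blast+

lemma theta_nuc: "\<exists>K\<ge>0. \<forall>V s. nuc V s \<longrightarrow> nuc (theta V) (K * s)"
proof -
  obtain k where k: "nuc C k" using C unfolding trace_class_iff_nuc by blast
  have "nuc (theta V) ((1 + \<bar>1 / trace C\<bar> * (3 * k)) * s)" if V: "nuc V s" for V s
  proof -
    have 1: "nuc (trace V *\<^sub>R C) (s * k)"
      by (rule nuc_mono[OF nuc_scaleR[OF k]]) (intro mult_right_mono trace_bound[OF V] nuc_nonneg[OF k])
    have 2: "nuc (optens tens (ptr2 tens V) (ptr1 tens C) + optens tens (ptr2 tens C) (ptr1 tens V)) (s * k + k * s)"
      by (intro nuc_add optens_nuc[OF tens] ptr1_nuc[OF tens] ptr2_nuc[OF tens] V k)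
    have "nuc (theta V) (s + \<bar>1 / trace C\<bar> * (s * k + (s * k + k * s)))"
      unfolding theta_def by (intro nuc_add V nuc_scaleR nuc_diff 1 2)
    moreover have "s + \<bar>1 / trace C\<bar> * (s * k + (s * k + k * s)) = (1 + \<bar>1 / trace C\<bar> * (3 * k)) * s"
      by (simp add: algebra_simps)
    ultimately show ?thesis by simp
  qed
  moreover have "0 \<le> 1 + \<bar>1 / trace C\<bar> * (3 * k)" using nuc_nonneg[OF k] by simp
  ultimately show ?thesis by blast
qed

lemma theta_trace_class: "trace_class V \<Longrightarrow> trace_class (theta V)"
  unfolding trace_class_iff_nuc using theta_nuc by blast

lemma theta_add: "trace_class S \<Longrightarrow> trace_class T \<Longrightarrow> theta (S + T) = theta S + theta T"
  unfolding theta_def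
  by (simp add: trace_add ptr1_add[OF tens] ptr2_add[OF tens] optens_add_left[OF tens] optens_add_right[OF tens]
      ptr_trace_class C algebra_simps)

lemma theta_scaleR: "trace_class T \<Longrightarrow> theta (r *\<^sub>R T) = r *\<^sub>R theta T"
  unfolding theta_def
  by (simp add: trace_scaleR ptr1_scaleR[OF tens] ptr2_scaleR[OF tens] optens_scaleR_left[OF tens] optens_scaleR_right[OF tens]
      ptr_trace_class C algebra_simps)

lemma theta_diff:
  assumes "trace_class S" "trace_class T" shows "theta (S - T) = theta S - theta T"
  using theta_add[OF assms(1) trace_class_scaleR[OF assms(2), of "-1"]] theta_scaleR[OF assms(2), of "-1"]
  by simp

text \<open>The size condition on \<epsilon> n keeps the trace of T at least half that of C in
  absolute value, since the trace of V is at most n; this yields the factor 2 over the trace. The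
  hypothesis \<open>prod\<close> makes the zeroth order term of the expansion cancel.\<close>

lemma theta_expansion:
  assumes prod: "optens tens (ptr2 tens C) (ptr1 tens C) = trace C *\<^sub>R C" and c: "trace C \<noteq> 0"
    and V: "nuc V n" and e: "\<epsilon> > 0" "\<epsilon> * n \<le> \<bar>trace C\<bar> / 2"
    and K: "K \<ge> 0" "\<And>V s. nuc V s \<Longrightarrow> nuc (theta V) (K * s)"
    and T: "T = C + \<epsilon> *\<^sub>R V"
  shows "nuc ((1 / \<epsilon>) *\<^sub>R (T - (1 / trace T) *\<^sub>R optens tens (ptr2 tens T) (ptr1 tens T)) - theta V)
    (\<epsilon> * (2 / \<bar>trace C\<bar> * (2 + K)) * n\<^sup>2)"
proof -
  define v where "v = trace V"
  define B where "B = optens tens (ptr2 tens V) (ptr1 tens C) + optens tens (ptr2 tens C) (ptr1 tens V)"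
  define D where "D = optens tens (ptr2 tens V) (ptr1 tens V)"
  have tV: "trace_class V" using V nuc_trace_class by blast
  note tc = tV C ptr_trace_class[OF tV] ptr_trace_class[OF C] trace_class_scaleR
  have n0: "n \<ge> 0" by (rule nuc_nonneg[OF V])
  have v: "\<bar>v\<bar> \<le> n" unfolding v_def by (rule trace_bound[OF V])
  have tT: "trace T = trace C + \<epsilon> * v" by (simp add: T v_def trace_add trace_scaleR tc)
  have "\<bar>\<epsilon> * v\<bar> \<le> \<epsilon> * n" using e(1) v by (simp add: abs_mult)
  then have big: "\<bar>trace T\<bar> \<ge> \<bar>trace C\<bar> / 2" using e(2) unfolding tT by linarith
  then have tT0: "trace T \<noteq> 0" using c by auto
  have "optens tens (ptr2 tens T) (ptr1 tens T) = trace C *\<^sub>R C + \<epsilon> *\<^sub>R B + (\<epsilon> * \<epsilon>) *\<^sub>R D"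
    unfolding T B_def D_def
    by (simp add: ptr1_add[OF tens] ptr2_add[OF tens] ptr1_scaleR[OF tens] ptr2_scaleR[OF tens]
      optens_add_left[OF tens] optens_add_right[OF tens] optens_scaleR_left[OF tens] optens_scaleR_right[OF tens]
      tc trace_class_add prod algebra_simps)
  then have eq: "(1 / \<epsilon>) *\<^sub>R (T - (1 / trace T) *\<^sub>R optens tens (ptr2 tens T) (ptr1 tens T)) - theta V =
    (\<epsilon> * (1 / trace T)) *\<^sub>R (v *\<^sub>R V - D - v *\<^sub>R theta V)"
    unfolding theta_def B_def[symmetric] v_def[symmetric] T[symmetric]
    using expansion_algebra[of "1 / \<epsilon>" \<epsilon> "1 / trace T" "trace C" v "1 / trace C" C V B D] e(1) c tT0
    by (simp add: T[symmetric] tT[symmetric])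
  have "nuc (v *\<^sub>R V - D - v *\<^sub>R theta V) ((\<bar>v\<bar> * n + n * n) + \<bar>v\<bar> * (K * n))"
    unfolding D_def
    by (intro nuc_diff nuc_scaleR V K(2) optens_nuc[OF tens] ptr1_nuc[OF tens] ptr2_nuc[OF tens])
  moreover have "(\<bar>v\<bar> * n + n * n) + \<bar>v\<bar> * (K * n) \<le> (2 + K) * n\<^sup>2"
  proof -
    have "\<bar>v\<bar> * n \<le> n * n" "\<bar>v\<bar> * (K * n) \<le> n * (K * n)" using v n0 K(1) by (auto intro!: mult_right_mono)
    then show ?thesis by (simp add: power2_eq_square algebra_simps)
  qed
  ultimately have "nuc (v *\<^sub>R V - D - v *\<^sub>R theta V) ((2 + K) * n\<^sup>2)" by (rule nuc_mono)
  then have "nuc ((\<epsilon> * (1 / trace T)) *\<^sub>R (v *\<^sub>R V - D - v *\<^sub>R theta V)) (\<bar>\<epsilon> * (1 / trace T)\<bar> * ((2 + K) * n\<^sup>2))"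
    by (rule nuc_scaleR)
  moreover have "\<bar>\<epsilon> * (1 / trace T)\<bar> * ((2 + K) * n\<^sup>2) \<le> \<epsilon> * (2 / \<bar>trace C\<bar> * (2 + K)) * n\<^sup>2"
  proof -
    have "\<bar>1 / trace T\<bar> \<le> 2 / \<bar>trace C\<bar>" using big c tT0 by (simp add: field_simps)
    then have "\<bar>\<epsilon> * (1 / trace T)\<bar> \<le> \<epsilon> * (2 / \<bar>trace C\<bar>)" using e(1) unfolding abs_mult by (intro mult_mono) auto
    then have "\<bar>\<epsilon> * (1 / trace T)\<bar> * ((2 + K) * n\<^sup>2) \<le> \<epsilon> * (2 / \<bar>trace C\<bar>) * ((2 + K) * n\<^sup>2)"
      using K(1) by (intro mult_right_mono) auto
    then show ?thesis by (simp only: mult.assoc)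
  qed
  ultimately show ?thesis unfolding eq by (rule nuc_mono)
qed

text \<open>The remainder is quadratic in the size n of V but f is bounded; the geometric mean of the two bounds
  is linear in n, so that only first moments are needed later.\<close>

lemma lipschitz_expansion:
  assumes prod: "optens tens (ptr2 tens C) (ptr1 tens C) = trace C *\<^sub>R C" and c: "trace C \<noteq> 0"
    and f: "nu_lipschitz f L" "\<And>T. trace_class T \<Longrightarrow> \<bar>f T\<bar> \<le> K"
  shows "\<exists>a b. 0 \<le> a \<and> 0 \<le> b \<and> (\<forall>V n \<epsilon>. nuc V n \<longrightarrow> \<epsilon> > 0 \<longrightarrow>
    \<bar>f ((1 / \<epsilon>) *\<^sub>R ((C + \<epsilon> *\<^sub>R V) - (1 / trace (C + \<epsilon> *\<^sub>R V)) *\<^sub>R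
      optens tens (ptr2 tens (C + \<epsilon> *\<^sub>R V)) (ptr1 tens (C + \<epsilon> *\<^sub>R V)))) - f (theta V)\<bar> \<le> (a * sqrt \<epsilon> + b * \<epsilon>) * n)"
proof -
  obtain K' where K': "K' \<ge> 0" "\<And>V s. nuc V s \<Longrightarrow> nuc (theta V) (K' * s)" using theta_nuc by blast
  define A where "A = L * (2 / \<bar>trace C\<bar> * (2 + K'))"
  have L: "L \<ge> 0" using f(1) by (simp add: nu_lipschitz_def)
  have K0: "K \<ge> 0" using f(2)[OF C] by linarith
  have A0: "A \<ge> 0" unfolding A_def using L K'(1) by simp
  \<comment> \<open>If \<epsilon> n is small, the product of the bounds 2 K and A \<epsilon> n^2 is
    the square of a sqrt \<epsilon> n. Otherwise 2 \<epsilon> n exceeds the absolute trace of C, and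
    the trivial bound 2 K is at most b \<epsilon> n.\<close>
  define a where "a = sqrt (2 * K * A)"
  define b where "b = 4 * K / \<bar>trace C\<bar>"
  have a0: "a \<ge> 0" and b0: "b \<ge> 0" using K0 A0 by (simp_all add: a_def b_def)
  have "\<bar>f Y - f (theta V)\<bar> \<le> (a * sqrt \<epsilon> + b * \<epsilon>) * n"
    if V: "nuc V n" and e: "\<epsilon> > 0" and T: "T = C + \<epsilon> *\<^sub>R V"
      and Y: "Y = (1 / \<epsilon>) *\<^sub>R (T - (1 / trace T) *\<^sub>R optens tens (ptr2 tens T) (ptr1 tens T))" for V n \<epsilon> T Y
  proof -
    have n0: "n \<ge> 0" by (rule nuc_nonneg[OF V])
    have tV: "trace_class V" using V nuc_trace_class by blast
    have tT: "trace_class T" unfolding T by (intro trace_class_add trace_class_scaleR C tV)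
    have tY: "trace_class Y" unfolding Y
      by (intro trace_class_scaleR trace_class_diff tT trace_class_optens[OF tens] ptr_trace_class)
    have bd: "\<bar>f Y - f (theta V)\<bar> \<le> 2 * K" using f(2)[OF tY] f(2)[OF theta_trace_class[OF tV]] by linarith
    show ?thesis
    proof (cases "\<epsilon> * n \<le> \<bar>trace C\<bar> / 2")
      case True
      have "nuc (Y - theta V) (\<epsilon> * (2 / \<bar>trace C\<bar> * (2 + K')) * n\<^sup>2)"
        unfolding Y by (rule theta_expansion[OF prod c V e True K' T])
      then have "nu (Y - theta V) \<le> \<epsilon> * (2 / \<bar>trace C\<bar> * (2 + K')) * n\<^sup>2" by (rule nu_le)
      then have "L * nu (Y - theta V) \<le> L * (\<epsilon> * (2 / \<bar>trace C\<bar> * (2 + K')) * n\<^sup>2)" using L by (rule mult_left_mono)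
      moreover have "\<bar>f Y - f (theta V)\<bar> \<le> L * nu (Y - theta V)"
        using f(1) tY theta_trace_class[OF tV] by (simp add: nu_lipschitz_def)
      ultimately have 1: "\<bar>f Y - f (theta V)\<bar> \<le> A * \<epsilon> * n\<^sup>2" by (simp add: A_def mult_ac)
      have "\<bar>f Y - f (theta V)\<bar>\<^sup>2 \<le> (2 * K) * (A * \<epsilon> * n\<^sup>2)"
        unfolding power2_eq_square[of "\<bar>_\<bar>"] by (rule mult_mono[OF bd 1]) (use K0 in auto)
      also have "\<dots> = (a * sqrt \<epsilon> * n)\<^sup>2" using K0 A0 e by (simp add: a_def power_mult_distrib mult_ac)
      finally have "\<bar>f Y - f (theta V)\<bar> \<le> a * sqrt \<epsilon> * n"
        by (rule power2_le_imp_le) (use a0 n0 e in simp)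
      also have "\<dots> \<le> (a * sqrt \<epsilon> + b * \<epsilon>) * n" using b0 n0 e by (intro mult_right_mono) auto
      finally show ?thesis .
    next
      case False
      have "2 * K = 2 * K * 1" by simp
      also have "\<dots> \<le> 2 * K * (\<epsilon> * n * 2 / \<bar>trace C\<bar>)" using False c K0 by (intro mult_left_mono) (auto simp: field_simps)
      also have "\<dots> = b * \<epsilon> * n" by (simp add: b_def)
      also have "\<dots> \<le> (a * sqrt \<epsilon> + b * \<epsilon>) * n" using a0 n0 e by (intro mult_right_mono) auto
      finally show ?thesis using bd by linarith
    qed
  qed
  then show ?thesis using a0 b0 by blast
qed

end

text \<open>The partial traces of C are multiples of C2 and C1 by the trace of the other factor, and
  these scalars multiply to the trace of C. The null hypothesis enters the limit theorem through
  this identity and through the trace class property of C.\<close>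

lemma optens_product_partial_traces:
  fixes tens :: "'a::{real_inner,banach,second_countable_topology} \<Rightarrow>
                 'b::{real_inner,banach,second_countable_topology} \<Rightarrow>
                 'h::{real_inner,banach,second_countable_topology}"
  assumes tens: "is_htensor tens" and C1: "trace_class C1" and C2: "trace_class C2" and C: "C = optens tens C1 C2"
  shows "optens tens (ptr2 tens C) (ptr1 tens C) = trace C *\<^sub>R C"
  unfolding C ptr1_optens[OF tens C1 C2] ptr2_optens[OF tens C1 C2] trace_optens[OF tens C1 C2]
  by (simp add: optens_scaleR_left[OF tens] optens_scaleR_right[OF tens] C1 C2 trace_class_scaleR mult.commute)

section \<open>Matrix coordinates and Gaussian marginals\<close>

subsection \<open>Operators with an absolutely summable matrix\<close>

lemma onb_eqI:
  assumes B: "onb B" and eq: "\<And>e. e \<in> B \<Longrightarrow> inner x e = inner y e" shows "x = y"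
proof -
  have "((\<lambda>e. inner x e *\<^sub>R e) has_sum y) B"
    using onb_expand[OF B, of y] by (rule has_sum_cong[THEN iffD1, rotated]) (simp add: eq)
  then show ?thesis using onb_expand[OF B, of x] has_sum_unique by blast
qed

lemma blinfun_onb_eqI:
  fixes T D :: "'h::real_inner \<Rightarrow>\<^sub>L 'k::real_normed_vector"
  assumes B: "onb B" and eq: "\<And>e. e \<in> B \<Longrightarrow> T e = D e" shows "T = D"
proof (rule blinfun_eqI)
  fix x
  have "((\<lambda>e. T (inner x e *\<^sub>R e)) has_sum T x) B"
    by (rule has_sum_bounded_linear[OF blinfun.bounded_linear_right onb_expand[OF B]])
  then have "((\<lambda>e. D (inner x e *\<^sub>R e)) has_sum T x) B"
    by (rule has_sum_cong[THEN iffD1, rotated]) (simp add: eq blinfun.scaleR_right)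
  moreover have "((\<lambda>e. D (inner x e *\<^sub>R e)) has_sum D x) B"
    by (rule has_sum_bounded_linear[OF blinfun.bounded_linear_right onb_expand[OF B]])
  ultimately show "T x = D x" using has_sum_unique by blast
qed

context
  fixes B :: "'h::{real_inner,banach,second_countable_topology} set" and e :: "nat \<Rightarrow> 'h"
  assumes B: "onb B" and e: "\<And>n. e n = 0 \<or> e n \<in> B" "bij_betw e {n. e n \<noteq> 0} B"
begin

text \<open>A single index runs over all matrix positions through \<open>prod_decode\<close>.
  Positions outside the basis enumeration give zero vectors.\<close>

definition row :: "nat \<Rightarrow> 'h" where "row j = e (fst (prod_decode j))"
definition col :: "nat \<Rightarrow> 'h" where "col j = e (snd (prod_decode j))"

lemma enum_norm_le: "norm (e n) \<le> 1"
  using e(1)[of n] B by (auto simp: onb_def)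

lemma row_norm: "norm (row j) \<le> 1" and col_norm: "norm (col j) \<le> 1"
  by (simp_all add: row_def col_def enum_norm_le)

lemma row_col_norm: "norm (z *\<^sub>R row j) * norm (col j) \<le> \<bar>z\<bar>"
proof -
  have "norm (row j) * norm (col j) \<le> 1 * 1" by (intro mult_mono row_norm col_norm) auto
  then have "\<bar>z\<bar> * (norm (row j) * norm (col j)) \<le> \<bar>z\<bar> * 1" by (intro mult_left_mono) auto
  then show ?thesis by (simp add: mult.assoc)
qed

lemma row_col_summable:
  "(\<lambda>j. \<bar>z j\<bar>) summable_on UNIV \<Longrightarrow> (\<lambda>j. norm (z j *\<^sub>R row j) * norm (col j)) summable_on UNIV"
  by (rule summable_on_comparison_test) (use row_col_norm in auto)

text \<open>Summable entries define a nuclear operator T with the same matrix, and an operator is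
  determined by its matrix, so T = D. In this way a bounded D acquires a nuclear representation from
  its entries alone.\<close>

lemma matrix_expand:
  assumes z: "(\<lambda>j. \<bar>z j\<bar>) summable_on UNIV" and D: "\<And>j. inner (blinfun_apply D (col j)) (row j) = z j"
  shows "((\<lambda>j. inner h (col j) *\<^sub>R (z j *\<^sub>R row j)) has_sum blinfun_apply D h) UNIV"
proof -
  note ei = onb_enum_inner[OF B e]
  obtain T where T: "\<And>h. ((\<lambda>j. inner h (col j) *\<^sub>R (z j *\<^sub>R row j)) has_sum blinfun_apply T h) UNIV"
    using nuc_exists[OF _ row_col_summable[OF z]] by auto
  have TD: "inner (T (col k)) (row k) = inner (D (col k)) (row k)" for k
  proof (cases "row k = 0 \<or> col k = 0")
    case True then show ?thesis by (auto simp: blinfun.zero_right)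
  next
    case False
    have h: "((\<lambda>j. inner (inner (col k) (col j) *\<^sub>R (z j *\<^sub>R row j)) (row k)) has_sum inner (T (col k)) (row k)) UNIV"
      by (rule has_sum_bounded_linear[OF bounded_linear_inner_left T])
    have "inner (inner (col k) (col j) *\<^sub>R (z j *\<^sub>R row j)) (row k) = (if j = k then z k else 0)" for j
    proof (cases "j = k")
      case True
      then show ?thesis using False by (simp add: row_def col_def ei)
    next
      case ne: False
      then have "prod_decode j \<noteq> prod_decode k" by (metis prod_decode_inverse)
      then show ?thesis using ne by (auto simp: row_def col_def ei prod_eq_iff)
    qed
    then have "((\<lambda>j. if j = k then z k else 0) has_sum inner (T (col k)) (row k)) UNIV" using h by simp
    moreover have "((\<lambda>j. if j = k then z k else 0) has_sum z k) UNIV"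
      by (rule has_sum_finite_neutralI[where B = "{k}"]) auto
    ultimately show ?thesis using D has_sum_unique by metis
  qed
  have "T = D"
  proof (rule blinfun_onb_eqI[OF B], rule onb_eqI[OF B])
    fix b a assume "b \<in> B" "a \<in> B"
    then obtain m n where "b = e m" "a = e n" using e(2) by (auto simp: bij_betw_def)
    then have "b = col (prod_encode (n, m))" "a = row (prod_encode (n, m))" by (simp_all add: row_def col_def)
    then show "inner (T b) a = inner (D b) a" using TD by simp
  qed
  then show ?thesis using T by simp
qed

definition unit_op :: "nat \<Rightarrow> ('h \<Rightarrow>\<^sub>L 'h)" where "unit_op j = outer (row j) (col j)"

lemma unit_op_nuc: "nuc (unit_op j) 1"
  unfolding unit_op_def
  by (rule nuc_mono[OF nuc_outer]) (use mult_mono[OF row_norm col_norm, of j j] in simp)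

lemma unit_op_trace_class: "trace_class (unit_op j)"
  using unit_op_nuc nuc_trace_class by blast

text \<open>Row and column vectors have norm at most 1, so the omitted entries bound the nuclear
  weight of the remainder.\<close>

lemma matrix_partial_sum_nuc:
  assumes z: "summable (\<lambda>j. \<bar>z j\<bar>)"
    and D: "\<And>h. ((\<lambda>j. inner h (col j) *\<^sub>R (z j *\<^sub>R row j)) has_sum blinfun_apply D h) UNIV"
  shows "nuc (D - (\<Sum>j<d. z j *\<^sub>R unit_op j)) (\<Sum>j. \<bar>z (j + d)\<bar>)"
proof -
  have zd: "summable (\<lambda>j. \<bar>z (j + d)\<bar>)" using summable_ignore_initial_segment[OF z] .
  have hz: "((\<lambda>j. \<bar>z (j + d)\<bar>) has_sum (\<Sum>j. \<bar>z (j + d)\<bar>)) UNIV"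
    by (rule sums_nonneg_imp_has_sum) (use zd in \<open>auto simp: summable_sums\<close>)
  then have sz: "(\<lambda>j. \<bar>z (j + d)\<bar>) summable_on UNIV" by (auto simp: has_sum_iff)
  have sm: "(\<lambda>j. norm (z (j + d) *\<^sub>R row (j + d)) * norm (col (j + d))) summable_on UNIV"
    by (rule summable_on_comparison_test[OF sz]) (use row_col_norm in auto)
  show ?thesis
  proof (rule nucI[where x = "\<lambda>j. z (j + d) *\<^sub>R row (j + d)" and y = "\<lambda>j. col (j + d)", OF _ sm])
    show "(\<Sum>\<^sub>\<infinity>j. norm (z (j + d) *\<^sub>R row (j + d)) * norm (col (j + d))) \<le> (\<Sum>j. \<bar>z (j + d)\<bar>)"
      using infsum_mono[OF sm sz row_col_norm] hz by (simp add: has_sum_iff)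
    fix h
    have ap: "blinfun_apply (\<Sum>j<d. z j *\<^sub>R unit_op j) h = (\<Sum>j<d. inner h (col j) *\<^sub>R (z j *\<^sub>R row j))"
      by (induction d) (auto simp: blinfun.add_left blinfun.scaleR_left unit_op_def mult.commute)
    have "((\<lambda>j. inner h (col j) *\<^sub>R (z j *\<^sub>R row j)) has_sum
        D h - (\<Sum>j<d. inner h (col j) *\<^sub>R (z j *\<^sub>R row j))) (UNIV - {..<d})"
      by (rule has_sum_Diff[OF D]) auto
    moreover have "bij_betw (\<lambda>j. j + d) UNIV (UNIV - {..<d})"
      by (rule bij_betwI[where g = "\<lambda>j. j - d"]) auto
    ultimately show "((\<lambda>j. inner h (col (j + d)) *\<^sub>R (z (j + d) *\<^sub>R row (j + d))) has_sum
        blinfun_apply (D - (\<Sum>j<d. z j *\<^sub>R unit_op j)) h) UNIV"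
      using has_sum_reindex_bij_betw[of "\<lambda>j. j + d" UNIV "UNIV - {..<d}"
        "\<lambda>j. inner h (col j) *\<^sub>R (z j *\<^sub>R row j)"] by (simp add: blinfun.diff_left ap)
  qed simp
qed

text \<open>Stated in the extended reals, the bound also holds where the matrix is not summable, since the right
  side is then infinite.\<close>

lemma matrix_partial_sum_lipschitz:
  assumes f: "nu_lipschitz f L" and tD: "trace_class D"
    and D: "\<And>h. summable (\<lambda>j. \<bar>z j\<bar>) \<Longrightarrow> ((\<lambda>j. inner h (col j) *\<^sub>R (z j *\<^sub>R row j)) has_sum blinfun_apply D h) UNIV"
  shows "ennreal \<bar>f D - f (\<Sum>j<d. z j *\<^sub>R unit_op j)\<bar> \<le> ennreal (L + 1) * (\<Sum>j. ennreal \<bar>z (j + d)\<bar>)"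
proof (cases "(\<Sum>j. ennreal \<bar>z (j + d)\<bar>) = top")
  case True
  have "L \<ge> 0" using f by (simp add: nu_lipschitz_def)
  then have "ennreal (L + 1) * (\<Sum>j. ennreal \<bar>z (j + d)\<bar>) = top" unfolding True by (simp add: ennreal_mult_top)
  then show ?thesis by simp
next
  case False
  have zd: "summable (\<lambda>j. \<bar>z (j + d)\<bar>)" by (rule summable_suminf_not_top) (use False in auto)
  then have z: "summable (\<lambda>j. \<bar>z j\<bar>)" using summable_iff_shift[of "\<lambda>j. \<bar>z j\<bar>" d] by simp
  define s where "s = (\<Sum>j. \<bar>z (j + d)\<bar>)"
  have s0: "s \<ge> 0" unfolding s_def by (rule suminf_nonneg[OF zd]) simp
  have eq: "(\<Sum>j. ennreal \<bar>z (j + d)\<bar>) = ennreal s" unfolding s_def by (rule suminf_ennreal2[OF _ zd]) simp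
  have L: "L \<ge> 0" using f by (simp add: nu_lipschitz_def)
  have tS: "trace_class (\<Sum>j<d. z j *\<^sub>R unit_op j)"
    by (intro trace_class_sum trace_class_scaleR unit_op_trace_class)
  have "nu (D - (\<Sum>j<d. z j *\<^sub>R unit_op j)) \<le> s" unfolding s_def by (intro nu_le matrix_partial_sum_nuc z D)
  then have "L * nu (D - (\<Sum>j<d. z j *\<^sub>R unit_op j)) \<le> L * s" using L by (rule mult_left_mono)
  moreover have "\<bar>f D - f (\<Sum>j<d. z j *\<^sub>R unit_op j)\<bar> \<le> L * nu (D - (\<Sum>j<d. z j *\<^sub>R unit_op j))"
    using f tD tS unfolding nu_lipschitz_def by blast
  ultimately have "\<bar>f D - f (\<Sum>j<d. z j *\<^sub>R unit_op j)\<bar> \<le> (L + 1) * s" using s0 by (simp add: algebra_simps)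
  then have "ennreal \<bar>f D - f (\<Sum>j<d. z j *\<^sub>R unit_op j)\<bar> \<le> ennreal ((L + 1) * s)" by (rule ennreal_leI)
  also have "\<dots> = ennreal (L + 1) * ennreal s" using L s0 by (intro ennreal_mult) auto
  finally show ?thesis unfolding eq .
qed

end

subsection \<open>Recognising Gaussian laws\<close>

text \<open>The phases 0 and - pi / 2 recover the real and imaginary parts of the characteristic
  function, and Levy's uniqueness theorem identifies the law. Variance 0 is the point mass required
  by \<open>centered_gaussian_law\<close>.\<close>

lemma gaussian_law:
  fixes \<psi> :: "'p \<Rightarrow> real"
  assumes P: "prob_space P" and \<psi> [measurable]: "\<psi> \<in> borel_measurable P" and s: "s \<ge> 0"
    and cosm: "\<And>b t. (\<integral>\<omega>. cos (b + t * \<psi> \<omega>) \<partial>P) = cos b * exp (- (t\<^sup>2 * s) / 2)"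
  shows "\<exists>\<sigma>\<ge>0. distr P borel \<psi> = (if \<sigma> = 0 then return borel 0 else density lborel (normal_density 0 \<sigma>))"
proof -
  interpret P: prob_space P by (rule P)
  define \<sigma> where "\<sigma> = sqrt s"
  have \<sigma>: "\<sigma> \<ge> 0" "\<sigma>\<^sup>2 = s" using s by (auto simp: \<sigma>_def)
  have c: "char (distr P borel \<psi>) t = complex_of_real (exp (- (t\<^sup>2 * s) / 2))" for t
  proof -
    have c1: "char (distr P borel (\<lambda>\<omega>. t * \<psi> \<omega>)) 1 = char (distr P borel \<psi>) t"
      unfolding char_def by (simp add: integral_distr)
    have "Re (char (distr P borel \<psi>) t) = exp (- (t\<^sup>2 * s) / 2)"
      using integral_cos_shift[OF P, of "\<lambda>\<omega>. t * \<psi> \<omega>" 0] cosm[of 0 t] by (simp add: c1)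
    moreover have "Im (char (distr P borel \<psi>) t) = 0"
    proof -
      have "iexp (- (pi / 2)) = - \<i>" by (simp add: complex_eq_iff Re_exp Im_exp)
      then show ?thesis
        using integral_cos_shift[OF P, of "\<lambda>\<omega>. t * \<psi> \<omega>" "- (pi / 2)"] cosm[of "- (pi / 2)" t]
        by (simp add: c1)
    qed
    ultimately show ?thesis by (simp add: complex_eq_iff)
  qed
  have rd: "real_distribution (distr P borel \<psi>)" by (rule P.real_distribution_distr) simp
  show ?thesis
  proof (cases "\<sigma> = 0")
    case True
    have "distr P borel \<psi> = return borel 0"
    proof (rule Levy_uniqueness[OF rd])
      show "real_distribution (return borel 0)"
        by (auto simp: real_distribution_def real_distribution_axioms_def prob_space_return)
      show "char (distr P borel \<psi>) = char (return borel 0)"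
      proof
        fix t
        have "char (return borel 0) t = 1" unfolding char_def by (subst integral_return) auto
        then show "char (distr P borel \<psi>) t = char (return borel 0) t" using True \<sigma>(2) by (simp add: c)
      qed
    qed
    then show ?thesis using True by (intro exI[of _ 0]) simp
  next
    case False
    then have \<sigma>0: "\<sigma> > 0" using \<sigma>(1) by simp
    interpret N: prob_space std_normal_distribution by (rule std_normal_prob)
    \<comment> \<open>The normal density of scale \<sigma> is written as the image of the standard
      one under scaling, whose characteristic function is known.\<close>
    have "distributed std_normal_distribution lborel (\<lambda>x. x) (normal_density 0 1)"
      unfolding distributed_def by (auto simp: distr_id2)
    then have "distributed std_normal_distribution lborel (\<lambda>x. 0 + \<sigma> * x) (normal_density (0 + \<sigma> * 0) (\<bar>\<sigma>\<bar> * 1))"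
      by (rule N.normal_density_affine) (use False in auto)
    then have "distr std_normal_distribution lborel (\<lambda>x. \<sigma> * x) = density lborel (normal_density 0 \<sigma>)"
      using \<sigma>0 by (simp add: distributed_distr_eq_density)
    moreover have "distr std_normal_distribution lborel (\<lambda>x. \<sigma> * x) = distr std_normal_distribution borel (\<lambda>x. \<sigma> * x)"
      by (rule distr_cong) auto
    ultimately have dn: "density lborel (normal_density 0 \<sigma>) = distr std_normal_distribution borel (\<lambda>x. \<sigma> * x)" by simp
    have "distr P borel \<psi> = density lborel (normal_density 0 \<sigma>)"
    proof (rule Levy_uniqueness[OF rd])
      show "real_distribution (density lborel (normal_density 0 \<sigma>))"
        unfolding dn by (rule N.real_distribution_distr) simp
      show "char (distr P borel \<psi>) = char (density lborel (normal_density 0 \<sigma>))"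
      proof
        fix t
        have "char (distr std_normal_distribution borel (\<lambda>x. \<sigma> * x)) t = char std_normal_distribution (t * \<sigma>)"
          unfolding char_def by (subst integral_distr) (auto simp: mult_ac)
        then show "char (distr P borel \<psi>) t = char (density lborel (normal_density 0 \<sigma>)) t"
          unfolding dn by (simp add: c char_std_normal_distribution power_mult_distrib \<sigma>)
      qed
    qed
    then show ?thesis using False \<sigma>(1) by (intro exI[of _ \<sigma>]) simp
  qed
qed

section \<open>The empirical covariance operator and its limit\<close>

subsection \<open>Moments of the coordinates\<close>

lemma powr_quarter: 
  fixes a :: real
  assumes "a \<ge> 0" shows "(a powr (1/4)) ^ 4 = a" "(a powr (1/4))\<^sup>2 = sqrt a"
proof -
  show 1: "(a powr (1/4)) ^ 4 = a"
    using assms by (cases "a = 0") (auto simp: powr_powr simp flip: powr_realpow)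
  have "((a powr (1/4))\<^sup>2)\<^sup>2 = a" using 1 by simp
  then show "(a powr (1/4))\<^sup>2 = sqrt a" by (metis real_sqrt_abs abs_of_nonneg zero_le_power2)
qed

lemma fourth_power_diff_le: "(a - b) ^ 4 \<le> 8 * (a ^ 4 + b ^ 4)" for a b :: real
proof -
  have sq: "(x - y)\<^sup>2 \<le> 2 * (x\<^sup>2 + y\<^sup>2)" for x y :: real
    using zero_le_power2[of "x + y"] by (simp add: power2_eq_square algebra_simps)
  have sq': "(x + y)\<^sup>2 \<le> 2 * (x\<^sup>2 + y\<^sup>2)" for x y :: real using sq[of x "- y"] by simp
  have "(a - b) ^ 4 = ((a - b)\<^sup>2)\<^sup>2" by simp
  also have "\<dots> \<le> (2 * (a\<^sup>2 + b\<^sup>2))\<^sup>2" using sq[of a b] by (intro power_mono) auto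
  also have "\<dots> = 4 * (a\<^sup>2 + b\<^sup>2)\<^sup>2" by (simp add: power2_eq_square algebra_simps)
  also have "\<dots> \<le> 4 * (2 * ((a\<^sup>2)\<^sup>2 + (b\<^sup>2)\<^sup>2))" using sq'[of "a\<^sup>2" "b\<^sup>2"] by simp
  finally show ?thesis by simp
qed

text \<open>\<open>X4\<close> stands beside \<open>X4_summable\<close> because the Bochner integral
  of a non-integrable function is 0, so summability of the integrals alone would say nothing about
  the moments.\<close>

locale covariance_clt = prob_space M for M :: "'x measure" +
  fixes X :: "'x \<Rightarrow> 'h::{real_inner,banach,second_countable_topology}" and Xs :: "nat \<Rightarrow> 'x \<Rightarrow> 'h"
    and B :: "'h set" and e :: "nat \<Rightarrow> 'h"
  assumes X_meas [measurable]: "X \<in> borel_measurable M"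
    and B: "onb B" and e: "\<And>n. e n = 0 \<or> e n \<in> B" "bij_betw e {n. e n \<noteq> 0} B"
    and X4: "\<And>b. b \<in> B \<Longrightarrow> integrable M (\<lambda>\<omega>. inner (X \<omega>) b ^ 4)"
    and X4_summable: "(\<lambda>b. (\<integral>\<omega>. inner (X \<omega>) b ^ 4 \<partial>M) powr (1/4)) summable_on B"
    and indep: "indep_vars (\<lambda>_. borel) Xs UNIV"
    and distr_Xs: "\<And>i. distr M borel (Xs i) = distr M borel X"
begin

lemma Xs_meas [measurable]: "Xs i \<in> borel_measurable M"
  using indep by (auto simp: indep_vars_def)

text \<open>The factor 2 pays for centring the coordinates.\<close>

definition m :: "nat \<Rightarrow> real" where
  "m n = 2 * (\<integral>\<omega>. inner (X \<omega>) (e n) ^ 4 \<partial>M) powr (1/4)"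

lemma m_nonneg: "m n \<ge> 0" by (simp add: m_def)

lemma m_summable: "summable m"
proof -
  let ?g = "\<lambda>b. (\<integral>\<omega>. inner (X \<omega>) b ^ 4 \<partial>M) powr (1/4)"
  have "((\<lambda>n. ?g (e n)) has_sum infsum ?g B) UNIV"
    by (subst onb_enum_has_sum[OF e]) (use X4_summable in \<open>auto intro: has_sum_infsum\<close>)
  then have "summable (\<lambda>n. ?g (e n))" using has_sum_imp_sums sums_summable by blast
  then show ?thesis unfolding m_def by (rule summable_mult)
qed

lemma u4: "integrable M (\<lambda>\<omega>. inner (X \<omega>) (e n) ^ 4)"
  using e(1)[of n] X4 by auto

lemma u2: "integrable M (\<lambda>\<omega>. (inner (X \<omega>) (e n))\<^sup>2)"
  by (rule square_integrable_imp_integrable) (use u4[of n] in \<open>auto simp: power_mult[symmetric]\<close>)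

lemma u2_le: "(\<integral>\<omega>. (inner (X \<omega>) (e n))\<^sup>2 \<partial>M) \<le> sqrt (\<integral>\<omega>. inner (X \<omega>) (e n) ^ 4 \<partial>M)"
proof -
  have "(\<integral>\<omega>. \<bar>(inner (X \<omega>) (e n))\<^sup>2\<bar> \<partial>M) \<le> sqrt (\<integral>\<omega>. ((inner (X \<omega>) (e n))\<^sup>2)\<^sup>2 \<partial>M)"
    by (rule expectation_abs_le) (use u4[of n] in \<open>auto simp: power_mult[symmetric]\<close>)
  then show ?thesis by (simp add: power_mult[symmetric])
qed

lemma m_sq_summable: "summable (\<lambda>n. (m n)\<^sup>2)"
proof (rule summable_comparison_test'[OF summable_mult[OF m_summable, of "suminf m"], of 0])
  fix n
  have "m n \<le> suminf m" using sum_le_suminf[OF m_summable, of "{n}"] m_nonneg by auto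
  then show "norm ((m n)\<^sup>2) \<le> suminf m * m n"
    using m_nonneg[of n] by (simp add: power2_eq_square mult_right_mono)
qed

lemma norm_sums: "(\<lambda>n. (inner x (e n))\<^sup>2) sums (norm x)\<^sup>2"
proof -
  have "((\<lambda>n. (inner x (e n))\<^sup>2) has_sum (norm x)\<^sup>2) UNIV"
    by (subst onb_enum_has_sum[OF e]) (use onb_parseval[OF B] in auto)
  then show ?thesis by (rule has_sum_imp_sums)
qed

lemma norm_sq_ennreal: "ennreal ((norm x)\<^sup>2) = (\<Sum>n. ennreal ((inner x (e n))\<^sup>2))"
  by (subst suminf_ennreal2) (use norm_sums[of x] in \<open>auto simp: sums_iff\<close>)

text \<open>Parseval and monotone convergence in the extended reals, where the exchange of sum and
  integral needs no integrability of the norm; that integrability is derived from this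
  bound.\<close>

lemma nn_integral_norm_sq_le:
  fixes U :: "'x \<Rightarrow> 'h"
  assumes [measurable]: "U \<in> borel_measurable M" and i: "\<And>n. integrable M (\<lambda>\<omega>. (inner (U \<omega>) (e n))\<^sup>2)"
    and a: "\<And>n. (\<integral>\<omega>. (inner (U \<omega>) (e n))\<^sup>2 \<partial>M) \<le> a n" and s: "summable a"
  shows "(\<integral>\<^sup>+\<omega>. ennreal ((norm (U \<omega>))\<^sup>2) \<partial>M) \<le> ennreal (suminf a)"
proof -
  have a0: "a n \<ge> 0" for n
  proof -
    have "0 \<le> (\<integral>\<omega>. (inner (U \<omega>) (e n))\<^sup>2 \<partial>M)" by simp
    then show ?thesis using a[of n] by linarith
  qed
  have "(\<integral>\<^sup>+\<omega>. ennreal ((norm (U \<omega>))\<^sup>2) \<partial>M) = (\<Sum>n. \<integral>\<^sup>+\<omega>. ennreal ((inner (U \<omega>) (e n))\<^sup>2) \<partial>M)"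
    unfolding norm_sq_ennreal by (rule nn_integral_suminf) simp
  also have "\<dots> = (\<Sum>n. ennreal (\<integral>\<omega>. (inner (U \<omega>) (e n))\<^sup>2 \<partial>M))"
    by (intro suminf_cong nn_integral_eq_integral i) simp
  also have "\<dots> \<le> (\<Sum>n. ennreal (a n))" by (intro suminf_le ennreal_leI a) auto
  also have "\<dots> = ennreal (suminf a)" by (rule suminf_ennreal2[OF a0 s])
  finally show ?thesis .
qed

text \<open>It makes X Bochner integrable, so that the mean \<mu> is meaningful.\<close>

lemma X_norm_sq: "integrable M (\<lambda>\<omega>. (norm (X \<omega>))\<^sup>2)"
proof -
  have "(\<integral>\<omega>. (inner (X \<omega>) (e n))\<^sup>2 \<partial>M) \<le> (m n)\<^sup>2" for n
  proof -
    have "sqrt (\<integral>\<omega>. inner (X \<omega>) (e n) ^ 4 \<partial>M) \<le> (m n)\<^sup>2"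
      by (simp add: m_def power_mult_distrib powr_quarter)
    then show ?thesis using u2_le[of n] by linarith
  qed
  from nn_integral_norm_sq_le[OF X_meas u2 this m_sq_summable]
  have "(\<integral>\<^sup>+\<omega>. ennreal ((norm (X \<omega>))\<^sup>2) \<partial>M) < \<infinity>" by (rule le_less_trans) simp
  then show ?thesis by (intro integrableI_nonneg) auto
qed

lemma X_integrable: "integrable M X"
proof -
  have "integrable M (\<lambda>\<omega>. norm (X \<omega>))" by (rule square_integrable_imp_integrable[OF _ X_norm_sq]) simp
  then show ?thesis by (simp add: integrable_norm_iff)
qed

definition \<mu> :: 'h where "\<mu> = (\<integral>\<omega>. X \<omega> \<partial>M)"

definition y :: "nat \<Rightarrow> 'h \<Rightarrow> real" where "y n x = inner (x - \<mu>) (e n)"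

lemma y_meas [measurable]: "y n \<in> borel_measurable borel"
  unfolding y_def[abs_def] by measurable

lemma y_eq: "y n (X \<omega>) = inner (X \<omega>) (e n) - (\<integral>\<omega>. inner (X \<omega>) (e n) \<partial>M)"
  using X_integrable by (simp add: y_def \<mu>_def inner_diff_left)

lemma y_mean: "(\<integral>\<omega>. y n (X \<omega>) \<partial>M) = 0"
  unfolding y_eq using X_integrable by (simp add: prob_space)

lemma y4: "integrable M (\<lambda>\<omega>. y n (X \<omega>) ^ 4)" "(\<integral>\<omega>. y n (X \<omega>) ^ 4 \<partial>M) \<le> (m n) ^ 4"
proof -
  define a where "a = (\<integral>\<omega>. inner (X \<omega>) (e n) ^ 4 \<partial>M)"
  define b where "b = (\<integral>\<omega>. inner (X \<omega>) (e n) \<partial>M)"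
  have a0: "a \<ge> 0" by (simp add: a_def)
  have "\<bar>b\<bar> \<le> sqrt (\<integral>\<omega>. (inner (X \<omega>) (e n))\<^sup>2 \<partial>M)"
  proof -
    have "(\<integral>\<omega>. \<bar>inner (X \<omega>) (e n)\<bar> \<partial>M) \<le> sqrt (\<integral>\<omega>. (inner (X \<omega>) (e n))\<^sup>2 \<partial>M)"
      by (rule expectation_abs_le[OF _ u2]) simp
    moreover have "\<bar>b\<bar> \<le> (\<integral>\<omega>. \<bar>inner (X \<omega>) (e n)\<bar> \<partial>M)" unfolding b_def by (rule integral_abs_bound)
    ultimately show ?thesis by linarith
  qed
  then have "\<bar>b\<bar>\<^sup>2 \<le> (sqrt (\<integral>\<omega>. (inner (X \<omega>) (e n))\<^sup>2 \<partial>M))\<^sup>2" by (intro power_mono) auto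
  \<comment> \<open>Jensen twice: the fourth power of the mean is at most the fourth moment a.
    Centring then costs 8 (a + a) = 16 a, and 16 = 2^4 is the factor 2 in \<open>m\<close>.\<close>
  then have "b\<^sup>2 \<le> sqrt a" using u2_le[of n] by (simp add: a_def)
  then have "(b\<^sup>2)\<^sup>2 \<le> (sqrt a)\<^sup>2" by (intro power_mono) auto
  then have b4: "b ^ 4 \<le> a" using a0 by simp
  have i: "integrable M (\<lambda>\<omega>. 8 * (inner (X \<omega>) (e n) ^ 4 + b ^ 4))" using u4[of n] by simp
  have le: "y n (X \<omega>) ^ 4 \<le> 8 * (inner (X \<omega>) (e n) ^ 4 + b ^ 4)" for \<omega>
    unfolding y_eq b_def[symmetric] by (rule fourth_power_diff_le)
  show 1: "integrable M (\<lambda>\<omega>. y n (X \<omega>) ^ 4)"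
    by (rule Bochner_Integration.integrable_bound[OF i]) (use le in \<open>auto intro: order_trans[OF _ abs_ge_self]\<close>)
  have "(\<integral>\<omega>. y n (X \<omega>) ^ 4 \<partial>M) \<le> (\<integral>\<omega>. 8 * (inner (X \<omega>) (e n) ^ 4 + b ^ 4) \<partial>M)"
    by (rule integral_mono[OF 1 i le])
  also have "\<dots> = 8 * (a + b ^ 4)" using u4[of n] by (simp add: a_def prob_space)
  also have "\<dots> \<le> 16 * a" using b4 by simp
  also have "\<dots> = (m n) ^ 4" using a0 by (simp add: m_def power_mult_distrib powr_quarter a_def[symmetric])
  finally show "(\<integral>\<omega>. y n (X \<omega>) ^ 4 \<partial>M) \<le> (m n) ^ 4" .
qed

lemma y2: "integrable M (\<lambda>\<omega>. (y n (X \<omega>))\<^sup>2)" "(\<integral>\<omega>. (y n (X \<omega>))\<^sup>2 \<partial>M) \<le> (m n)\<^sup>2"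
proof -
  have 4: "integrable M (\<lambda>\<omega>. ((y n (X \<omega>))\<^sup>2)\<^sup>2)" using y4(1)[of n] by (simp add: power_mult[symmetric])
  show "integrable M (\<lambda>\<omega>. (y n (X \<omega>))\<^sup>2)" by (rule square_integrable_imp_integrable[OF _ 4]) simp
  have "(\<integral>\<omega>. \<bar>(y n (X \<omega>))\<^sup>2\<bar> \<partial>M) \<le> sqrt (\<integral>\<omega>. ((y n (X \<omega>))\<^sup>2)\<^sup>2 \<partial>M)"
    by (rule expectation_abs_le[OF _ 4]) simp
  also have "\<dots> \<le> sqrt ((m n) ^ 4)" using y4(2)[of n] by (simp add: power_mult[symmetric])
  also have "\<dots> = (m n)\<^sup>2"
  proof -
    have "(m n) ^ 4 = ((m n)\<^sup>2)\<^sup>2" by simp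
    then show ?thesis by (simp only: real_sqrt_abs abs_power2)
  qed
  finally show "(\<integral>\<omega>. (y n (X \<omega>))\<^sup>2 \<partial>M) \<le> (m n)\<^sup>2" by simp
qed

subsection \<open>Matrix entries of the centred rank-one operators\<close>

text \<open>The entry at position j of \<open>outer (x - \<mu>) (x - \<mu>)\<close> minus the
  covariance operator, as \<open>phi_matrix\<close> confirms. The integral is written out because
  the operator itself is identified only in \<open>covop_inner\<close>.\<close>

definition \<phi> :: "nat \<Rightarrow> 'h \<Rightarrow> real" where
  "\<phi> j x = y (fst (prod_decode j)) x * y (snd (prod_decode j)) x -
     (\<integral>\<omega>. y (fst (prod_decode j)) (X \<omega>) * y (snd (prod_decode j)) (X \<omega>) \<partial>M)"

definition w :: "nat \<Rightarrow> real" where "w j = m (fst (prod_decode j)) * m (snd (prod_decode j))"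

lemma w_nonneg: "w j \<ge> 0" by (simp add: w_def m_nonneg)

text \<open>The sum over all matrix positions factors into the square of the sum of
  \<open>m\<close>; here the exponent 1/4 in the moment assumption pays off.\<close>

lemma w_summable: "summable w"
proof -
  have hm: "(m has_sum suminf m) UNIV"
    by (rule sums_nonneg_imp_has_sum) (use m_nonneg m_summable in \<open>auto simp: summable_sums\<close>)
  have "((\<lambda>(i, j). m i * m j) has_sum suminf m * suminf m) (UNIV \<times> UNIV)"
    by (rule has_sum_prod_nonneg) (use hm m_nonneg in auto)
  moreover have "bij_betw prod_decode UNIV (UNIV \<times> UNIV)" using bij_prod_decode by simp
  ultimately have "((\<lambda>j. case prod_decode j of (i, j) \<Rightarrow> m i * m j) has_sum suminf m * suminf m) UNIV"
    using has_sum_reindex_bij_betw by fastforce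
  then have "(w has_sum suminf m * suminf m) UNIV" by (simp add: w_def[abs_def] case_prod_unfold)
  then show ?thesis using has_sum_imp_sums sums_summable by blast
qed

lemma phi_meas [measurable]: "\<phi> j \<in> borel_measurable borel"
  unfolding \<phi>_def[abs_def] by measurable

text \<open>Cauchy-Schwarz turns the second moment of a matrix entry into fourth moments of two
  coordinates, so \<open>w\<close> bounds its L2 norm.\<close>

lemma yy_sq: "integrable M (\<lambda>\<omega>. (y n (X \<omega>) * y k (X \<omega>))\<^sup>2)" 
  "(\<integral>\<omega>. (y n (X \<omega>) * y k (X \<omega>))\<^sup>2 \<partial>M) \<le> (m n * m k)\<^sup>2"
proof -
  have 4: "integrable M (\<lambda>\<omega>. ((y n (X \<omega>))\<^sup>2)\<^sup>2)" for n using y4(1)[of n] by (simp add: power_mult[symmetric])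
  show "integrable M (\<lambda>\<omega>. (y n (X \<omega>) * y k (X \<omega>))\<^sup>2)"
    unfolding power_mult_distrib by (rule integrable_mult_square[OF _ _ 4 4]) auto
  have "(\<integral>\<omega>. (y n (X \<omega>))\<^sup>2 * (y k (X \<omega>))\<^sup>2 \<partial>M)\<^sup>2 \<le> (\<integral>\<omega>. ((y n (X \<omega>))\<^sup>2)\<^sup>2 \<partial>M) * (\<integral>\<omega>. ((y k (X \<omega>))\<^sup>2)\<^sup>2 \<partial>M)"
    by (rule integral_cauchy_schwarz[OF _ _ 4 4]) auto
  also have "\<dots> \<le> (m n) ^ 4 * (m k) ^ 4"
    using y4(2) by (intro mult_mono) (auto simp: power_mult[symmetric])
  also have "\<dots> = ((m n * m k)\<^sup>2)\<^sup>2" by (simp add: power_mult_distrib)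
  finally show "(\<integral>\<omega>. (y n (X \<omega>) * y k (X \<omega>))\<^sup>2 \<partial>M) \<le> (m n * m k)\<^sup>2"
    unfolding power_mult_distrib[of "y n _"] by (rule power2_le_imp_le) simp
qed

lemma phi_moments: "integrable M (\<lambda>\<omega>. (\<phi> j (X \<omega>))\<^sup>2)" "(\<integral>\<omega>. (\<phi> j (X \<omega>))\<^sup>2 \<partial>M) \<le> (w j)\<^sup>2"
   "(\<integral>\<omega>. \<phi> j (X \<omega>) \<partial>M) = 0"
proof -
  define p where "p = fst (prod_decode j)"
  define q where "q = snd (prod_decode j)"
  define u where "u \<omega> = y p (X \<omega>) * y q (X \<omega>)" for \<omega>
  define c where "c = (\<integral>\<omega>. u \<omega> \<partial>M)"
  have um [measurable]: "u \<in> borel_measurable M" unfolding u_def[abs_def] by measurable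
  have u2: "integrable M (\<lambda>\<omega>. (u \<omega>)\<^sup>2)" unfolding u_def by (rule yy_sq)
  have u1: "integrable M u" by (rule square_integrable_imp_integrable[OF um u2])
  have eq: "\<phi> j (X \<omega>) = u \<omega> - c" for \<omega> by (simp add: \<phi>_def u_def c_def p_def q_def)
  have sq: "(u \<omega> - c)\<^sup>2 = (u \<omega>)\<^sup>2 - (2 * c) * u \<omega> + c\<^sup>2" for \<omega> by (simp add: power2_diff)
  show "integrable M (\<lambda>\<omega>. (\<phi> j (X \<omega>))\<^sup>2)" unfolding eq sq using u1 u2 by simp
  have "(\<integral>\<omega>. (\<phi> j (X \<omega>))\<^sup>2 \<partial>M) = (\<integral>\<omega>. (u \<omega>)\<^sup>2 \<partial>M) - c\<^sup>2"
    unfolding eq sq using u1 u2 by (simp add: prob_space c_def[symmetric]) (simp add: power2_eq_square)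
  also have "\<dots> \<le> (\<integral>\<omega>. (u \<omega>)\<^sup>2 \<partial>M)" by simp
  also have "\<dots> \<le> (w j)\<^sup>2" unfolding u_def w_def p_def[symmetric] q_def[symmetric] by (rule yy_sq)
  finally show "(\<integral>\<omega>. (\<phi> j (X \<omega>))\<^sup>2 \<partial>M) \<le> (w j)\<^sup>2" .
  show "(\<integral>\<omega>. \<phi> j (X \<omega>) \<partial>M) = 0" unfolding eq using u1 by (simp add: prob_space c_def)
qed

subsection \<open>Transfer to the sample\<close>

lemma sample_integral:
  fixes g :: "'h \<Rightarrow> real"
  assumes [measurable]: "g \<in> borel_measurable borel"
  shows "(\<integral>\<omega>. g (Xs i \<omega>) \<partial>M) = (\<integral>\<omega>. g (X \<omega>) \<partial>M)"
    "integrable M (\<lambda>\<omega>. g (Xs i \<omega>)) \<longleftrightarrow> integrable M (\<lambda>\<omega>. g (X \<omega>))"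
proof -
  have "(\<integral>\<omega>. g (Xs i \<omega>) \<partial>M) = (\<integral>x. g x \<partial>distr M borel (Xs i))" by (simp add: integral_distr)
  then show "(\<integral>\<omega>. g (Xs i \<omega>) \<partial>M) = (\<integral>\<omega>. g (X \<omega>) \<partial>M)" by (simp add: distr_Xs integral_distr)
  have "integrable M (\<lambda>\<omega>. g (Xs i \<omega>)) \<longleftrightarrow> integrable (distr M borel (Xs i)) g" by (simp add: integrable_distr_eq)
  then show "integrable M (\<lambda>\<omega>. g (Xs i \<omega>)) \<longleftrightarrow> integrable M (\<lambda>\<omega>. g (X \<omega>))"
    by (simp add: distr_Xs integrable_distr_eq)
qed

lemma sample_indep:
  assumes [measurable]: "g \<in> borel_measurable borel"
  shows "indep_vars (\<lambda>_. borel) (\<lambda>i \<omega>. g (Xs i \<omega>)) UNIV"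
  by (rule indep_vars_compose2[OF indep]) simp

lemma sample_sum_sq:
  fixes g :: "'h \<Rightarrow> real"
  assumes [measurable]: "g \<in> borel_measurable borel" and m0: "(\<integral>\<omega>. g (X \<omega>) \<partial>M) = 0"
    and sq: "integrable M (\<lambda>\<omega>. (g (X \<omega>))\<^sup>2)"
  shows "integrable M (\<lambda>\<omega>. (\<Sum>i<N. g (Xs i \<omega>))\<^sup>2)"
    "(\<integral>\<omega>. (\<Sum>i<N. g (Xs i \<omega>))\<^sup>2 \<partial>M) = real N * (\<integral>\<omega>. (g (X \<omega>))\<^sup>2 \<partial>M)"
proof -
  have s: "integrable M (\<lambda>\<omega>. (g (Xs i \<omega>))\<^sup>2)" for i
    by (subst sample_integral(2)[of "\<lambda>x. (g x)\<^sup>2"]) (use sq in auto)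
  show "integrable M (\<lambda>\<omega>. (\<Sum>i<N. g (Xs i \<omega>))\<^sup>2)" by (rule integrable_sum_square) (use s in auto)
  have i: "integrable M (\<lambda>\<omega>. g (Xs i \<omega>))" for i by (rule square_integrable_imp_integrable[OF _ s]) simp
  have "(\<integral>\<omega>. (\<Sum>i<N. g (Xs i \<omega>))\<^sup>2 \<partial>M) = (\<Sum>i<N. \<integral>\<omega>. (g (Xs i \<omega>))\<^sup>2 \<partial>M)"
  proof (rule orthogonal_sum_square)
    show "(\<integral>\<omega>. g (Xs i \<omega>) * g (Xs j \<omega>) \<partial>M) = 0" if "i \<noteq> j" for i j
      by (rule indep_orthogonal[OF sample_indep _ _ that]) (use i m0 in \<open>auto simp: sample_integral\<close>)
  qed (use s in auto)
  also have "\<dots> = real N * (\<integral>\<omega>. (g (X \<omega>))\<^sup>2 \<partial>M)"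
    using sample_integral(1)[of "\<lambda>x. (g x)\<^sup>2"] by simp
  finally show "(\<integral>\<omega>. (\<Sum>i<N. g (Xs i \<omega>))\<^sup>2 \<partial>M) = real N * (\<integral>\<omega>. (g (X \<omega>))\<^sup>2 \<partial>M)" .
qed

definition W :: "nat \<Rightarrow> 'x \<Rightarrow> nat \<Rightarrow> real" where
  "W N \<omega> j = (\<Sum>i<N. \<phi> j (Xs i \<omega>)) / sqrt (real N)"

lemma W_meas [measurable]: "(\<lambda>\<omega>. W N \<omega> j) \<in> borel_measurable M"
  unfolding W_def by measurable

lemma W_sq: "integrable M (\<lambda>\<omega>. (W N \<omega> j)\<^sup>2)" "(\<integral>\<omega>. (W N \<omega> j)\<^sup>2 \<partial>M) \<le> (w j)\<^sup>2"
proof -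
  note s = sample_sum_sq[OF phi_meas[of j] phi_moments(3)[of j] phi_moments(1)[of j], of N]
  show "integrable M (\<lambda>\<omega>. (W N \<omega> j)\<^sup>2)" using s(1) by (simp add: W_def power_divide)
  have "(\<integral>\<omega>. (W N \<omega> j)\<^sup>2 \<partial>M) = real N * (\<integral>\<omega>. (\<phi> j (X \<omega>))\<^sup>2 \<partial>M) / real N"
    using s(2) by (simp add: W_def power_divide)
  \<comment> \<open>Equality for N > 0; for N = 0 the left side is 0 by the convention for division
    by 0, so the bound holds for every N.\<close>
  also have "\<dots> \<le> (\<integral>\<omega>. (\<phi> j (X \<omega>))\<^sup>2 \<partial>M)" by (cases "N = 0") auto
  also have "\<dots> \<le> (w j)\<^sup>2" by (rule phi_moments)
  finally show "(\<integral>\<omega>. (W N \<omega> j)\<^sup>2 \<partial>M) \<le> (w j)\<^sup>2" .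
qed

text \<open>The Cramer-Wold device: a fixed linear combination of the entries is itself a normalised
  sum of independent copies of one centred real variable, to which \<open>clt_cos\<close>
  applies.\<close>

lemma W_cos: "(\<lambda>N. \<integral>\<omega>. cos (b + (\<Sum>j<d. t j * W N \<omega> j)) \<partial>M) \<longlonglongrightarrow>
   cos b * exp (- (\<integral>\<omega>. (\<Sum>j<d. t j * \<phi> j (X \<omega>))\<^sup>2 \<partial>M) / 2)"
proof -
  define g where "g x = (\<Sum>j<d. t j * \<phi> j x)" for x
  have gm [measurable]: "g \<in> borel_measurable borel" unfolding g_def[abs_def] by measurable
  have phi1: "integrable M (\<lambda>\<omega>. \<phi> j (X \<omega>))" for j
    by (rule square_integrable_imp_integrable[OF _ phi_moments(1)]) simp
  have m0: "(\<integral>\<omega>. g (X \<omega>) \<partial>M) = 0"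
    unfolding g_def using phi1 phi_moments(3) by (simp add: Bochner_Integration.integral_sum)
  have sq: "integrable M (\<lambda>\<omega>. (g (X \<omega>))\<^sup>2)"
    unfolding g_def by (rule integrable_sum_square) (auto simp: power_mult_distrib phi_moments)
  have "(\<lambda>N. \<integral>\<omega>. cos (b + (\<Sum>i<N. g (Xs i \<omega>)) / sqrt (real N)) \<partial>M) \<longlonglongrightarrow> cos b * exp (- (\<integral>\<omega>. (g (X \<omega>))\<^sup>2 \<partial>M) / 2)"
  proof (rule clt_cos[OF sample_indep[OF gm]])
    show "integrable M (\<lambda>\<omega>. (g (Xs i \<omega>))\<^sup>2)" for i
      by (subst sample_integral(2)[of "\<lambda>x. (g x)\<^sup>2"]) (use sq in auto)
    show "(\<integral>\<omega>. (g (Xs i \<omega>))\<^sup>2 \<partial>M) = (\<integral>\<omega>. (g (X \<omega>))\<^sup>2 \<partial>M)" for i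
      by (rule sample_integral(1)[of "\<lambda>x. (g x)\<^sup>2"]) simp
    show "expectation (\<lambda>\<omega>. g (Xs i \<omega>)) = 0" for i using m0 by (simp add: sample_integral)
    show "distr M borel (\<lambda>\<omega>. g (Xs i \<omega>)) = distr (distr M borel X) borel g" for i
      by (subst distr_Xs[of i, symmetric], subst distr_distr) (auto simp: comp_def)
  qed
  moreover have "(\<Sum>i<N. g (Xs i \<omega>)) / sqrt (real N) = (\<Sum>j<d. t j * W N \<omega> j)" for N \<omega>
  proof -
    have "(\<Sum>i<N. g (Xs i \<omega>)) = (\<Sum>j<d. \<Sum>i<N. t j * \<phi> j (Xs i \<omega>))" unfolding g_def by (rule sum.swap)
    then show ?thesis by (simp add: W_def sum_distrib_left sum_divide_distrib)
  qed
  ultimately show ?thesis by (simp add: g_def)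
qed

text \<open>The probability space is left free because the bound serves both the empirical entries
  on \<open>M\<close> and the Gaussian entries on \<open>gauss_space\<close>, with the same tails of
  \<open>w\<close>.\<close>

lemma tail_nn_integral:
  fixes U :: "'p \<Rightarrow> nat \<Rightarrow> real"
  assumes P: "prob_space P" and Um: "\<And>j. (\<lambda>\<omega>. U \<omega> j) \<in> borel_measurable P"
    and U2: "\<And>j. integrable P (\<lambda>\<omega>. (U \<omega> j)\<^sup>2)" "\<And>j. (\<integral>\<omega>. (U \<omega> j)\<^sup>2 \<partial>P) \<le> (w j)\<^sup>2"
  shows "(\<integral>\<^sup>+\<omega>. (\<Sum>j. ennreal \<bar>U \<omega> (j + d)\<bar>) \<partial>P) \<le> ennreal (\<Sum>j. w (j + d))"
proof -
  interpret P: prob_space P by (rule P)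
  have i: "integrable P (\<lambda>\<omega>. \<bar>U \<omega> j\<bar>)" for j
    using P.square_integrable_imp_integrable[OF Um U2(1)] by auto
  have le: "(\<integral>\<omega>. \<bar>U \<omega> j\<bar> \<partial>P) \<le> w j" for j
  proof -
    have "(\<integral>\<omega>. \<bar>U \<omega> j\<bar> \<partial>P) \<le> sqrt (\<integral>\<omega>. (U \<omega> j)\<^sup>2 \<partial>P)" by (rule P.expectation_abs_le[OF Um U2(1)])
    also have "\<dots> \<le> sqrt ((w j)\<^sup>2)" using U2(2) by (rule real_sqrt_le_mono)
    finally show ?thesis using w_nonneg by simp
  qed
  have "(\<integral>\<^sup>+\<omega>. (\<Sum>j. ennreal \<bar>U \<omega> (j + d)\<bar>) \<partial>P) = (\<Sum>j. \<integral>\<^sup>+\<omega>. ennreal \<bar>U \<omega> (j + d)\<bar> \<partial>P)"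
    by (rule nn_integral_suminf) (use Um in measurable)
  also have "\<dots> = (\<Sum>j. ennreal (\<integral>\<omega>. \<bar>U \<omega> (j + d)\<bar> \<partial>P))"
    by (intro suminf_cong nn_integral_eq_integral i) simp
  also have "\<dots> \<le> (\<Sum>j. ennreal (w (j + d)))" by (intro suminf_le ennreal_leI le) auto
  also have "\<dots> = ennreal (\<Sum>j. w (j + d))"
    by (rule suminf_ennreal2) (use w_nonneg summable_ignore_initial_segment[OF w_summable] in auto)
  finally show ?thesis .
qed

subsection \<open>The covariance operator\<close>

abbreviation C :: "'h \<Rightarrow>\<^sub>L 'h" where "C \<equiv> covop M X"

lemma centred_norm_sq: "integrable M (\<lambda>\<omega>. (norm (X \<omega> - \<mu>))\<^sup>2)"
proof -
  have "(\<integral>\<^sup>+\<omega>. ennreal ((norm (X \<omega> - \<mu>))\<^sup>2) \<partial>M) \<le> ennreal (\<Sum>n. (m n)\<^sup>2)"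
    by (rule nn_integral_norm_sq_le[OF _ _ _ m_sq_summable]) (use y2 in \<open>auto simp: y_def\<close>)
  then have "(\<integral>\<^sup>+\<omega>. ennreal ((norm (X \<omega> - \<mu>))\<^sup>2) \<partial>M) < \<infinity>" by (rule le_less_trans) simp
  then show ?thesis by (intro integrableI_nonneg) auto
qed

lemma centred_inner_integrable: "integrable M (\<lambda>\<omega>. inner (X \<omega> - \<mu>) u * inner (X \<omega> - \<mu>) v)"
  and centred_inner_bound: "\<bar>\<integral>\<omega>. inner (X \<omega> - \<mu>) u * inner (X \<omega> - \<mu>) v \<partial>M\<bar> \<le>
     (\<integral>\<omega>. (norm (X \<omega> - \<mu>))\<^sup>2 \<partial>M) * norm u * norm v"
proof -
  have b: "\<bar>inner (X \<omega> - \<mu>) u * inner (X \<omega> - \<mu>) v\<bar> \<le> (norm (X \<omega> - \<mu>))\<^sup>2 * (norm u * norm v)" for \<omega>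
  proof -
    have "\<bar>inner (X \<omega> - \<mu>) u\<bar> * \<bar>inner (X \<omega> - \<mu>) v\<bar> \<le> (norm (X \<omega> - \<mu>) * norm u) * (norm (X \<omega> - \<mu>) * norm v)"
      by (intro mult_mono Cauchy_Schwarz_ineq2) auto
    then show ?thesis by (simp add: abs_mult power2_eq_square mult_ac)
  qed
  have i: "integrable M (\<lambda>\<omega>. (norm (X \<omega> - \<mu>))\<^sup>2 * (norm u * norm v))" using centred_norm_sq by simp
  show 1: "integrable M (\<lambda>\<omega>. inner (X \<omega> - \<mu>) u * inner (X \<omega> - \<mu>) v)"
    by (rule Bochner_Integration.integrable_bound[OF i]) (use b in auto)
  have "\<bar>\<integral>\<omega>. inner (X \<omega> - \<mu>) u * inner (X \<omega> - \<mu>) v \<partial>M\<bar> \<le> (\<integral>\<omega>. \<bar>inner (X \<omega> - \<mu>) u * inner (X \<omega> - \<mu>) v\<bar> \<partial>M)"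
    by (rule integral_abs_bound)
  also have "\<dots> \<le> (\<integral>\<omega>. (norm (X \<omega> - \<mu>))\<^sup>2 * (norm u * norm v) \<partial>M)"
    by (rule integral_mono[OF integrable_abs[OF 1] i b])
  finally show "\<bar>\<integral>\<omega>. inner (X \<omega> - \<mu>) u * inner (X \<omega> - \<mu>) v \<partial>M\<bar> \<le>
     (\<integral>\<omega>. (norm (X \<omega> - \<mu>))\<^sup>2 \<partial>M) * norm u * norm v" by (simp add: mult.assoc)
qed

text \<open>The covariance form is bounded and symmetric, so \<open>riesz\<close> in each argument
  produces the operator that \<open>covop\<close> describes; before that the description could be
  void.\<close>

lemma covop_inner: "inner (C u) v = (\<integral>\<omega>. inner (X \<omega> - \<mu>) u * inner (X \<omega> - \<mu>) v \<partial>M)"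
proof -
  define b where "b u v = (\<integral>\<omega>. inner (X \<omega> - \<mu>) u * inner (X \<omega> - \<mu>) v \<partial>M)" for u v
  define K where "K = (\<integral>\<omega>. (norm (X \<omega> - \<mu>))\<^sup>2 \<partial>M)"
  have sym: "b u v = b v u" for u v by (simp add: b_def mult.commute)
  have add: "b u (v + v') = b u v + b u v'" for u v v'
    unfolding b_def by (simp add: inner_add_right distrib_left centred_inner_integrable)
  have scale: "b u (r *\<^sub>R v) = r * b u v" for u v r
    unfolding b_def by (simp add: mult.left_commute)
  have bd: "\<bar>b u v\<bar> \<le> K * norm u * norm v" for u v
    unfolding b_def K_def by (rule centred_inner_bound)
  have "bounded_linear (b u)" for u
    by (rule bounded_linear_intro[where K = "K * norm u"]) (use add scale bd in \<open>auto simp: mult.commute\<close>)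
  then have "\<exists>z. \<forall>v. b u v = inner v z" for u by (rule riesz)
  then obtain f where f: "\<And>u v. b u v = inner v (f u)" by metis
  have bf: "b u v = inner (f u) v" for u v by (simp add: f inner_commute)
  have "bounded_linear f"
  proof (rule bounded_linear_intro[where K = K])
    fix u u' and r :: real
    have "inner (f (u + u')) v = inner (f u + f u') v" for v
      unfolding inner_add_left bf[symmetric] using add[of v u u'] by (simp add: sym)
    then show "f (u + u') = f u + f u'" using vector_eq_rdot by blast
    have "inner (f (r *\<^sub>R u)) v = inner (r *\<^sub>R f u) v" for v
      unfolding inner_scaleR_left bf[symmetric] using scale[of v r u] by (simp add: sym)
    then show "f (r *\<^sub>R u) = r *\<^sub>R f u" using vector_eq_rdot by blast
    have "norm (f u) * norm (f u) = b u (f u)" unfolding bf by (simp add: power2_norm_eq_inner flip: power2_eq_square)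
    also have "\<dots> \<le> (norm u * K) * norm (f u)" using bd[of u "f u"] by (simp add: mult_ac)
    finally have "norm (f u) * norm (f u) \<le> (norm u * K) * norm (f u)" .
    moreover have "K \<ge> 0" by (simp add: K_def)
    ultimately show "norm (f u) \<le> norm u * K" by (cases "f u = 0") auto
  qed
  then have F: "inner (blinfun_apply (Blinfun f) u) v = b u v" for u v
    by (simp add: bounded_linear_Blinfun_apply bf)
  have "C = Blinfun f"
    unfolding covop_def \<mu>_def[symmetric] b_def[symmetric]
  proof (rule the_equality)
    fix D assume "\<forall>u v. inner (blinfun_apply D u) v = b u v"
    then have "inner (blinfun_apply D u) v = inner (blinfun_apply (Blinfun f) u) v" for u v using F by simp
    then have "blinfun_apply D u = blinfun_apply (Blinfun f) u" for u using vector_eq_rdot by blast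
    then show "D = Blinfun f" by (rule blinfun_eqI)
  qed (use F in auto)
  then show ?thesis using F by (simp add: b_def)
qed

abbreviation "Row \<equiv> row e"
abbreviation "Col \<equiv> col e"
abbreviation "Unit_op \<equiv> unit_op e"

text \<open>Centring at the true mean \<mu> makes this a normalised sum of independent operators;
  the sample mean is dealt with in \<open>sample_cov_decomp\<close>.\<close>

definition D :: "nat \<Rightarrow> 'x \<Rightarrow> ('h \<Rightarrow>\<^sub>L 'h)" where
  "D N \<omega> = (1 / sqrt (real N)) *\<^sub>R (\<Sum>i<N. outer (Xs i \<omega> - \<mu>) (Xs i \<omega> - \<mu>) - C)"

lemma phi_matrix: "inner (blinfun_apply (outer (x - \<mu>) (x - \<mu>) - C) (Col j)) (Row j) = \<phi> j x"
proof -
  have "inner (blinfun_apply (outer (x - \<mu>) (x - \<mu>) - C) c) r =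
    inner (x - \<mu>) r * inner (x - \<mu>) c - (\<integral>\<omega>. inner (X \<omega> - \<mu>) r * inner (X \<omega> - \<mu>) c \<partial>M)" for c r
  proof -
    have "inner (blinfun_apply (outer z z - T) c) r = inner z r * inner z c - inner (T c) r" for z and T :: "'h \<Rightarrow>\<^sub>L 'h"
      by (simp add: blinfun.diff_left inner_diff_left inner_commute[of c z] mult.commute)
    from this[of "x - \<mu>" C] show ?thesis unfolding covop_inner by (simp only: mult.commute)
  qed
  then show ?thesis unfolding \<phi>_def y_def row_def[OF B e] col_def[OF B e] .
qed

lemma D_matrix: "inner (blinfun_apply (D N \<omega>) (Col j)) (Row j) = W N \<omega> j"
proof -
  have "blinfun_apply (\<Sum>i<N. T i) h = (\<Sum>i<N. blinfun_apply (T i) h)" for T :: "nat \<Rightarrow> ('h \<Rightarrow>\<^sub>L 'h)" and h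
    by (induction N) (auto simp: blinfun.add_left)
  then have "inner (blinfun_apply (D N \<omega>) (Col j)) (Row j) =
     (1 / sqrt (real N)) * (\<Sum>i<N. inner (blinfun_apply (outer (Xs i \<omega> - \<mu>) (Xs i \<omega> - \<mu>) - C) (Col j)) (Row j))"
    unfolding D_def by (simp add: blinfun.scaleR_left inner_sum_left)
  then show ?thesis unfolding phi_matrix by (simp add: W_def)
qed

lemma D_expand:
  assumes "summable (\<lambda>j. \<bar>W N \<omega> j\<bar>)"
  shows "((\<lambda>j. inner h (Col j) *\<^sub>R (W N \<omega> j *\<^sub>R Row j)) has_sum blinfun_apply (D N \<omega>) h) UNIV"
  by (rule matrix_expand[OF B e _ D_matrix]) (rule summable_nonneg_imp_summable_on[OF assms], simp)

subsection \<open>The sample covariance\<close>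

definition mean_dev :: "nat \<Rightarrow> 'x \<Rightarrow> 'h" where "mean_dev N \<omega> = sample_mean Xs N \<omega> - \<mu>"

lemma sample_mean_meas [measurable]: "sample_mean Xs N \<in> borel_measurable M"
  unfolding sample_mean_def[abs_def] by measurable

lemma mean_dev_meas [measurable]: "mean_dev N \<in> borel_measurable M"
  unfolding mean_dev_def[abs_def] by measurable

lemma outer_sum_left: "outer (\<Sum>i<N. f i) g = (\<Sum>i<N. outer (f i) g)" for N :: nat
  by (induction N) (auto simp: outer_add_left intro!: blinfun_eqI)

lemma outer_sum_right: "outer g (\<Sum>i<N. f i) = (\<Sum>i<N. outer g (f i))" for N :: nat
  by (induction N) (auto simp: outer_add_right intro!: blinfun_eqI)

lemma outer_diff_diff: "outer (a - b) (a - b) = outer a a - outer a b - outer b a + outer b b" for a b :: 'h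
  by (rule blinfun_eqI) (simp add: blinfun.add_left blinfun.diff_left inner_diff_right algebra_simps)

text \<open>The centred observations sum to N times the deviation of the sample mean, so both mixed
  terms and the quadratic term combine into a single rank-one correction.\<close>

lemma sample_cov_decomp:
  assumes N: "N > 0"
  shows "sqrt (real N) *\<^sub>R (sample_cov Xs N \<omega> - C) = D N \<omega> - sqrt (real N) *\<^sub>R outer (mean_dev N \<omega>) (mean_dev N \<omega>)"
proof -
  define z where "z i = Xs i \<omega> - \<mu>" for i
  define a where "a = mean_dev N \<omega>"
  have za: "(\<Sum>i<N. z i) = real N *\<^sub>R a"
    using N by (simp add: z_def a_def mean_dev_def sample_mean_def sum_subtractf scaleR_diff_right sum_constant_scaleR)
  have "Xs i \<omega> - sample_mean Xs N \<omega> = z i - a" for i by (simp add: z_def a_def mean_dev_def)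
  then have "sample_cov Xs N \<omega> = (1 / real N) *\<^sub>R (\<Sum>i<N. outer (z i - a) (z i - a))" by (simp add: sample_cov_def)
  also have "(\<Sum>i<N. outer (z i - a) (z i - a)) =
     (\<Sum>i<N. outer (z i) (z i)) - outer (\<Sum>i<N. z i) a - outer a (\<Sum>i<N. z i) + real N *\<^sub>R outer a a"
    by (simp add: outer_diff_diff sum.distrib sum_subtractf outer_sum_left outer_sum_right sum_constant_scaleR)
  also have "\<dots> = (\<Sum>i<N. outer (z i) (z i)) - real N *\<^sub>R outer a a"
    unfolding za by (simp add: outer_scaleR_left outer_scaleR_right)
  finally have sc: "sample_cov Xs N \<omega> = (1 / real N) *\<^sub>R (\<Sum>i<N. outer (z i) (z i)) - outer a a"
    using N by (simp add: scaleR_diff_right)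
  have "D N \<omega> = (1 / sqrt (real N)) *\<^sub>R ((\<Sum>i<N. outer (z i) (z i)) - real N *\<^sub>R C)"
    by (simp add: D_def z_def sum_subtractf sum_constant_scaleR)
  also have "\<dots> = sqrt (real N) *\<^sub>R ((1 / real N) *\<^sub>R (\<Sum>i<N. outer (z i) (z i)) - C)"
    using N by (simp add: scaleR_diff_right real_div_sqrt field_simps real_sqrt_mult_self)
  finally show ?thesis unfolding sc a_def[symmetric] by (simp add: scaleR_diff_right)
qed

text \<open>The squared deviation of the sample mean has expectation of order 1 / N by orthogonality
  of the centred summands, so after multiplication by sqrt N the correction still vanishes.\<close>

lemma mean_dev_nn_integral:
  assumes N: "N > 0"
  shows "(\<integral>\<^sup>+\<omega>. ennreal (sqrt (real N) * (norm (mean_dev N \<omega>))\<^sup>2) \<partial>M) \<le> ennreal ((\<Sum>n. (m n)\<^sup>2) / sqrt (real N))"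
proof -
  have eq: "inner (mean_dev N \<omega>) (e n) = (\<Sum>i<N. y n (Xs i \<omega>)) / real N" for \<omega> n
    using N by (simp add: mean_dev_def sample_mean_def y_def inner_diff_left inner_sum_left sum_subtractf field_simps)
  have sq: "integrable M (\<lambda>\<omega>. (\<Sum>i<N. y n (Xs i \<omega>))\<^sup>2)"
    "(\<integral>\<omega>. (\<Sum>i<N. y n (Xs i \<omega>))\<^sup>2 \<partial>M) = real N * (\<integral>\<omega>. (y n (X \<omega>))\<^sup>2 \<partial>M)" for n
    using sample_sum_sq[OF y_meas y_mean y2(1)] by auto
  have "(\<integral>\<^sup>+\<omega>. ennreal ((norm (mean_dev N \<omega>))\<^sup>2) \<partial>M) \<le> ennreal (\<Sum>n. (m n)\<^sup>2 / real N)"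
  proof (rule nn_integral_norm_sq_le)
    show "integrable M (\<lambda>\<omega>. (inner (mean_dev N \<omega>) (e n))\<^sup>2)" for n
      unfolding eq power_divide using sq(1) by simp
    have "(\<integral>\<omega>. (inner (mean_dev N \<omega>) (e n))\<^sup>2 \<partial>M) = (\<integral>\<omega>. (y n (X \<omega>))\<^sup>2 \<partial>M) / real N" for n
      unfolding eq power_divide using sq(2) N by (simp add: power2_eq_square[of "real N"])
    then show "(\<integral>\<omega>. (inner (mean_dev N \<omega>) (e n))\<^sup>2 \<partial>M) \<le> (m n)\<^sup>2 / real N" for n
      using y2(2)[of n] by (simp add: divide_right_mono)
    show "summable (\<lambda>n. (m n)\<^sup>2 / real N)" by (rule summable_divide[OF m_sq_summable])
  qed simp
  then have le: "(\<integral>\<^sup>+\<omega>. ennreal ((norm (mean_dev N \<omega>))\<^sup>2) \<partial>M) \<le> ennreal ((\<Sum>n. (m n)\<^sup>2) / real N)"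
    by (simp add: suminf_divide[OF m_sq_summable])
  have "(\<integral>\<^sup>+\<omega>. ennreal (sqrt (real N) * (norm (mean_dev N \<omega>))\<^sup>2) \<partial>M) =
    ennreal (sqrt (real N)) * (\<integral>\<^sup>+\<omega>. ennreal ((norm (mean_dev N \<omega>))\<^sup>2) \<partial>M)"
    by (simp add: ennreal_mult nn_integral_cmult)
  also have "\<dots> \<le> ennreal (sqrt (real N)) * ennreal ((\<Sum>n. (m n)\<^sup>2) / real N)" by (intro mult_left_mono le) simp
  also have "\<dots> = ennreal (sqrt (real N) * ((\<Sum>n. (m n)\<^sup>2) / real N))"
    by (rule ennreal_mult[symmetric]) (auto intro!: divide_nonneg_nonneg suminf_nonneg m_sq_summable)
  also have "sqrt (real N) * ((\<Sum>n. (m n)\<^sup>2) / real N) = (\<Sum>n. (m n)\<^sup>2) / sqrt (real N)"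
    using N by (simp add: field_simps real_sqrt_mult_self)
  finally show ?thesis .
qed

lemma sample_cov_tn_measurable: "tn_measurable M (sample_cov Xs N)"
  unfolding sample_cov_def[abs_def]
  by (intro tn_measurable_scaleR tn_measurable_sum tn_measurable_outer) measurable

end

context covariance_clt
begin

subsection \<open>The Gaussian limit\<close>

text \<open>Z is tied to the entries G only where these are absolutely summable, which is almost
  everywhere; elsewhere it only has to be trace class. The cosine clause fixes the joint law of the
  entries, and the second moment clause controls the tails.\<close>

definition gaussian_limit :: "(nat \<Rightarrow> (nat \<Rightarrow> real) \<Rightarrow> real) \<Rightarrow> ((nat \<Rightarrow> real) \<Rightarrow> ('h \<Rightarrow>\<^sub>L 'h)) \<Rightarrow> bool" where
  "gaussian_limit G Z \<longleftrightarrow>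
    (\<forall>j. G j \<in> borel_measurable gauss_space) \<and>
    (\<forall>j. integrable gauss_space (\<lambda>\<omega>. (G j \<omega>)\<^sup>2)) \<and> (\<forall>j. (\<integral>\<omega>. (G j \<omega>)\<^sup>2 \<partial>gauss_space) \<le> (w j)\<^sup>2) \<and>
    (\<forall>t d b. (\<integral>\<omega>. cos (b + (\<Sum>j<d. t j * G j \<omega>)) \<partial>gauss_space) =
        cos b * exp (- (\<integral>\<omega>. (\<Sum>j<d. t j * \<phi> j (X \<omega>))\<^sup>2 \<partial>M) / 2)) \<and>
    (\<forall>\<omega>. trace_class (Z \<omega>)) \<and>
    (\<forall>\<omega> h. summable (\<lambda>j. \<bar>G j \<omega>\<bar>) \<longrightarrow>
       ((\<lambda>j. inner h (Col j) *\<^sub>R (G j \<omega> *\<^sub>R Row j)) has_sum blinfun_apply (Z \<omega>) h) UNIV) \<and>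
    (\<forall>f. tn_continuous f \<longrightarrow> (\<lambda>\<omega>. f (Z \<omega>)) \<in> borel_measurable gauss_space)"

lemma gaussian_limitD:
  assumes GZ: "gaussian_limit G Z"
  shows "G j \<in> borel_measurable gauss_space"
    and "integrable gauss_space (\<lambda>\<omega>. (G j \<omega>)\<^sup>2)" and "(\<integral>\<omega>. (G j \<omega>)\<^sup>2 \<partial>gauss_space) \<le> (w j)\<^sup>2"
    and "(\<integral>\<omega>. cos (b + (\<Sum>j<d. t j * G j \<omega>)) \<partial>gauss_space) =
        cos b * exp (- (\<integral>\<omega>. (\<Sum>j<d. t j * \<phi> j (X \<omega>))\<^sup>2 \<partial>M) / 2)"
    and "trace_class (Z \<omega>)"
    and "summable (\<lambda>j. \<bar>G j \<omega>\<bar>) \<Longrightarrow>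
       ((\<lambda>j. inner h (Col j) *\<^sub>R (G j \<omega> *\<^sub>R Row j)) has_sum blinfun_apply (Z \<omega>) h) UNIV"
    and "tn_continuous f \<Longrightarrow> (\<lambda>\<omega>. f (Z \<omega>)) \<in> borel_measurable gauss_space"
proof -
  note d1 = GZ[unfolded gaussian_limit_def]
  note d2 = d1[THEN conjunct2] note d3 = d2[THEN conjunct2] note d4 = d3[THEN conjunct2]
  note d5 = d4[THEN conjunct2] note d6 = d5[THEN conjunct2]
  show "G j \<in> borel_measurable gauss_space" by (rule d1[THEN conjunct1, rule_format])
  show "integrable gauss_space (\<lambda>\<omega>. (G j \<omega>)\<^sup>2)" by (rule d2[THEN conjunct1, rule_format])
  show "(\<integral>\<omega>. (G j \<omega>)\<^sup>2 \<partial>gauss_space) \<le> (w j)\<^sup>2" by (rule d3[THEN conjunct1, rule_format])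
  show "(\<integral>\<omega>. cos (b + (\<Sum>j<d. t j * G j \<omega>)) \<partial>gauss_space) =
        cos b * exp (- (\<integral>\<omega>. (\<Sum>j<d. t j * \<phi> j (X \<omega>))\<^sup>2 \<partial>M) / 2)" by (rule d4[THEN conjunct1, rule_format])
  show "trace_class (Z \<omega>)" by (rule d5[THEN conjunct1, rule_format])
  show "((\<lambda>j. inner h (Col j) *\<^sub>R (G j \<omega> *\<^sub>R Row j)) has_sum blinfun_apply (Z \<omega>) h) UNIV"
    if "summable (\<lambda>j. \<bar>G j \<omega>\<bar>)" by (rule d6[THEN conjunct1, rule_format, OF that])
  show "(\<lambda>\<omega>. f (Z \<omega>)) \<in> borel_measurable gauss_space" if "tn_continuous f"
    by (rule d6[THEN conjunct2, rule_format, OF that])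
qed

lemma gaussian_limit_exists: "\<exists>G Z. gaussian_limit G Z"
proof -
  have "\<exists>G :: nat \<Rightarrow> (nat \<Rightarrow> real) \<Rightarrow> real. (\<forall>j. G j \<in> borel_measurable gauss_space) \<and>
    (\<forall>j. integrable gauss_space (\<lambda>\<omega>. (G j \<omega>)\<^sup>2)) \<and>
    (\<forall>j. (\<integral>\<omega>. (G j \<omega>)\<^sup>2 \<partial>gauss_space) = (\<integral>\<omega>. (\<phi> j (X \<omega>))\<^sup>2 \<partial>M)) \<and>
    (\<forall>t d b. (\<integral>\<omega>. cos (b + (\<Sum>j<d. t j * G j \<omega>)) \<partial>gauss_space) =
        cos b * exp (- (\<integral>\<omega>. (\<Sum>j<d. t j * \<phi> j (X \<omega>))\<^sup>2 \<partial>M) / 2))"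
    by (rule gaussian_sequence_exists) (auto intro: phi_moments)
  then obtain G :: "nat \<Rightarrow> (nat \<Rightarrow> real) \<Rightarrow> real" where Gm: "\<forall>j. G j \<in> borel_measurable gauss_space" and
    G: "\<forall>j. integrable gauss_space (\<lambda>\<omega>. (G j \<omega>)\<^sup>2)"
    "\<forall>j. (\<integral>\<omega>. (G j \<omega>)\<^sup>2 \<partial>gauss_space) = (\<integral>\<omega>. (\<phi> j (X \<omega>))\<^sup>2 \<partial>M)"
    "\<forall>t d b. (\<integral>\<omega>. cos (b + (\<Sum>j<d. t j * G j \<omega>)) \<partial>gauss_space) =
        cos b * exp (- (\<integral>\<omega>. (\<Sum>j<d. t j * \<phi> j (X \<omega>))\<^sup>2 \<partial>M) / 2)" by (elim exE conjE)
  have [measurable]: "G j \<in> borel_measurable gauss_space" for j using Gm by blast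
  define S where "S \<omega> \<longleftrightarrow> summable (\<lambda>j. \<bar>G j \<omega>\<bar>)" for \<omega>
  \<comment> \<open>Restated as finiteness of an extended sum, summability becomes a measurable
    event.\<close>
  have S_iff: "S \<omega> \<longleftrightarrow> (\<Sum>j. ennreal \<bar>G j \<omega>\<bar>) \<noteq> top" for \<omega>
  proof
    assume "S \<omega>"
    then have "(\<Sum>j. ennreal \<bar>G j \<omega>\<bar>) = ennreal (\<Sum>j. \<bar>G j \<omega>\<bar>)" unfolding S_def by (intro suminf_ennreal2) auto
    then show "(\<Sum>j. ennreal \<bar>G j \<omega>\<bar>) \<noteq> top" by simp
  next
    assume "(\<Sum>j. ennreal \<bar>G j \<omega>\<bar>) \<noteq> top"
    then show "S \<omega>" unfolding S_def by (intro summable_suminf_not_top) auto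
  qed
  have Sm [measurable]: "Measurable.pred gauss_space S" unfolding S_iff[abs_def] by measurable
  define Q where "Q \<omega> T \<longleftrightarrow> trace_class T \<and>
     (\<forall>h. ((\<lambda>j. inner h (Col j) *\<^sub>R (G j \<omega> *\<^sub>R Row j)) has_sum blinfun_apply T h) UNIV)" for \<omega> T
  have ex: "\<exists>T. Q \<omega> T" if "S \<omega>" for \<omega>
  proof -
    have "(\<lambda>j. \<bar>G j \<omega>\<bar>) summable_on UNIV"
      by (rule summable_nonneg_imp_summable_on) (use that in \<open>auto simp: S_def\<close>)
    from nuc_exists[OF _ row_col_summable[OF B e this]] show ?thesis
      unfolding Q_def using nuc_trace_class(1) by blast
  qed
  define Z where "Z \<omega> = (if S \<omega> then SOME T. Q \<omega> T else 0)" for \<omega>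
  have ZQ: "Q \<omega> (Z \<omega>)" if "S \<omega>" for \<omega> using someI_ex[OF ex[OF that]] that by (simp add: Z_def)
  have Ztc: "trace_class (Z \<omega>)" for \<omega>
    using ZQ[of \<omega>] by (cases "S \<omega>") (auto simp: Q_def Z_def trace_class_zero)
  have Zmeas: "(\<lambda>\<omega>. f (Z \<omega>)) \<in> borel_measurable gauss_space" if f: "tn_continuous f" for f
  proof (rule borel_measurable_LIMSEQ_real)
    \<comment> \<open>The scalar factor switches the partial sums off where the entries are not
      summable and Z is 0, so that F d tends to Z at every point and not only almost
      everywhere.\<close>
    define F where "F d \<omega> = (if S \<omega> then 1 else 0::real) *\<^sub>R (\<Sum>j<d. G j \<omega> *\<^sub>R Unit_op j)" for d \<omega>
    have "tn_measurable gauss_space (F d)" for d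
      unfolding F_def[abs_def]
      by (intro tn_measurable_scaleR tn_measurable_sum tn_measurable_const unit_op_trace_class[OF B e]) measurable
    then show "(\<lambda>\<omega>. f (F d \<omega>)) \<in> borel_measurable gauss_space" for d
      using f by (rule tn_measurable_compose)
    fix \<omega>
    have tF: "trace_class (F d \<omega>)" for d
      unfolding F_def by (intro trace_class_scaleR trace_class_sum unit_op_trace_class[OF B e])
    have "(\<lambda>d. nu (Z \<omega> - F d \<omega>)) \<longlonglongrightarrow> 0"
    proof (cases "S \<omega>")
      case True
      then have s: "summable (\<lambda>j. \<bar>G j \<omega>\<bar>)" by (simp add: S_def)
      show ?thesis
      proof (rule null_seq_le)
        show "(\<lambda>d. \<Sum>j. \<bar>G (j + d) \<omega>\<bar>) \<longlonglongrightarrow> 0" by (rule suminf_tail_tendsto[OF s])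
        show "0 \<le> nu (Z \<omega> - F d \<omega>)" for d by (intro nu_nonneg trace_class_diff Ztc tF)
        show "nu (Z \<omega> - F d \<omega>) \<le> (\<Sum>j. \<bar>G (j + d) \<omega>\<bar>)" for d
          using nu_le[OF matrix_partial_sum_nuc[OF B e s, of "Z \<omega>" d]] ZQ[OF True] True by (simp add: F_def Q_def)
      qed
    next
      case False
      then show ?thesis by (simp add: Z_def F_def nu_zero)
    qed
    then show "(\<lambda>d. f (F d \<omega>)) \<longlonglongrightarrow> f (Z \<omega>)" by (rule tn_continuous_seq[OF f Ztc tF])
  qed
  have "gaussian_limit G Z" unfolding gaussian_limit_def
  proof (intro conjI allI impI)
    show "(\<integral>\<omega>. (G j \<omega>)\<^sup>2 \<partial>gauss_space) \<le> (w j)\<^sup>2" for j using G(2) phi_moments(2)[of j] by simp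
    show "((\<lambda>j. inner h (Col j) *\<^sub>R (G j \<omega> *\<^sub>R Row j)) has_sum blinfun_apply (Z \<omega>) h) UNIV"
      if "summable (\<lambda>j. \<bar>G j \<omega>\<bar>)" for \<omega> h using ZQ[of \<omega>] that by (simp add: S_def Q_def)
  qed (use G Ztc Zmeas Gm in blast)+
  then show ?thesis by blast
qed

text \<open>\<psi> of Z is the almost sure limit of finite linear combinations of jointly Gaussian
  entries, and the cosine integrals pass to the limit by dominated convergence. A general functional
  \<psi> is allowed so that a linear map can be absorbed into it.\<close>

lemma gaussian_limit_marginal:
  assumes GZ: "gaussian_limit G Z"
    and \<psi>: "\<And>S T. trace_class S \<Longrightarrow> trace_class T \<Longrightarrow> \<psi> (S + T) = \<psi> S + \<psi> T"
      "\<And>c T. trace_class T \<Longrightarrow> \<psi> (c *\<^sub>R T) = c * \<psi> T"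
      "0 \<le> \<kappa>" "\<And>T s. nuc T s \<Longrightarrow> \<bar>\<psi> T\<bar> \<le> \<kappa> * s"
  shows "\<exists>\<sigma>\<ge>0. distr gauss_space borel (\<lambda>\<omega>. \<psi> (Z \<omega>)) =
    (if \<sigma> = 0 then return borel 0 else density lborel (normal_density 0 \<sigma>))"
proof -
  interpret P: prob_space gauss_space by (rule gauss_space_prob)
  note Gm [measurable] = gaussian_limitD(1)[OF GZ]
  note G2 = gaussian_limitD(2,3)[OF GZ] and Gcos = gaussian_limitD(4)[OF GZ] and Ztc = gaussian_limitD(5)[OF GZ]
    and Zs = gaussian_limitD(6)[OF GZ] and Zm = gaussian_limitD(7)[OF GZ]
  have \<psi>d: "\<psi> (S - T) = \<psi> S - \<psi> T" if "trace_class S" "trace_class T" for S T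
    using \<psi>(1)[OF that(1) trace_class_scaleR[OF that(2), of "-1"]] \<psi>(2)[OF that(2), of "-1"] by simp
  have lip: "nu_lipschitz \<psi> \<kappa>" using \<psi> by (rule linear_nu_lipschitz)
  have \<psi>m [measurable]: "(\<lambda>\<omega>. \<psi> (Z \<omega>)) \<in> borel_measurable gauss_space"
    by (rule Zm[OF nu_lipschitz_continuous[OF lip]])
  define a where "a j = \<psi> (Unit_op j)" for j
  have a: "\<bar>a j\<bar> \<le> \<kappa>" for j using \<psi>(4)[OF unit_op_nuc[OF B e], of j] by (simp add: a_def)
  have psum: "\<psi> (\<Sum>j<d. z j *\<^sub>R Unit_op j) = (\<Sum>j<d. z j * a j)" for z d
  proof (induction d)
    case 0
    show ?case using \<psi>(2)[OF trace_class_zero, of 0] by simp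
  next
    case (Suc d)
    then show ?case
      by (simp add: \<psi>(1,2) a_def trace_class_sum trace_class_scaleR unit_op_trace_class[OF B e])
  qed
  have "(\<integral>\<^sup>+\<omega>. (\<Sum>j. ennreal \<bar>G j \<omega>\<bar>) \<partial>gauss_space) \<le> ennreal (\<Sum>j. w j)"
    using tail_nn_integral[OF gauss_space_prob, where U = "\<lambda>\<omega> j. G j \<omega>" and d = 0, OF Gm G2] by simp
  then have "(\<integral>\<^sup>+\<omega>. (\<Sum>j. ennreal \<bar>G j \<omega>\<bar>) \<partial>gauss_space) \<noteq> \<infinity>" by (auto simp: top_unique)
  then have "AE \<omega> in gauss_space. (\<Sum>j. ennreal \<bar>G j \<omega>\<bar>) \<noteq> \<infinity>" by (rule nn_integral_PInf_AE[rotated]) simp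
  then have lim: "AE \<omega> in gauss_space. (\<lambda>d. \<Sum>j<d. G j \<omega> * a j) \<longlonglongrightarrow> \<psi> (Z \<omega>)"
  proof eventually_elim
    case (elim \<omega>)
    then have s: "summable (\<lambda>j. \<bar>G j \<omega>\<bar>)" by (intro summable_suminf_not_top) auto
    have "(\<lambda>d. (\<Sum>j<d. G j \<omega> * a j) - \<psi> (Z \<omega>)) \<longlonglongrightarrow> 0"
    proof (rule Lim_null_comparison[OF always_eventually, OF allI])
      fix d
      have "\<psi> (Z \<omega> - (\<Sum>j<d. G j \<omega> *\<^sub>R Unit_op j)) = \<psi> (Z \<omega>) - (\<Sum>j<d. G j \<omega> * a j)"
        by (subst \<psi>d) (auto simp: psum Ztc intro!: trace_class_sum trace_class_scaleR unit_op_trace_class[OF B e])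
      moreover have "\<bar>\<psi> (Z \<omega> - (\<Sum>j<d. G j \<omega> *\<^sub>R Unit_op j))\<bar> \<le> \<kappa> * (\<Sum>j. \<bar>G (j + d) \<omega>\<bar>)"
        by (intro \<psi>(4) matrix_partial_sum_nuc[OF B e s] Zs s)
      ultimately show "norm ((\<Sum>j<d. G j \<omega> * a j) - \<psi> (Z \<omega>)) \<le> \<kappa> * (\<Sum>j. \<bar>G (j + d) \<omega>\<bar>)"
        by (simp add: abs_minus_commute)
    next
      show "(\<lambda>d. \<kappa> * (\<Sum>j. \<bar>G (j + d) \<omega>\<bar>)) \<longlonglongrightarrow> 0"
        using tendsto_mult_left[OF suminf_tail_tendsto[OF s], of \<kappa>] by simp
    qed
    then show ?case by (rule LIM_zero_cancel)
  qed
  define v where "v d = (\<integral>\<omega>. (\<Sum>j<d. a j * \<phi> j (X \<omega>))\<^sup>2 \<partial>M)" for d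
  have v0: "v d \<ge> 0" for d by (simp add: v_def)
  have "v d \<le> (\<kappa> * suminf w)\<^sup>2" for d
  proof -
    have "v d \<le> (\<Sum>j<d. \<kappa> * w j)\<^sup>2" unfolding v_def
    proof (rule sum_square_bound)
      show "integrable M (\<lambda>\<omega>. (a j * \<phi> j (X \<omega>))\<^sup>2)" for j
        unfolding power_mult_distrib using phi_moments(1) by simp
      have "(\<integral>\<omega>. (a j * \<phi> j (X \<omega>))\<^sup>2 \<partial>M) = (a j)\<^sup>2 * (\<integral>\<omega>. (\<phi> j (X \<omega>))\<^sup>2 \<partial>M)" for j
        unfolding power_mult_distrib by simp
      also have "\<dots> j \<le> \<kappa>\<^sup>2 * (w j)\<^sup>2" for j
        using a[of j] \<psi>(3) by (intro mult_mono phi_moments(2)) (auto simp: abs_le_square_iff[symmetric])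
      finally show "(\<integral>\<omega>. (a j * \<phi> j (X \<omega>))\<^sup>2 \<partial>M) \<le> (\<kappa> * w j)\<^sup>2" for j by (simp add: power_mult_distrib)
    qed (use \<psi>(3) w_nonneg in auto)
    also have "\<dots> \<le> (\<kappa> * suminf w)\<^sup>2"
      unfolding sum_distrib_left[symmetric] using \<psi>(3) w_nonneg
      by (intro power_mono mult_left_mono sum_le_suminf w_summable mult_nonneg_nonneg sum_nonneg) auto
    finally show ?thesis .
  qed
  then have "bounded (range v)" unfolding bounded_iff using v0
    by (intro exI[of _ "(\<kappa> * suminf w)\<^sup>2"]) auto
  \<comment> \<open>Only boundedness of the variances is used. A limit point is enough: the cosine
    integrals already converge along the full sequence, so the subsequence identifies their
    limit.\<close>
  then obtain l r where r: "strict_mono (r :: nat \<Rightarrow> nat)" "(v \<circ> r) \<longlonglongrightarrow> l"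
    using bounded_imp_convergent_subsequence by blast
  have l0: "l \<ge> 0" by (rule LIMSEQ_le_const[OF r(2)]) (auto simp: v0)
  show ?thesis
  proof (rule gaussian_law[OF gauss_space_prob \<psi>m l0])
    fix b t :: real
    have "(\<lambda>d. \<integral>\<omega>. cos (b + t * (\<Sum>j<d. G j \<omega> * a j)) \<partial>gauss_space) \<longlonglongrightarrow> (\<integral>\<omega>. cos (b + t * \<psi> (Z \<omega>)) \<partial>gauss_space)"
    proof (rule integral_dominated_convergence[where w = "\<lambda>_. 1"])
      show "AE \<omega> in gauss_space. (\<lambda>d. cos (b + t * (\<Sum>j<d. G j \<omega> * a j))) \<longlonglongrightarrow> cos (b + t * \<psi> (Z \<omega>))"
        using lim by eventually_elim (intro tendsto_intros)
    qed auto
    moreover have "(\<integral>\<omega>. cos (b + t * (\<Sum>j<d. G j \<omega> * a j)) \<partial>gauss_space) = cos b * exp (- (t\<^sup>2 * v d) / 2)" for d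
    proof -
      have "(\<integral>\<omega>. cos (b + (\<Sum>j<d. (t * a j) * G j \<omega>)) \<partial>gauss_space) =
        cos b * exp (- (\<integral>\<omega>. (\<Sum>j<d. (t * a j) * \<phi> j (X \<omega>))\<^sup>2 \<partial>M) / 2)" by (rule Gcos)
      moreover have "(\<Sum>j<d. (t * a j) * G j \<omega>) = t * (\<Sum>j<d. G j \<omega> * a j)" for \<omega>
        by (simp add: sum_distrib_left mult_ac)
      moreover have "(\<Sum>j<d. (t * a j) * \<phi> j (X \<omega>)) = t * (\<Sum>j<d. a j * \<phi> j (X \<omega>))" for \<omega>
        by (simp add: sum_distrib_left mult_ac)
      ultimately show ?thesis by (simp add: power_mult_distrib v_def)
    qed
    ultimately have "(\<lambda>d. cos b * exp (- (t\<^sup>2 * v d) / 2)) \<longlonglongrightarrow> (\<integral>\<omega>. cos (b + t * \<psi> (Z \<omega>)) \<partial>gauss_space)" by simp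
    then have "((\<lambda>d. cos b * exp (- (t\<^sup>2 * v d) / 2)) \<circ> r) \<longlonglongrightarrow> (\<integral>\<omega>. cos (b + t * \<psi> (Z \<omega>)) \<partial>gauss_space)"
      using r(1) by (rule LIMSEQ_subseq_LIMSEQ)
    moreover have "((\<lambda>d. cos b * exp (- (t\<^sup>2 * v d) / 2)) \<circ> r) \<longlonglongrightarrow> cos b * exp (- (t\<^sup>2 * l) / 2)"
      using r(2) unfolding o_def by (intro tendsto_intros) auto
    ultimately show "(\<integral>\<omega>. cos (b + t * \<psi> (Z \<omega>)) \<partial>gauss_space) = cos b * exp (- (t\<^sup>2 * l) / 2)"
      by (rule LIMSEQ_unique)
  qed
qed

subsection \<open>Convergence of the empirical covariance\<close>

definition V :: "nat \<Rightarrow> 'x \<Rightarrow> ('h \<Rightarrow>\<^sub>L 'h)" where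
  "V N \<omega> = sqrt (real N) *\<^sub>R (sample_cov Xs N \<omega> - C)"

definition rest :: "nat \<Rightarrow> 'x \<Rightarrow> real" where
  "rest N \<omega> = sqrt (real N) * (norm (mean_dev N \<omega>))\<^sup>2"

lemma rest_nonneg: "rest N \<omega> \<ge> 0" by (simp add: rest_def)

lemma rest_meas [measurable]: "rest N \<in> borel_measurable M"
  unfolding rest_def[abs_def] by measurable

context
  assumes C_tc: "trace_class C"
begin

lemma V_tn_measurable: "tn_measurable M (V N)"
  unfolding V_def[abs_def]
  by (intro tn_measurable_scaleR tn_measurable_diff sample_cov_tn_measurable tn_measurable_const C_tc) simp

lemma V_tc: "trace_class (V N \<omega>)"
  unfolding V_def sample_cov_def
  by (intro trace_class_scaleR trace_class_diff trace_class_sum trace_class_outer C_tc)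

lemma D_tc: "trace_class (D N \<omega>)"
  unfolding D_def by (intro trace_class_scaleR trace_class_diff trace_class_sum trace_class_outer C_tc)

lemma V_D_nuc:
  assumes N: "N > 0" shows "nuc (V N \<omega> - D N \<omega>) (rest N \<omega>)"
proof -
  have "V N \<omega> - D N \<omega> = (- sqrt (real N)) *\<^sub>R outer (mean_dev N \<omega>) (mean_dev N \<omega>)"
    unfolding V_def sample_cov_decomp[OF N] by simp
  then show ?thesis
    using nuc_scaleR[OF nuc_outer, of "- sqrt (real N)" "mean_dev N \<omega>" "mean_dev N \<omega>"]
    by (simp add: rest_def power2_eq_square)
qed

text \<open>Turns any estimate linear in the nuclear size of V into a pointwise bound with
  integrable right side. Where the entries of W are not summable that side is infinite, which
  requires c > 0.\<close>

lemma V_bound: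
  assumes N: "N > 0" and c: "c > 0" and F: "\<And>n. nuc (V N \<omega>) n \<Longrightarrow> \<bar>F\<bar> \<le> c * n"
  shows "ennreal \<bar>F\<bar> \<le> ennreal c * ((\<Sum>j. ennreal \<bar>W N \<omega> j\<bar>) + ennreal (rest N \<omega>))"
proof (cases "(\<Sum>j. ennreal \<bar>W N \<omega> j\<bar>) = top")
  case True
  then show ?thesis using c by (simp add: ennreal_mult_top)
next
  case False
  have s: "summable (\<lambda>j. \<bar>W N \<omega> j\<bar>)" by (rule summable_suminf_not_top) (use False in auto)
  have "nuc (D N \<omega>) (\<Sum>j. \<bar>W N \<omega> j\<bar>)"
    using matrix_partial_sum_nuc[OF B e s D_expand[OF s], of 0] by simp
  from nuc_add[OF V_D_nuc[OF N, of \<omega>] this] have "nuc (V N \<omega>) ((\<Sum>j. \<bar>W N \<omega> j\<bar>) + rest N \<omega>)" by (simp add: add.commute)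
  then have "\<bar>F\<bar> \<le> c * ((\<Sum>j. \<bar>W N \<omega> j\<bar>) + rest N \<omega>)" by (rule F)
  then have "ennreal \<bar>F\<bar> \<le> ennreal (c * ((\<Sum>j. \<bar>W N \<omega> j\<bar>) + rest N \<omega>))" by (rule ennreal_leI)
  also have "\<dots> = ennreal c * (ennreal (\<Sum>j. \<bar>W N \<omega> j\<bar>) + ennreal (rest N \<omega>))"
    using c rest_nonneg suminf_nonneg[OF s] by (simp add: ennreal_mult ennreal_plus)
  also have "ennreal (\<Sum>j. \<bar>W N \<omega> j\<bar>) = (\<Sum>j. ennreal \<bar>W N \<omega> j\<bar>)" by (rule suminf_ennreal2[symmetric, OF _ s]) simp
  finally show ?thesis .
qed

lemma W_tail: "(\<integral>\<^sup>+\<omega>. (\<Sum>j. ennreal \<bar>W N \<omega> (j + d)\<bar>) \<partial>M) \<le> ennreal (\<Sum>j. w (j + d))"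
  by (rule tail_nn_integral[OF prob_space_axioms]) (auto intro: W_sq)

lemma rest_nn: "N > 0 \<Longrightarrow> (\<integral>\<^sup>+\<omega>. ennreal (rest N \<omega>) \<partial>M) \<le> ennreal ((\<Sum>n. (m n)\<^sup>2) / sqrt (real N))"
  unfolding rest_def by (rule mean_dev_nn_integral)

lemma w_tail_nonneg: "0 \<le> (\<Sum>j. w (j + d))"
  by (rule suminf_nonneg[OF summable_ignore_initial_segment[OF w_summable]]) (rule w_nonneg)

text \<open>A comparison in three moves: \<open>h\<close> of V with \<open>g\<close> of the
  truncated entries, these with the truncated Gaussian entries by
  \<open>lipschitz_convergence\<close>, and back to \<open>h\<close> of Z.\<close>

lemma V_convergence:
  assumes GZ: "gaussian_limit G Z" and h: "nu_lipschitz h L" "\<And>T. trace_class T \<Longrightarrow> \<bar>h T\<bar> \<le> K"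
  shows "(\<lambda>N. \<integral>\<omega>. h (V N \<omega>) \<partial>M) \<longlonglongrightarrow> (\<integral>\<omega>. h (Z \<omega>) \<partial>gauss_space)"
proof (rule tendstoI)
  fix \<epsilon> :: real assume \<epsilon>: "\<epsilon> > 0"
  interpret P: prob_space gauss_space by (rule gauss_space_prob)
  note Gm [measurable] = gaussian_limitD(1)[OF GZ]
  note G2 = gaussian_limitD(2,3)[OF GZ] and Gcos = gaussian_limitD(4)[OF GZ] and Ztc = gaussian_limitD(5)[OF GZ]
    and Zs = gaussian_limitD(6)[OF GZ] and Zm = gaussian_limitD(7)[OF GZ]
  have L: "L \<ge> 0" using h(1) by (simp add: nu_lipschitz_def)
  have hc: "tn_continuous h" by (rule nu_lipschitz_continuous[OF h(1)])
  define S2 where "S2 = (\<Sum>n. (m n)\<^sup>2)"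
  have S20: "S2 \<ge> 0" unfolding S2_def by (rule suminf_nonneg[OF m_sq_summable]) simp
  have "(\<lambda>d. (L + 1) * (\<Sum>j. w (j + d))) \<longlonglongrightarrow> (L + 1) * 0"
    by (intro tendsto_intros suminf_tail_tendsto w_summable)
  then have "eventually (\<lambda>d. (L + 1) * (\<Sum>j. w (j + d)) < \<epsilon> / 4) sequentially"
    by (intro order_tendstoD(2)) (use \<epsilon> in auto)
  \<comment> \<open>The same tails of \<open>w\<close> serve every N and the limit, so one
    truncation level suffices. The truncation error enters twice, beside the mean correction and the
    finite-dimensional error, hence the quarters of \<epsilon>.\<close>
  then obtain d where d: "(L + 1) * (\<Sum>j. w (j + d)) < \<epsilon> / 4" by (auto simp: eventually_sequentially)
  define \<delta> where "\<delta> = (L + 1) * (\<Sum>j. w (j + d))"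
  have \<delta>0: "\<delta> \<ge> 0" unfolding \<delta>_def using L w_tail_nonneg by (intro mult_nonneg_nonneg) auto
  have \<delta>_eq: "ennreal (L + 1) * ennreal (\<Sum>j. w (j + d)) = ennreal \<delta>"
    unfolding \<delta>_def by (rule ennreal_mult[symmetric]) (use L w_tail_nonneg in auto)
  define g where "g x = h (\<Sum>j<d. x j *\<^sub>R Unit_op j)" for x :: "nat \<Rightarrow> real"
  have tS: "trace_class (\<Sum>j<d. x j *\<^sub>R Unit_op j)" for x
    by (intro trace_class_sum trace_class_scaleR unit_op_trace_class[OF B e])
  have g_lip: "\<bar>g x - g y\<bar> \<le> L * (\<Sum>j<d. \<bar>x j - y j\<bar>)" for x y
  proof -
    have "nuc (\<Sum>j<d. (x j - y j) *\<^sub>R Unit_op j) (\<Sum>j<d. \<bar>x j - y j\<bar> * 1)"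
      by (intro nuc_sum nuc_scaleR unit_op_nuc[OF B e])
    moreover have "(\<Sum>j<d. (x j - y j) *\<^sub>R Unit_op j) = (\<Sum>j<d. x j *\<^sub>R Unit_op j) - (\<Sum>j<d. y j *\<^sub>R Unit_op j)"
      by (simp add: scaleR_diff_left sum_subtractf)
    ultimately have "nu ((\<Sum>j<d. x j *\<^sub>R Unit_op j) - (\<Sum>j<d. y j *\<^sub>R Unit_op j)) \<le> (\<Sum>j<d. \<bar>x j - y j\<bar>)"
      using nu_le by fastforce
    then have "L * nu ((\<Sum>j<d. x j *\<^sub>R Unit_op j) - (\<Sum>j<d. y j *\<^sub>R Unit_op j)) \<le> L * (\<Sum>j<d. \<bar>x j - y j\<bar>)"
      using L by (rule mult_left_mono)
    moreover have "\<bar>g x - g y\<bar> \<le> L * nu ((\<Sum>j<d. x j *\<^sub>R Unit_op j) - (\<Sum>j<d. y j *\<^sub>R Unit_op j))"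
      unfolding g_def using h(1) tS unfolding nu_lipschitz_def by blast
    ultimately show ?thesis by linarith
  qed
  have g_bdd: "\<bar>g x\<bar> \<le> K" for x unfolding g_def by (rule h(2)[OF tS])
  have fd: "(\<lambda>N. \<integral>\<omega>. g (W N \<omega>) \<partial>M) \<longlonglongrightarrow> (\<integral>\<omega>. g (\<lambda>j. G j \<omega>) \<partial>gauss_space)"
  proof (rule lipschitz_convergence[OF prob_space_axioms gauss_space_prob, where W = W and G = "\<lambda>\<omega> j. G j \<omega>"
        and v = "\<lambda>j. (w j)\<^sup>2" and d = d and L = L and K = K])
    show "(\<lambda>N. \<integral>\<omega>. cos (b + (\<Sum>j<d. t j * W N \<omega> j)) \<partial>M) \<longlonglongrightarrow>
       (\<integral>\<omega>. cos (b + (\<Sum>j<d. t j * G j \<omega>)) \<partial>gauss_space)" for t b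
      unfolding Gcos by (rule W_cos)
  qed (use W_sq G2 g_lip L g_bdd in auto)
  have gm1: "(\<lambda>\<omega>. g (W N \<omega>)) \<in> borel_measurable M" for N
    unfolding g_def
    by (rule tn_measurable_compose[OF _ hc])
       (intro tn_measurable_sum tn_measurable_scaleR tn_measurable_const unit_op_trace_class[OF B e] W_meas)
  have gm2: "(\<lambda>\<omega>. g (\<lambda>j. G j \<omega>)) \<in> borel_measurable gauss_space"
    unfolding g_def
    by (rule tn_measurable_compose[OF _ hc])
       (intro tn_measurable_sum tn_measurable_scaleR tn_measurable_const unit_op_trace_class[OF B e] Gm)
  have hm1: "(\<lambda>\<omega>. h (V N \<omega>)) \<in> borel_measurable M" for N by (rule tn_measurable_compose[OF V_tn_measurable hc])
  have hm2: "(\<lambda>\<omega>. h (Z \<omega>)) \<in> borel_measurable gauss_space" by (rule Zm[OF hc])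
  have b1: "\<bar>(\<integral>\<omega>. h (V N \<omega>) \<partial>M) - (\<integral>\<omega>. g (W N \<omega>) \<partial>M)\<bar> \<le> \<delta> + L * (S2 / sqrt (real N))" if N: "N > 0" for N
  proof -
    have i1: "integrable M (\<lambda>\<omega>. h (V N \<omega>))"
      by (rule integrable_const_bound[where B = K]) (use h(2)[OF V_tc] hm1 in auto)
    have i2: "integrable M (\<lambda>\<omega>. g (W N \<omega>))"
      by (rule integrable_const_bound[where B = K]) (use g_bdd gm1 in auto)
    have "\<bar>\<integral>\<omega>. h (V N \<omega>) - g (W N \<omega>) \<partial>M\<bar> \<le> \<delta> + L * (S2 / sqrt (real N))"
    proof (rule abs_integral_le_nn)
      show "(\<lambda>\<omega>. h (V N \<omega>) - g (W N \<omega>)) \<in> borel_measurable M" using hm1 gm1 by simp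
      fix \<omega>
      have "L * nu (V N \<omega> - D N \<omega>) \<le> L * rest N \<omega>" by (intro mult_left_mono nu_le V_D_nuc N L)
      then have 1: "\<bar>h (V N \<omega>) - h (D N \<omega>)\<bar> \<le> L * rest N \<omega>"
        using h(1) V_tc D_tc unfolding nu_lipschitz_def by (meson order_trans)
      have 2: "ennreal \<bar>h (D N \<omega>) - g (W N \<omega>)\<bar> \<le> ennreal (L + 1) * (\<Sum>j. ennreal \<bar>W N \<omega> (j + d)\<bar>)"
        unfolding g_def by (rule matrix_partial_sum_lipschitz[OF B e h(1) D_tc D_expand])
      have "ennreal \<bar>h (V N \<omega>) - g (W N \<omega>)\<bar> \<le> ennreal (\<bar>h (D N \<omega>) - g (W N \<omega>)\<bar> + \<bar>h (V N \<omega>) - h (D N \<omega>)\<bar>)"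
        by (rule ennreal_leI) simp
      also have "\<dots> = ennreal \<bar>h (D N \<omega>) - g (W N \<omega>)\<bar> + ennreal \<bar>h (V N \<omega>) - h (D N \<omega>)\<bar>" by (simp add: ennreal_plus)
      also have "\<dots> \<le> ennreal (L + 1) * (\<Sum>j. ennreal \<bar>W N \<omega> (j + d)\<bar>) + ennreal (L * rest N \<omega>)"
        by (intro add_mono 2 ennreal_leI 1)
      finally show "ennreal \<bar>h (V N \<omega>) - g (W N \<omega>)\<bar> \<le>
        ennreal (L + 1) * (\<Sum>j. ennreal \<bar>W N \<omega> (j + d)\<bar>) + ennreal L * ennreal (rest N \<omega>)"
        using L rest_nonneg by (simp add: ennreal_mult)
    next
      have "(\<integral>\<^sup>+\<omega>. ennreal (L + 1) * (\<Sum>j. ennreal \<bar>W N \<omega> (j + d)\<bar>) + ennreal L * ennreal (rest N \<omega>) \<partial>M) =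
        ennreal (L + 1) * (\<integral>\<^sup>+\<omega>. (\<Sum>j. ennreal \<bar>W N \<omega> (j + d)\<bar>) \<partial>M) + ennreal L * (\<integral>\<^sup>+\<omega>. ennreal (rest N \<omega>) \<partial>M)"
        by (subst nn_integral_add) (auto simp: nn_integral_cmult)
      also have "\<dots> \<le> ennreal (L + 1) * ennreal (\<Sum>j. w (j + d)) + ennreal L * ennreal (S2 / sqrt (real N))"
        unfolding S2_def by (intro add_mono mult_left_mono W_tail rest_nn N) auto
      also have "\<dots> = ennreal (\<delta> + L * (S2 / sqrt (real N)))"
        unfolding \<delta>_eq using L S20 \<delta>0 by (simp add: ennreal_mult[symmetric] ennreal_plus)
      finally show "(\<integral>\<^sup>+\<omega>. ennreal (L + 1) * (\<Sum>j. ennreal \<bar>W N \<omega> (j + d)\<bar>) + ennreal L * ennreal (rest N \<omega>) \<partial>M) \<le>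
        ennreal (\<delta> + L * (S2 / sqrt (real N)))" .
    qed (use \<delta>0 L S20 in simp)
    then show ?thesis using i1 i2 by simp
  qed
  have b2: "\<bar>(\<integral>\<omega>. h (Z \<omega>) \<partial>gauss_space) - (\<integral>\<omega>. g (\<lambda>j. G j \<omega>) \<partial>gauss_space)\<bar> \<le> \<delta>"
  proof -
    have i1: "integrable gauss_space (\<lambda>\<omega>. h (Z \<omega>))"
      by (rule P.integrable_const_bound[where B = K]) (use h(2)[OF Ztc] hm2 in auto)
    have i2: "integrable gauss_space (\<lambda>\<omega>. g (\<lambda>j. G j \<omega>))"
      by (rule P.integrable_const_bound[where B = K]) (use g_bdd gm2 in auto)
    have "\<bar>\<integral>\<omega>. h (Z \<omega>) - g (\<lambda>j. G j \<omega>) \<partial>gauss_space\<bar> \<le> \<delta>"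
    proof (rule abs_integral_le_nn)
      show "(\<lambda>\<omega>. h (Z \<omega>) - g (\<lambda>j. G j \<omega>)) \<in> borel_measurable gauss_space" using hm2 gm2 by simp
      show "ennreal \<bar>h (Z \<omega>) - g (\<lambda>j. G j \<omega>)\<bar> \<le> ennreal (L + 1) * (\<Sum>j. ennreal \<bar>G (j + d) \<omega>\<bar>)" for \<omega>
        unfolding g_def by (rule matrix_partial_sum_lipschitz[OF B e h(1) Ztc Zs])
      have "(\<integral>\<^sup>+\<omega>. ennreal (L + 1) * (\<Sum>j. ennreal \<bar>G (j + d) \<omega>\<bar>) \<partial>gauss_space) =
        ennreal (L + 1) * (\<integral>\<^sup>+\<omega>. (\<Sum>j. ennreal \<bar>G (j + d) \<omega>\<bar>) \<partial>gauss_space)"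
        by (rule nn_integral_cmult) simp
      also have "\<dots> \<le> ennreal (L + 1) * ennreal (\<Sum>j. w (j + d))"
        by (intro mult_left_mono tail_nn_integral[OF gauss_space_prob, where U = "\<lambda>\<omega> j. G j \<omega>", OF Gm G2]) simp
      also have "\<dots> = ennreal \<delta>" by (rule \<delta>_eq)
      finally show "(\<integral>\<^sup>+\<omega>. ennreal (L + 1) * (\<Sum>j. ennreal \<bar>G (j + d) \<omega>\<bar>) \<partial>gauss_space) \<le> ennreal \<delta>" .
    qed (rule \<delta>0)
    then show ?thesis using i1 i2 by simp
  qed
  have "(\<lambda>N. L * (S2 / sqrt (real N))) \<longlonglongrightarrow> L * 0"
    by (intro tendsto_intros tendsto_divide_0[OF tendsto_const] filterlim_at_top_imp_at_infinity
      filterlim_compose[OF sqrt_at_top filterlim_real_sequentially])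
  then have "eventually (\<lambda>N. L * (S2 / sqrt (real N)) < \<epsilon> / 4) sequentially"
    by (intro order_tendstoD(2)) (use \<epsilon> in auto)
  moreover have "eventually (\<lambda>N. dist (\<integral>\<omega>. g (W N \<omega>) \<partial>M) (\<integral>\<omega>. g (\<lambda>j. G j \<omega>) \<partial>gauss_space) < \<epsilon> / 4) sequentially"
    using fd by (rule tendstoD) (use \<epsilon> in simp)
  moreover have "eventually (\<lambda>N::nat. N > 0) sequentially" by (rule eventually_gt_at_top)
  ultimately show "eventually (\<lambda>N. dist (\<integral>\<omega>. h (V N \<omega>) \<partial>M) (\<integral>\<omega>. h (Z \<omega>) \<partial>gauss_space) < \<epsilon>) sequentially"
  proof eventually_elim
    case (elim N)
    have "\<delta> < \<epsilon> / 4" using d by (simp add: \<delta>_def)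
    then show ?case using elim(1,2) b1[OF elim(3)] b2 unfolding dist_real_def by linarith
  qed
qed

end

end

section \<open>The limit law of the test statistic\<close>

context covariance_clt
begin

context
  fixes tens :: "'a::{real_inner,banach,second_countable_topology} \<Rightarrow>
                 'b::{real_inner,banach,second_countable_topology} \<Rightarrow> 'h"
  assumes tens: "is_htensor tens" and C_tc: "trace_class C"
begin

definition Y :: "nat \<Rightarrow> 'x \<Rightarrow> ('h \<Rightarrow>\<^sub>L 'h)" where
  "Y N \<omega> = sqrt (real N) *\<^sub>R (sample_cov Xs N \<omega> -
     (1 / trace (sample_cov Xs N \<omega>)) *\<^sub>R optens tens (ptr2 tens (sample_cov Xs N \<omega>)) (ptr1 tens (sample_cov Xs N \<omega>)))"

lemma Y_tn_measurable: "tn_measurable M (Y N)"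
proof -
  have sub: "\<Phi> (S - T) = \<Phi> S - \<Phi> T"
    if "\<And>S T. trace_class S \<Longrightarrow> trace_class T \<Longrightarrow> \<Phi> (S + T) = \<Phi> S + \<Phi> T"
      "\<And>c T. trace_class T \<Longrightarrow> \<Phi> (c *\<^sub>R T) = c *\<^sub>R \<Phi> T" "trace_class S" "trace_class T"
    for \<Phi> :: "('h \<Rightarrow>\<^sub>L 'h) \<Rightarrow> ('k::real_normed_vector \<Rightarrow>\<^sub>L 'k)" and S T
    using that(1)[OF that(3) trace_class_scaleR[OF that(4), of "-1"]] that(2)[OF that(4), of "-1"] by simp
  have p1: "tn_measurable M (\<lambda>\<omega>. ptr1 tens (sample_cov Xs N \<omega>))"
    by (rule tn_measurable_linear[OF sample_cov_tn_measurable, where K = 1])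
       (auto intro: sub ptr1_add[OF tens] ptr1_scaleR[OF tens] ptr1_nuc[OF tens])
  have p2: "tn_measurable M (\<lambda>\<omega>. ptr2 tens (sample_cov Xs N \<omega>))"
    by (rule tn_measurable_linear[OF sample_cov_tn_measurable, where K = 1])
       (auto intro: sub ptr2_add[OF tens] ptr2_scaleR[OF tens] ptr2_nuc[OF tens])
  have pt: "tn_measurable M (\<lambda>\<omega>. optens tens (ptr2 tens (sample_cov Xs N \<omega>)) (ptr1 tens (sample_cov Xs N \<omega>)))"
    by (rule tn_measurable_bilinear[OF p2 p1])
       (auto intro: optens_add_left[OF tens] optens_add_right[OF tens] optens_nuc[OF tens])
  have "(\<lambda>\<omega>. trace (sample_cov Xs N \<omega>)) \<in> borel_measurable M"
    by (rule tn_measurable_compose[OF sample_cov_tn_measurable trace_continuous])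
  then show ?thesis unfolding Y_def[abs_def]
    by (intro tn_measurable_scaleR tn_measurable_diff sample_cov_tn_measurable pt) auto
qed

lemma Y_tc: "\<omega> \<in> space M \<Longrightarrow> trace_class (Y N \<omega>)"
  using Y_tn_measurable unfolding tn_measurable_def simple_approx_def by blast

lemma Y_convergence:
  assumes prod: "optens tens (ptr2 tens C) (ptr1 tens C) = trace C *\<^sub>R C" and c: "trace C \<noteq> 0"
    and GZ: "gaussian_limit G Z" and f: "nu_lipschitz f L" "\<And>T. trace_class T \<Longrightarrow> \<bar>f T\<bar> \<le> K"
  shows "(\<lambda>N. \<integral>\<omega>. f (Y N \<omega>) \<partial>M) \<longlonglongrightarrow> (\<integral>\<omega>. f (theta tens C (Z \<omega>)) \<partial>gauss_space)"
proof -
  obtain K' where K': "K' \<ge> 0" "\<And>V s. nuc V s \<Longrightarrow> nuc (theta tens C V) (K' * s)"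
    using theta_nuc[OF tens C_tc] by blast
  note td = theta_diff[OF tens C_tc]
  define h where "h T = f (theta tens C T)" for T
  have hl: "nu_lipschitz h (L * K')"
    unfolding h_def[abs_def] by (rule nu_lipschitz_linear_compose[OF f(1) td K'])
  have hb: "\<bar>h T\<bar> \<le> K" if "trace_class T" for T
    unfolding h_def by (rule f(2)[OF theta_trace_class[OF tens C_tc that]])
  have lim: "(\<lambda>N. \<integral>\<omega>. h (V N \<omega>) \<partial>M) \<longlonglongrightarrow> (\<integral>\<omega>. h (Z \<omega>) \<partial>gauss_space)"
    by (rule V_convergence[OF C_tc GZ hl hb])
  obtain a b where ab: "0 \<le> a" "0 \<le> b" "\<And>V n \<epsilon>. nuc V n \<Longrightarrow> \<epsilon> > 0 \<Longrightarrow>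
    \<bar>f ((1 / \<epsilon>) *\<^sub>R ((C + \<epsilon> *\<^sub>R V) - (1 / trace (C + \<epsilon> *\<^sub>R V)) *\<^sub>R
      optens tens (ptr2 tens (C + \<epsilon> *\<^sub>R V)) (ptr1 tens (C + \<epsilon> *\<^sub>R V)))) - f (theta tens C V)\<bar> \<le> (a * sqrt \<epsilon> + b * \<epsilon>) * n"
    using lipschitz_expansion[OF tens C_tc prod c f] by blast
  define S where "S = (\<Sum>j. w j) + (\<Sum>n. (m n)\<^sup>2)"
  have S1: "(\<Sum>j. w j) \<ge> 0" by (rule suminf_nonneg[OF w_summable]) (rule w_nonneg)
  have S2: "(\<Sum>n. (m n)\<^sup>2) \<ge> 0" by (rule suminf_nonneg[OF m_sq_summable]) simp
  define \<epsilon> where "\<epsilon> N = 1 / sqrt (real N)" for N :: nat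
  \<comment> \<open>The extra summand \<epsilon> N keeps r N positive when a = b = 0, as
    \<open>V_bound\<close> requires, and tends to 0 as well. S bounds the first moment of the
    nuclear size of V for all N > 0.\<close>
  define r where "r N = a * sqrt (\<epsilon> N) + b * \<epsilon> N + \<epsilon> N" for N
  have fm: "(\<lambda>\<omega>. f (Y N \<omega>)) \<in> borel_measurable M" for N
    by (rule tn_measurable_compose[OF Y_tn_measurable nu_lipschitz_continuous[OF f(1)]])
  have hm: "(\<lambda>\<omega>. h (V N \<omega>)) \<in> borel_measurable M" for N
    by (rule tn_measurable_compose[OF V_tn_measurable[OF C_tc] nu_lipschitz_continuous[OF hl]])
  have bound: "\<bar>(\<integral>\<omega>. f (Y N \<omega>) \<partial>M) - (\<integral>\<omega>. h (V N \<omega>) \<partial>M)\<bar> \<le> r N * S" if N: "N > 0" for N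
  proof -
    have e0: "\<epsilon> N > 0" using N by (simp add: \<epsilon>_def)
    have r0: "r N > 0" unfolding r_def using ab e0 by (intro add_nonneg_pos add_nonneg_nonneg) auto
    have Cv: "C + \<epsilon> N *\<^sub>R V N \<omega> = sample_cov Xs N \<omega>" for \<omega> using N by (simp add: \<epsilon>_def V_def)
    have i1: "integrable M (\<lambda>\<omega>. f (Y N \<omega>))"
      by (rule integrable_const_bound[where B = K]) (use f(2)[OF Y_tc] fm in auto)
    have i2: "integrable M (\<lambda>\<omega>. h (V N \<omega>))"
      by (rule integrable_const_bound[where B = K]) (use hb[OF V_tc[OF C_tc]] hm in auto)
    have "\<bar>\<integral>\<omega>. f (Y N \<omega>) - h (V N \<omega>) \<partial>M\<bar> \<le> r N * S"
    proof (rule abs_integral_le_nn)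
      show "(\<lambda>\<omega>. f (Y N \<omega>) - h (V N \<omega>)) \<in> borel_measurable M" using fm hm by simp
      show "ennreal \<bar>f (Y N \<omega>) - h (V N \<omega>)\<bar> \<le> ennreal (r N) * ((\<Sum>j. ennreal \<bar>W N \<omega> j\<bar>) + ennreal (rest N \<omega>))" for \<omega>
      proof (rule V_bound[OF C_tc N r0])
        fix n assume n: "nuc (V N \<omega>) n"
        have "\<bar>f (Y N \<omega>) - h (V N \<omega>)\<bar> \<le> (a * sqrt (\<epsilon> N) + b * \<epsilon> N) * n"
          using ab(3)[OF n e0] N unfolding Cv h_def Y_def by (simp add: \<epsilon>_def)
        also have "\<dots> \<le> r N * n" unfolding r_def using e0 nuc_nonneg[OF n] by (intro mult_right_mono) auto
        finally show "\<bar>f (Y N \<omega>) - h (V N \<omega>)\<bar> \<le> r N * n" .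
      qed
      have "(\<integral>\<^sup>+\<omega>. ennreal (r N) * ((\<Sum>j. ennreal \<bar>W N \<omega> j\<bar>) + ennreal (rest N \<omega>)) \<partial>M) =
        ennreal (r N) * ((\<integral>\<^sup>+\<omega>. (\<Sum>j. ennreal \<bar>W N \<omega> j\<bar>) \<partial>M) + (\<integral>\<^sup>+\<omega>. ennreal (rest N \<omega>) \<partial>M))"
        by (subst nn_integral_cmult, simp, subst nn_integral_add) auto
      also have "\<dots> \<le> ennreal (r N) * (ennreal (\<Sum>j. w j) + ennreal (\<Sum>n. (m n)\<^sup>2))"
      proof (intro mult_left_mono add_mono)
        show "(\<integral>\<^sup>+\<omega>. (\<Sum>j. ennreal \<bar>W N \<omega> j\<bar>) \<partial>M) \<le> ennreal (\<Sum>j. w j)"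
          using W_tail[OF C_tc, of N 0] by simp
        have "(\<Sum>n. (m n)\<^sup>2) / sqrt (real N) \<le> (\<Sum>n. (m n)\<^sup>2)"
          using S2 N by (simp add: divide_le_eq mult_le_cancel_left1)
        then show "(\<integral>\<^sup>+\<omega>. ennreal (rest N \<omega>) \<partial>M) \<le> ennreal (\<Sum>n. (m n)\<^sup>2)"
          using rest_nn[OF C_tc N] ennreal_leI order_trans by blast
      qed simp
      also have "\<dots> = ennreal (r N) * ennreal S" unfolding S_def using S1 S2 by (simp add: ennreal_plus)
      also have "\<dots> = ennreal (r N * S)" using r0 S1 S2 by (intro ennreal_mult[symmetric]) (auto simp: S_def)
      finally show "(\<integral>\<^sup>+\<omega>. ennreal (r N) * ((\<Sum>j. ennreal \<bar>W N \<omega> j\<bar>) + ennreal (rest N \<omega>)) \<partial>M) \<le> ennreal (r N * S)" .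
      show "0 \<le> r N * S" using r0 S1 S2 by (simp add: S_def)
    qed
    then show ?thesis using i1 i2 by simp
  qed
  have e: "\<epsilon> \<longlonglongrightarrow> 0" unfolding \<epsilon>_def[abs_def]
    by (intro tendsto_divide_0[OF tendsto_const] filterlim_at_top_imp_at_infinity
      filterlim_compose[OF sqrt_at_top filterlim_real_sequentially])
  have "(\<lambda>N. r N * S) \<longlonglongrightarrow> (a * sqrt 0 + b * 0 + 0) * S"
    unfolding r_def[abs_def] by (intro tendsto_intros e)
  then have rS: "(\<lambda>N. r N * S) \<longlonglongrightarrow> 0" by simp
  have "(\<lambda>N. (\<integral>\<omega>. f (Y N \<omega>) \<partial>M) - (\<integral>\<omega>. h (V N \<omega>) \<partial>M)) \<longlonglongrightarrow> 0"
    by (rule Lim_null_comparison[OF _ rS])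
       (use bound in \<open>auto intro: eventually_mono[OF eventually_gt_at_top[of 0]]\<close>)
  from tendsto_add[OF this lim] show ?thesis by (simp add: h_def)
qed

text \<open>Composing the trace against A with \<open>theta\<close> gives a linear functional of Z
  bounded in nuclear norm by norm A times K', so the marginal lemma applies to it directly.\<close>

lemma gaussian_law_theta:
  assumes GZ: "gaussian_limit G Z"
  shows "centered_gaussian_law (distr gauss_space tn_space (\<lambda>\<omega>. theta tens C (Z \<omega>)))"
    and "tn_continuous f \<Longrightarrow> (\<lambda>\<omega>. f (theta tens C (Z \<omega>))) \<in> borel_measurable gauss_space"
proof -
  interpret P: prob_space gauss_space by (rule gauss_space_prob)
  obtain K' where K': "K' \<ge> 0" "\<And>V s. nuc V s \<Longrightarrow> nuc (theta tens C V) (K' * s)"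
    using theta_nuc[OF tens C_tc] by blast
  have Zm: "(\<lambda>\<omega>. f (theta tens C (Z \<omega>))) \<in> borel_measurable gauss_space" if "tn_continuous f" for f
    by (rule gaussian_limitD(7)[OF GZ tn_continuous_linear_compose[OF that theta_diff[OF tens C_tc] K']])
  then show "tn_continuous f \<Longrightarrow> (\<lambda>\<omega>. f (theta tens C (Z \<omega>))) \<in> borel_measurable gauss_space" .
  have tc: "trace_class (theta tens C (Z \<omega>))" for \<omega>
    by (intro theta_trace_class[OF tens C_tc] gaussian_limitD(5)[OF GZ])
  have m: "(\<lambda>\<omega>. theta tens C (Z \<omega>)) \<in> measurable gauss_space tn_space"
    by (rule measurable_tn_space[OF tc]) (rule Zm[OF nu_lipschitz_continuous])
  show "centered_gaussian_law (distr gauss_space tn_space (\<lambda>\<omega>. theta tens C (Z \<omega>)))"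
    unfolding centered_gaussian_law_def
  proof (intro conjI allI)
    show "prob_space (distr gauss_space tn_space (\<lambda>\<omega>. theta tens C (Z \<omega>)))" by (rule P.prob_space_distr[OF m])
    show "space (distr gauss_space tn_space (\<lambda>\<omega>. theta tens C (Z \<omega>))) = {T. trace_class T}" by simp
    show "sets (distr gauss_space tn_space (\<lambda>\<omega>. theta tens C (Z \<omega>))) = tn_borel_sets" by (simp add: sets_tn_space)
    fix A :: "'h \<Rightarrow>\<^sub>L 'h"
    have cont: "tn_continuous (\<lambda>T. trace (A o\<^sub>L T))"
      by (rule nu_lipschitz_continuous[OF linear_nu_lipschitz[where \<kappa> = "norm A"]])
         (auto simp: trace_compose)
    have "distr (distr gauss_space tn_space (\<lambda>\<omega>. theta tens C (Z \<omega>))) borel (\<lambda>T. trace (A o\<^sub>L T)) =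
       distr gauss_space borel ((\<lambda>T. trace (A o\<^sub>L T)) \<circ> (\<lambda>\<omega>. theta tens C (Z \<omega>)))"
      by (rule distr_distr[OF tn_continuous_measurable[OF cont] m])
    moreover have "\<exists>\<sigma>\<ge>0. distr gauss_space borel (\<lambda>\<omega>. (\<lambda>T. trace (A o\<^sub>L theta tens C T)) (Z \<omega>)) =
        (if \<sigma> = 0 then return borel 0 else density lborel (normal_density 0 \<sigma>))"
    proof (rule gaussian_limit_marginal[OF GZ, where \<kappa> = "norm A * K'"])
      show "trace (A o\<^sub>L theta tens C (S + T)) = trace (A o\<^sub>L theta tens C S) + trace (A o\<^sub>L theta tens C T)"
        if "trace_class S" "trace_class T" for S T
        by (simp add: theta_add[OF tens C_tc] trace_compose theta_trace_class[OF tens C_tc] that)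
      show "trace (A o\<^sub>L theta tens C (c *\<^sub>R T)) = c * trace (A o\<^sub>L theta tens C T)" if "trace_class T" for c T
        by (simp add: theta_scaleR[OF tens C_tc] trace_compose theta_trace_class[OF tens C_tc] that)
      show "\<bar>trace (A o\<^sub>L theta tens C T)\<bar> \<le> norm A * K' * s" if "nuc T s" for T s
        using trace_compose(3)[OF K'(2)[OF that], of A] by (simp add: mult.assoc)
    qed (use K' in simp)
    ultimately show "\<exists>\<sigma>\<ge>0. distr (distr gauss_space tn_space (\<lambda>\<omega>. theta tens C (Z \<omega>))) borel (\<lambda>T. trace (A o\<^sub>L T)) =
        (if \<sigma> = 0 then return borel 0 else density lborel (normal_density 0 \<sigma>))" by (simp add: o_def)
  qed
qed

lemma separability_test_clt:
  assumes prod: "optens tens (ptr2 tens C) (ptr1 tens C) = trace C *\<^sub>R C" and c: "trace C \<noteq> 0"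
  shows "\<exists>Q. centered_gaussian_law Q \<and> conv_distr_tn M (\<lambda>N \<omega>. sqrt (real N) *\<^sub>R (sample_cov Xs N \<omega> -
     (1 / trace (sample_cov Xs N \<omega>)) *\<^sub>R
       optens tens (ptr2 tens (sample_cov Xs N \<omega>)) (ptr1 tens (sample_cov Xs N \<omega>)))) Q"
proof -
  obtain G Z where GZ: "gaussian_limit G Z" using gaussian_limit_exists by blast
  have "conv_distr_tn M Y (distr gauss_space tn_space (\<lambda>\<omega>. theta tens C (Z \<omega>)))"
  proof (rule conv_from_lipschitz[OF prob_space_axioms gauss_space_prob])
    show "trace_class (theta tens C (Z \<omega>))" for \<omega>
      by (intro theta_trace_class[OF tens C_tc] gaussian_limitD(5)[OF GZ])
    show "(\<lambda>\<omega>. f (Y N \<omega>)) \<in> borel_measurable M" if "tn_continuous f" for f N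
      by (rule tn_measurable_compose[OF Y_tn_measurable that])
    show "(\<lambda>N. \<integral>\<omega>. f (Y N \<omega>) \<partial>M) \<longlonglongrightarrow> (\<integral>\<omega>. f (theta tens C (Z \<omega>)) \<partial>gauss_space)"
      if "nu_lipschitz f L" "\<And>T. trace_class T \<Longrightarrow> \<bar>f T\<bar> \<le> K" for f L K
      by (rule Y_convergence[OF prod c GZ that])
  qed (auto intro: Y_tc gaussian_law_theta(2)[OF GZ])
  then show ?thesis using gaussian_law_theta(1)[OF GZ] unfolding Y_def[abs_def] by blast
qed

end

end

theorem theorem1:
  fixes tens :: "'a::{real_inner,banach,second_countable_topology} \<Rightarrow>
                 'b::{real_inner,banach,second_countable_topology} \<Rightarrow>
                 'h::{real_inner,banach,second_countable_topology}"
    and M :: "'x measure" and X :: "'x \<Rightarrow> 'h" and Xs :: "nat \<Rightarrow> 'x \<Rightarrow> 'h"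
  assumes "is_htensor tens"
    and "prob_space M"
    and "X \<in> borel_measurable M"
    and "\<exists>B. onb B \<and> (\<forall>e\<in>B. integrable M (\<lambda>\<omega>. inner (X \<omega>) e ^ 4)) \<and>
              (\<lambda>e. (\<integral>\<omega>. inner (X \<omega>) e ^ 4 \<partial>M) powr (1/4)) summable_on B"
    and "trace (covop M X) \<noteq> 0"
    and "prob_space.indep_vars M (\<lambda>_. borel) Xs UNIV"
    and "\<And>i. distr M borel (Xs i) = distr M borel X"
    and "\<exists>C1 C2. trace_class C1 \<and> trace_class C2 \<and> covop M X = optens tens C1 C2"
  shows "\<exists>Q. centered_gaussian_law Q \<and>
           conv_distr_tn M
             (\<lambda>N \<omega>. sqrt (real N) *\<^sub>R
                (sample_cov Xs N \<omega> -
                 (1 / trace (sample_cov Xs N \<omega>)) *\<^sub>R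
                   optens tens (ptr2 tens (sample_cov Xs N \<omega>)) (ptr1 tens (sample_cov Xs N \<omega>))))
             Q"
proof -
  obtain B where B: "onb B" "\<forall>b\<in>B. integrable M (\<lambda>\<omega>. inner (X \<omega>) b ^ 4)"
    "(\<lambda>b. (\<integral>\<omega>. inner (X \<omega>) b ^ 4 \<partial>M) powr (1/4)) summable_on B"
    using assms(4) by blast
  obtain e :: "nat \<Rightarrow> 'h" where e: "\<And>n. e n = 0 \<or> e n \<in> B" "bij_betw e {n. e n \<noteq> 0} B"
    using onb_enum[OF B(1)] by blast
  interpret covariance_clt M X Xs B e
    by (intro covariance_clt.intro covariance_clt_axioms.intro assms(2,3,6,7) B(1,3) e) (use B(2) in blast)
  obtain C1 C2 where C: "trace_class C1" "trace_class C2" "C = optens tens C1 C2"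
    using assms(8) by blast
  have C_tc: "trace_class C" unfolding C(3) by (rule trace_class_optens[OF assms(1) C(1,2)])
  show ?thesis
    by (rule separability_test_clt[OF assms(1) C_tc optens_product_partial_traces[OF assms(1) C] assms(5)])
qed

end
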